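(* Let $\gamma,\beta\in(0,1)$, $0<b<\lambda_1/\sqrt2$, $\mathsf T>0$, $s\in[0,1/2]$, and assume that $f\in L^\infty(0,\mathsf T;\dot H^{2s})$. Let $\mathcal N,\mathcal M$ be positive integers, let $N$ be a positive integer, $d\in(0,\pi/4)$, and set $k=\sqrt{\frac{\pi d}{\beta N}}$. Let $$u_h^{\mathcal N,\mathcal M}(\mathsf T):=\sum_{j=1}^{\mathcal M-1}\sum_{l=1}^{\mathcal N}\Big(\int_{t_{j,l-1}}^{t_{j,l}}W_h(r)\,dr\Big)\pi_hf(\mathsf T-t_{j,l-\frac12})$$ and $$u_{h,k}^{\mathcal N,N}(\mathsf T):=\sum_{j=1}^{\mathcal M-1}\sum_{l=1}^{\mathcal N}Q_{h,k}^N(t_{j,l-1},\tau_j)\,\pi_hf(\mathsf T-t_{j,l-\frac12}),$$ with the partition $\{t_{j,l}\}$ and the operators $W_h$, $Q_{h,k}^N(\cdot,\cdot)$ defined in the context. Then there exists a constant $C$ independent of $h,\mathsf T,k,N,\mathcal N,\mathcal M$ satisfying $$\|u_h^{\mathcal N,\mathcal M}(\mathsf T)-u_{h,k}^{\mathcal N,N}(\mathsf T)\|_{\dot H^{2s}}\le C\,\mathcal M\,e^{-\sqrt{\pi\beta dN}}\,\|f\|_{L^\infty(0,\mathsf T;\dot H^{2s})}.$$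
   Context: Domain and operator. $\Omega\subset\mathbb R^n$ is a bounded polygonal domain with Lipschitz boundary; $L^2=L^2(\Omega)$ and $H^1_0=H^1_0(\Omega)$ are spaces of complex-valued functions, $(v,w)=\int_\Omega v\overline w\,dx$. $a(\cdot,\cdot)$ is a Hermitian, coercive, bounded sesquilinear form on $H^1_0\times H^1_0$. $L$ is the associated unbounded operator on $L^2$ (the inverse of $T|_{L^2}$, where $T:H^{-1}\to H_0^1$ satisfies $a(TF,\theta)=\langle F,\theta\rangle$ for all $\theta\in H^1_0$). There is an $L^2$-orthonormal basis $\{\psi_j\}_{j\ge1}$ with $L\psi_j=\lambda_j\psi_j$, $0<\lambda_1\le\lambda_2\le\cdots$. For $r\ge0$, $\dot H^r=\{v\in L^2:\|v\|_{\dot H^r}^2:=\sum_j\lambda_j^r|(v,\psi_j)|^2<\infty\}$. Since point values of $f$ are used, $f$ is understood as an everywhere-defined function whose values are bounded in $\dot H^{2s}$ by $\|f\|_{L^\infty(0,\mathsf T;\dot H^{2s})}$. Finite elements. $\{\mathcal T_h\}_{h>0}$ is a globally shape regular and quasi-uniform family of conforming simplicial subdivisions of $\Omega$. $\mathbb V_h\subset H^1_0$ is the space of continuous piecewise linear functions on $\mathcal T_h$, $\pi_h:L^2\to\mathbb V_h$ is the $L^2$ projection, and $L_h:\mathbb V_h\to\mathbb V_h$ is defined by $(L_hv_h,\phi_h)=a(v_h,\phi_h)$ for all $\phi_h\in\mathbb V_h$. $L_h$ has $L^2$-orthonormal eigenfunctions $\psi_{j,h}$ with eigenvalues $\lambda_{j,h}>0$,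 $j=1,\dots,M_h=\dim\mathbb V_h$. With the Mittag-Leffler function $e_{\gamma,\mu}(z)=\sum_{m\ge0}z^m/\Gamma(m\gamma+\mu)$, set for $r>0$, $v_h\in\mathbb V_h$, $$W_h(r)v_h:=r^{\gamma-1}e_{\gamma,\gamma}(-r^\gamma L_h^\beta)v_h=\sum_{j=1}^{M_h}r^{\gamma-1}e_{\gamma,\gamma}(-r^\gamma\lambda_{j,h}^\beta)(v_h,\psi_{j,h})\psi_{j,h}.$$ Time partition. $t_j:=2^{-(\mathcal M-j)}\mathsf T$ for $j=1,\dots,\mathcal M$; for $j=1,\dots,\mathcal M-1$ and $l=0,\dots,\mathcal N$, $t_{j,l}:=t_j+l\tau_j$ with $\tau_j:=2^{-(\mathcal M-j)}\mathsf T/\mathcal N$, and $t_{j,l-\frac12}:=\frac12(t_{j,l-1}+t_{j,l})$. Empty sums are $0$. Sinc quadrature. $z(y)=b(\cosh y+i\sinh y)$, $z^{\beta}=e^{\beta\ln z}$ (and $z^{-\beta}=e^{-\beta\ln z}$) with branch cut of $\ln$ along the negative real axis, $y_j=jk$, and for $t,\tau>0$, $g_h\in\mathbb V_h$, $$Q_{h,k}^N(t,\tau)g_h:=\frac{k}{2\pi i}\sum_{j=-N}^{N}\big[e_{\gamma,1}(-t^\gamma z(y_j)^\beta)-e_{\gamma,1}(-(t+\tau)^\gamma z(y_j)^\beta)\big]z(y_j)^{-\beta}z'(y_j)(z(y_j)I-L_h)^{-1}g_h .$$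
   Formalization: The sinc quadrature Q_{h,k}^N carries a leading minus sign absent from the printed formula; as printed (upward contour, resolvent (zI−L_h)^{-1}) it approximates minus the integral of W_h, so the estimate fails as N→∞ whenever u_h is nonzero. *)

theory Defs
  imports
    "HOL-Analysis.Analysis"
    "HOL-Probability.Essential_Supremum"
    "HOL-Library.Function_Algebras"
begin

text \<open>
  Elements of the function spaces are functions on all of \<open>real ^ 'n\<close>; only their restriction to
  the domain \<open>\<Omega>\<close> matters, and the norms below are seminorms (equality is equality almost everywhere
  in \<open>\<Omega>\<close>). The exception is the finite element space, whose members are normalised to vanish off
  \<open>\<Omega>\<close>, so that it is an honest space of functions.
\<close>

section \<open>Lebesgue and Sobolev spaces\<close>

definition L2 :: "(real ^ 'n) set \<Rightarrow> (real ^ 'n \<Rightarrow> complex) set" where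
  "L2 \<Omega> = {v. v \<in> borel_measurable (lebesgue_on \<Omega>)
              \<and> integrable (lebesgue_on \<Omega>) (\<lambda>x. (cmod (v x))\<^sup>2)}"

definition ip :: "(real ^ 'n) set \<Rightarrow> (real ^ 'n \<Rightarrow> complex) \<Rightarrow> (real ^ 'n \<Rightarrow> complex) \<Rightarrow> complex" where
  "ip \<Omega> v w = integral\<^sup>L (lebesgue_on \<Omega>) (\<lambda>x. v x * cnj (w x))"

definition L2_nrm :: "(real ^ 'n) set \<Rightarrow> (real ^ 'n \<Rightarrow> complex) \<Rightarrow> real" where
  "L2_nrm \<Omega> v = sqrt (integral\<^sup>L (lebesgue_on \<Omega>) (\<lambda>x. (cmod (v x))\<^sup>2))"

definition pdiff :: "'n \<Rightarrow> (real ^ 'n \<Rightarrow> complex) \<Rightarrow> real ^ 'n \<Rightarrow> complex" where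
  "pdiff i u x = frechet_derivative u (at x) (axis i 1)"

primrec Ck :: "nat \<Rightarrow> (real ^ 'n \<Rightarrow> complex) \<Rightarrow> bool" where
  "Ck 0 u \<longleftrightarrow> continuous_on UNIV u"
| "Ck (Suc m) u \<longleftrightarrow> (\<forall>x. u differentiable (at x)) \<and> (\<forall>i. Ck m (pdiff i u))"

definition test_functions :: "(real ^ 'n) set \<Rightarrow> (real ^ 'n \<Rightarrow> complex) set" where
  "test_functions \<Omega> = {\<phi>. (\<forall>m. Ck m \<phi>) \<and> compact (closure {x. \<phi> x \<noteq> 0})
                            \<and> closure {x. \<phi> x \<noteq> 0} \<subseteq> \<Omega>}"

definition weak_pdiff ::
  "(real ^ 'n) set \<Rightarrow> 'n \<Rightarrow> (real ^ 'n \<Rightarrow> complex) \<Rightarrow> (real ^ 'n \<Rightarrow> complex) \<Rightarrow> bool" where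
  "weak_pdiff \<Omega> i v g \<longleftrightarrow>
     (\<forall>\<phi>\<in>test_functions \<Omega>.
        integral\<^sup>L (lebesgue_on \<Omega>) (\<lambda>x. v x * pdiff i \<phi> x)
        = - integral\<^sup>L (lebesgue_on \<Omega>) (\<lambda>x. g x * \<phi> x))"

definition H1 :: "(real ^ 'n) set \<Rightarrow> (real ^ 'n \<Rightarrow> complex) set" where
  "H1 \<Omega> = {v \<in> L2 \<Omega>. \<forall>i. \<exists>g\<in>L2 \<Omega>. weak_pdiff \<Omega> i v g}"

text \<open>Weak derivatives are unique almost everywhere, so the norm does not depend on the choice.\<close>

definition wd :: "(real ^ 'n) set \<Rightarrow> 'n \<Rightarrow> (real ^ 'n \<Rightarrow> complex) \<Rightarrow> real ^ 'n \<Rightarrow> complex" where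
  "wd \<Omega> i v = (SOME g. g \<in> L2 \<Omega> \<and> weak_pdiff \<Omega> i v g)"

definition H1_nrm :: "(real ^ 'n) set \<Rightarrow> (real ^ 'n \<Rightarrow> complex) \<Rightarrow> real" where
  "H1_nrm \<Omega> v = sqrt ((L2_nrm \<Omega> v)\<^sup>2 + (\<Sum>i\<in>UNIV. (L2_nrm \<Omega> (wd \<Omega> i v))\<^sup>2))"

definition H10 :: "(real ^ 'n) set \<Rightarrow> (real ^ 'n \<Rightarrow> complex) set" where
  "H10 \<Omega> = {v \<in> H1 \<Omega>. \<exists>\<phi>. (\<forall>m::nat. \<phi> m \<in> test_functions \<Omega>)
                          \<and> (\<lambda>m. H1_nrm \<Omega> (\<lambda>x. v x - \<phi> m x)) \<longlonglongrightarrow> 0}"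

section \<open>Domain, form and operator\<close>

text \<open>Near each boundary point the domain is the set above the graph of a Lipschitz function over the
  hyperplane orthogonal to some unit vector \<open>\<nu>\<close>.\<close>

definition lipschitz_boundary :: "(real ^ 'n) set \<Rightarrow> bool" where
  "lipschitz_boundary \<Omega> \<longleftrightarrow>
     (\<forall>p\<in>frontier \<Omega>. \<exists>r>0. \<exists>\<nu> \<phi> B. norm \<nu> = 1 \<and> lipschitz_on B {y. y \<bullet> \<nu> = 0} \<phi>
        \<and> \<Omega> \<inter> ball p r = {y \<in> ball p r. y \<bullet> \<nu> > (\<phi> (y - (y \<bullet> \<nu>) *\<^sub>R \<nu>) :: real)})"

definition polygonal_domain :: "(real ^ 'n) set \<Rightarrow> bool" where
  "polygonal_domain \<Omega> \<longleftrightarrow> open \<Omega> \<and> connected \<Omega> \<and> \<Omega> \<noteq> {} \<and> bounded \<Omega>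
     \<and> (\<exists>F. finite F \<and> (\<forall>P\<in>F. polytope P) \<and> closure \<Omega> = \<Union>F)"

definition elliptic_form ::
  "(real ^ 'n) set \<Rightarrow> ((real ^ 'n \<Rightarrow> complex) \<Rightarrow> (real ^ 'n \<Rightarrow> complex) \<Rightarrow> complex) \<Rightarrow> bool" where
  "elliptic_form \<Omega> a \<longleftrightarrow>
     (\<forall>u\<in>H10 \<Omega>. \<forall>v\<in>H10 \<Omega>. \<forall>w\<in>H10 \<Omega>. \<forall>c::complex.
        a (\<lambda>x. u x + v x) w = a u w + a v w \<and> a (\<lambda>x. c * u x) w = c * a u w
        \<and> a w (\<lambda>x. u x + v x) = a w u + a w v \<and> a w (\<lambda>x. c * u x) = cnj c * a w u)
     \<and> (\<forall>v\<in>H10 \<Omega>. \<forall>w\<in>H10 \<Omega>. a v w = cnj (a w v))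
     \<and> (\<exists>c0>0. \<forall>v\<in>H10 \<Omega>. Re (a v v) \<ge> c0 * (H1_nrm \<Omega> v)\<^sup>2)
     \<and> (\<exists>c1. \<forall>v\<in>H10 \<Omega>. \<forall>w\<in>H10 \<Omega>. cmod (a v w) \<le> c1 * H1_nrm \<Omega> v * H1_nrm \<Omega> w)"

text \<open>\<open>T_graph \<Omega> a F u\<close> means \<open>T F = u\<close>, for an antilinear functional \<open>F\<close> on \<open>H10 \<Omega>\<close>.
  \<open>L_graph \<Omega> a u g\<close> means that \<open>u\<close> is in the domain of \<open>L\<close> and \<open>L u = g\<close>, where \<open>L\<close> is the inverse
  of the restriction of \<open>T\<close> to \<open>L2 \<Omega>\<close> and \<open>g \<in> L2 \<Omega>\<close> acts as the functional \<open>\<theta> \<mapsto> (g, \<theta>)\<close>. Graphs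
  are used because functions equal almost everywhere are not identified.\<close>

definition T_graph ::
  "(real ^ 'n) set \<Rightarrow> ((real ^ 'n \<Rightarrow> complex) \<Rightarrow> (real ^ 'n \<Rightarrow> complex) \<Rightarrow> complex)
   \<Rightarrow> ((real ^ 'n \<Rightarrow> complex) \<Rightarrow> complex) \<Rightarrow> (real ^ 'n \<Rightarrow> complex) \<Rightarrow> bool" where
  "T_graph \<Omega> a F u \<longleftrightarrow> u \<in> H10 \<Omega> \<and> (\<forall>\<theta>\<in>H10 \<Omega>. a u \<theta> = F \<theta>)"

definition L_graph ::
  "(real ^ 'n) set \<Rightarrow> ((real ^ 'n \<Rightarrow> complex) \<Rightarrow> (real ^ 'n \<Rightarrow> complex) \<Rightarrow> complex)
   \<Rightarrow> (real ^ 'n \<Rightarrow> complex) \<Rightarrow> (real ^ 'n \<Rightarrow> complex) \<Rightarrow> bool" where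
  "L_graph \<Omega> a u g \<longleftrightarrow> g \<in> L2 \<Omega> \<and> T_graph \<Omega> a (\<lambda>\<theta>. ip \<Omega> g \<theta>) u"

text \<open>The eigenpairs are numbered from 0, so \<open>lam 0\<close> is the smallest eigenvalue.\<close>

definition eigenbasis ::
  "(real ^ 'n) set \<Rightarrow> ((real ^ 'n \<Rightarrow> complex) \<Rightarrow> (real ^ 'n \<Rightarrow> complex) \<Rightarrow> complex)
   \<Rightarrow> (nat \<Rightarrow> real ^ 'n \<Rightarrow> complex) \<Rightarrow> (nat \<Rightarrow> real) \<Rightarrow> bool" where
  "eigenbasis \<Omega> a \<psi> lam \<longleftrightarrow>
     (\<forall>j. \<psi> j \<in> L2 \<Omega>) \<and> (\<forall>i j. ip \<Omega> (\<psi> i) (\<psi> j) = (if i = j then 1 else 0))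
     \<and> (\<forall>v\<in>L2 \<Omega>. (\<lambda>m. L2_nrm \<Omega> (\<lambda>x. v x - (\<Sum>j<m. ip \<Omega> v (\<psi> j) * \<psi> j x))) \<longlonglongrightarrow> 0)
     \<and> (\<forall>j. L_graph \<Omega> a (\<psi> j) (\<lambda>x. complex_of_real (lam j) * \<psi> j x))
     \<and> 0 < lam 0 \<and> mono lam"

definition Hdot ::
  "(real ^ 'n) set \<Rightarrow> (nat \<Rightarrow> real ^ 'n \<Rightarrow> complex) \<Rightarrow> (nat \<Rightarrow> real) \<Rightarrow> real
   \<Rightarrow> (real ^ 'n \<Rightarrow> complex) set" where
  "Hdot \<Omega> \<psi> lam r = {v \<in> L2 \<Omega>. summable (\<lambda>j. lam j powr r * (cmod (ip \<Omega> v (\<psi> j)))\<^sup>2)}"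

definition Hdot_nrm ::
  "(real ^ 'n) set \<Rightarrow> (nat \<Rightarrow> real ^ 'n \<Rightarrow> complex) \<Rightarrow> (nat \<Rightarrow> real) \<Rightarrow> real
   \<Rightarrow> (real ^ 'n \<Rightarrow> complex) \<Rightarrow> real" where
  "Hdot_nrm \<Omega> \<psi> lam r v = sqrt (\<Sum>j. lam j powr r * (cmod (ip \<Omega> v (\<psi> j)))\<^sup>2)"

text \<open>The Bochner space of essentially bounded, strongly measurable functions on \<open>(0, tmax)\<close> with
  values in \<open>Hdot\<close>: strong measurability is almost everywhere approximation by simple functions.\<close>

definition Linf_Hdot_nrm ::
  "(real ^ 'n) set \<Rightarrow> (nat \<Rightarrow> real ^ 'n \<Rightarrow> complex) \<Rightarrow> (nat \<Rightarrow> real) \<Rightarrow> real \<Rightarrow> real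
   \<Rightarrow> (real \<Rightarrow> real ^ 'n \<Rightarrow> complex) \<Rightarrow> ereal" where
  "Linf_Hdot_nrm \<Omega> \<psi> lam r tmax f =
     esssup (lebesgue_on {0<..<tmax}) (\<lambda>t. ereal (Hdot_nrm \<Omega> \<psi> lam r (f t)))"

definition Linf_Hdot ::
  "(real ^ 'n) set \<Rightarrow> (nat \<Rightarrow> real ^ 'n \<Rightarrow> complex) \<Rightarrow> (nat \<Rightarrow> real) \<Rightarrow> real \<Rightarrow> real
   \<Rightarrow> (real \<Rightarrow> real ^ 'n \<Rightarrow> complex) set" where
  "Linf_Hdot \<Omega> \<psi> lam r tmax =
     {f. (\<forall>t\<in>{0<..<tmax}. f t \<in> Hdot \<Omega> \<psi> lam r)
       \<and> (\<exists>g :: nat \<Rightarrow> real \<Rightarrow> real ^ 'n \<Rightarrow> complex.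
            (\<forall>m. finite (g m ` {0<..<tmax}) \<and> g m ` {0<..<tmax} \<subseteq> Hdot \<Omega> \<psi> lam r
                 \<and> (\<forall>v. {t \<in> {0<..<tmax}. g m t = v} \<in> sets lebesgue))
            \<and> (AE t in lebesgue_on {0<..<tmax}.
                 (\<lambda>m. Hdot_nrm \<Omega> \<psi> lam r (\<lambda>x. g m t x - f t x)) \<longlonglongrightarrow> 0))
       \<and> Linf_Hdot_nrm \<Omega> \<psi> lam r tmax f < \<infinity>}"

section \<open>Finite elements\<close>

definition inradius :: "(real ^ 'n) set \<Rightarrow> real" where
  "inradius K = Sup {r. 0 \<le> r \<and> (\<exists>x. cball x r \<subseteq> K)}"

text \<open>A family of meshes indexed by a set \<open>H\<close> of mesh sizes. The index set is arbitrary because not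
  every positive real is the mesh size of a subdivision.\<close>

definition mesh_family ::
  "(real ^ 'n) set \<Rightarrow> real set \<Rightarrow> (real \<Rightarrow> (real ^ 'n) set set) \<Rightarrow> bool" where
  "mesh_family \<Omega> H \<T> \<longleftrightarrow>
     H \<subseteq> {0<..}
     \<and> (\<forall>h\<in>H. triangulation (\<T> h) \<and> (\<forall>K\<in>\<T> h. (int CARD('n)) simplex K)
           \<and> \<Union>(\<T> h) = closure \<Omega> \<and> h = Max (diameter ` \<T> h))
     \<and> (\<exists>c. \<forall>h\<in>H. \<forall>K\<in>\<T> h. diameter K \<le> c * inradius K)
     \<and> (\<exists>\<rho>. \<forall>h\<in>H. \<forall>K\<in>\<T> h. \<forall>K'\<in>\<T> h. diameter K \<le> \<rho> * diameter K')"

definition Vh :: "(real ^ 'n) set \<Rightarrow> (real ^ 'n) set set \<Rightarrow> (real ^ 'n \<Rightarrow> complex) set" where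
  "Vh \<Omega> S = {v \<in> H10 \<Omega>. (\<forall>x. x \<notin> \<Omega> \<longrightarrow> v x = 0) \<and> continuous_on (closure \<Omega>) v
               \<and> (\<forall>K\<in>S. \<exists>c l. linear l \<and> (\<forall>x\<in>K. v x = c + l x))}"

definition pih ::
  "(real ^ 'n) set \<Rightarrow> (real ^ 'n) set set \<Rightarrow> (real ^ 'n \<Rightarrow> complex) \<Rightarrow> (real ^ 'n \<Rightarrow> complex)" where
  "pih \<Omega> S v = (THE w. w \<in> Vh \<Omega> S \<and> (\<forall>\<phi>\<in>Vh \<Omega> S. ip \<Omega> w \<phi> = ip \<Omega> v \<phi>))"

definition Lh ::
  "(real ^ 'n) set \<Rightarrow> ((real ^ 'n \<Rightarrow> complex) \<Rightarrow> (real ^ 'n \<Rightarrow> complex) \<Rightarrow> complex)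
   \<Rightarrow> (real ^ 'n) set set \<Rightarrow> (real ^ 'n \<Rightarrow> complex) \<Rightarrow> (real ^ 'n \<Rightarrow> complex)" where
  "Lh \<Omega> a S v = (THE w. w \<in> Vh \<Omega> S \<and> (\<forall>\<phi>\<in>Vh \<Omega> S. ip \<Omega> w \<phi> = a v \<phi>))"

definition dim_Vh :: "(real ^ 'n) set \<Rightarrow> (real ^ 'n) set set \<Rightarrow> nat" where
  "dim_Vh \<Omega> S = vector_space.dim (\<lambda>(c::complex) v x. c * v x) (Vh \<Omega> S)"

definition discrete_eigensystem ::
  "(real ^ 'n) set \<Rightarrow> ((real ^ 'n \<Rightarrow> complex) \<Rightarrow> (real ^ 'n \<Rightarrow> complex) \<Rightarrow> complex)
   \<Rightarrow> (real ^ 'n) set set \<Rightarrow> (nat \<Rightarrow> real ^ 'n \<Rightarrow> complex) \<Rightarrow> (nat \<Rightarrow> real) \<Rightarrow> bool" where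
  "discrete_eigensystem \<Omega> a S \<psi>h lamh \<longleftrightarrow>
     (\<forall>j<dim_Vh \<Omega> S. \<psi>h j \<in> Vh \<Omega> S \<and> 0 < lamh j
        \<and> Lh \<Omega> a S (\<psi>h j) = (\<lambda>x. complex_of_real (lamh j) * \<psi>h j x))
     \<and> (\<forall>i<dim_Vh \<Omega> S. \<forall>j<dim_Vh \<Omega> S. ip \<Omega> (\<psi>h i) (\<psi>h j) = (if i = j then 1 else 0))"

section \<open>Solution operator, time partition and sinc quadrature\<close>

definition mittag_leffler :: "real \<Rightarrow> real \<Rightarrow> complex \<Rightarrow> complex" where
  "mittag_leffler \<gamma> \<mu> z = (\<Sum>m. z ^ m / complex_of_real (Gamma (real m * \<gamma> + \<mu>)))"

definition Wh ::
  "(real ^ 'n) set \<Rightarrow> (real ^ 'n) set set \<Rightarrow> (nat \<Rightarrow> real ^ 'n \<Rightarrow> complex) \<Rightarrow> (nat \<Rightarrow> real)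
   \<Rightarrow> real \<Rightarrow> real \<Rightarrow> real \<Rightarrow> (real ^ 'n \<Rightarrow> complex) \<Rightarrow> (real ^ 'n \<Rightarrow> complex)" where
  "Wh \<Omega> S \<psi>h lamh \<gamma> \<beta> r v = (\<lambda>x. \<Sum>j<dim_Vh \<Omega> S.
     complex_of_real (r powr (\<gamma> - 1))
     * mittag_leffler \<gamma> \<gamma> (complex_of_real (- (r powr \<gamma>) * lamh j powr \<beta>))
     * ip \<Omega> v (\<psi>h j) * \<psi>h j x)"

definition tpt :: "real \<Rightarrow> nat \<Rightarrow> nat \<Rightarrow> real" where
  "tpt tmax M j = 2 powr (- (real M - real j)) * tmax"

definition tau :: "real \<Rightarrow> nat \<Rightarrow> nat \<Rightarrow> nat \<Rightarrow> real" where
  "tau tmax M NN j = 2 powr (- (real M - real j)) * tmax / real NN"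

definition tsub :: "real \<Rightarrow> nat \<Rightarrow> nat \<Rightarrow> nat \<Rightarrow> nat \<Rightarrow> real" where
  "tsub tmax M NN j l = tpt tmax M j + real l * tau tmax M NN j"

definition tmid :: "real \<Rightarrow> nat \<Rightarrow> nat \<Rightarrow> nat \<Rightarrow> nat \<Rightarrow> real" where
  "tmid tmax M NN j l = (tsub tmax M NN j (l - 1) + tsub tmax M NN j l) / 2"

definition zc :: "real \<Rightarrow> real \<Rightarrow> complex" where
  "zc b y = complex_of_real b * (complex_of_real (cosh y) + \<i> * complex_of_real (sinh y))"

definition resolvent_h ::
  "(real ^ 'n) set \<Rightarrow> ((real ^ 'n \<Rightarrow> complex) \<Rightarrow> (real ^ 'n \<Rightarrow> complex) \<Rightarrow> complex)
   \<Rightarrow> (real ^ 'n) set set \<Rightarrow> complex \<Rightarrow> (real ^ 'n \<Rightarrow> complex) \<Rightarrow> (real ^ 'n \<Rightarrow> complex)" where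
  "resolvent_h \<Omega> a S z g = inv_into (Vh \<Omega> S) (\<lambda>v x. z * v x - Lh \<Omega> a S v x) g"

text \<open>The leading minus sign is the orientation of the contour. The Cauchy integral formula with
  kernel \<open>inverse (z - lam)\<close> needs the spectrum on the left of the contour, whereas increasing \<open>y\<close>
  traverses the hyperbola \<open>zc b\<close> upwards, with the spectrum on its right. Without the sign the sum
  converges to minus the integral of \<open>Wh\<close> over \<open>[t, t + \<tau>]\<close>.\<close>

definition Qhk ::
  "(real ^ 'n) set \<Rightarrow> ((real ^ 'n \<Rightarrow> complex) \<Rightarrow> (real ^ 'n \<Rightarrow> complex) \<Rightarrow> complex)
   \<Rightarrow> (real ^ 'n) set set \<Rightarrow> real \<Rightarrow> real \<Rightarrow> real \<Rightarrow> real \<Rightarrow> nat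
   \<Rightarrow> real \<Rightarrow> real \<Rightarrow> (real ^ 'n \<Rightarrow> complex) \<Rightarrow> (real ^ 'n \<Rightarrow> complex)" where
  "Qhk \<Omega> a S \<gamma> \<beta> b k N t \<tau> g = (\<lambda>x.
     - (complex_of_real k / (2 * complex_of_real pi * \<i>)) *
     (\<Sum>j\<in>{- int N..int N}.
        let z = zc b (of_int j * k) in
        (mittag_leffler \<gamma> 1 (- complex_of_real (t powr \<gamma>) * z powr complex_of_real \<beta>)
         - mittag_leffler \<gamma> 1 (- complex_of_real ((t + \<tau>) powr \<gamma>) * z powr complex_of_real \<beta>))
        * z powr complex_of_real (- \<beta>)
        * vector_derivative (zc b) (at (of_int j * k))
        * resolvent_h \<Omega> a S z g x))"

text \<open>Since the finite element space is finite dimensional, the operator-valued integral of \<open>Wh\<close> is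
  evaluated pointwise.\<close>

definition u_semi ::
  "(real ^ 'n) set \<Rightarrow> (real ^ 'n) set set \<Rightarrow> (nat \<Rightarrow> real ^ 'n \<Rightarrow> complex) \<Rightarrow> (nat \<Rightarrow> real)
   \<Rightarrow> real \<Rightarrow> real \<Rightarrow> real \<Rightarrow> (real \<Rightarrow> real ^ 'n \<Rightarrow> complex) \<Rightarrow> nat \<Rightarrow> nat
   \<Rightarrow> (real ^ 'n \<Rightarrow> complex)" where
  "u_semi \<Omega> S \<psi>h lamh \<gamma> \<beta> tmax f NN M = (\<lambda>x. \<Sum>j = 1..M - 1. \<Sum>l = 1..NN.
     integral {tsub tmax M NN j (l - 1)..tsub tmax M NN j l}
       (\<lambda>r. Wh \<Omega> S \<psi>h lamh \<gamma> \<beta> r (pih \<Omega> S (f (tmax - tmid tmax M NN j l))) x))"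

definition u_full ::
  "(real ^ 'n) set \<Rightarrow> ((real ^ 'n \<Rightarrow> complex) \<Rightarrow> (real ^ 'n \<Rightarrow> complex) \<Rightarrow> complex)
   \<Rightarrow> (real ^ 'n) set set \<Rightarrow> real \<Rightarrow> real \<Rightarrow> real \<Rightarrow> real \<Rightarrow> nat
   \<Rightarrow> real \<Rightarrow> (real \<Rightarrow> real ^ 'n \<Rightarrow> complex) \<Rightarrow> nat \<Rightarrow> nat \<Rightarrow> (real ^ 'n \<Rightarrow> complex)" where
  "u_full \<Omega> a S \<gamma> \<beta> b k N tmax f NN M = (\<lambda>x. \<Sum>j = 1..M - 1. \<Sum>l = 1..NN.
     Qhk \<Omega> a S \<gamma> \<beta> b k N (tsub tmax M NN j (l - 1)) (tau tmax M NN j)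
       (pih \<Omega> S (f (tmax - tmid tmax M NN j l))) x)"

end

theory Submission
  imports Defs "HOL-Complex_Analysis.Complex_Analysis" "HOL-Real_Asymp.Real_Asymp"
begin

text \<open>In the orthonormal discrete eigenfunctions both approximations are diagonal: on \<open>[t, t + \<tau>]\<close> the
\<open>i\<close>-th coefficient of the data is multiplied by \<open>exact_symbol\<close> or by \<open>quad_symbol\<close> at \<open>lamh i\<close>. The
theorem follows from a scalar error bound and from a comparison of norms. In the lemmas \<open>W\<close> is
the domain.

The difference of the two symbols is the integral over \<open>r \<in> [t, t + \<tau>]\<close> of the error of the
sinc rule for the Cauchy integral of \<open>ml_kernel \<gamma> \<beta> r\<close> along the hyperbola. This kernel is holomorphic in
the right half plane and bounded there by a multiple of \<open>\<bar>z\<bar> powr - \<beta> / r\<close>: the Mittag-Leffler function is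
bounded by 1 on the left half plane (\<open>mittag_leffler_half_plane_bound\<close>), and Cauchy's estimate then
controls its derivative. The integrand extends to a strip of half width \<open>d\<close>, where the
trapezoidal rule has an error of order \<open>exp (- 2 \<pi> d / k)\<close>; cutting the sum at \<open>N\<close> costs
\<open>exp (- \<beta> k N)\<close>. For the given \<open>k\<close> both \<open>\<pi> d / k\<close> and \<open>\<beta> k N\<close> equal \<open>sqrt (\<pi> \<beta> d N)\<close>. The factor
\<open>1 / r\<close> integrates to a logarithm, and a dyadic block \<open>[t, 2 t]\<close> contributes \<open>ln 2\<close>; this gives the factor \<open>M\<close>.

It remains to pass from the norm of order \<open>2 s\<close> of the data to weighted discrete coefficients and back, with
constants independent of the mesh. By the K-method for finite matrices (\<open>matrix_interpolation\<close>) the orders 0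
and 1 suffice. Order 0 is Bessel's inequality. For order 1, \<open>energy_bessel\<close> bounds the energy in
the continuous eigenfunctions by the form. The converse direction is the \<open>H1\<close> stability of the \<open>L2\<close>
projection (\<open>projection_H1_stable\<close>), which needs an inverse inequality and a quasi-interpolant. The nodal
values of the interpolant are means over balls of radius proportional to \<open>h\<close>. Near the boundary the balls are
placed outside the domain, which is possible because the boundary is Lipschitz; so the interpolant vanishes
near the boundary and lies in \<open>H10\<close>, as one sees by mollifying it.\<close>

abbreviation (input) seq_lim (infix "---->" 60) where "u ----> l \<equiv> u \<longlonglongrightarrow> l"

section \<open>Bounds for the Mittag-Leffler function\<close>

text \<open>The coefficient of \<open>x ^ n\<close> in \<open>(1 - x) powr - a\<close>.\<close>

definition rising_coeff :: "real => nat => real" where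
 "rising_coeff a n = pochhammer a n / fact n"

lemma rising_coeff_0 [simp]: "rising_coeff a 0 = 1"
 by (simp add: rising_coeff_def)

lemma rising_coeff_one [simp]: "rising_coeff 1 n = 1"
 by (simp add: rising_coeff_def pochhammer_fact[symmetric])

lemma rising_coeff_vandermonde:
 "(\<Sum>k\<le>n. rising_coeff a k * rising_coeff b (n - k)) = rising_coeff (a + b) n"
proof -
 have eq: "rising_coeff c k = (-1) ^ k * ((- c) gchoose k)" for c k
  by (simp add: rising_coeff_def gbinomial_pochhammer power_mult_distrib[symmetric])
 have "(\<Sum>k\<le>n. rising_coeff a k * rising_coeff b (n - k))
   = (\<Sum>k\<le>n. (-1) ^ n * (((- a) gchoose k) * ((- b) gchoose (n - k))))"
 proof (rule sum.cong)
  fix k assume "k \<in> {..n}"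
  then have "(-1::real) ^ n = (-1) ^ k * (-1) ^ (n - k)"
   by (simp flip: power_add)
  then show "rising_coeff a k * rising_coeff b (n - k)
    = (-1) ^ n * (((- a) gchoose k) * ((- b) gchoose (n - k)))"
   by (simp add: eq)
 qed simp
 also have "... = (-1) ^ n * ((- a + - b) gchoose n)"
  by (simp only: sum_distrib_left[symmetric] atMost_atLeast0 gbinomial_Vandermonde)
 also have "... = rising_coeff (a + b) n"
  by (simp add: eq)
 finally show ?thesis .
qed

lemma rising_coeff_Suc: "rising_coeff a (Suc n) = rising_coeff a n * (a + real n) / (real n + 1)"
 by (simp add: rising_coeff_def pochhammer_Suc field_simps)

lemma rising_coeff_pos: "0 < a ==> 0 < rising_coeff a n"
 by (simp add: rising_coeff_def pochhammer_pos)

lemma rising_coeff_neg: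
 assumes "0 < \<gamma>" "\<gamma> < 1"
 shows "rising_coeff (- \<gamma>) (Suc k) \<le> 0"
proof (induction k)
 case 0
 then show ?case using assms by (simp add: rising_coeff_Suc)
next
 case (Suc k)
 then show ?case
  using assms by (subst rising_coeff_Suc) (auto intro!: divide_nonpos_pos mult_nonpos_nonneg)
qed

lemma rising_coeff_mono:
 assumes "0 \<le> a" "k \<le> n"
 shows "rising_coeff (a + 1) k \<le> rising_coeff (a + 1) n"
 using assms(2)
proof (induction n rule: dec_induct)
 case (step n)
 have "rising_coeff (a + 1) n * (real n + 1) \<le> rising_coeff (a + 1) n * (a + 1 + real n)"
  using assms(1) rising_coeff_pos[of "a + 1" n] by (intro mult_left_mono) auto
 then have "rising_coeff (a + 1) n \<le> rising_coeff (a + 1) (Suc n)"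
  by (simp add: rising_coeff_Suc field_simps)
 with step show ?case by linarith
qed simp

text \<open>Expanding in powers of \<open>\<sigma>\<close>, this is the coefficient of \<open>x ^ n\<close> in
\<open>1 / ((1 - x) (1 + \<sigma> (1 - x) powr - \<gamma>))\<close>, the backward Euler convolution quadrature of the fractional
relaxation equation. With \<open>\<sigma> = z / n powr \<gamma>\<close> it approximates the Mittag-Leffler function at \<open>- z\<close>, and
its stability can be read off from a recursion.\<close>

definition cq_sum :: "real => nat => complex => complex" where
 "cq_sum \<gamma> n \<sigma> = (\<Sum>m. (- \<sigma>) ^ m * of_real (rising_coeff (\<gamma> * real m + 1) n))"

text \<open>Multiplying the generating function by \<open>(1 - x) powr \<gamma>\<close> (Vandermonde) expresses
\<open>(1 + \<sigma>) cq_sum \<gamma> n \<sigma>\<close> by earlier values with nonnegative weights and a nonnegative inhomogeneity, all of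
which add up to 1. Since \<open>\<bar>1 + \<sigma>\<bar> \<ge> 1\<close>, induction applies.\<close>

lemma cq_sum_bound:
 assumes g: "0 < \<gamma>" "\<gamma> < 1" and re: "0 \<le> Re \<sigma>"
  and summ: "summable (\<lambda>m. cmod \<sigma> ^ m * rising_coeff (\<gamma> * real m + 1) N)"
  and "n \<le> N"
 shows "cmod (cq_sum \<gamma> n \<sigma>) \<le> 1"
 using \<open>n \<le> N\<close>
proof (induction n rule: less_induct)
 case (less n)
 let ?w = "rising_coeff (- \<gamma>)"
 let ?B = "\<lambda>m. rising_coeff (\<gamma> * real m + 1)"
 have sm: "summable (\<lambda>m. (- \<sigma>) ^ m * complex_of_real (?B m j))" if "j \<le> N" for j
 proof (rule summable_comparison_test'[OF summ])
  fix m
  show "norm ((- \<sigma>) ^ m * complex_of_real (?B m j)) \<le> cmod \<sigma> ^ m * ?B m N"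
   using rising_coeff_mono[of "\<gamma> * real m" j N] g that
    rising_coeff_pos[of "\<gamma> * real m + 1" j, OF add_nonneg_pos]
   by (auto simp: norm_mult norm_power intro!: mult_left_mono)
 qed
 have conv: "(\<Sum>k\<le>n. of_real (?w k) * cq_sum \<gamma> (n - k) \<sigma>)
   = of_real (rising_coeff (1 - \<gamma>) n) - \<sigma> * cq_sum \<gamma> n \<sigma>"
 proof -
  have "(\<Sum>k\<le>n. of_real (?w k) * cq_sum \<gamma> (n - k) \<sigma>)
   = (\<Sum>k\<le>n. \<Sum>m. of_real (?w k) * ((- \<sigma>) ^ m * of_real (?B m (n - k))))"
   unfolding cq_sum_def using less.prems by (intro sum.cong refl suminf_mult[symmetric] sm) auto
  also have "... = (\<Sum>m. \<Sum>k\<le>n. of_real (?w k) * ((- \<sigma>) ^ m * of_real (?B m (n - k))))"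
   using less.prems by (intro suminf_sum[symmetric] summable_mult sm) auto
  also have "... = (\<Sum>m. (- \<sigma>) ^ m * of_real (\<Sum>k\<le>n. ?w k * ?B m (n - k)))"
   by (simp add: sum_distrib_left algebra_simps)
  also have "... = (\<Sum>m. (- \<sigma>) ^ m * of_real (rising_coeff (\<gamma> * (real m - 1) + 1) n))"
   unfolding rising_coeff_vandermonde by (simp add: algebra_simps)
  also have "... = of_real (rising_coeff (1 - \<gamma>) n)
    + (\<Sum>m. (- \<sigma>) ^ Suc m * of_real (?B m n))"
  proof -
   have *: "summable (\<lambda>m. (- \<sigma>) ^ Suc m * of_real (?B m n))"
    using summable_mult[OF sm[OF less.prems], of "- \<sigma>"] by (simp add: mult.assoc)
   then have "summable (\<lambda>m. (- \<sigma>) ^ m * complex_of_real (rising_coeff (\<gamma> * (real m - 1) + 1) n))"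
    by (subst summable_Suc_iff[symmetric]) simp
   from suminf_split_head[OF this] show ?thesis by simp
  qed
  also have "(\<Sum>m. (- \<sigma>) ^ Suc m * of_real (?B m n)) = - \<sigma> * cq_sum \<gamma> n \<sigma>"
   unfolding cq_sum_def
   by (subst suminf_mult[OF sm[OF less.prems], symmetric]) (simp add: mult.assoc)
  finally show ?thesis by simp
 qed
 have split: "{..n} = insert 0 {1..n}" by auto
 have "(1 + \<sigma>) * cq_sum \<gamma> n \<sigma>
   = of_real (rising_coeff (1 - \<gamma>) n) - (\<Sum>k=1..n. of_real (?w k) * cq_sum \<gamma> (n - k) \<sigma>)"
  using conv unfolding split by (simp add: algebra_simps)
 then have "cmod (1 + \<sigma>) * cmod (cq_sum \<gamma> n \<sigma>)
   \<le> cmod (of_real (rising_coeff (1 - \<gamma>) n)) + cmod (\<Sum>k=1..n. of_real (?w k) * cq_sum \<gamma> (n - k) \<sigma>)"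
  by (metis norm_mult norm_triangle_ineq4)
 also have "... \<le> rising_coeff (1 - \<gamma>) n + (\<Sum>k=1..n. - ?w k)"
 proof (intro add_mono sum_norm_le)
  show "cmod (of_real (rising_coeff (1 - \<gamma>) n)) \<le> rising_coeff (1 - \<gamma>) n"
   using rising_coeff_pos[of "1 - \<gamma>" n] g by simp
  fix k assume k: "k \<in> {1..n}"
  then have "?w k \<le> 0" using rising_coeff_neg[OF g, of "k - 1"] by simp
  moreover have "cmod (cq_sum \<gamma> (n - k) \<sigma>) \<le> 1" using k less by auto
  ultimately show "cmod (of_real (?w k) * cq_sum \<gamma> (n - k) \<sigma>) \<le> - ?w k"
   using mult_left_le[of "cmod (cq_sum \<gamma> (n - k) \<sigma>)" "- ?w k"] by (simp add: norm_mult)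
 qed
 also have "... = 1"
  using rising_coeff_vandermonde[of "- \<gamma>" 1 n] unfolding split by (simp add: sum_negf)
 finally have "cmod (1 + \<sigma>) * cmod (cq_sum \<gamma> n \<sigma>) \<le> 1" .
 moreover have "1 \<le> cmod (1 + \<sigma>)" using re complex_Re_le_cmod[of "1 + \<sigma>"] by simp
 ultimately show ?case
  using mult_right_mono[of 1 "cmod (1 + \<sigma>)" "cmod (cq_sum \<gamma> n \<sigma>)"] by simp
qed

lemma Gamma_add_le:
 fixes x s :: real
 assumes "0 < x" "0 \<le> s" "s \<le> 1"
 shows "Gamma (x + s) \<le> x powr s * Gamma x"
proof -
 have "ln (Gamma ((1 - s) * x + s * (x + 1))) \<le> (1 - s) * ln (Gamma x) + s * ln (Gamma (x + 1))"
  using convex_onD[OF log_convex_Gamma_real, of s x "x + 1"] assms by simp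
 also have "(1 - s) * x + s * (x + 1) = x + s" by (simp add: algebra_simps)
 also have "Gamma (x + 1) = x * Gamma x"
  using assms by (intro Gamma_plus1) (auto elim!: nonpos_Ints_cases)
 also have "(1 - s) * ln (Gamma x) + s * ln (x * Gamma x) = ln (x powr s * Gamma x)"
  using assms by (simp add: ln_mult algebra_simps)
 finally show ?thesis using assms by (subst (asm) ln_le_cancel_iff) auto
qed

text \<open>This bound and the next one majorize the terms of the series for small and for large
index, so that the limit of \<open>cq_sum\<close> can be taken term by term.\<close>

lemma rising_coeff_scaled_le:
 assumes "0 \<le> a" "a + 1 \<le> real n"
 shows "rising_coeff (a + 1) n \<le> (2 * real n) powr a / Gamma (a + 1)"
proof -
 define q where "q = nat \<lfloor>a\<rfloor>"
 define s where "s = a - real q"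
 have s: "0 \<le> s" "s \<le> 1" "a = real q + s" using assms by (auto simp: s_def q_def) linarith
 have le: "real (n + q + 1) \<le> 2 * real n" using s assms by linarith
 have "rising_coeff (a + 1) n = Gamma (a + 1 + real n) / Gamma (a + 1) / fact n"
  unfolding rising_coeff_def using assms
  by (subst pochhammer_Gamma) (auto elim!: nonpos_Ints_cases)
 also have "Gamma (a + 1 + real n) = Gamma (real (n + q + 1) + s)"
  using s by (simp add: algebra_simps)
 also have "... \<le> real (n + q + 1) powr s * Gamma (real (n + q + 1))"
  using s by (intro Gamma_add_le) auto
 also have "Gamma (real (n + q + 1)) = fact (n + q)"
  using Gamma_fact[of "n + q", where ?'a = real] by (simp add: add_ac)
 also have "fact (n + q) \<le> real (n + q + 1) ^ q * fact n"
 proof -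
  have "fact (n + q) div fact (n + q - q) \<le> (n + q) ^ q"
   by (rule fact_div_fact_le_pow) simp
  moreover have "fact (n + q) = (fact (n + q) div fact n) * (fact n :: nat)"
   by (simp add: fact_dvd)
  ultimately have "(fact (n + q) :: nat) \<le> (n + q) ^ q * fact n"
   by (metis add_diff_cancel_right' mult_le_mono1)
  also have "... \<le> (n + q + 1) ^ q * fact n"
   by (intro mult_right_mono power_mono) auto
  finally have "real (fact (n + q)) \<le> real ((n + q + 1) ^ q * fact n)"
   by (simp only: of_nat_le_iff)
  then show ?thesis by simp
 qed
 also have "real (n + q + 1) powr s * (real (n + q + 1) ^ q * fact n) / Gamma (a + 1) / fact n
   = real (n + q + 1) powr a / Gamma (a + 1)"
  unfolding s by (simp add: powr_add powr_realpow[symmetric] del: of_nat_add of_nat_Suc)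
 also have "... \<le> (2 * real n) powr a / Gamma (a + 1)"
  using le assms by (intro divide_right_mono powr_mono2) (auto intro!: less_imp_le)
 finally show ?thesis using assms
  by (simp add: divide_right_mono mult_left_mono)
qed

lemma rising_coeff_le_power4:
 assumes "0 \<le> a" "real n < a + 1"
 shows "rising_coeff (a + 1) n \<le> 4 powr (a + 1)"
proof -
 define p where "p = nat \<lceil>a\<rceil>"
 have p: "a \<le> real p" "real p < a + 1" using assms unfolding p_def by linarith+
 have "pochhammer (a + 1) n \<le> pochhammer (real p + 1) n"
  unfolding pochhammer_prod using p assms by (intro prod_mono) auto
 also have "pochhammer (real p + 1) n = fact (p + n) / fact p"
  using pochhammer_Gamma[of "real p + 1" n] Gamma_fact[of p, where ?'a = real]
   Gamma_fact[of "p + n", where ?'a = real] of_nat_in_nonpos_Ints_iff[of "Suc p", where ?'a = real]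
  by (simp add: add_ac)
 finally have "rising_coeff (a + 1) n \<le> fact (p + n) / fact p / fact n"
  unfolding rising_coeff_def by (intro divide_right_mono) auto
 also have "... = real ((p + n) choose n)"
  by (subst binomial_fact) auto
 also have "... \<le> 2 ^ (p + n)"
  by (metis binomial_le_pow2 of_nat_le_iff of_nat_numeral of_nat_power)
 also have "... = 2 powr (real p + real n)" by (simp add: powr_realpow[symmetric])
 also have "... \<le> 2 powr ((a + 1) + (a + 1))" using p assms by (intro powr_mono) auto
 also have "... = 4 powr (a + 1)" by (subst powr_add) (simp add: powr_mult[symmetric])
 finally show ?thesis .
qed

lemma rising_coeff_limit:
 assumes "0 \<le> a"
 shows "(\<lambda>n. rising_coeff (a + 1) n * real n powr - a) ----> 1 / Gamma (a + 1)"
proof -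
 have "(\<lambda>n. rGamma_series (a + 1) n * (real n / (real n + a + 1))) ----> rGamma (a + 1) * 1"
 proof (intro tendsto_mult rGamma_series_LIMSEQ)
  show "(\<lambda>n. real n / (real n + a + 1)) ----> 1" by real_asymp
 qed
 moreover have "\<forall>\<^sub>F n in sequentially. rGamma_series (a + 1) n * (real n / (real n + a + 1))
   = rising_coeff (a + 1) n * real n powr - a"
  using eventually_gt_at_top[of 0]
 proof eventually_elim
  case (elim n)
  have "exp ((a + 1) * ln (real n)) = real n powr a * real n"
   using elim by (simp add: powr_def exp_add algebra_simps)
  moreover have "pochhammer (a + 1) (n + 1) = pochhammer (a + 1) n * (real n + a + 1)"
   by (simp add: pochhammer_Suc algebra_simps)
  moreover have "real n + a + 1 > 0" using assms by linarith
  moreover have aux: "P * X / (F * (N * M)) * (M / X) = P / F * inverse N"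
   if "X > 0" "M > 0" for P X F N M :: real
   using that by (simp add: field_simps)
  ultimately show ?case
   unfolding rGamma_series_def rising_coeff_def powr_minus
   using aux[of "real n + a + 1" "real n" "pochhammer (a + 1) n" "fact n" "real n powr a"] elim
   by simp
 qed
 ultimately show ?thesis
  by (simp add: rGamma_inverse_Gamma inverse_eq_divide tendsto_cong)
qed

lemma Gamma_add_ge:
 fixes x s :: real
 assumes "1 \<le> x" "0 \<le> s" "s \<le> 1"
 shows "Gamma (x + s) \<ge> Gamma x * x powr s / 2"
proof -
 have "x * Gamma x = Gamma (x + 1)"
  using assms by (intro Gamma_plus1[symmetric]) (auto elim!: nonpos_Ints_cases)
 also have "... = Gamma ((x + s) + (1 - s))" by simp
 also have "... \<le> (x + s) powr (1 - s) * Gamma (x + s)"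
  using assms by (intro Gamma_add_le) auto
 also have "... \<le> (2 * x) powr (1 - s) * Gamma (x + s)"
  using assms by (intro mult_right_mono powr_mono2) auto
 also have "(2 * x) powr (1 - s) = 2 powr (1 - s) * (x * x powr - s)"
  using assms by (simp add: powr_mult powr_diff powr_minus divide_inverse)
 also have "2 powr (1 - s) * (x * x powr - s) \<le> 2 * (x * x powr - s)"
  using assms powr_mono[of "1 - s" 1 2] by (intro mult_right_mono) auto
 finally have "x * Gamma x \<le> 2 * (x * x powr - s) * Gamma (x + s)"
  using assms by (simp add: mult_right_mono)
 then have "Gamma x \<le> 2 * x powr - s * Gamma (x + s)" using assms by (simp add: mult.assoc)
 then show ?thesis using assms by (simp add: powr_minus field_simps)
qed

lemma mittag_leffler_summable:
 fixes z :: complex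
 assumes "0 < \<gamma>" "\<gamma> \<le> 1" "0 < \<mu>"
 shows "summable (\<lambda>m. cmod z ^ m / Gamma (real m * \<gamma> + \<mu>))"
proof -
 have "filterlim (\<lambda>m. (real m * \<gamma> + \<mu>) powr \<gamma>) at_top sequentially"
  using assms by real_asymp
 then have "\<forall>\<^sub>F m in sequentially. (real m * \<gamma> + \<mu>) powr \<gamma> \<ge> 4 * cmod z"
  by (simp add: filterlim_at_top)
 moreover have "filterlim (\<lambda>m. real m * \<gamma> + \<mu>) at_top sequentially"
  using assms by real_asymp
 then have "\<forall>\<^sub>F m in sequentially. real m * \<gamma> + \<mu> \<ge> 1"
  by (simp add: filterlim_at_top)
 ultimately have "\<forall>\<^sub>F m in sequentially. (real m * \<gamma> + \<mu>) powr \<gamma> \<ge> 4 * cmod z \<and> real m * \<gamma> + \<mu> \<ge> 1"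
  by eventually_elim auto
 then obtain n0 where n0: "\<And>m. m \<ge> n0 ==> (real m * \<gamma> + \<mu>) powr \<gamma> \<ge> 4 * cmod z \<and> real m * \<gamma> + \<mu> \<ge> 1"
  by (auto simp: eventually_sequentially)
 show ?thesis
 proof (rule summable_ratio_test[of "1/2" n0])
  fix m assume m: "n0 \<le> m"
  let ?x = "real m * \<gamma> + \<mu>"
  have x: "1 \<le> ?x" "4 * cmod z \<le> ?x powr \<gamma>" using n0[OF m] by auto
  have G: "Gamma ?x > 0" "Gamma (?x + \<gamma>) > 0" using x assms by auto
  have "Gamma ?x * (2 * cmod z) \<le> Gamma ?x * (?x powr \<gamma> / 2)"
   using x G by (intro mult_left_mono) auto
  also have "... \<le> Gamma (?x + \<gamma>)" using Gamma_add_ge[of ?x \<gamma>] x assms by simp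
  finally have "cmod z / Gamma (?x + \<gamma>) \<le> 1/2 * (1 / Gamma ?x)"
   using G by (simp add: field_simps)
  then have "cmod z ^ m * (cmod z / Gamma (?x + \<gamma>)) \<le> cmod z ^ m * (1/2 * (1 / Gamma ?x))"
   by (intro mult_left_mono) auto
  moreover have eq: "real (Suc m) * \<gamma> + \<mu> = ?x + \<gamma>" by (simp add: algebra_simps)
  ultimately show "norm (cmod z ^ Suc m / Gamma (real (Suc m) * \<gamma> + \<mu>))
    \<le> 1/2 * norm (cmod z ^ m / Gamma ?x)"
   using G unfolding eq by (simp add: mult_ac)
 qed simp
qed

lemma powr_power_nat:
 fixes x :: real
 assumes "0 < x"
 shows "(x powr a) ^ m = x powr (a * real m)"
 by (metis assms powr_gt_zero powr_powr powr_realpow)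

text \<open>The limit \<open>n \<rightarrow> \<infinity>\<close> of \<open>cq_sum_bound\<close> at \<open>\<sigma> = z / n powr \<gamma>\<close>, by dominated
convergence of the series.\<close>

lemma mittag_leffler_half_plane_bound:
 assumes g: "0 < \<gamma>" "\<gamma> < 1" and re: "0 \<le> Re z"
 shows "cmod (mittag_leffler \<gamma> 1 (- z)) \<le> 1"
proof -
 \<comment> \<open>The first term majorizes while \<open>\<gamma> m + 1 \<le> n\<close>, the second one beyond.\<close>
 define M where "M m = (2 powr \<gamma> * cmod z) ^ m / Gamma (real m * \<gamma> + 1) + 4 * (1/2) ^ m" for m :: nat
 define A where "A m n = (- z / of_real (real n powr \<gamma>)) ^ m * complex_of_real (rising_coeff (\<gamma> * real m + 1) n)"
  for m n :: nat
 have sM: "summable M"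
  unfolding M_def
  using mittag_leffler_summable[of \<gamma> 1 "of_real (2 powr \<gamma>) * z"] g
  by (intro summable_add summable_mult) (auto simp: norm_mult summable_geometric)
 have "(\<lambda>n. cmod z * (4 / real n) powr \<gamma>) ----> 0"
  using g by real_asymp
 then have "\<forall>\<^sub>F n in sequentially. cmod z * (4 / real n) powr \<gamma> < 1/2"
  by (rule order_tendstoD) simp
 then obtain n0 where n0: "\<And>n. n \<ge> n0 ==> cmod z * (4 / real n) powr \<gamma> < 1/2"
  by (auto simp: eventually_sequentially)
 have normA: "norm (A m n) = cmod z ^ m * (rising_coeff (\<gamma> * real m + 1) n * real n powr - (\<gamma> * real m))"
  if "0 < n" for m n
 proof -
  have "(real n powr \<gamma>) ^ m = real n powr (\<gamma> * real m)"
   using that by (simp add: powr_power_nat)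
  moreover have "0 < rising_coeff (\<gamma> * real m + 1) n"
   using g by (intro rising_coeff_pos add_nonneg_pos) auto
  ultimately have "norm (A m n) = cmod z ^ m / real n powr (\<gamma> * real m) * rising_coeff (\<gamma> * real m + 1) n"
   by (simp add: A_def norm_mult norm_power norm_divide power_divide)
  then show ?thesis by (simp add: powr_minus_divide)
 qed
 have bound: "norm (A m n) \<le> M m" if n: "n0 \<le> n" "0 < n" for m n
 proof -
  let ?a = "\<gamma> * real m"
  have a: "0 \<le> ?a" using g by simp
  show ?thesis
  proof (cases "?a + 1 \<le> real n")
   case True
   have "rising_coeff (?a + 1) n * real n powr - ?a \<le> (2 * real n) powr ?a / Gamma (?a + 1) * real n powr - ?a"
    using rising_coeff_scaled_le[OF a True] by (intro mult_right_mono) auto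
   also have "... = 2 powr ?a / Gamma (?a + 1)"
    using n by (simp add: powr_mult powr_minus)
   finally have "norm (A m n) \<le> cmod z ^ m * (2 powr ?a / Gamma (?a + 1))"
    unfolding normA[OF n(2)] by (intro mult_left_mono) auto
   also have "... = (2 powr \<gamma> * cmod z) ^ m / Gamma (real m * \<gamma> + 1)"
    by (simp add: power_mult_distrib powr_power_nat mult.commute[of \<gamma>])
   finally show ?thesis unfolding M_def by (simp add: add_increasing2)
  next
   case False
   have "rising_coeff (?a + 1) n * real n powr - ?a \<le> 4 powr (?a + 1) * real n powr - ?a"
    using rising_coeff_le_power4[OF a] False by (intro mult_right_mono) auto
   also have "... = 4 * (4 powr ?a / real n powr ?a)"
    by (simp add: powr_add powr_minus_divide)
   also have "4 powr ?a / real n powr ?a = (4 / real n) powr ?a"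
    by (subst powr_divide) auto
   also have "(4 / real n) powr ?a = ((4 / real n) powr \<gamma>) ^ m"
    using n by (simp add: powr_power_nat)
   finally have "norm (A m n) \<le> cmod z ^ m * (4 * ((4 / real n) powr \<gamma>) ^ m)"
    unfolding normA[OF n(2)] by (intro mult_left_mono) auto
   also have "... = 4 * (cmod z * (4 / real n) powr \<gamma>) ^ m" by (simp add: power_mult_distrib)
   also have "... \<le> 4 * (1/2) ^ m" using n0[OF n(1)] by (intro mult_left_mono power_mono) auto
   finally show ?thesis
    unfolding M_def using g Gamma_real_pos[of "real m * \<gamma> + 1"]
    by (intro order.trans[OF _ add_increasing[OF _ order.refl]]) (auto simp: add_nonneg_pos)
  qed
 qed
 have lim: "(\<lambda>n. suminf (\<lambda>m. A m n)) ----> suminf (\<lambda>m. (- z) ^ m / complex_of_real (Gamma (real m * \<gamma> + 1)))"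
 proof (rule tannerys_theorem[where M = M, THEN conjunct2, THEN conjunct2])
  fix m
  have "(\<lambda>n. (- z) ^ m * complex_of_real (rising_coeff (\<gamma> * real m + 1) n * real n powr - (\<gamma> * real m)))
    ----> (- z) ^ m * of_real (1 / Gamma (\<gamma> * real m + 1))"
   using g by (intro tendsto_mult tendsto_const tendsto_of_real rising_coeff_limit) auto
  moreover have "\<forall>\<^sub>F n in sequentially. A m n
    = (- z) ^ m * complex_of_real (rising_coeff (\<gamma> * real m + 1) n * real n powr - (\<gamma> * real m))"
   using eventually_gt_at_top[of 0]
  proof eventually_elim
   case (elim n)
   have "(real n powr \<gamma>) ^ m = real n powr (\<gamma> * real m)"
    using elim by (simp add: powr_power_nat)
   then have "complex_of_real (real n powr \<gamma>) ^ m = of_real (real n powr (\<gamma> * real m))"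
    by (metis of_real_power)
   moreover have "A m n = (- z) ^ m / complex_of_real (real n powr \<gamma>) ^ m
     * complex_of_real (rising_coeff (\<gamma> * real m + 1) n)"
    unfolding A_def power_divide ..
   ultimately show ?case by (simp add: powr_minus divide_inverse mult_ac)
  qed
  ultimately show "(\<lambda>n. A m n) ----> (- z) ^ m / complex_of_real (Gamma (real m * \<gamma> + 1))"
   by (simp add: tendsto_cong mult.commute)
 next
  have "\<forall>\<^sub>F n in sequentially. \<forall>m. norm (A m n) \<le> M m"
   using eventually_ge_at_top[of "max 1 n0"] by eventually_elim (auto intro: bound)
  then have "\<forall>\<^sub>F (i :: nat, n) in at_top \<times>\<^sub>F sequentially. \<forall>m. norm (A m n) \<le> M m"
   by (subst eventually_prod2) (auto simp: trivial_limit_at_top_linorder)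
  then show "\<forall>\<^sub>F (m, n) in at_top \<times>\<^sub>F sequentially. norm (A m n) \<le> M m"
   by eventually_elim auto
 qed (use sM in auto)
 have "cmod (suminf (\<lambda>m. A m n)) \<le> 1" if n: "max 1 n0 \<le> n" for n
 proof -
  have "summable (\<lambda>m. norm (A m n))"
   using bound[of n] n by (intro summable_comparison_test'[OF sM]) auto
  then have "summable (\<lambda>m. cmod (z / of_real (real n powr \<gamma>)) ^ m * rising_coeff (\<gamma> * real m + 1) n)"
   using g rising_coeff_pos[of "\<gamma> * real m + 1" n for m]
   by (auto simp: A_def norm_mult norm_power norm_divide abs_of_pos add_nonneg_pos)
  moreover have "0 \<le> Re (z / of_real (real n powr \<gamma>))" using re by (simp add: Re_divide_of_real)
  ultimately show ?thesis
   using cq_sum_bound[OF g, of "z / of_real (real n powr \<gamma>)" n n]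
   unfolding cq_sum_def A_def by simp
 qed
 then have "\<forall>\<^sub>F n in sequentially. cmod (suminf (\<lambda>m. A m n)) \<le> 1"
  unfolding eventually_sequentially by blast
 then show ?thesis
  unfolding mittag_leffler_def
  by (rule tendsto_upperbound[OF tendsto_norm[OF lim]]) simp
qed

lemma mittag_leffler_deriv:
 assumes "0 < \<gamma>" "\<gamma> \<le> 1"
 shows "(mittag_leffler \<gamma> 1 has_field_derivative mittag_leffler \<gamma> \<gamma> z / of_real \<gamma>) (at z)"
proof -
 define c where "c m = 1 / complex_of_real (Gamma (real m * \<gamma> + 1))" for m :: nat
 have "summable (\<lambda>m. c m * y ^ m)" for y
 proof (rule summable_norm_cancel)
  have "norm (c m * y ^ m) = cmod y ^ m / Gamma (real m * \<gamma> + 1)" for m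
   using assms Gamma_real_pos[OF add_nonneg_pos, of "real m * \<gamma>" 1]
   by (simp add: c_def norm_mult norm_power norm_divide)
  then show "summable (\<lambda>m. norm (c m * y ^ m))"
   using mittag_leffler_summable[of \<gamma> 1 y] assms by simp
 qed
 then have "((\<lambda>x. \<Sum>n. c n * x ^ n) has_field_derivative (\<Sum>n. diffs c n * z ^ n)) (at z)"
  by (rule termdiffs_strong_converges_everywhere)
 moreover have "(\<lambda>x. \<Sum>n. c n * x ^ n) = mittag_leffler \<gamma> 1"
  by (simp add: c_def mittag_leffler_def fun_eq_iff)
 moreover have "diffs c n * z ^ n = (1 / of_real \<gamma>) * (z ^ n / complex_of_real (Gamma (real n * \<gamma> + \<gamma>)))" for n
 proof -
  let ?x = "real n * \<gamma> + \<gamma>"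
  have "0 < ?x" using assms by (simp add: add_nonneg_pos)
  then have "Gamma (?x + 1) = ?x * Gamma ?x" by (intro Gamma_plus1) (auto elim!: nonpos_Ints_cases)
  moreover have "real (Suc n) * \<gamma> + 1 = ?x + 1" by (simp add: algebra_simps)
  moreover have "complex_of_real ?x = of_nat (Suc n) * of_real \<gamma>" by (simp add: algebra_simps)
  moreover have "Gamma ?x ~= 0" using \<open>0 < ?x\<close> by (metis Gamma_real_pos less_irrefl)
  moreover have "complex_of_nat (Suc n) ~= 0" using of_nat_eq_0_iff[of "Suc n", where ?'a=complex] by blast
  ultimately show ?thesis
   using assms unfolding diffs_def c_def
   by (simp del: of_nat_Suc of_real_add)
 qed
 moreover have "summable (\<lambda>n. z ^ n / complex_of_real (Gamma (real n * \<gamma> + \<gamma>)))"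
 proof (rule summable_norm_cancel)
  have "norm (z ^ n / complex_of_real (Gamma (real n * \<gamma> + \<gamma>)))
    = cmod z ^ n / Gamma (real n * \<gamma> + \<gamma>)" for n
   using assms Gamma_real_pos[OF add_nonneg_pos, of "real n * \<gamma>" \<gamma>]
   by (simp add: norm_mult norm_power norm_divide)
  then show "summable (\<lambda>n. norm (z ^ n / complex_of_real (Gamma (real n * \<gamma> + \<gamma>))))"
   using mittag_leffler_summable[of \<gamma> \<gamma> z] assms by simp
 qed
 then have "(\<Sum>n. (1 / of_real \<gamma>) * (z ^ n / complex_of_real (Gamma (real n * \<gamma> + \<gamma>))))
   = (1 / of_real \<gamma>) * mittag_leffler \<gamma> \<gamma> z"
  unfolding mittag_leffler_def by (rule suminf_mult)
 ultimately show ?thesis by simp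
qed

text \<open>The disc of radius \<open>c \<bar>w\<bar>\<close> about \<open>- w\<close> lies in the left half plane, where
\<open>mittag_leffler \<gamma> 1\<close> is bounded; its derivative is \<open>mittag_leffler \<gamma> \<gamma> / \<gamma>\<close>.\<close>

lemma mittag_leffler_sector_bound:
 assumes g: "0 < \<gamma>" "\<gamma> < 1" and c: "0 < c" "c * cmod w \<le> Re w" "w ~= 0"
 shows "cmod (mittag_leffler \<gamma> \<gamma> (- w)) \<le> 2 * \<gamma> / (c * cmod w)"
proof -
 let ?f = "mittag_leffler \<gamma> 1"
 have hol: "?f holomorphic_on S" for S
  using mittag_leffler_deriv[OF g(1) less_imp_le[OF g(2)]]
  by (meson holomorphic_on_def field_differentiable_def field_differentiable_at_within)
 have r: "0 < c * cmod w" using c by simp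
 have "cmod ((deriv ^^ 1) ?f (- w)) \<le> fact 1 * 2 / (c * cmod w) ^ 1"
 proof (rule Cauchy_higher_deriv_bound[where y = 0])
  show "?f w' \<in> ball 0 2" if "w' \<in> ball (- w) (c * cmod w)" for w'
  proof -
   have "\<bar>Re (- w) - Re w'\<bar> < c * cmod w"
    using that abs_Re_le_cmod[of "- w - w'"] by (simp add: dist_norm)
   then have "0 \<le> Re (- w')" using c by auto
   from mittag_leffler_half_plane_bound[OF g this] show ?thesis by simp
  qed
 qed (use r hol in \<open>auto intro: holomorphic_on_imp_continuous_on\<close>)
 moreover have "deriv ?f (- w) = mittag_leffler \<gamma> \<gamma> (- w) / of_real \<gamma>"
  using mittag_leffler_deriv[of \<gamma> "- w"] g by (intro DERIV_imp_deriv) auto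
 ultimately show ?thesis using g by (simp add: norm_divide field_simps)
qed

section \<open>The trapezoidal rule on a strip\<close>

lemma contour_integral_linepath_same_Im:
 assumes "Im z = c" "Im z' = c" "Re z < Re z'"
 shows "contour_integral (linepath z z') f = integral {Re z..Re z'} (\<lambda>x. f (Complex x c))"
proof -
 let ?a = "complex_of_real (Re z)" and ?b = "complex_of_real (Re z')"
 have "linepath z z' x = linepath ?a ?b x + \<i> * of_real c" for x
  using assms by (simp add: linepath_def complex_eq_iff algebra_simps)
 moreover have "z' - z = ?b - ?a" using assms by (simp add: complex_eq_iff)
 ultimately have "contour_integral (linepath z z') f
   = contour_integral (linepath ?a ?b) (\<lambda>w. f (w + \<i> * of_real c))"
  by (simp add: contour_integral_integral)
 also have "... = integral {Re z..Re z'} (\<lambda>x. f (of_real x + \<i> * of_real c))"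
  using assms by (subst contour_integral_linepath_Reals_eq) auto
 finally show ?thesis by (simp add: Complex_eq)
qed

lemma integral_exp_neg_abs_le:
 fixes \<beta> R :: real
 assumes "0 < \<beta>" "0 \<le> R"
 shows "(\<lambda>u. exp (- \<beta> * \<bar>u\<bar>)) integrable_on {- R..R}"
  and "integral {- R..R} (\<lambda>u. exp (- \<beta> * \<bar>u\<bar>)) \<le> 2 / \<beta>"
proof -
 show int: "(\<lambda>u. exp (- \<beta> * \<bar>u\<bar>)) integrable_on {- R..R}"
  by (intro integrable_continuous_real continuous_intros)
 have p: "((\<lambda>u. exp (- \<beta> * u)) has_integral ((- exp (- \<beta> * R) / \<beta>) - (- exp (- \<beta> * 0) / \<beta>))) {0..R}"
  using assms
  by (intro fundamental_theorem_of_calculus)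
   (auto intro!: derivative_eq_intros simp flip: has_real_derivative_iff_has_vector_derivative)
 then have p': "integral {0..R} (\<lambda>u. exp (- \<beta> * \<bar>u\<bar>)) = (1 - exp (- \<beta> * R)) / \<beta>"
  by (subst integral_cong[where g = "\<lambda>u. exp (- \<beta> * u)"])
   (auto simp: integral_unique diff_divide_distrib)
 have "integral {- R..0} (\<lambda>u. exp (- \<beta> * \<bar>u\<bar>)) = integral {0..R} (\<lambda>u. exp (- \<beta> * \<bar>u\<bar>))"
  using Henstock_Kurzweil_Integration.integral_reflect_real[of R 0 "\<lambda>u. exp (- \<beta> * \<bar>u\<bar>)"] by simp
 moreover have "integral {- R..R} (\<lambda>u. exp (- \<beta> * \<bar>u\<bar>))
   = integral {- R..0} (\<lambda>u. exp (- \<beta> * \<bar>u\<bar>)) + integral {0..R} (\<lambda>u. exp (- \<beta> * \<bar>u\<bar>))"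
  using assms int by (subst Henstock_Kurzweil_Integration.integral_combine) auto
 ultimately have "integral {- R..R} (\<lambda>u. exp (- \<beta> * \<bar>u\<bar>)) = 2 * ((1 - exp (- \<beta> * R)) / \<beta>)"
  using p' by simp
 also have "... \<le> 2 * (1 / \<beta>)"
  using assms by (intro mult_left_mono divide_right_mono) auto
 finally show "integral {- R..R} (\<lambda>u. exp (- \<beta> * \<bar>u\<bar>)) \<le> 2 / \<beta>" by simp
qed

lemma norm_integral_exp_decay_le:
 fixes f :: "real => complex"
 assumes "0 < \<beta>" "0 \<le> R" "0 \<le> B" "continuous_on {- R..R} f"
  and "\<And>u. cmod (f u) \<le> B * exp (- \<beta> * \<bar>u\<bar>)"
 shows "cmod (integral {- R..R} f) \<le> 2 * B / \<beta>"
proof -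
 have "cmod (integral {- R..R} f) \<le> integral {- R..R} (\<lambda>u. B * exp (- \<beta> * \<bar>u\<bar>))"
  using assms integral_exp_neg_abs_le(1)[of \<beta> R]
  by (intro integral_norm_bound_integral integrable_continuous_real integrable_on_mult_right continuous_intros) auto
 also have "... = B * integral {- R..R} (\<lambda>u. exp (- \<beta> * \<bar>u\<bar>))" by simp
 also have "... \<le> B * (2 / \<beta>)"
  using assms integral_exp_neg_abs_le(2)[of \<beta> R] by (intro mult_left_mono) auto
 finally show ?thesis by (simp add: mult.commute)
qed

text \<open>The function \<open>1 / (1 - exp (- 2 \<pi> \<i> y / k))\<close> has simple poles at the nodes with residue
\<open>k / (2 \<pi> \<i>)\<close>, so the sum is the integral of \<open>G\<close> times this function around a rectangle whose vertical sides
lie halfway between nodes. On the lower side the factor is \<open>1 + O(q)\<close>, on the upper side \<open>O(q)\<close>, and on the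
vertical sides at most 1 in modulus.\<close>

lemma strip_trapezoid:
 fixes G :: "complex => complex" and d d1 \<beta> k A :: real and n :: nat
 defines "q \<equiv> exp (- 2 * pi * d / k)" and "R \<equiv> (real n + 1/2) * k"
 assumes hol: "G holomorphic_on {y. \<bar>Im y\<bar> < d1}" and d: "0 < d" "d < d1"
  and bnd: "\<And>y. \<bar>Im y\<bar> \<le> d ==> cmod (G y) \<le> A * exp (- \<beta> * \<bar>Re y\<bar>)"
  and pos: "0 < \<beta>" "0 < k" "0 \<le> A"
 shows "cmod (of_real k * (\<Sum>j\<in>{- int n..int n}. G (of_real (of_int j * k)))
      - integral {- R..R} (\<lambda>u. G (Complex u (- d))))
     \<le> 4 * A / \<beta> * (q / (1 - q)) + 4 * d * (A * exp (- \<beta> * R))"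
proof -
 define S where "S = {y. \<bar>Im y\<bar> < d1}"
 have Seq: "S = {y. Im y < d1} \<inter> {y. - d1 < Im y}" by (auto simp: S_def)
 have S: "open S" "convex S" unfolding Seq
  by (auto intro!: open_Int convex_Int simp: open_halfspace_Im_lt open_halfspace_Im_gt
    convex_halfspace_Im_lt convex_halfspace_Im_gt)
 define E where "E y = exp (- (2 * pi * \<i> * y / of_real k))" for y :: complex
 have normE: "cmod (E y) = exp (2 * pi * Im y / k)" for y
  by (simp add: E_def norm_exp_eq_Re)
 define F where "F y = G y / (1 - E y)" for y
 define node where "node j = complex_of_real (of_int j * k)" for j :: int
 have R: "0 < R" using pos by (simp add: R_def)
 have q: "0 < q" "q < 1" using pos d by (auto simp: q_def)
 have E1: "E y = 1 \<longleftrightarrow> (\<exists>j. y = node j)" for y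
 proof
  assume "E y = 1"
  then have "exp (- (2 * pi * \<i> * y / of_real k)) = exp 0" by (simp add: E_def)
  then obtain j :: int where j: "- (2 * pi * \<i> * y / of_real k) = of_int (2 * j) * pi * \<i>"
   unfolding exp_eq by auto
  have "2 * pi * \<i> ~= 0" by simp
  have "y = of_real k / (- (2 * pi * \<i>)) * (- (2 * pi * \<i> * y / of_real k))"
   using pos by simp
  also have "... = node (- j)" unfolding j by (simp add: node_def algebra_simps complex_eq_iff)
  finally show "\<exists>j. y = node j" ..
 next
  assume "\<exists>j. y = node j"
  then obtain j where "y = node j" ..
  then have "- (2 * pi * \<i> * y / of_real k) = of_int (2 * (- j)) * pi * \<i>" using pos by (simp add: node_def)
  then show "E y = 1" unfolding E_def exp_eq_1 by (auto intro!: exI[of _ "- j"])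
 qed
 define T where "T = S \<inter> {y. Re y < (real n + 1) * k} \<inter> {y. - ((real n + 1) * k) < Re y}"
 have T: "open T" "convex T" unfolding T_def using S
  by (auto intro!: open_Int convex_Int simp: open_halfspace_Re_lt open_halfspace_Re_gt
    convex_halfspace_Re_lt convex_halfspace_Re_gt)
 define pts where "pts = node ` {- int n..int n}"
 have inj: "inj node" using pos by (auto simp: inj_def node_def)
 have fin: "finite pts" by (simp add: pts_def)
 have nodeT: "node j \<in> T ==> node j \<in> pts" for j
 proof -
  assume "node j \<in> T"
  then have "\<bar>of_int j * k\<bar> < (real n + 1) * k" by (auto simp: T_def node_def)
  then have "\<bar>real_of_int j\<bar> < real n + 1" using pos by (simp add: abs_mult)
  then have "j \<in> {- int n..int n}" by auto
  then show ?thesis by (auto simp: pts_def)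
 qed
 have E_ne: "E y ~= 1" if "y \<in> T - pts" for y
  using that nodeT E1 by auto
 have holE: "E holomorphic_on X" for X
  unfolding E_def using pos by (auto intro!: holomorphic_intros)
 have holG: "G holomorphic_on X" if "X \<subseteq> T" for X
  using that by (intro holomorphic_on_subset[OF hol]) (auto simp: T_def S_def)
 have holF: "F holomorphic_on (T - pts)"
  unfolding F_def using E_ne by (intro holomorphic_intros holG holE) (auto dest: sym)
 have pT: "pts \<subseteq> T"
 proof
  fix y assume "y \<in> pts"
  then obtain j where j: "y = node j" "\<bar>real_of_int j\<bar> < real n + 1" by (auto simp: pts_def)
  then have "\<bar>of_int j * k\<bar> < (real n + 1) * k" using pos by (simp add: abs_mult)
  then show "y \<in> T" using d by (auto simp: T_def S_def j node_def)
 qed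
 have res: "residue F p = G p * of_real k / (2 * pi * \<i>)" if "p \<in> pts" for p
 proof (rule residue_simple'[where s = "T - (pts - {p})"])
  show "open (T - (pts - {p}))" using T fin by (intro open_Diff finite_imp_closed) auto
  show "p \<in> T - (pts - {p})" using that pT by auto
  show "F holomorphic_on T - (pts - {p}) - {p}"
   using holF by (rule holomorphic_on_subset) auto
  have Ep: "E p = 1" using that by (auto simp: pts_def E1)
  have "((\<lambda>y. 1 - E y) has_field_derivative (2 * pi * \<i> / of_real k) * E p) (at p)"
   unfolding E_def using pos by (auto intro!: derivative_eq_intros)
  then have "((\<lambda>y. (1 - E y) / (y - p)) \<longlongrightarrow> 2 * pi * \<i> / of_real k) (at p)"
   unfolding has_field_derivative_iff using Ep by simp
  then have "((\<lambda>y. inverse ((1 - E y) / (y - p))) \<longlongrightarrow> inverse (2 * pi * \<i> / of_real k)) (at p)"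
   using pos by (intro tendsto_inverse) auto
  moreover have "(G \<longlongrightarrow> G p) (at p)"
   using that pT T holG[OF order.refl]
   by (metis continuous_on_eq_continuous_at holomorphic_on_imp_continuous_on isContD subsetD)
  ultimately have "((\<lambda>y. G y * inverse ((1 - E y) / (y - p))) \<longlongrightarrow> G p * inverse (2 * pi * \<i> / of_real k)) (at p)"
   by (rule tendsto_mult[rotated])
  moreover have "G y * inverse ((1 - E y) / (y - p)) = F y * (y - p)" for y
   by (simp add: F_def)
  moreover have "G p * inverse (2 * pi * \<i> / of_real k) = G p * of_real k / (2 * pi * \<i>)"
   by simp
  ultimately show "((\<lambda>w. F w * (w - p)) \<longlongrightarrow> G p * of_real k / (2 * pi * \<i>)) (at p)"
   by (simp only:)
 qed
 define a1 a2 a3 a4 where "a1 = Complex (- R) (- d)" and "a2 = Complex R (- d)"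
  and "a3 = Complex R d" and "a4 = Complex (- R) d"
 have rp: "rectpath a1 a3 = linepath a1 a2 +++ linepath a2 a3 +++ linepath a3 a4 +++ linepath a4 a1"
  by (simp add: rectpath_def Let_def a1_def a2_def a3_def a4_def)
 have R_lt: "R < (real n + 1) * k" using pos by (simp add: R_def)
 have boxT: "cbox a1 a3 \<subseteq> T"
  using R_lt d by (auto simp: T_def S_def a1_def a3_def in_cbox_complex_iff)
 have node_R: "Re (node j) ~= R \<and> Re (node j) ~= - R" for j
 proof -
  have "2 * j ~= 2 * int n + 1" "2 * j ~= - (2 * int n + 1)" by presburger+
  then have "real_of_int (2 * j) ~= real_of_int (2 * int n + 1)"
   "real_of_int (2 * j) ~= real_of_int (- (2 * int n + 1))"
   by (simp_all only: of_int_eq_iff not_False_eq_True)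
  then have "of_int j ~= real n + 1/2" "of_int j ~= - (real n + 1/2)" by auto
  then have "of_int j * k ~= (real n + 1/2) * k" "of_int j * k ~= - (real n + 1/2) * k"
   using pos by (metis mult_cancel_right less_irrefl)+
  then have "of_int j * k ~= (real n + 1/2) * k" "of_int j * k ~= - ((real n + 1/2) * k)"
   by (simp_all only: mult_minus_left not_False_eq_True)
  then show ?thesis unfolding node_def R_def by auto
 qed
 have img: "path_image (rectpath a1 a3) \<subseteq> T - pts"
 proof -
  have "path_image (rectpath a1 a3) \<subseteq> T"
   using path_image_rectpath_subset_cbox[of a1 a3] boxT d R by (auto simp: a1_def a3_def)
  moreover have "node j \<notin> path_image (rectpath a1 a3)" for j
   using d R node_R[of j] by (subst path_image_rectpath) (auto simp: a1_def a3_def node_def)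
  ultimately show ?thesis by (auto simp: pts_def)
 qed
 have segs: "closed_segment a1 a2 \<subseteq> T - pts" "closed_segment a2 a3 \<subseteq> T - pts"
  "closed_segment a3 a4 \<subseteq> T - pts" "closed_segment a4 a1 \<subseteq> T - pts"
  using img by (auto simp: rp path_image_join)
 have contF: "continuous_on (T - pts) F" by (rule holomorphic_on_imp_continuous_on[OF holF])
 have cont: "continuous_on (closed_segment a1 a2) F" "continuous_on (closed_segment a2 a3) F"
  "continuous_on (closed_segment a3 a4) F" "continuous_on (closed_segment a4 a1) F"
  using segs by (auto intro: continuous_on_subset[OF contF])
 have integ: "F contour_integrable_on linepath a1 a2" "F contour_integrable_on linepath a2 a3"
  "F contour_integrable_on linepath a3 a4" "F contour_integrable_on linepath a4 a1"
  using cont by (auto intro: contour_integrable_continuous_linepath)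
 have "contour_integral (rectpath a1 a3) F
   = 2 * pi * \<i> * (\<Sum>p\<in>pts. winding_number (rectpath a1 a3) p * residue F p)"
 proof (rule Residue_theorem[OF T(1) convex_connected[OF T(2)] fin holF _ _ img])
  show "\<forall>z. z \<notin> T --> winding_number (rectpath a1 a3) z = 0"
   using boxT d R by (auto intro!: winding_number_rectpath_outside simp: a1_def a3_def)
 qed (auto simp: rp)
 also have "... = (\<Sum>p\<in>pts. of_real k * G p)"
  unfolding sum_distrib_left
 proof (intro sum.cong refl)
  fix p assume p: "p \<in> pts"
  then obtain j where j: "p = node j" "\<bar>real_of_int j\<bar> \<le> real n" by (auto simp: pts_def)
  have "\<bar>real_of_int j\<bar> * k \<le> real n * k" using j pos by (intro mult_right_mono) auto
  moreover have "\<bar>real_of_int j * k\<bar> = \<bar>real_of_int j\<bar> * k" using pos by (simp add: abs_mult)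
  ultimately have "\<bar>real_of_int j * k\<bar> < R" unfolding R_def distrib_right using pos by linarith
  then have "p \<in> box a1 a3" using d by (auto simp: j node_def a1_def a3_def in_box_complex_iff)
  then have "winding_number (rectpath a1 a3) p = 1" by (rule winding_number_rectpath)
  then show "2 * pi * \<i> * (winding_number (rectpath a1 a3) p * residue F p) = of_real k * G p"
   unfolding res[OF p] by simp
 qed
 also have "... = of_real k * (\<Sum>j\<in>{- int n..int n}. G (node j))"
  unfolding pts_def by (subst sum.reindex) (auto simp: sum_distrib_left intro: inj_on_subset[OF inj])
 finally have sum_eq: "of_real k * (\<Sum>j\<in>{- int n..int n}. G (node j)) = contour_integral (rectpath a1 a3) F" ..
 have split: "contour_integral (rectpath a1 a3) F
   = contour_integral (linepath a1 a2) F + contour_integral (linepath a2 a3) F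
    - contour_integral (linepath a4 a3) F + contour_integral (linepath a4 a1) F"
  unfolding rp using integ contour_integral_reverse_linepath[OF cont(3)]
  by (simp add: contour_integrable_join)
 have lineT: "Complex u v \<in> T - pts" if "u \<in> {- R..R}" "v = d \<or> v = - d" for u v
 proof -
  have "Complex u v \<in> path_image (rectpath a1 a3)"
   using that d R by (subst path_image_rectpath) (auto simp: a1_def a3_def)
  then show ?thesis using img by auto
 qed
 have cont_line: "continuous_on {- R..R} (\<lambda>u. h (Complex u v))"
  if "continuous_on (T - pts) h" "v = d \<or> v = - d" for h :: "complex => complex" and v
 proof (rule continuous_on_compose2[OF that(1)])
  show "continuous_on {- R..R} (\<lambda>u. Complex u v)"
   unfolding Complex_eq by (intro continuous_intros)
  show "(\<lambda>u. Complex u v) ` {- R..R} \<subseteq> T - pts" using lineT that by blast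
 qed
 have contG: "continuous_on (T - pts) G"
  by (intro holomorphic_on_imp_continuous_on holG) auto
 have bot: "contour_integral (linepath a1 a2) F = integral {- R..R} (\<lambda>u. F (Complex u (- d)))"
  using R by (subst contour_integral_linepath_same_Im) (auto simp: a1_def a2_def)
 have top: "contour_integral (linepath a4 a3) F = integral {- R..R} (\<lambda>u. F (Complex u d))"
  using R by (subst contour_integral_linepath_same_Im) (auto simp: a3_def a4_def)
 have q': "0 \<le> A * (q / (1 - q))" using q pos by auto
 have low: "cmod (contour_integral (linepath a1 a2) F - integral {- R..R} (\<lambda>u. G (Complex u (- d))))
   \<le> 2 * (A * (q / (1 - q))) / \<beta>"
 proof -
  have "contour_integral (linepath a1 a2) F - integral {- R..R} (\<lambda>u. G (Complex u (- d)))
   = integral {- R..R} (\<lambda>u. F (Complex u (- d)) - G (Complex u (- d)))"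
   unfolding bot
   by (intro Henstock_Kurzweil_Integration.integral_diff[symmetric] integrable_continuous_real cont_line contF contG) auto
  also have "cmod ... \<le> 2 * (A * (q / (1 - q))) / \<beta>"
  proof (rule norm_integral_exp_decay_le)
   fix u
   let ?y = "Complex u (- d)"
   have Eq: "cmod (E ?y) = q" by (simp add: normE q_def)
   then have ne: "1 - E ?y ~= 0" and ge: "1 - q \<le> cmod (1 - E ?y)"
    using q norm_triangle_ineq2[of 1 "E ?y"] by auto
   have "F ?y - G ?y = G ?y * (E ?y / (1 - E ?y))" using ne by (simp add: F_def field_simps)
   then have "cmod (F ?y - G ?y) = cmod (G ?y) * (q / cmod (1 - E ?y))"
    by (simp add: norm_mult norm_divide Eq)
   also have "... \<le> (A * exp (- \<beta> * \<bar>u\<bar>)) * (q / (1 - q))"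
    using bnd[of ?y] ge q d pos by (intro mult_mono divide_left_mono mult_pos_pos) auto
   finally show "cmod (F ?y - G ?y) \<le> A * (q / (1 - q)) * exp (- \<beta> * \<bar>u\<bar>)"
    by (simp add: mult_ac)
  qed (use pos R q' in \<open>auto intro!: continuous_intros cont_line contF contG\<close>)
  finally show ?thesis .
 qed
 have high: "cmod (contour_integral (linepath a4 a3) F) \<le> 2 * (A * (q / (1 - q))) / \<beta>"
  unfolding top
 proof (rule norm_integral_exp_decay_le)
  fix u
  let ?y = "Complex u d"
  have Eq: "cmod (E ?y) = 1 / q" by (simp add: normE q_def exp_minus divide_inverse)
  then have ge: "1 / q - 1 \<le> cmod (1 - E ?y)"
   using q norm_triangle_ineq2[of "E ?y" 1] by (auto simp: norm_minus_commute)
  have q1: "0 < 1 / q - 1" using q by (simp add: field_simps)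
  have "cmod (F ?y) = cmod (G ?y) * (1 / cmod (1 - E ?y))" by (simp add: F_def norm_divide)
  also have "... \<le> (A * exp (- \<beta> * \<bar>u\<bar>)) * (1 / (1 / q - 1))"
   using bnd[of ?y] ge q1 d pos by (intro mult_mono divide_left_mono mult_pos_pos) auto
  also have "1 / (1 / q - 1) = q / (1 - q)" using q by (simp add: field_simps)
  finally show "cmod (F ?y) \<le> A * (q / (1 - q)) * exp (- \<beta> * \<bar>u\<bar>)" by (simp add: mult_ac)
 qed (use pos R q' in \<open>auto intro!: continuous_intros cont_line contF\<close>)
 have sideF: "cmod (F y) \<le> A * exp (- \<beta> * R)" if y: "\<bar>Re y\<bar> = R" "\<bar>Im y\<bar> \<le> d" for y
 proof -
  have "- (2 * pi * \<i> * y / of_real k) = Complex (2 * pi * Im y / k) (- (2 * pi * Re y / k))"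
   by (simp add: complex_eq_iff)
  then have "Re (E y) = exp (2 * pi * Im y / k) * cos (2 * pi * Re y / k)"
   by (simp add: E_def Re_exp)
  also have "cos (2 * pi * Re y / k) = cos (\<bar>2 * pi * Re y / k\<bar>)" by (rule cos_abs_real[symmetric])
  also have "\<bar>2 * pi * Re y / k\<bar> = 2 * pi * \<bar>Re y\<bar> / k"
   using pos by (simp add: abs_mult)
  also have "... = real (2 * n + 1) * pi"
   unfolding y(1) R_def using pos by (simp add: field_simps)
  also have "cos (real (2 * n + 1) * pi) = -1"
   by (simp only: cos_npi) simp
  finally have "Re (1 - E y) \<ge> 1" by simp
  then have "1 \<le> cmod (1 - E y)" using complex_Re_le_cmod[of "1 - E y"] by linarith
  then have "cmod (G y) / cmod (1 - E y) \<le> cmod (G y) / 1"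
   by (intro divide_left_mono) auto
  then have "cmod (F y) \<le> cmod (G y)" by (simp add: F_def norm_divide)
  also have "... \<le> A * exp (- \<beta> * R)" using bnd[of y] y by simp
  finally show ?thesis .
 qed
 have side: "cmod (contour_integral (linepath (Complex x v) (Complex x (- v))) F) \<le> 2 * d * (A * exp (- \<beta> * R))"
  if "F contour_integrable_on linepath (Complex x v) (Complex x (- v))" "\<bar>x\<bar> = R" "\<bar>v\<bar> = d" for x v
 proof -
  have "cmod (contour_integral (linepath (Complex x v) (Complex x (- v))) F)
    \<le> (A * exp (- \<beta> * R)) * cmod (Complex x (- v) - Complex x v)"
  proof (rule contour_integral_bound_linepath[OF that(1)])
   fix y assume "y \<in> closed_segment (Complex x v) (Complex x (- v))"
   then have "Re y = x" "Im y \<in> closed_segment v (- v)"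
    by (auto simp: closed_segment_same_Re)
   then show "cmod (F y) \<le> A * exp (- \<beta> * R)"
    using that by (intro sideF) (auto simp: closed_segment_eq_real_ivl split: if_splits)
  qed (use pos in auto)
  also have "Complex x (- v) - Complex x v = \<i> * of_real (- 2 * v)"
   by (simp add: complex_eq_iff)
  also have "cmod ... = 2 * d" using that by (simp add: norm_mult)
  finally show ?thesis by (simp add: mult_ac)
 qed
 have sides: "cmod (contour_integral (linepath a2 a3) F) \<le> 2 * d * (A * exp (- \<beta> * R))"
  "cmod (contour_integral (linepath a4 a1) F) \<le> 2 * d * (A * exp (- \<beta> * R))"
  using side[of R "- d"] side[of "- R" d] integ d R by (auto simp: a1_def a2_def a3_def a4_def)
 have tri: "cmod (x + y - z + w) \<le> cmod x + cmod y + cmod z + cmod w" for x y z w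
  using norm_triangle_ineq[of "x + y - z" w] norm_triangle_ineq4[of "x + y" z] norm_triangle_ineq[of x y]
  by linarith
 have eq: "of_real k * (\<Sum>j\<in>{- int n..int n}. G (node j)) - integral {- R..R} (\<lambda>u. G (Complex u (- d)))
   = (contour_integral (linepath a1 a2) F - integral {- R..R} (\<lambda>u. G (Complex u (- d))))
    + contour_integral (linepath a2 a3) F
    - contour_integral (linepath a4 a3) F + contour_integral (linepath a4 a1) F"
  unfolding sum_eq split by simp
 have "cmod (of_real k * (\<Sum>j\<in>{- int n..int n}. G (node j)) - integral {- R..R} (\<lambda>u. G (Complex u (- d))))
   \<le> 2 * (A * (q / (1 - q))) / \<beta> + 2 * d * (A * exp (- \<beta> * R))
   + 2 * (A * (q / (1 - q))) / \<beta> + 2 * d * (A * exp (- \<beta> * R))"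
  unfolding eq using low high sides
   tri[of "contour_integral (linepath a1 a2) F - integral {- R..R} (\<lambda>u. G (Complex u (- d)))"
    "contour_integral (linepath a2 a3) F" "contour_integral (linepath a4 a3) F" "contour_integral (linepath a4 a1) F"]
  by linarith
 also have "... = 4 * A / \<beta> * (q / (1 - q)) + 4 * d * (A * exp (- \<beta> * R))"
  by (simp add: field_simps)
 finally show ?thesis by (simp add: node_def)
qed

section \<open>Sinc quadrature of a Cauchy integral on the hyperbola\<close>

text \<open>The extension of the contour \<open>zc\<close> to complex parameters, followed by its derivative.\<close>

definition hyp :: "real => complex => complex" where
 "hyp b y = of_real b * (cosh y + \<i> * sinh y)"

definition hyp' :: "real => complex => complex" where
 "hyp' b y = of_real b * (sinh y + \<i> * cosh y)"

lemma hyp_Complex: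
 "hyp b (Complex u v) = Complex (b * cosh u * (cos v - sin v)) (b * sinh u * (cos v + sin v))"
 "hyp' b (Complex u v) = Complex (b * sinh u * (cos v - sin v)) (b * cosh u * (cos v + sin v))"
 by (simp_all add: hyp_def hyp'_def complex_eq_iff cosh_field_def sinh_field_def Re_exp Im_exp field_simps)

lemma hyp_deriv: "(hyp b has_field_derivative hyp' b y) (at y)"
 unfolding hyp_def hyp'_def by (auto intro!: derivative_eq_intros simp: algebra_simps)

lemma hyp'_deriv: "(hyp' b has_field_derivative hyp b y) (at y)"
 unfolding hyp_def hyp'_def by (auto intro!: derivative_eq_intros simp: algebra_simps)

lemma hyp_holomorphic: "hyp b holomorphic_on S" "hyp' b holomorphic_on S"
 using hyp_deriv hyp'_deriv
 by (meson holomorphic_on_def field_differentiable_def field_differentiable_at_within)+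

lemma cos_minus_sin_pos:
 fixes d :: real
 assumes "0 \<le> d" "d < pi / 4"
 shows "0 < cos d - sin d"
 using cos_monotone_0_pi[of d "pi / 2 - d"] assms by (simp add: cos_diff)

lemma cos_sin_bounds:
 fixes v d :: real
 assumes "\<bar>v\<bar> \<le> d" "d < pi / 4"
 shows "cos d - sin d \<le> cos v - sin v" "cos d - sin d \<le> cos v + sin v"
  "cos v - sin v \<le> sqrt 2" "cos v + sin v \<le> sqrt 2"
proof -
 have "cos d \<le> cos \<bar>v\<bar>" using assms by (intro cos_monotone_0_pi_le) auto
 then have c: "cos d \<le> cos v" by simp
 have s: "\<bar>sin v\<bar> \<le> sin d"
  using assms sin_mono_le_eq[of v d] sin_mono_le_eq[of "- v" d]
  by (auto simp: abs_le_iff)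
 show "cos d - sin d \<le> cos v - sin v" "cos d - sin d \<le> cos v + sin v" using c s by auto
 have eq: "(cos v - sin v)^2 + (cos v + sin v)^2 = 2"
  using sin_cos_squared_add[of v] by (simp add: power2_eq_square algebra_simps)
 show "cos v - sin v \<le> sqrt 2" "cos v + sin v \<le> sqrt 2"
  by (rule real_le_rsqrt, use eq zero_le_power2[of "cos v + sin v"] zero_le_power2[of "cos v - sin v"] in linarith)+
qed

lemma hyp_bounds:
 assumes "0 < b" "\<bar>v\<bar> \<le> d" "d < pi / 4"
 shows "b * (cos d - sin d) * cosh u \<le> Re (hyp b (Complex u v))"
  and "b * (cos d - sin d) * cosh u \<le> cmod (hyp b (Complex u v))"
  and "cmod (hyp' b (Complex u v)) \<le> 4 * b * cosh u"
proof -
 note cs = cos_sin_bounds[OF assms(2,3)]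
 have pos: "0 < cos d - sin d" using assms by (intro cos_minus_sin_pos) auto
 have ch: "1 \<le> cosh u" by (rule cosh_real_ge_1)
 have sh: "\<bar>sinh u\<bar> \<le> cosh u"
  using sinh_le_cosh_real[of u] sinh_le_cosh_real[of "- u"] by (auto simp: abs_le_iff)
 have "b * cosh u * (cos d - sin d) \<le> b * cosh u * (cos v - sin v)"
  using assms cs ch by (intro mult_left_mono) auto
 then show *: "b * (cos d - sin d) * cosh u \<le> Re (hyp b (Complex u v))"
  by (simp add: hyp_Complex mult_ac)
 then show "b * (cos d - sin d) * cosh u \<le> cmod (hyp b (Complex u v))"
  using complex_Re_le_cmod order_trans by blast
 have s2: "sqrt 2 \<le> 2" by (simp add: real_le_lsqrt)
 have "cmod (hyp' b (Complex u v)) \<le> \<bar>b * sinh u * (cos v - sin v)\<bar> + \<bar>b * cosh u * (cos v + sin v)\<bar>"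
  using cmod_le[of "hyp' b (Complex u v)"] by (simp add: hyp_Complex)
 also have "... = b * (\<bar>sinh u\<bar> * (cos v - sin v)) + b * (cosh u * (cos v + sin v))"
  using assms(1) ch cs pos by (simp add: abs_mult)
 also have "... \<le> b * (cosh u * 2) + b * (cosh u * 2)"
  using assms(1) ch cs pos sh s2 by (intro add_mono mult_left_mono mult_mono) linarith+
 finally show "cmod (hyp' b (Complex u v)) \<le> 4 * b * cosh u" by simp
qed

text \<open>Where \<open>cosh u\<close> is large the imaginary part of the hyperbola is comparable with \<open>cosh u\<close>; where it
is close to 1 the real part stays below \<open>sqrt 2 * b * m < lam0\<close>.\<close>

lemma hyp_separation:
 assumes b: "0 < b" "sqrt 2 * b < lam0" and d: "0 \<le> d" "d < pi / 4"
 obtains c where "0 < c"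
  "\<And>u v lam. \<bar>v\<bar> \<le> d ==> lam0 \<le> lam ==> c * cosh u \<le> cmod (hyp b (Complex u v) - of_real lam)"
proof -
 define \<kappa> where "\<kappa> = cos d - sin d"
 have k: "0 < \<kappa>" unfolding \<kappa>_def using d by (rule cos_minus_sin_pos)
 define \<rho> where "\<rho> = lam0 / (sqrt 2 * b)"
 \<comment> \<open>The threshold for \<open>cosh u\<close>, chosen such that \<open>sqrt 2 * b * m\<close> is still below \<open>lam0\<close>.\<close>
 define m where "m = (1 + \<rho>) / 2"
 have "1 < \<rho>" using b by (simp add: \<rho>_def)
 then have m: "1 < m" "m < \<rho>" by (simp_all add: m_def)
 have lm: "sqrt 2 * b * m < lam0"
  using m(2) b by (simp add: \<rho>_def pos_less_divide_eq mult.commute)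
 define c1 where "c1 = (lam0 - sqrt 2 * b * m) / m"
 define c2 where "c2 = b * \<kappa> * sqrt (1 - 1 / m\<^sup>2)"
 have m2: "1 / m\<^sup>2 < 1" using m by (simp add: field_simps power_strict_mono one_less_power)
 have c: "0 < c1" "0 < c2" using lm m m2 b k by (auto simp: c1_def c2_def)
 have sep: "min c1 c2 * cosh u \<le> cmod (hyp b (Complex u v) - of_real lam)"
  if v: "\<bar>v\<bar> \<le> d" and l: "lam0 \<le> lam" for u v lam
 proof -
  note cs = cos_sin_bounds[OF v d(2), folded \<kappa>_def]
  have ch: "1 \<le> cosh u" by (rule cosh_real_ge_1)
  show ?thesis
  proof (cases "cosh u \<le> m")
   case True
   have "b * cosh u * (cos v - sin v) \<le> b * m * sqrt 2"
    using True b cs k ch m by (intro mult_mono) auto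
   then have "lam0 - sqrt 2 * b * m \<le> lam - Re (hyp b (Complex u v))"
    using l by (simp add: hyp_Complex mult_ac)
   also have "... \<le> cmod (hyp b (Complex u v) - of_real lam)"
    using abs_Re_le_cmod[of "hyp b (Complex u v) - of_real lam"] by simp
   finally have "c1 * m \<le> cmod (hyp b (Complex u v) - of_real lam)" using m by (simp add: c1_def)
   moreover have "min c1 c2 * cosh u \<le> c1 * m" using True c ch by (intro mult_mono) auto
   ultimately show ?thesis by linarith
  next
   case False
   have "1 \<le> (cosh u)^2 / m\<^sup>2" using False m by (simp add: field_simps power_mono)
   then have "(cosh u)^2 * (1 - 1 / m\<^sup>2) \<le> (cosh u)^2 - 1" by (simp add: algebra_simps)
   also have "... = (sinh u)^2" using cosh_square_eq[of u] by simp
   finally have "sqrt ((cosh u)^2 * (1 - 1 / m\<^sup>2)) \<le> sqrt ((sinh u)^2)" by (rule real_sqrt_le_mono)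
   then have *: "cosh u * sqrt (1 - 1 / m\<^sup>2) \<le> \<bar>sinh u\<bar>"
    using ch by (simp add: real_sqrt_mult)
   have "c2 * cosh u = b * (cosh u * sqrt (1 - 1 / m\<^sup>2)) * \<kappa>" by (simp add: c2_def)
   also have "... \<le> b * \<bar>sinh u\<bar> * (cos v + sin v)"
    using * b cs k m2 by (intro mult_mono mult_nonneg_nonneg) auto
   also have "... = \<bar>Im (hyp b (Complex u v) - of_real lam)\<bar>"
    using b cs k by (simp add: hyp_Complex abs_mult)
   also have "... \<le> cmod (hyp b (Complex u v) - of_real lam)" by (rule abs_Im_le_cmod)
   finally have "c2 * cosh u \<le> cmod (hyp b (Complex u v) - of_real lam)" .
   moreover have "min c1 c2 * cosh u \<le> c2 * cosh u" using ch by (intro mult_right_mono) auto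
   ultimately show ?thesis by linarith
  qed
 qed
 show thesis using c by (intro that[of "min c1 c2"] sep) auto
qed

text \<open>Cauchy's formula for the contour formed by a truncated hyperbola and a vertical segment. The difference
quotient of \<open>g\<close> has a primitive in the half plane and the rest integrates to a logarithm, so that no
general contour is needed; the vertical segment gives the remainder.\<close>

lemma hyp_cauchy:
 fixes g :: "complex => complex" and b d \<beta> A R lam :: real
 defines "X \<equiv> b * cosh R * (cos d + sin d)"
 assumes b: "0 < b" "sqrt 2 * b < lam" and d: "0 < d" "d < pi / 4"
  and hol: "g holomorphic_on {z. 0 < Re z}"
  and bnd: "\<And>z. 0 < Re z ==> cmod (g z) \<le> A * cmod z powr - \<beta>"
  and A: "0 \<le> A" and \<beta>: "0 < \<beta>" and R: "0 < R" "lam < X"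
 shows "cmod (integral {- R..R} (\<lambda>u. g (hyp b (Complex u (- d))) * hyp' b (Complex u (- d))
      / (hyp b (Complex u (- d)) - of_real lam)) + 2 * pi * \<i> * g (of_real lam))
    \<le> A * X powr - \<beta> * (2 * X / (X - lam))"
proof -
 define H where "H = {z :: complex. 0 < Re z}"
 have cancel: "(x - y) / w + y * inverse w = x / w" for x y w :: complex
  by (simp add: divide_inverse left_diff_distrib)
 have H: "open H" "convex H" unfolding H_def by (simp_all add: open_halfspace_Re_gt convex_halfspace_Re_gt)
 have lam: "0 < lam" using b by (smt (verit) mult_pos_pos real_sqrt_gt_zero)
 have cs: "0 < cos d - sin d" "0 < cos d + sin d" "cos d + sin d \<le> sqrt 2" "cos d - sin d \<le> cos d + sin d"
  using cos_minus_sin_pos[of d] cos_sin_bounds[of d d] d sin_gt_zero[of d] by auto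
 define p where "p u = hyp b (Complex u (- d))" for u
 define p' where "p' u = hyp' b (Complex u (- d))" for u
 have p: "p u = Complex (b * cosh u * (cos d + sin d)) (b * sinh u * (cos d - sin d))" for u
  by (simp add: p_def hyp_Complex)
 have pder: "(p has_vector_derivative p' u) (at u within S)" for u S
 proof -
  have "((\<lambda>u. Complex u (- d)) has_vector_derivative 1) (at u within S)"
   unfolding Complex_eq by (auto intro!: derivative_eq_intros)
  from field_vector_diff_chain_within[OF this has_field_derivative_at_within[OF hyp_deriv]]
  show ?thesis by (simp add: p_def[abs_def] p'_def o_def)
 qed
 have pH: "p u \<in> H" for u using b cs by (simp add: H_def p)
 have p_real: "p u = of_real (b * (cos d + sin d))" if "Im (p u) = 0" for u
 proof -
  have "u = 0" using that b cs by (simp add: p)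
  then show ?thesis by (simp add: p complex_eq_iff)
 qed
 have lt: "b * (cos d + sin d) < lam"
 proof -
  have "b * (cos d + sin d) \<le> b * sqrt 2" using b cs by (intro mult_left_mono) auto
  then show ?thesis using b(2) by (simp only: mult.commute[of b])
 qed
 have pnr: "of_real lam - p u \<notin> \<real>\<^sub>\<le>\<^sub>0" for u
  using p_real[of u] lt by (auto simp: complex_nonpos_Reals_iff)
 have pne: "p u ~= of_real lam" for u using pnr[of u] by auto
 define h where "h z = (if z = of_real lam then deriv g (of_real lam)
   else (g z - g (of_real lam)) / (z - of_real lam))" for z
 have "h holomorphic_on H"
  unfolding h_def[abs_def] using hol H lam
  by (intro pole_lemma) (auto simp: H_def interior_open open_halfspace_Re_gt)
 then have "\<exists>P. \<forall>z\<in>H. (P has_field_derivative h z) (at z within H)"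
  by (rule holomorphic_convex_primitive'[OF H(2,1)]) (intro exI ballI)
 then obtain P where P: "\<And>z. z \<in> H ==> (P has_field_derivative h z) (at z within H)"
  by blast
 have P': "(P has_field_derivative h z) (at z)" if "z \<in> H" for z
  using P[OF that] at_within_open[OF that H(1)] by simp
 define Q where "Q u = Ln (of_real lam - p u)" for u
 have int1: "((\<lambda>u. p' u * h (p u)) has_integral (P (p R) - P (p (- R)))) {- R..R}"
 proof (rule fundamental_theorem_of_calculus)
  fix u
  from field_vector_diff_chain_within[OF pder has_field_derivative_at_within[OF P'[OF pH]]]
  show "((\<lambda>u. P (p u)) has_vector_derivative p' u * h (p u)) (at u within {- R..R})"
   by (simp add: o_def)
 qed (use R in simp)
 have int2: "((\<lambda>u. - p' u * inverse (of_real lam - p u)) has_integral (Q R - Q (- R))) {- R..R}"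
 proof (rule fundamental_theorem_of_calculus)
  fix u
  have "((\<lambda>u. of_real lam - p u) has_vector_derivative - p' u) (at u within {- R..R})"
   by (auto intro!: derivative_eq_intros pder)
  from field_vector_diff_chain_within[OF this has_field_derivative_at_within[OF has_field_derivative_Ln[OF pnr]]]
  show "(Q has_vector_derivative - p' u * inverse (of_real lam - p u)) (at u within {- R..R})"
   by (simp add: o_def Q_def[abs_def])
 qed (use R in simp)
 have "((\<lambda>u. p' u * h (p u) + g (of_real lam) * (- p' u * inverse (of_real lam - p u))) has_integral
   (P (p R) - P (p (- R)) + g (of_real lam) * (Q R - Q (- R)))) {- R..R}"
  by (intro has_integral_add int1 has_integral_mult_right int2)
 moreover have "p' u * h (p u) + g (of_real lam) * (- p' u * inverse (of_real lam - p u))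
   = g (p u) * p' u / (p u - of_real lam)" for u
 proof -
  have "- inverse (of_real lam - p u) = inverse (p u - of_real lam)"
   by (metis inverse_minus_eq minus_diff_eq)
  then have "- p' u * inverse (of_real lam - p u) = p' u * inverse (p u - of_real lam)"
   by (metis mult_minus_left mult_minus_right)
  then have "p' u * h (p u) + g (of_real lam) * (- p' u * inverse (of_real lam - p u))
    = p' u * h (p u) + g (of_real lam) * (p' u * inverse (p u - of_real lam))" by (simp only:)
  also have "... = (h (p u) + g (of_real lam) * inverse (p u - of_real lam)) * p' u"
   by (simp only: distrib_left distrib_right mult_ac)
  also have "h (p u) + g (of_real lam) * inverse (p u - of_real lam) = g (p u) / (p u - of_real lam)"
   using pne[of u] unfolding h_def by (simp only: if_False cancel)
  finally show ?thesis by simp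
 qed
 ultimately have I: "((\<lambda>u. g (p u) * p' u / (p u - of_real lam)) has_integral
   (P (p R) - P (p (- R)) + g (of_real lam) * (Q R - Q (- R)))) {- R..R}"
  by simp
 have ReX: "Re (p R) = X" "Re (p (- R)) = X" by (simp_all add: p X_def)
 have seg: "Re z = X" if "z \<in> closed_segment (p (- R)) (p R)" for z
  using that ReX by (auto simp: closed_segment_same_Re)
 have segH: "closed_segment (p (- R)) (p R) \<subseteq> {z. lam < Re z}" using seg R by auto
 have c1: "(h has_contour_integral (P (p R) - P (p (- R)))) (linepath (p (- R)) (p R))"
 proof -
  have "closed_segment (p (- R)) (p R) \<subseteq> H" using segH lam by (auto simp: H_def)
  then show ?thesis
   using contour_integral_primitive[OF P, where g = "linepath (p (- R)) (p R)"] by simp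
 qed
 define L where "L = Ln (p R - of_real lam) - Ln (p (- R) - of_real lam)"
 have c2: "((\<lambda>z. inverse (z - of_real lam)) has_contour_integral L) (linepath (p (- R)) (p R))"
 proof -
  have "((\<lambda>z. Ln (z - of_real lam)) has_field_derivative inverse (z - of_real lam)) (at z within {z. lam < Re z})"
   if "z \<in> {z. lam < Re z}" for z
   using that by (auto intro!: derivative_eq_intros simp: complex_nonpos_Reals_iff)
  from contour_integral_primitive[OF this, of "linepath (p (- R)) (p R)"] segH
  show ?thesis by (simp add: L_def)
 qed
 have "((\<lambda>z. h z + g (of_real lam) * inverse (z - of_real lam)) has_contour_integral
   (P (p R) - P (p (- R)) + g (of_real lam) * L)) (linepath (p (- R)) (p R))"
  by (intro has_contour_integral_add c1 has_contour_integral_lmul c2)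
 then have c3: "((\<lambda>z. g z / (z - of_real lam)) has_contour_integral
   (P (p R) - P (p (- R)) + g (of_real lam) * L)) (linepath (p (- R)) (p R))"
 proof (rule has_contour_integral_eq)
  fix z assume "z \<in> path_image (linepath (p (- R)) (p R))"
  then have "z ~= of_real lam" using segH by auto
  then show "h z + g (of_real lam) * inverse (z - of_real lam) = g z / (z - of_real lam)"
   using cancel[of "g z" "g (of_real lam)" "z - of_real lam"] by (simp only: h_def if_False)
 qed
 have LQ: "Q R - Q (- R) = L - 2 * pi * \<i>"
 proof -
  have Im: "0 < Im (p R - of_real lam)" "Im (p (- R) - of_real lam) < 0"
   using b cs R by (simp_all add: p)
  then have "p R - of_real lam ~= 0" "p (- R) - of_real lam ~= 0" by (metis zero_complex.simps(2) less_irrefl)+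
  from Ln_minus[OF this(1)] Ln_minus[OF this(2)] Im show ?thesis
   by (simp add: Q_def L_def)
 qed
 have X: "0 < X" "0 < X - lam" using R lam by auto
 have bound: "cmod (P (p R) - P (p (- R)) + g (of_real lam) * L)
   \<le> (A * X powr - \<beta> / (X - lam)) * cmod (p R - p (- R))"
 proof (rule has_contour_integral_bound_linepath[OF c3])
  fix z assume z: "z \<in> closed_segment (p (- R)) (p R)"
  have Rz: "Re z = X" by (rule seg[OF z])
  have "X \<le> cmod z" using complex_Re_le_cmod[of z] Rz by simp
  then have "cmod z powr - \<beta> \<le> X powr - \<beta>" using X \<beta> by (intro powr_mono2') auto
  then have "A * cmod z powr - \<beta> \<le> A * X powr - \<beta>" using A by (rule mult_left_mono)
  with bnd[of z] Rz X have g: "cmod (g z) \<le> A * X powr - \<beta>" by linarith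
  have "X - lam \<le> cmod (z - of_real lam)" using complex_Re_le_cmod[of "z - of_real lam"] Rz by simp
  then show "cmod (g z / (z - of_real lam)) \<le> A * X powr - \<beta> / (X - lam)"
   unfolding norm_divide using g X A by (intro frac_le) auto
 qed (use A X in auto)
 have "p R - p (- R) = \<i> * of_real (2 * (b * sinh R * (cos d - sin d)))"
  by (simp add: p complex_eq_iff)
 moreover have "cmod (\<i> * of_real (2 * y)) = 2 * \<bar>y\<bar>" for y by (simp add: norm_mult)
 ultimately have "cmod (p R - p (- R)) = 2 * \<bar>b * sinh R * (cos d - sin d)\<bar>" by (simp only:)
 also have "... = 2 * (b * sinh R * (cos d - sin d))" using b cs R by simp
 also have "... \<le> 2 * X" unfolding X_def
  using b cs R sinh_le_cosh_real[of R] by (intro mult_left_mono mult_mono) auto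
 finally have len: "cmod (p R - p (- R)) \<le> 2 * X" .
 have "integral {- R..R} (\<lambda>u. g (p u) * p' u / (p u - of_real lam)) + 2 * pi * \<i> * g (of_real lam)
   = P (p R) - P (p (- R)) + g (of_real lam) * L"
  unfolding integral_unique[OF I] LQ by (simp add: algebra_simps)
 then have "cmod (integral {- R..R} (\<lambda>u. g (p u) * p' u / (p u - of_real lam)) + 2 * pi * \<i> * g (of_real lam))
   \<le> (A * X powr - \<beta> / (X - lam)) * cmod (p R - p (- R))" using bound by simp
 also have "... \<le> (A * X powr - \<beta> / (X - lam)) * (2 * X)"
  using len A X by (intro mult_left_mono) auto
 finally show ?thesis by (simp add: p_def p'_def)
qed

lemma sum_symmetric_Suc:
 fixes f :: "int => complex"
 shows "(\<Sum>j\<in>{- int (Suc n)..int (Suc n)}. f j)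
  = (\<Sum>j\<in>{- int n..int n}. f j) + (f (int n + 1) + f (- int n - 1))"
proof -
 have "{- int (Suc n)..int (Suc n)} = insert (int n + 1) (insert (- int n - 1) {- int n..int n})"
  by auto
 then show ?thesis by simp
qed

text \<open>The right-hand side telescopes in \<open>n\<close>, which makes the bound an induction without geometric
series.\<close>

lemma symmetric_tail_bound:
 fixes f :: "int => complex"
 assumes "0 < \<beta>" "0 < k" "0 \<le> B"
  and bnd: "\<And>j. cmod (f j) \<le> B * exp (- \<beta> * \<bar>of_int j * k\<bar>)" and "N \<le> n"
 shows "k * cmod ((\<Sum>j\<in>{- int n..int n}. f j) - (\<Sum>j\<in>{- int N..int N}. f j))
  \<le> 2 * B / \<beta> * (exp (- \<beta> * k * real N) - exp (- \<beta> * k * real n))"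
 using \<open>N \<le> n\<close>
proof (induction n rule: dec_induct)
 case (step n)
 let ?e = "\<lambda>n. exp (- \<beta> * k * real n)"
 have f: "cmod (f (int n + 1)) \<le> B * ?e (Suc n)" "cmod (f (- int n - 1)) \<le> B * ?e (Suc n)"
 proof -
  have "\<bar>real_of_int (int n + 1) * k\<bar> = k * real (Suc n)"
   "\<bar>real_of_int (- int n - 1) * k\<bar> = k * real (Suc n)"
   using assms(2) by (simp_all add: abs_mult)
  then show "cmod (f (int n + 1)) \<le> B * ?e (Suc n)" "cmod (f (- int n - 1)) \<le> B * ?e (Suc n)"
   using bnd[of "int n + 1"] bnd[of "- int n - 1"] by (simp_all only: mult.assoc)
 qed
 have "?e n = ?e (Suc n) * exp (\<beta> * k)"
  by (simp add: exp_add[symmetric] algebra_simps)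
 then have "?e (Suc n) * (1 + \<beta> * k) \<le> ?e n"
  using exp_ge_add_one_self[of "\<beta> * k"] by simp
 then have e: "k * ?e (Suc n) \<le> (?e n - ?e (Suc n)) / \<beta>"
  using assms(1) by (simp add: pos_le_divide_eq algebra_simps)
 let ?D = "(\<Sum>j\<in>{- int n..int n}. f j) - (\<Sum>j\<in>{- int N..int N}. f j)"
 have "k * cmod (?D + (f (int n + 1) + f (- int n - 1)))
   \<le> k * (cmod ?D + (cmod (f (int n + 1)) + cmod (f (- int n - 1))))"
  using assms(2) by (intro mult_left_mono order_trans[OF norm_triangle_ineq] add_mono norm_triangle_ineq) auto
 also have "... \<le> k * cmod ?D + k * (2 * (B * ?e (Suc n)))"
  unfolding distrib_left using assms(2) f by (intro add_mono order.refl)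
   (simp flip: distrib_left)
 also have "k * (2 * (B * ?e (Suc n))) = 2 * B * (k * ?e (Suc n))" by (simp only: mult_ac)
 also have "... \<le> 2 * B * ((?e n - ?e (Suc n)) / \<beta>)"
  using e assms(3) by (intro mult_left_mono) auto
 also have "k * cmod ?D \<le> 2 * B / \<beta> * (?e N - ?e n)" by (rule step.IH)
 finally have "k * cmod (?D + (f (int n + 1) + f (- int n - 1)))
   \<le> 2 * B / \<beta> * (?e N - ?e n) + 2 * B * ((?e n - ?e (Suc n)) / \<beta>)" by simp
 also have "... = 2 * B / \<beta> * (?e N - ?e (Suc n))" by (simp only: times_divide_eq_right times_divide_eq_left
   add_divide_distrib[symmetric] distrib_left[symmetric]) simp
 finally show ?case unfolding sum_symmetric_Suc by (simp only: add_diff_eq diff_add_eq)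
qed simp

text \<open>Combination of \<open>strip_trapezoid\<close> with \<open>n\<close> nodes on either side, Cauchy's formula and the tail
bound, in the limit \<open>n \<rightarrow> \<infinity>\<close>. The constant depends on \<open>g\<close> only through the factor \<open>A\<close>, which is what allows
integration over the time variable afterwards.\<close>

lemma sinc_contour_error:
 fixes b lam0 d \<beta> :: real
 assumes b: "0 < b" "sqrt 2 * b < lam0" and d: "0 < d" "d < pi / 4" and \<beta>: "0 < \<beta>"
 obtains C where "0 \<le> C"
  "\<And>g A lam N k. g holomorphic_on {z. 0 < Re z} ==> 0 \<le> A
   ==> (\<And>z. 0 < Re z ==> cmod (g z) \<le> A * cmod z powr - \<beta>)
   ==> lam0 \<le> lam ==> 1 \<le> N ==> k = sqrt (pi * d / (\<beta> * real N))
   ==> cmod (g (of_real lam) + of_real k / (2 * pi * \<i>) * (\<Sum>j\<in>{- int N..int N}.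
      g (hyp b (of_real (of_int j * k))) * hyp' b (of_real (of_int j * k))
       / (hyp b (of_real (of_int j * k)) - of_real lam)))
     \<le> C * A * exp (- sqrt (pi * \<beta> * d * real N))"
proof -
 \<comment> \<open>A strip slightly wider than \<open>d\<close> on which the integrand is still holomorphic.\<close>
 define d1 where "d1 = (d + pi / 4) / 2"
 have d1: "0 < d1" "d < d1" "d1 < pi / 4" using d by (auto simp: d1_def)
 define \<kappa> where "\<kappa> = cos d - sin d"
 have k0: "0 < \<kappa>" unfolding \<kappa>_def using d by (intro cos_minus_sin_pos) auto
 obtain c where c: "0 < c"
  "\<And>u v lam. \<bar>v\<bar> \<le> d ==> lam0 \<le> lam ==> c * cosh u \<le> cmod (hyp b (Complex u v) - of_real lam)"
  using hyp_separation[OF b, of d] d by auto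
 obtain c' where c': "0 < c'"
  "\<And>u v lam. \<bar>v\<bar> \<le> d1 ==> lam0 \<le> lam ==> c' * cosh u \<le> cmod (hyp b (Complex u v) - of_real lam)"
  using hyp_separation[OF b, of d1] d1 by auto
 define B where "B = (b * \<kappa> / 2) powr - \<beta> * (4 * b / c)"
 have B: "0 \<le> B" using b k0 c by (simp add: B_def)
 define kmax where "kmax = sqrt (pi * d / \<beta>)"
 have kmax: "0 < kmax" using d \<beta> by (simp add: kmax_def)
 define q0 where "q0 = exp (- 2 * pi * d / kmax)"
 have q0: "0 < q0" "q0 < 1" using kmax d by (auto simp: q0_def)
 define C where "C = (4 * B / \<beta> / (1 - q0) + 2 * B / \<beta>) / (2 * pi)"
 have C: "0 \<le> C" using B \<beta> q0 by (simp add: C_def)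
 show thesis
 proof (rule that[OF C])
  fix g :: "complex => complex" and A lam k :: real and N :: nat
  assume hol: "g holomorphic_on {z. 0 < Re z}" and A: "0 \<le> A"
   and bnd: "\<And>z. 0 < Re z ==> cmod (g z) \<le> A * cmod z powr - \<beta>"
   and lam: "lam0 \<le> lam" and N: "1 \<le> N" and k: "k = sqrt (pi * d / (\<beta> * real N))"
  have kpos: "0 < k" using d \<beta> N by (simp add: k)
  have kle: "k \<le> kmax" unfolding k kmax_def
  proof (rule real_sqrt_le_mono)
   show "pi * d / (\<beta> * real N) \<le> pi * d / \<beta>"
    using d \<beta> N by (intro divide_left_mono) auto
  qed
  define x where "x = sqrt (pi * \<beta> * d * real N)"
  \<comment> \<open>The choice of \<open>k\<close> makes the truncation exponent and the discretization exponent equal.\<close>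
  have x1: "\<beta> * k * real N = x"
  proof -
   have "(\<beta> * k * real N)^2 = \<beta>\<^sup>2 * (pi * d / (\<beta> * real N)) * (real N)^2"
    using d \<beta> N by (simp add: k power_mult_distrib)
   also have "... = pi * \<beta> * d * real N" using \<beta> N by (simp add: power2_eq_square field_simps)
   finally show ?thesis unfolding x_def using kpos \<beta> by (metis real_sqrt_unique mult_nonneg_nonneg less_imp_le of_nat_0_le_iff)
  qed
  have x2: "pi * d / k = x"
  proof -
   have "(pi * d / k)^2 = pi\<^sup>2 * d\<^sup>2 / (pi * d / (\<beta> * real N))"
    using d \<beta> N by (simp add: k power_mult_distrib power_divide)
   also have "... = pi * \<beta> * d * real N" using d \<beta> N by (simp add: power2_eq_square field_simps)
   finally show ?thesis unfolding x_def using kpos d by (intro real_sqrt_unique[symmetric]) auto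
  qed
  define \<epsilon> where "\<epsilon> = exp (- x)"
  define q where "q = exp (- 2 * pi * d / k)"
  have "q = exp (- (2 * (pi * d / k)))" by (simp add: q_def mult.assoc)
  then have q_eq: "q = exp (- (2 * x))" unfolding x2 .
  have x0: "0 \<le> x" using d \<beta> by (simp add: x_def)
  have q_le: "q \<le> \<epsilon>" unfolding q_eq \<epsilon>_def using x0 by simp
  have "q \<le> q0" unfolding q_def q0_def using kle kpos d kmax
   by (simp add: divide_left_mono mult_pos_pos)
  then have qq: "q / (1 - q) \<le> \<epsilon> / (1 - q0)"
   using q_le q0 by (intro frac_le) (auto simp: \<epsilon>_def)
  define G where "G y = g (hyp b y) * hyp' b y / (hyp b y - of_real lam)" for y
  have ReH: "0 < Re (hyp b y)" if "\<bar>Im y\<bar> \<le> d1" for y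
  proof -
   have "0 < b * (cos d1 - sin d1) * cosh (Re y)"
    using b d1 cos_minus_sin_pos[of d1] by simp
   also have "... \<le> Re (hyp b (Complex (Re y) (Im y)))"
    using that b d1 by (intro hyp_bounds)
   finally show ?thesis by simp
  qed
  have ne: "hyp b y ~= of_real lam" if "\<bar>Im y\<bar> \<le> d1" for y
  proof -
   have "0 < c' * cosh (Re y)" using c' by simp
   also have "... \<le> cmod (hyp b (Complex (Re y) (Im y)) - of_real lam)" using c' that lam by blast
   finally show ?thesis by auto
  qed
  have holGs: "G holomorphic_on {y. \<bar>Im y\<bar> < d1}"
  proof -
   have "(g \<circ> hyp b) holomorphic_on {y. \<bar>Im y\<bar> < d1}"
    using ReH by (intro holomorphic_on_compose_gen[OF hyp_holomorphic(1) hol]) force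
   then show ?thesis unfolding G_def o_def
    using ne by (intro holomorphic_intros hyp_holomorphic) force+
  qed
  have bndG: "cmod (G y) \<le> (A * B) * exp (- \<beta> * \<bar>Re y\<bar>)" if y: "\<bar>Im y\<bar> \<le> d" for y
  proof -
   define u where "u = Re y"
   have yeq: "y = Complex u (Im y)" by (simp add: u_def)
   note hb = hyp_bounds[OF b(1) y d(2), of u, folded yeq \<kappa>_def]
   have ch: "0 < cosh u" by simp
   have "exp \<bar>u\<bar> / 2 \<le> cosh u" by (cases "0 \<le> u") (auto simp: cosh_field_def)
   then have "(b * \<kappa>) * (exp \<bar>u\<bar> / 2) \<le> (b * \<kappa>) * cosh u"
    using b k0 by (intro mult_left_mono) auto
   then have "(b * \<kappa> / 2) * exp \<bar>u\<bar> \<le> cmod (hyp b y)" using hb(2) by simp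
   then have "cmod (hyp b y) powr - \<beta> \<le> ((b * \<kappa> / 2) * exp \<bar>u\<bar>) powr - \<beta>"
    using b k0 \<beta> by (intro powr_mono2') auto
   also have "... = (b * \<kappa> / 2) powr - \<beta> * exp (- \<beta> * \<bar>u\<bar>)"
    using b k0 by (subst powr_mult) (auto simp: powr_def[of "exp _"])
   finally have "A * cmod (hyp b y) powr - \<beta> \<le> A * ((b * \<kappa> / 2) powr - \<beta> * exp (- \<beta> * \<bar>u\<bar>))"
    using A by (rule mult_left_mono)
   with bnd[OF ReH, of y] y d1 have 1: "cmod (g (hyp b y)) \<le> A * ((b * \<kappa> / 2) powr - \<beta> * exp (- \<beta> * \<bar>u\<bar>))"
    by linarith
   have sep: "c * cosh u \<le> cmod (hyp b y - of_real lam)" using c(2)[OF y lam, of u] yeq by simp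
   have 2: "cmod (hyp' b y) / cmod (hyp b y - of_real lam) \<le> 4 * b * cosh u / (c * cosh u)"
    using hb(3) sep c(1) ch b by (intro frac_le) auto
   have "4 * b * cosh u / (c * cosh u) = 4 * b / c" using ch by simp
   with 1 2 have "cmod (g (hyp b y)) * (cmod (hyp' b y) / cmod (hyp b y - of_real lam))
     \<le> A * ((b * \<kappa> / 2) powr - \<beta> * exp (- \<beta> * \<bar>u\<bar>)) * (4 * b / c)"
    using A by (intro mult_mono) auto
   then show ?thesis by (simp add: G_def norm_mult norm_divide B_def u_def mult_ac)
  qed
  define S where "S n = (\<Sum>j\<in>{- int n..int n}. G (of_real (of_int j * k)))" for n :: nat
  define R where "R n = (real n + 1/2) * k" for n :: nat
  define X where "X n = b * cosh (R n) * (cos d + sin d)" for n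
  define I where "I n = integral {- R n..R n} (\<lambda>u. G (Complex u (- d)))" for n
  define err where "err n = 4 * d * (A * B * exp (- \<beta> * R n)) + A * X n powr - \<beta> * (2 * X n / (X n - lam))" for n
  have cd: "0 < cos d + sin d" using cos_sin_bounds(2)[of d d] d cos_minus_sin_pos[of d] by auto
  have Rtop: "filterlim R at_top sequentially" unfolding R_def using kpos by real_asymp
  have Xtop: "filterlim X at_top sequentially"
  proof -
   have "filterlim (\<lambda>r. b * cosh r * (cos d + sin d)) at_top at_top"
    using b cd unfolding cosh_field_def by real_asymp
   from filterlim_compose[OF this Rtop] show ?thesis by (simp add: X_def[abs_def])
  qed
  have err0: "err ----> 0"
  proof -
   have "((\<lambda>r. 4 * d * (A * B * exp (- \<beta> * r))) \<longlongrightarrow> 0) at_top"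
    using \<beta> by real_asymp
   from filterlim_compose[OF this Rtop]
   have 1: "(\<lambda>n. 4 * d * (A * B * exp (- \<beta> * R n))) ----> 0" .
   have "((\<lambda>y. A * y powr - \<beta> * (2 * y / (y - lam))) \<longlongrightarrow> 0) at_top"
    using \<beta> by real_asymp
   from filterlim_compose[OF this Xtop]
   have 2: "(\<lambda>n. A * X n powr - \<beta> * (2 * X n / (X n - lam))) ----> 0" .
   show ?thesis unfolding err_def using tendsto_add[OF 1 2] by simp
  qed
  have main: "cmod (of_real k * S N + 2 * pi * \<i> * g (of_real lam))
    \<le> A * (4 * B / \<beta> / (1 - q0) + 2 * B / \<beta>) * \<epsilon> + err n" if n: "N \<le> n" "lam < X n" for n
  proof -
   have t1: "cmod (of_real k * S n - I n) \<le> 4 * (A * B) / \<beta> * (q / (1 - q)) + 4 * d * (A * B * exp (- \<beta> * R n))"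
    unfolding S_def I_def R_def q_def
    by (rule strip_trapezoid[OF holGs d(1) d1(2) bndG \<beta> kpos]) (use A B in auto)
   have t2: "cmod (I n + 2 * pi * \<i> * g (of_real lam)) \<le> A * X n powr - \<beta> * (2 * X n / (X n - lam))"
    unfolding I_def G_def X_def
    by (rule hyp_cauchy[OF b(1) _ d hol bnd A \<beta>]) (use b lam n kpos in \<open>auto simp: X_def R_def\<close>)
   have t3: "k * cmod (S n - S N) \<le> 2 * (A * B) / \<beta> * (exp (- \<beta> * k * real N) - exp (- \<beta> * k * real n))"
    unfolding S_def
   proof (rule symmetric_tail_bound[OF \<beta> kpos _ _ n(1)])
    show "cmod (G (of_real (of_int j * k))) \<le> A * B * exp (- \<beta> * \<bar>of_int j * k\<bar>)" for j
     using bndG[of "complex_of_real (of_int j * k)"] d by (simp del: of_real_mult)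
   qed (use A B in auto)
   have "exp (- \<beta> * k * real N) - exp (- \<beta> * k * real n) \<le> \<epsilon>"
    unfolding \<epsilon>_def x1[symmetric] by simp
   then have "2 * (A * B) / \<beta> * (exp (- \<beta> * k * real N) - exp (- \<beta> * k * real n)) \<le> 2 * (A * B) / \<beta> * \<epsilon>"
    using A B \<beta> by (intro mult_left_mono) auto
   with t3 have t3': "cmod (of_real k * (S n - S N)) \<le> 2 * (A * B) / \<beta> * \<epsilon>"
    using kpos by (simp only: norm_mult norm_of_real abs_of_pos)
   have "4 * (A * B) / \<beta> * (q / (1 - q)) \<le> 4 * (A * B) / \<beta> * (\<epsilon> / (1 - q0))"
    using qq A B \<beta> by (intro mult_left_mono) auto
   with t1 have t1': "cmod (of_real k * S n - I n)
     \<le> 4 * (A * B) / \<beta> * (\<epsilon> / (1 - q0)) + 4 * d * (A * B * exp (- \<beta> * R n))" by linarith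
   have eq: "of_real k * S N + 2 * pi * \<i> * g (of_real lam)
     = (of_real k * S n - I n) + (I n + 2 * pi * \<i> * g (of_real lam)) - of_real k * (S n - S N)"
    by (simp add: right_diff_distrib)
   have "cmod (of_real k * S N + 2 * pi * \<i> * g (of_real lam))
     \<le> cmod (of_real k * S n - I n) + cmod (I n + 2 * pi * \<i> * g (of_real lam)) + cmod (of_real k * (S n - S N))"
    unfolding eq by (intro order_trans[OF norm_triangle_ineq4] add_right_mono norm_triangle_ineq)
   also have "... \<le> 4 * (A * B) / \<beta> * (\<epsilon> / (1 - q0)) + 2 * (A * B) / \<beta> * \<epsilon> + err n"
    using t1' t2 t3' unfolding err_def by linarith
   also have "4 * (A * B) / \<beta> * (\<epsilon> / (1 - q0)) + 2 * (A * B) / \<beta> * \<epsilon>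
     = A * (4 * B / \<beta> / (1 - q0) + 2 * B / \<beta>) * \<epsilon>"
    by (simp add: algebra_simps)
   finally show ?thesis .
  qed
  have ev: "\<forall>\<^sub>F n in sequentially. cmod (of_real k * S N + 2 * pi * \<i> * g (of_real lam))
    \<le> A * (4 * B / \<beta> / (1 - q0) + 2 * B / \<beta>) * \<epsilon> + err n"
   using eventually_ge_at_top[of N] filterlim_at_top_dense[THEN iffD1, OF Xtop, rule_format, of lam]
   by eventually_elim (rule main)
  have lim: "(\<lambda>n. A * (4 * B / \<beta> / (1 - q0) + 2 * B / \<beta>) * \<epsilon> + err n)
    ----> A * (4 * B / \<beta> / (1 - q0) + 2 * B / \<beta>) * \<epsilon>"
   using tendsto_add[OF tendsto_const err0] by simp
  have fin: "cmod (of_real k * S N + 2 * pi * \<i> * g (of_real lam)) \<le> A * (4 * B / \<beta> / (1 - q0) + 2 * B / \<beta>) * \<epsilon>"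
   by (rule tendsto_lowerbound[OF lim ev]) simp
  have "of_real k * S N + 2 * pi * \<i> * g (of_real lam)
    = 2 * pi * \<i> * (g (of_real lam) + of_real k / (2 * pi * \<i>) * S N)"
   by (simp add: distrib_left)
  then have "cmod (of_real k * S N + 2 * pi * \<i> * g (of_real lam))
    = 2 * pi * cmod (g (of_real lam) + of_real k / (2 * pi * \<i>) * S N)"
   by (simp add: norm_mult)
  moreover have "2 * pi * (C * A * \<epsilon>) = A * (4 * B / \<beta> / (1 - q0) + 2 * B / \<beta>) * \<epsilon>"
   unfolding C_def by simp
  ultimately have "2 * pi * cmod (g (of_real lam) + of_real k / (2 * pi * \<i>) * S N)
    \<le> 2 * pi * (C * A * \<epsilon>)"
   using fin by linarith
  then have "cmod (g (of_real lam) + of_real k / (2 * pi * \<i>) * S N) \<le> C * A * \<epsilon>"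
   by simp
  then show "cmod (g (of_real lam) + of_real k / (2 * pi * \<i>) * (\<Sum>j\<in>{- int N..int N}.
      g (hyp b (of_real (of_int j * k))) * hyp' b (of_real (of_int j * k))
       / (hyp b (of_real (of_int j * k)) - of_real lam)))
     \<le> C * A * exp (- sqrt (pi * \<beta> * d * real N))"
   unfolding S_def G_def \<epsilon>_def x_def .
 qed
qed

section \<open>The scalar error of the time stepping symbol\<close>

lemma zc_eq_hyp: "zc b y = hyp b (of_real y)"
 by (simp add: zc_def hyp_def complex_eq_iff cosh_field_def sinh_field_def Re_exp Im_exp)

lemma zc_vector_derivative: "vector_derivative (zc b) (at y) = hyp' b (of_real y)"
proof -
 have "((\<lambda>y. hyp b (of_real y)) has_vector_derivative 1 * hyp' b (of_real y)) (at y)"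
  using field_vector_diff_chain_at[of of_real 1 y "hyp b" "hyp' b (of_real y)"] hyp_deriv
  by (simp add: o_def has_vector_derivative_real_field)
 then show ?thesis
  by (subst vector_derivative_at[symmetric]) (auto simp: zc_eq_hyp[abs_def])
qed

lemma cos_half_pi_pos:
 fixes \<beta> :: real
 assumes "0 < \<beta>" "\<beta> < 1"
 shows "0 < cos (\<beta> * pi / 2)"
 using mult_pos_pos[OF assms(1) pi_gt_zero] mult_strict_right_mono[OF assms(2) pi_gt_zero]
 by (intro cos_gt_zero_pi) linarith+

text \<open>The symbol of the solution operator at time \<open>r\<close> as a function of a complex spectral parameter.\<close>

definition ml_kernel :: "real => real => real => complex => complex" where
 "ml_kernel \<gamma> \<beta> r z = of_real (r powr (\<gamma> - 1))
  * mittag_leffler \<gamma> \<gamma> (- (of_real (r powr \<gamma>) * z powr of_real \<beta>))"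

text \<open>For \<open>z\<close> in the right half plane the argument of \<open>z powr \<beta>\<close> is at most \<open>\<beta> \<pi> / 2\<close> in modulus, so the
sector bound applies with the constant \<open>cos (\<beta> \<pi> / 2)\<close>.\<close>

lemma ml_kernel_bound:
 assumes g: "0 < \<gamma>" "\<gamma> < 1" and be: "0 < \<beta>" "\<beta> < 1" and r: "0 < r" and z: "0 < Re z"
 shows "cmod (ml_kernel \<gamma> \<beta> r z) \<le> 2 * \<gamma> / (cos (\<beta> * pi / 2) * r) * cmod z powr - \<beta>"
proof -
 have z0: "z ~= 0" using z by auto
 define w where "w = of_real (r powr \<gamma>) * z powr of_real \<beta>"
 have c: "0 < cos (\<beta> * pi / 2)" by (rule cos_half_pi_pos[OF be])
 have nz: "cmod (z powr of_real \<beta>) = cmod z powr \<beta>" using z0 by (simp add: norm_powr_real_powr')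
 have nw: "cmod w = r powr \<gamma> * cmod z powr \<beta>" by (simp add: w_def norm_mult nz)
 have im: "\<bar>Im (Ln z)\<bar> \<le> pi / 2" using Re_Ln_pos_lt[OF z0] z by auto
 have "cos (\<beta> * pi / 2) \<le> cos \<bar>\<beta> * Im (Ln z)\<bar>"
 proof (rule cos_monotone_0_pi_le)
  show "\<bar>\<beta> * Im (Ln z)\<bar> \<le> \<beta> * pi / 2"
   using mult_left_mono[OF im, of \<beta>] be by (simp add: abs_mult)
  show "\<beta> * pi / 2 \<le> pi" using be by (simp add: field_simps)
 qed simp
 moreover have "Re (z powr of_real \<beta>) = cmod z powr \<beta> * cos (\<beta> * Im (Ln z))"
  using z0 by (simp add: powr_def Re_exp)
 moreover have "Re w = r powr \<gamma> * Re (z powr of_real \<beta>)" by (simp add: w_def)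
 ultimately have "cos (\<beta> * pi / 2) * cmod w \<le> Re w"
  using mult_left_mono[of "cos (\<beta> * pi / 2)" "cos (\<beta> * Im (Ln z))" "r powr \<gamma> * cmod z powr \<beta>"]
  by (simp add: nw mult_ac)
 then have "cmod (mittag_leffler \<gamma> \<gamma> (- w)) \<le> 2 * \<gamma> / (cos (\<beta> * pi / 2) * cmod w)"
  using r z0 by (intro mittag_leffler_sector_bound[OF g c]) (auto simp: w_def)
 then have "r powr (\<gamma> - 1) * cmod (mittag_leffler \<gamma> \<gamma> (- w))
   \<le> r powr (\<gamma> - 1) * (2 * \<gamma> / (cos (\<beta> * pi / 2) * cmod w))"
  by (rule mult_left_mono) simp
 moreover have "cmod (ml_kernel \<gamma> \<beta> r z) = r powr (\<gamma> - 1) * cmod (mittag_leffler \<gamma> \<gamma> (- w))"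
  unfolding ml_kernel_def w_def[symmetric] norm_mult by simp
 ultimately have "cmod (ml_kernel \<gamma> \<beta> r z) \<le> r powr (\<gamma> - 1) * (2 * \<gamma> / (cos (\<beta> * pi / 2) * cmod w))"
  by (simp only:)
 also have "... = 2 * \<gamma> / (cos (\<beta> * pi / 2) * r) * cmod z powr - \<beta>"
  unfolding nw using r by (simp add: powr_diff powr_minus field_simps)
 finally show ?thesis .
qed

lemma ml_kernel_holomorphic:
 assumes g: "0 < \<gamma>" "\<gamma> < 1"
 shows "ml_kernel \<gamma> \<beta> r holomorphic_on {z. 0 < Re z}"
proof -
 have "mittag_leffler \<gamma> 1 holomorphic_on UNIV"
  using mittag_leffler_deriv[OF g(1) less_imp_le[OF g(2)]]
  by (meson holomorphic_on_def field_differentiable_def field_differentiable_at_within)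
 then have "deriv (mittag_leffler \<gamma> 1) holomorphic_on UNIV" by (intro holomorphic_deriv) auto
 then have "(\<lambda>z. of_real \<gamma> * deriv (mittag_leffler \<gamma> 1) z) holomorphic_on UNIV"
  by (rule holomorphic_on_mult[OF holomorphic_on_const])
 moreover have "deriv (mittag_leffler \<gamma> 1) z = mittag_leffler \<gamma> \<gamma> z / of_real \<gamma>" for z
  using mittag_leffler_deriv[OF g(1) less_imp_le[OF g(2)]] by (intro DERIV_imp_deriv)
 ultimately have ml: "mittag_leffler \<gamma> \<gamma> holomorphic_on UNIV" using g by simp
 have "(\<lambda>z. - (of_real (r powr \<gamma>) * z powr of_real \<beta>)) holomorphic_on {z. 0 < Re z}"
  by (intro holomorphic_intros) (auto simp: complex_nonpos_Reals_iff)
 from holomorphic_on_compose_gen[OF this ml]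
 have "(\<lambda>z. mittag_leffler \<gamma> \<gamma> (- (of_real (r powr \<gamma>) * z powr of_real \<beta>))) holomorphic_on {z. 0 < Re z}"
  by (simp add: o_def)
 then show ?thesis unfolding ml_kernel_def[abs_def] by (intro holomorphic_intros)
qed

lemma ml_kernel_integral:
 assumes g: "0 < \<gamma>" "\<gamma> < 1" and t: "0 < t" "t \<le> t'" and z: "z ~= 0"
 shows "((\<lambda>r. ml_kernel \<gamma> \<beta> r z) has_integral
  (mittag_leffler \<gamma> 1 (- of_real (t powr \<gamma>) * z powr of_real \<beta>)
   - mittag_leffler \<gamma> 1 (- of_real (t' powr \<gamma>) * z powr of_real \<beta>)) * z powr of_real (- \<beta>)) {t..t'}"
proof -
 define w where "w = z powr of_real \<beta>"
 have w: "w ~= 0" "z powr of_real (- \<beta>) = inverse w" using z by (auto simp: w_def powr_minus)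
 define P where "P r = - (mittag_leffler \<gamma> 1 (- of_real (r powr \<gamma>) * w) * inverse w)" for r
 have "((\<lambda>r. ml_kernel \<gamma> \<beta> r z) has_integral (P t' - P t)) {t..t'}"
 proof (rule fundamental_theorem_of_calculus[OF t(2)])
  fix r assume r: "r \<in> {t..t'}"
  have "((\<lambda>r. r powr \<gamma>) has_real_derivative \<gamma> * r powr (\<gamma> - 1)) (at r within {t..t'})"
   using r t by (auto intro!: derivative_eq_intros)
  then have "((\<lambda>r. complex_of_real (r powr \<gamma>)) has_vector_derivative of_real (\<gamma> * r powr (\<gamma> - 1))) (at r within {t..t'})"
   by (rule has_vector_derivative_of_real)
  then have i: "((\<lambda>r. - complex_of_real (r powr \<gamma>) * w) has_vector_derivative - of_real (\<gamma> * r powr (\<gamma> - 1)) * w) (at r within {t..t'})"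
   by (intro has_vector_derivative_mult_left has_vector_derivative_minus)
  from field_vector_diff_chain_within[OF i has_field_derivative_at_within[OF mittag_leffler_deriv[OF g(1) less_imp_le[OF g(2)]]]]
  have "((\<lambda>r. mittag_leffler \<gamma> 1 (- of_real (r powr \<gamma>) * w)) has_vector_derivative
    - of_real (\<gamma> * r powr (\<gamma> - 1)) * w * (mittag_leffler \<gamma> \<gamma> (- of_real (r powr \<gamma>) * w) / of_real \<gamma>)) (at r within {t..t'})"
   by (simp add: o_def)
  then have "(P has_vector_derivative
    - (- of_real (\<gamma> * r powr (\<gamma> - 1)) * w * (mittag_leffler \<gamma> \<gamma> (- of_real (r powr \<gamma>) * w) / of_real \<gamma>) * inverse w)) (at r within {t..t'})"
   unfolding P_def[abs_def] by (intro has_vector_derivative_mult_left has_vector_derivative_minus)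
  moreover have "- (- of_real (\<gamma> * r powr (\<gamma> - 1)) * w * (mittag_leffler \<gamma> \<gamma> (- of_real (r powr \<gamma>) * w) / of_real \<gamma>) * inverse w)
    = ml_kernel \<gamma> \<beta> r z"
   using w g by (simp add: ml_kernel_def w_def[symmetric])
  ultimately show "(P has_vector_derivative ml_kernel \<gamma> \<beta> r z) (at r within {t..t'})" by simp
 qed
 then show ?thesis unfolding P_def w(2) w_def[symmetric] by (simp add: left_diff_distrib)
qed

text \<open>The factor by which \<open>Qhk\<close> multiplies a discrete eigenfunction with eigenvalue \<open>lam\<close>.\<close>

definition quad_symbol :: "real => real => real => real => nat => real => real => real => complex" where
 "quad_symbol \<gamma> \<beta> b k N t \<tau> lam = - (of_real k / (2 * of_real pi * \<i>)) *
  (\<Sum>j\<in>{- int N..int N}. let z = zc b (of_int j * k) in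
    (mittag_leffler \<gamma> 1 (- of_real (t powr \<gamma>) * z powr of_real \<beta>)
    - mittag_leffler \<gamma> 1 (- of_real ((t + \<tau>) powr \<gamma>) * z powr of_real \<beta>))
    * z powr of_real (- \<beta>) * vector_derivative (zc b) (at (of_int j * k)) / (z - of_real lam))"

text \<open>The factor by which the time integral of \<open>Wh\<close> multiplies a discrete eigenfunction with eigenvalue \<open>lam\<close>.\<close>

definition exact_symbol :: "real => real => real => real => real => complex" where
 "exact_symbol \<gamma> \<beta> t \<tau> lam = integral {t..t + \<tau>} (\<lambda>r. of_real (r powr (\<gamma> - 1))
  * mittag_leffler \<gamma> \<gamma> (of_real (- (r powr \<gamma>) * lam powr \<beta>)))"

lemma exact_symbol_has_integral:
 assumes g: "0 < \<gamma>" "\<gamma> < 1" and t: "0 < t" "0 \<le> \<tau>" and lam: "0 < lam"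
 shows "((\<lambda>r. of_real (r powr (\<gamma> - 1)) * mittag_leffler \<gamma> \<gamma> (of_real (- (r powr \<gamma>) * lam powr \<beta>)))
   has_integral exact_symbol \<gamma> \<beta> t \<tau> lam) {t..t + \<tau>}"
proof -
 have "of_real (r powr (\<gamma> - 1)) * mittag_leffler \<gamma> \<gamma> (of_real (- (r powr \<gamma>) * lam powr \<beta>))
   = ml_kernel \<gamma> \<beta> r (of_real lam)" for r
  using lam by (simp add: ml_kernel_def powr_of_real)
 then show ?thesis
  using ml_kernel_integral[OF g t(1), of "t + \<tau>" "of_real lam" \<beta>] t lam
  unfolding exact_symbol_def by (simp add: has_integral_integrable_integral)
qed

text \<open>The quadrature weights of \<open>Qhk\<close> are time integrals of \<open>ml_kernel\<close> at the nodes
(\<open>ml_kernel_integral\<close>), so the error is the integral over \<open>r\<close> of the sinc error at time \<open>r\<close>, which carries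
the factor \<open>1 / r\<close>.\<close>

lemma quad_symbol_error:
 fixes b lam0 d \<beta> \<gamma> :: real
 assumes b: "0 < b" "b < lam0 / sqrt 2" and d: "0 < d" "d < pi / 4"
  and be: "0 < \<beta>" "\<beta> < 1" and g: "0 < \<gamma>" "\<gamma> < 1"
 obtains C where "0 \<le> C"
  "\<And>lam N k t \<tau>. lam0 \<le> lam ==> 1 \<le> N ==> k = sqrt (pi * d / (\<beta> * real N)) ==> 0 < t ==> 0 \<le> \<tau>
   ==> cmod (exact_symbol \<gamma> \<beta> t \<tau> lam - quad_symbol \<gamma> \<beta> b k N t \<tau> lam)
     \<le> C * exp (- sqrt (pi * \<beta> * d * real N)) * (ln (t + \<tau>) - ln t)"
proof -
 have b2: "sqrt 2 * b < lam0" using b by (simp add: field_simps)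
 have lam0: "0 < lam0" using b2 b by (smt (verit) mult_pos_pos real_sqrt_gt_zero)
 obtain C where C: "0 \<le> C"
  "\<And>g A lam N k. g holomorphic_on {z. 0 < Re z} ==> 0 \<le> A
   ==> (\<And>z. 0 < Re z ==> cmod (g z) \<le> A * cmod z powr - \<beta>)
   ==> lam0 \<le> lam ==> 1 \<le> N ==> k = sqrt (pi * d / (\<beta> * real N))
   ==> cmod (g (of_real lam) + of_real k / (2 * pi * \<i>) * (\<Sum>j\<in>{- int N..int N}.
      g (hyp b (of_real (of_int j * k))) * hyp' b (of_real (of_int j * k))
       / (hyp b (of_real (of_int j * k)) - of_real lam)))
     \<le> C * A * exp (- sqrt (pi * \<beta> * d * real N))"
  by (rule sinc_contour_error[OF b(1) b2 d be(1)]) blast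
 define c where "c = 2 * \<gamma> / cos (\<beta> * pi / 2)"
 have "0 < cos (\<beta> * pi / 2)" by (rule cos_half_pi_pos[OF be])
 then have c: "0 < c" using g by (simp add: c_def)
 show thesis
 proof (rule that[of "C * c"])
  show "0 \<le> C * c" using C c by simp
  fix lam k t \<tau> :: real and N :: nat
  assume lam: "lam0 \<le> lam" and N: "1 \<le> N" and k: "k = sqrt (pi * d / (\<beta> * real N))"
   and t: "0 < t" "0 \<le> \<tau>"
  define \<epsilon> where "\<epsilon> = exp (- sqrt (pi * \<beta> * d * real N))"
  define z where "z j = zc b (of_int j * k)" for j
  define z' where "z' j = vector_derivative (zc b) (at (of_int j * k))" for j
  have zh: "z j = hyp b (of_real (of_int j * k))" "z' j = hyp' b (of_real (of_int j * k))" for j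
   by (simp_all only: z_def z'_def zc_eq_hyp zc_vector_derivative)
  have Rez: "0 < Re (z j)" for j using b by (simp add: z_def zc_def)
  have zn0: "z j ~= 0" for j using Rez[of j] by auto
  define E where "E r = ml_kernel \<gamma> \<beta> r (of_real lam) + of_real k / (2 * pi * \<i>) *
    (\<Sum>j\<in>{- int N..int N}. ml_kernel \<gamma> \<beta> r (z j) * (z' j / (z j - of_real lam)))" for r
  have E: "cmod (E r) \<le> C * c * \<epsilon> * (1 / r)" if r: "0 < r" for r
  proof -
   have E_eq: "E r = ml_kernel \<gamma> \<beta> r (of_real lam) + of_real k / (2 * pi * \<i>) *
     (\<Sum>j\<in>{- int N..int N}. ml_kernel \<gamma> \<beta> r (hyp b (of_real (of_int j * k))) * hyp' b (of_real (of_int j * k))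
       / (hyp b (of_real (of_int j * k)) - of_real lam))"
    by (simp only: E_def zh times_divide_eq_right)
   have "cmod (E r) \<le> C * (c / r) * \<epsilon>"
    unfolding E_eq \<epsilon>_def
   proof (rule C(2)[OF ml_kernel_holomorphic[OF g] _ _ lam N k])
    show "cmod (ml_kernel \<gamma> \<beta> r z) \<le> c / r * cmod z powr - \<beta>" if "0 < Re z" for z
     using ml_kernel_bound[OF g be r that] by (simp add: c_def)
   qed (use c r in simp)
   then show ?thesis by simp
  qed
  have I1: "((\<lambda>r. ml_kernel \<gamma> \<beta> r (of_real lam)) has_integral exact_symbol \<gamma> \<beta> t \<tau> lam) {t..t + \<tau>}"
   using exact_symbol_has_integral[OF g t, of lam \<beta>] lam lam0
   by (simp add: ml_kernel_def powr_of_real)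
  have I2: "((\<lambda>r. ml_kernel \<gamma> \<beta> r (z j)) has_integral
   (mittag_leffler \<gamma> 1 (- of_real (t powr \<gamma>) * z j powr of_real \<beta>)
    - mittag_leffler \<gamma> 1 (- of_real ((t + \<tau>) powr \<gamma>) * z j powr of_real \<beta>)) * z j powr of_real (- \<beta>)) {t..t + \<tau>}" for j
   using t by (intro ml_kernel_integral[OF g t(1) _ zn0]) auto
  have qs: "quad_symbol \<gamma> \<beta> b k N t \<tau> lam = - (of_real k / (2 * pi * \<i>) *
   (\<Sum>j\<in>{- int N..int N}. (mittag_leffler \<gamma> 1 (- of_real (t powr \<gamma>) * z j powr of_real \<beta>)
    - mittag_leffler \<gamma> 1 (- of_real ((t + \<tau>) powr \<gamma>) * z j powr of_real \<beta>)) * z j powr of_real (- \<beta>)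
    * (z' j / (z j - of_real lam))))"
   unfolding quad_symbol_def Let_def z_def z'_def
   by (simp only: mult_minus_left times_divide_eq_right of_real_mult of_real_numeral)
  have I: "(E has_integral (exact_symbol \<gamma> \<beta> t \<tau> lam - quad_symbol \<gamma> \<beta> b k N t \<tau> lam)) {t..t + \<tau>}"
   unfolding E_def[abs_def] qs diff_minus_eq_add
   by (intro has_integral_add I1 has_integral_mult_right has_integral_sum has_integral_mult_left I2) auto
  have L: "((\<lambda>r. C * c * \<epsilon> * (1 / r)) has_integral C * c * \<epsilon> * (ln (t + \<tau>) - ln t)) {t..t + \<tau>}"
  proof (intro has_integral_mult_right fundamental_theorem_of_calculus)
   fix r assume "r \<in> {t..t + \<tau>}"
   then have "(ln has_real_derivative 1 / r) (at r within {t..t + \<tau>})"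
    using t by (auto intro!: derivative_eq_intros)
   then show "(ln has_vector_derivative 1 / r) (at r within {t..t + \<tau>})"
    by (simp add: has_real_derivative_iff_has_vector_derivative)
  qed (use t in simp)
  have "cmod (integral {t..t + \<tau>} E) \<le> integral {t..t + \<tau>} (\<lambda>r. C * c * \<epsilon> * (1 / r))"
   using I L E t by (intro integral_norm_bound_integral) (auto simp: has_integral_iff)
  then show "cmod (exact_symbol \<gamma> \<beta> t \<tau> lam - quad_symbol \<gamma> \<beta> b k N t \<tau> lam)
     \<le> C * c * exp (- sqrt (pi * \<beta> * d * real N)) * (ln (t + \<tau>) - ln t)"
   using integral_unique[OF I] integral_unique[OF L] by (simp add: \<epsilon>_def)
 qed
qed

section \<open>The space L2\<close>

abbreviation lint where "lint W u \<equiv> integral\<^sup>L (lebesgue_on W) u"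


lemma open_lebesgue: "open W ==> W \<in> sets lebesgue"
 by (simp add: borel_open sets_completionI_sets)

lemma L2_measurable: "v \<in> L2 W ==> v \<in> borel_measurable (lebesgue_on W)"
 by (simp add: L2_def)

lemma L2_integrable_square: "v \<in> L2 W ==> integrable (lebesgue_on W) (\<lambda>x. (cmod (v x))^2)"
 by (simp add: L2_def)

lemma L2_integrable_prod:
 assumes "u \<in> L2 W" "v \<in> L2 W"
 shows "integrable (lebesgue_on W) (\<lambda>x. cmod (u x) * cmod (v x))"
proof (rule Bochner_Integration.integrable_bound)
 show "integrable (lebesgue_on W) (\<lambda>x. (cmod (u x))^2 + (cmod (v x))^2)"
  using assms by (intro Bochner_Integration.integrable_add L2_integrable_square)
 show "(\<lambda>x. cmod (u x) * cmod (v x)) \<in> borel_measurable (lebesgue_on W)"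
  using assms[THEN L2_measurable] by measurable
 have "a * b \<le> a\<^sup>2 + b\<^sup>2" if "0 \<le> a" "0 \<le> b" for a b :: real
  using sum_squares_bound[of a b] that zero_le_power2[of a] zero_le_power2[of b] mult_nonneg_nonneg[OF that]
  by linarith
 then show "AE x in lebesgue_on W. norm (cmod (u x) * cmod (v x)) \<le> norm ((cmod (u x))^2 + (cmod (v x))^2)"
  by (intro AE_I2) simp
qed

lemma L2_mult_cnj_integrable:
 assumes "u \<in> L2 W" "v \<in> L2 W"
 shows "integrable (lebesgue_on W) (\<lambda>x. u x * cnj (v x))"
proof (rule Bochner_Integration.integrable_bound[OF L2_integrable_prod[OF assms]])
 show "(\<lambda>x. u x * cnj (v x)) \<in> borel_measurable (lebesgue_on W)"
  using assms[THEN L2_measurable]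
  by (intro borel_measurable_times borel_measurable_continuous_on[of cnj]) (auto intro: continuous_intros)
qed (simp add: norm_mult)

lemma L2_add:
 assumes "u \<in> L2 W" "v \<in> L2 W"
 shows "(\<lambda>x. u x + v x) \<in> L2 W"
proof -
 have m: "u \<in> borel_measurable (lebesgue_on W)" "v \<in> borel_measurable (lebesgue_on W)"
  using assms by (auto dest: L2_measurable)
 have "integrable (lebesgue_on W) (\<lambda>x. (cmod (u x + v x))^2)"
 proof (rule Bochner_Integration.integrable_bound)
  show "integrable (lebesgue_on W) (\<lambda>x. 2 * (cmod (u x))^2 + 2 * (cmod (v x))^2)"
   using assms by (intro Bochner_Integration.integrable_add integrable_mult_right L2_integrable_square)
  have "(cmod (u x + v x))^2 \<le> 2 * (cmod (u x))^2 + 2 * (cmod (v x))^2" for x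
  proof -
   have "(cmod (u x + v x))^2 \<le> (cmod (u x) + cmod (v x))^2"
    by (intro power_mono norm_triangle_ineq) auto
   also have "... \<le> 2 * (cmod (u x))^2 + 2 * (cmod (v x))^2"
    using sum_squares_bound[of "cmod (u x)" "cmod (v x)"] by (simp add: power2_sum)
   finally show ?thesis .
  qed
  then show "AE x in lebesgue_on W. norm ((cmod (u x + v x))^2) \<le> norm (2 * (cmod (u x))^2 + 2 * (cmod (v x))^2)"
   by (intro AE_I2) simp
 qed (use m in measurable)
 then show ?thesis using m by (auto simp: L2_def)
qed

lemma L2_cmult: "u \<in> L2 W ==> (\<lambda>x. c * u x) \<in> L2 W"
 by (auto simp: L2_def norm_mult power_mult_distrib)

lemma L2_uminus: "u \<in> L2 W ==> (\<lambda>x. - u x) \<in> L2 W"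
 using L2_cmult[of u W "-1"] by simp

lemma L2_diff: "u \<in> L2 W ==> v \<in> L2 W ==> (\<lambda>x. u x - v x) \<in> L2 W"
 using L2_add[OF _ L2_uminus, of u W v] by simp

lemma L2_zero: "(\<lambda>x. 0) \<in> L2 W"
 by (simp add: L2_def)

lemma L2_sum: "(\<And>i. i \<in> I ==> u i \<in> L2 W) ==> (\<lambda>x. \<Sum>i\<in>I. u i x) \<in> L2 W"
 by (induction I rule: infinite_finite_induct) (auto intro: L2_zero L2_add)

lemma ip_add_left: "u \<in> L2 W ==> v \<in> L2 W ==> w \<in> L2 W ==> ip W (\<lambda>x. u x + v x) w = ip W u w + ip W v w"
 unfolding ip_def distrib_right by (intro Bochner_Integration.integral_add L2_mult_cnj_integrable)

lemma ip_cmult_left: "ip W (\<lambda>x. c * u x) w = c * ip W u w"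
 unfolding ip_def by (simp add: mult.assoc)

lemma ip_cnj: "ip W w u = cnj (ip W u w)"
 unfolding ip_def Bochner_Integration.integral_cnj[symmetric] by (simp add: mult.commute)

lemma ip_add_right: "u \<in> L2 W ==> v \<in> L2 W ==> w \<in> L2 W ==> ip W w (\<lambda>x. u x + v x) = ip W w u + ip W w v"
 by (simp add: ip_cnj[of W w] ip_add_left)

lemma ip_zero_left: "ip W (\<lambda>x. 0) w = 0"
 by (simp add: ip_def)

lemma ip_diff_left: "u \<in> L2 W ==> v \<in> L2 W ==> w \<in> L2 W ==> ip W (\<lambda>x. u x - v x) w = ip W u w - ip W v w"
 unfolding ip_def left_diff_distrib by (intro Bochner_Integration.integral_diff L2_mult_cnj_integrable)

lemma ip_diff_right: "u \<in> L2 W ==> v \<in> L2 W ==> w \<in> L2 W ==> ip W w (\<lambda>x. u x - v x) = ip W w u - ip W w v"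
 by (simp add: ip_cnj[of W w] ip_diff_left)

lemma ip_sum_left:
 "(\<And>i. i \<in> I ==> u i \<in> L2 W) ==> w \<in> L2 W ==> ip W (\<lambda>x. \<Sum>i\<in>I. c i * u i x) w = (\<Sum>i\<in>I. c i * ip W (u i) w)"
 by (induction I rule: infinite_finite_induct)
  (auto simp: ip_zero_left ip_add_left ip_cmult_left L2_cmult L2_sum)

lemma ip_sum_right:
 "(\<And>i. i \<in> I ==> u i \<in> L2 W) ==> w \<in> L2 W ==> ip W w (\<lambda>x. \<Sum>i\<in>I. c i * u i x) = (\<Sum>i\<in>I. cnj (c i) * ip W w (u i))"
 by (simp add: ip_cnj[of W w] ip_sum_left)

lemma L2_nrm_nonneg: "0 \<le> L2_nrm W v"
 by (simp add: L2_nrm_def)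

lemma L2_nrm_square: "(L2_nrm W v)^2 = lint W (\<lambda>x. (cmod (v x))^2)"
 by (simp add: L2_nrm_def)

lemma ip_self: "ip W v v = of_real ((L2_nrm W v)^2)"
 unfolding ip_def L2_nrm_square complex_norm_square[symmetric]
 by (simp only: of_real_power[symmetric] integral_complex_of_real)

lemma cmod_ip_le: 
 assumes "u \<in> L2 W" "v \<in> L2 W"
 shows "lint W (\<lambda>x. cmod (u x) * cmod (v x)) \<le> L2_nrm W u * L2_nrm W v"
  and "cmod (ip W u v) \<le> L2_nrm W u * L2_nrm W v"
proof -
 let ?I = "lint W (\<lambda>x. cmod (u x) * cmod (v x))"
 define a b where "a = L2_nrm W u" and "b = L2_nrm W v"
 have ab: "0 \<le> a" "0 \<le> b" by (auto simp: a_def b_def L2_nrm_nonneg)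
 have I0: "0 \<le> ?I" by (intro integral_nonneg_AE) auto
 have key: "2 * ?I \<le> t * a\<^sup>2 + b\<^sup>2 / t" if t: "0 < t" for t
 proof -
  have "2 * ?I = lint W (\<lambda>x. 2 * (cmod (u x) * cmod (v x)))" by simp
  also have "... \<le> lint W (\<lambda>x. t * (cmod (u x))^2 + (1 / t) * (cmod (v x))^2)"
  proof (rule integral_mono)
   fix x
   have "0 \<le> (t * cmod (u x) - cmod (v x))^2 / t" using t by simp
   also have "... = t * (cmod (u x))^2 + (1 / t) * (cmod (v x))^2 - 2 * (cmod (u x) * cmod (v x))"
    using t by (simp add: power2_eq_square field_simps)
   finally show "2 * (cmod (u x) * cmod (v x)) \<le> t * (cmod (u x))^2 + (1 / t) * (cmod (v x))^2" by simp
  qed (use assms in \<open>auto intro!: Bochner_Integration.integrable_add integrable_mult_right L2_integrable_square L2_integrable_prod simp del: times_divide_eq_left\<close>)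
  also have "... = t * a\<^sup>2 + b\<^sup>2 / t"
   unfolding a_def b_def L2_nrm_square using assms
   by (subst Bochner_Integration.integral_add) (auto intro!: integrable_mult_right L2_integrable_square)
  finally show ?thesis .
 qed
 show I: "?I \<le> L2_nrm W u * L2_nrm W v"
 proof (cases "a = 0 \<or> b = 0")
  case True
  have "?I \<le> e" if "0 < e" for e
  proof (cases "a = 0")
   case True
   have "2 * ?I \<le> b\<^sup>2 / ((b\<^sup>2 + 1) / e)" using key[of "(b\<^sup>2 + 1) / e"] True that by (simp add: add_nonneg_pos)
   also have "... = b\<^sup>2 / (b\<^sup>2 + 1) * e" using that by simp
   also have "... \<le> 1 * e" using that by (intro mult_right_mono) (auto simp: divide_le_eq add_nonneg_pos)
   finally show ?thesis using I0 by linarith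
  next
   case False
   then have "b = 0" using \<open>a = 0 \<or> b = 0\<close> by simp
   then have "2 * ?I \<le> e / (a\<^sup>2 + 1) * a\<^sup>2" using key[of "e / (a\<^sup>2 + 1)"] that by (simp add: add_nonneg_pos)
   also have "... = a\<^sup>2 / (a\<^sup>2 + 1) * e" by simp
   also have "... \<le> 1 * e" using that by (intro mult_right_mono) (auto simp: divide_le_eq add_nonneg_pos)
   finally show ?thesis using I0 by linarith
  qed
  then have "?I \<le> 0" by (rule field_le_epsilon[of _ 0, simplified])
  then show ?thesis using ab unfolding a_def b_def by (meson mult_nonneg_nonneg order_trans)
 next
  case False
  then have "0 < b / a" using ab by simp
  from key[OF this] False ab show ?thesis
   by (simp add: a_def[symmetric] b_def[symmetric] power2_eq_square field_simps)
 qed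
 have "cmod (ip W u v) \<le> ?I"
  unfolding ip_def using integral_norm_bound[of "lebesgue_on W" "\<lambda>x. u x * cnj (v x)"] by (simp add: norm_mult)
 then show "cmod (ip W u v) \<le> L2_nrm W u * L2_nrm W v" using I by linarith
qed

lemma L2_nrm_triangle:
 assumes "u \<in> L2 W" "v \<in> L2 W"
 shows "L2_nrm W (\<lambda>x. u x + v x) \<le> L2_nrm W u + L2_nrm W v"
proof (rule power2_le_imp_le)
 have "complex_of_real ((L2_nrm W (\<lambda>x. u x + v x))^2)
   = of_real ((L2_nrm W u)^2) + ip W u v + cnj (ip W u v) + of_real ((L2_nrm W v)^2)"
  using assms unfolding ip_self[symmetric] ip_cnj[of W v u, symmetric]
  by (simp add: ip_add_left ip_add_right L2_add)
 then have "(L2_nrm W (\<lambda>x. u x + v x))^2 = (L2_nrm W u)^2 + 2 * Re (ip W u v) + (L2_nrm W v)^2"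
  by (simp add: complex_eq_iff)
 also have "... \<le> (L2_nrm W u)^2 + 2 * (L2_nrm W u * L2_nrm W v) + (L2_nrm W v)^2"
  using cmod_ip_le(2)[OF assms] complex_Re_le_cmod[of "ip W u v"] by simp
 finally show "(L2_nrm W (\<lambda>x. u x + v x))^2 \<le> (L2_nrm W u + L2_nrm W v)^2"
  by (simp add: power2_sum algebra_simps)
qed (simp add: L2_nrm_nonneg)

lemma L2_nrm_cmult: "L2_nrm W (\<lambda>x. c * u x) = cmod c * L2_nrm W u"
 by (simp add: L2_nrm_def norm_mult power_mult_distrib real_sqrt_mult)

lemma L2_nrm_zero: "L2_nrm W (\<lambda>x. 0) = 0"
 by (simp add: L2_nrm_def)

lemma L2_nrm_cong_AE:
 assumes "AE x in lebesgue_on W. u x = v x" "u \<in> L2 W" "v \<in> L2 W"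
 shows "L2_nrm W u = L2_nrm W v"
 unfolding L2_nrm_def
 by (intro arg_cong[where f = sqrt] integral_cong_AE borel_measurable_integrable L2_integrable_square assms)
  (use assms(1) in \<open>auto elim!: eventually_mono\<close>)

lemma nn_integral_square_eq:
 assumes "u \<in> L2 W"
 shows "(\<integral>\<^sup>+x. ennreal ((cmod (u x))^2) \<partial>lebesgue_on W) = ennreal ((L2_nrm W u)^2)"
 unfolding L2_nrm_square by (intro nn_integral_eq_integral L2_integrable_square assms) auto

section \<open>Smooth functions and bumps\<close>

lemma has_derivative_pdiff: "(u has_derivative u') (at x) ==> pdiff i u x = u' (axis i 1)"
 unfolding pdiff_def by (simp flip: frechet_derivative_at)

lemma pdiff_add:
 assumes "u differentiable (at x)" "v differentiable (at x)"
 shows "pdiff i (\<lambda>x. u x + v x) x = pdiff i u x + pdiff i v x"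
proof -
 obtain u' v' where "(u has_derivative u') (at x)" "(v has_derivative v') (at x)"
  using assms by (auto simp: differentiable_def)
 from has_derivative_pdiff[OF has_derivative_add[OF this]] has_derivative_pdiff[OF this(1)] has_derivative_pdiff[OF this(2)]
 show ?thesis by simp
qed

lemma pdiff_mult:
 assumes "u differentiable (at x)" "v differentiable (at x)"
 shows "pdiff i (\<lambda>x. u x * v x) x = pdiff i u x * v x + u x * pdiff i v x"
proof -
 obtain u' v' where "(u has_derivative u') (at x)" "(v has_derivative v') (at x)"
  using assms by (auto simp: differentiable_def)
 from has_derivative_pdiff[OF has_derivative_mult[OF this]] has_derivative_pdiff[OF this(1)] has_derivative_pdiff[OF this(2)]
 show ?thesis by simp
qed

lemma pdiff_const: "pdiff i (\<lambda>x. c) x = 0"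
 using has_derivative_pdiff[OF has_derivative_const] .

lemma Ck_const: "Ck m (\<lambda>x. c)"
 by (induction m arbitrary: c) (auto simp: pdiff_const[abs_def])

lemma Ck_lower: "Ck (Suc m) u ==> Ck m u"
proof (induction m arbitrary: u)
 case 0
 then show ?case
  by (auto intro!: differentiable_imp_continuous_on simp: differentiable_on_def)
qed auto

lemma Ck_add: "Ck m u ==> Ck m v ==> Ck m (\<lambda>x. u x + v x)"
proof (induction m arbitrary: u v)
 case 0
 then show ?case by (auto intro!: continuous_intros)
next
 case (Suc m)
 then have d: "u differentiable (at x)" "v differentiable (at x)" for x by auto
 have "pdiff i (\<lambda>x. u x + v x) = (\<lambda>x. pdiff i u x + pdiff i v x)" for i
  using pdiff_add[OF d] by blast
 with Suc d show ?case by simp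
qed

lemma Ck_mult: "Ck m u ==> Ck m v ==> Ck m (\<lambda>x. u x * v x)"
proof (induction m arbitrary: u v)
 case 0
 then show ?case by (auto intro!: continuous_intros)
next
 case (Suc m)
 then have d: "u differentiable (at x)" "v differentiable (at x)" for x by auto
 have "pdiff i (\<lambda>x. u x * v x) = (\<lambda>x. pdiff i u x * v x + u x * pdiff i v x)" for i
  using pdiff_mult[OF d] by blast
 moreover have "Ck m (\<lambda>x. pdiff i u x * v x + u x * pdiff i v x)" for i
  using Suc Ck_lower by (intro Ck_add Suc.IH) auto
 ultimately show ?case using d by simp
qed

lemma Ck_prod: "finite I ==> (\<And>i. i \<in> I ==> Ck m (u i)) ==> Ck m (\<lambda>x. \<Prod>i\<in>I. u i x)"
 by (induction I rule: finite_induct) (auto intro: Ck_mult Ck_const)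

lemma Ck_univariate:
 fixes G :: "nat => real => real"
 assumes "\<And>n t. (G n has_real_derivative G (Suc n) t) (at t)"
 shows "Ck m (\<lambda>x :: real^'n. complex_of_real (G n (c * (x $ i) + d)))"
proof (induction m arbitrary: n)
 have der: "((\<lambda>x :: real^'n. complex_of_real (G n (c * (x $ i) + d))) has_derivative
   (\<lambda>h. of_real (c * (h $ i) * G (Suc n) (c * (x $ i) + d)))) (at x)" for n x
 proof -
  have "((\<lambda>x :: real^'n. c * (x $ i) + d) has_derivative (\<lambda>h. c * (h $ i))) (at x)"
   by (auto intro!: derivative_eq_intros bounded_linear.has_derivative[OF bounded_linear_vec_nth])
  from has_derivative_of_real[OF DERIV_compose_FDERIV[OF assms this]] show ?thesis by simp
 qed
 {
  case 0
  have "(\<lambda>x :: real^'n. complex_of_real (G n (c * (x $ i) + d))) differentiable_on UNIV"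
   using der by (auto simp: differentiable_on_def differentiable_def intro!: exI)
  then show ?case unfolding Ck.simps by (rule differentiable_imp_continuous_on)
 next
  case (Suc m)
  have "(\<lambda>x :: real^'n. complex_of_real (G n (c * (x $ i) + d))) differentiable (at x)" for x
   unfolding differentiable_def using der by blast
  moreover
  have "pdiff j (\<lambda>x :: real^'n. complex_of_real (G n (c * (x $ i) + d)))
    = (\<lambda>x. of_real (if i = j then c else 0) * complex_of_real (G (Suc n) (c * (x $ i) + d)))" for j
   using has_derivative_pdiff[OF der] by (auto simp: fun_eq_iff axis_def)
  moreover have "Ck m (\<lambda>x :: real^'n. of_real (if i = j then c else 0) * complex_of_real (G (Suc n) (c * (x $ i) + d)))" for j
   using Suc by (intro Ck_mult Ck_const)
  ultimately show ?case by simp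
 }
qed

text \<open>A class of functions that is closed under differentiation and contains \<open>exp (- 1 / t)\<close>; hence the latter is smooth.\<close>

definition flat_exp :: "real poly => real => real" where
 "flat_exp p t = (if 0 < t then poly p (1 / t) * exp (- 1 / t) else 0)"

lemma poly_exp_tendsto_0: "((\<lambda>s. poly p s * exp (- s)) \<longlongrightarrow> (0 :: real)) at_top"
proof -
 have "((\<lambda>s. \<Sum>i\<le>degree p. coeff p i * (s ^ i / exp s)) \<longlongrightarrow> (\<Sum>i\<le>degree p. coeff p i * 0)) at_top"
  by (intro tendsto_sum tendsto_mult tendsto_const tendsto_power_div_exp_0)
 then show ?thesis
  by (simp add: poly_altdef sum_distrib_right exp_minus divide_inverse mult.assoc)
qed

lemma flat_exp_deriv:
 "(flat_exp p has_real_derivative flat_exp ([:0, 0, 1:] * (p - pderiv p)) t) (at t)"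
proof (cases t "0 :: real" rule: linorder_cases)
 case greater
 have "((\<lambda>t. poly p (1 / t) * exp (- 1 / t)) has_real_derivative
   flat_exp ([:0, 0, 1:] * (p - pderiv p)) t) (at t)"
  using greater unfolding flat_exp_def
  by (auto intro!: derivative_eq_intros simp: power2_eq_square field_simps)
 then show ?thesis
  by (rule has_field_derivative_transform_within_open[where S = "{0<..}"])
   (use greater in \<open>auto simp: flat_exp_def\<close>)
next
 case less
 have "((\<lambda>t. 0) has_real_derivative flat_exp ([:0, 0, 1:] * (p - pderiv p)) t) (at t)"
  using less by (simp add: flat_exp_def)
 then show ?thesis
  by (rule has_field_derivative_transform_within_open[where S = "{..<0}"])
   (use less in \<open>auto simp: flat_exp_def\<close>)
next
 case equal
 have l: "((\<lambda>y. (flat_exp p y - flat_exp p 0) / (y - 0)) \<longlongrightarrow> 0) (at_left 0)"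
  by (rule tendsto_eventually) (auto simp: flat_exp_def eventually_at_left_field intro!: exI[of _ "-1"])
 have "((\<lambda>y. poly (p * [:0, 1:]) (inverse y) * exp (- inverse y)) \<longlongrightarrow> 0) (at_right (0::real))"
  using filterlim_compose[OF poly_exp_tendsto_0[of "p * [:0, 1:]"] filterlim_inverse_at_top_right] .
 moreover have "\<forall>\<^sub>F y in at_right 0. poly (p * [:0, 1:]) (inverse y) * exp (- inverse y)
   = (flat_exp p y - flat_exp p 0) / (y - 0)"
  by (auto simp: flat_exp_def eventually_at_right_field divide_inverse intro!: exI[of _ 1])
 ultimately have r: "((\<lambda>y. (flat_exp p y - flat_exp p 0) / (y - 0)) \<longlongrightarrow> 0) (at_right 0)"
  by (rule Lim_transform_eventually)
 from filterlim_split_at[OF l r] show ?thesis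
  unfolding equal has_field_derivative_iff by (simp add: flat_exp_def)
qed

definition flat1 :: "real => real" where
 "flat1 = flat_exp 1"

lemma flat1_eq: "flat1 t = (if 0 < t then exp (- 1 / t) else 0)"
 by (simp add: flat1_def flat_exp_def)

lemma Ck_flat1: "Ck m (\<lambda>x :: real^'n. complex_of_real (flat1 (c * (x $ i) + d)))"
proof -
 let ?G = "\<lambda>n. flat_exp (((\<lambda>p. [:0, 0, 1:] * (p - pderiv p)) ^^ n) 1)"
 have "(?G n has_real_derivative ?G (Suc n) t) (at t)" for n t
  using flat_exp_deriv by simp
 from Ck_univariate[where G = ?G and n = 0, OF this] show ?thesis by (simp add: flat1_def)
qed

text \<open>Smooth, positive exactly on the box, and increasing to its indicator function as \<open>m\<close> grows.\<close>

definition box_bump :: "real => real^'n => real^'n => real^'n => real" where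
 "box_bump m a b x = (\<Prod>i\<in>UNIV. flat1 (m * (x $ i - a $ i)) * flat1 (m * (b $ i - x $ i)))"

lemma flat1_bounds: "0 \<le> flat1 t" "flat1 t \<le> 1"
 by (auto simp: flat1_eq)

lemma box_bump_bounds: "0 \<le> box_bump m a b x" "box_bump m a b x \<le> 1"
 unfolding box_bump_def
 by (intro prod_nonneg ballI mult_nonneg_nonneg flat1_bounds)
  (intro prod_le_1 conjI mult_nonneg_nonneg mult_le_one flat1_bounds)

lemma box_bump_pos_iff: "0 < m ==> box_bump m a b x ~= 0 \<longleftrightarrow> x \<in> box a b"
 by (auto simp: box_bump_def mem_box_cart flat1_eq zero_less_mult_iff split: if_splits)

lemma Ck_box_bump:
 fixes a b :: "real^'n"
 shows "Ck n (\<lambda>x. complex_of_real (box_bump m a b x))"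
proof -
 have 1: "Ck n (\<lambda>x :: real^'n. complex_of_real (flat1 (m * (x $ i - a $ i))))" for i
  using Ck_flat1[of n m i "- m * a $ i"] by (simp add: algebra_simps)
 have 2: "Ck n (\<lambda>x :: real^'n. complex_of_real (flat1 (m * (b $ i - x $ i))))" for i
  using Ck_flat1[of n "- m" i "m * b $ i"] by (simp add: algebra_simps)
 have "Ck n (\<lambda>x. \<Prod>i\<in>UNIV. complex_of_real (flat1 (m * (x $ i - a $ i))) * complex_of_real (flat1 (m * (b $ i - x $ i))))"
  by (intro Ck_prod Ck_mult 1 2) auto
 then show ?thesis by (simp add: box_bump_def)
qed

lemma box_bump_test:
 assumes "0 < m" "cbox a b \<subseteq> W"
 shows "(\<lambda>x. complex_of_real (box_bump m a b x)) \<in> test_functions W"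
proof -
 have "{x. complex_of_real (box_bump m a b x) ~= 0} = box a b"
  using box_bump_pos_iff[OF assms(1)] by auto
 moreover have "closure (box a b) \<subseteq> cbox a b"
  using box_subset_cbox by (intro closure_minimal) auto
 moreover have "compact (closure (box a b))" by simp
 ultimately show ?thesis using assms by (auto simp: test_functions_def Ck_box_bump)
qed

lemma box_bump_limit: "(\<lambda>m. box_bump (real (Suc m)) a b x) ----> indicator (box a b) x"
proof (cases "x \<in> box a b")
 case True
 have f: "(\<lambda>m. flat1 (real (Suc m) * t)) ----> 1" if "0 < t" for t
 proof -
  have "(\<lambda>m. exp (- 1 / (real (Suc m) * t))) ----> exp (- 0)"
  proof (intro tendsto_exp)
   have "(\<lambda>m. (- 1 / t) * inverse (real (Suc m))) ----> (- 1 / t) * 0"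
    by (intro tendsto_mult tendsto_const LIMSEQ_inverse_real_of_nat)
   then show "(\<lambda>m. - 1 / (real (Suc m) * t)) ----> - 0" by (simp add: field_simps)
  qed
  then show ?thesis using that by (simp add: flat1_eq)
 qed
 have "(\<lambda>m. box_bump (real (Suc m)) a b x) ----> (\<Prod>i\<in>(UNIV :: 'a set). 1 * 1)"
  unfolding box_bump_def using True
  by (intro tendsto_prod tendsto_mult f) (auto simp: mem_box_cart)
 then show ?thesis using True by simp
next
 case False
 then have "box_bump (real (Suc m)) a b x = 0" for m
  using box_bump_pos_iff[of "real (Suc m)" a b x] by auto
 then show ?thesis using False by simp
qed

lemma box_Int_box_cart:
 fixes a b c d :: "real^'n"
 shows "box a b \<inter> box c d = box (\<chi> i. max (a $ i) (c $ i)) (\<chi> i. min (b $ i) (d $ i))"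
 by (auto simp: mem_box_cart)

section \<open>Test functions and the fundamental lemma of the calculus of variations\<close>

text \<open>Boxes are stable under intersection and generate the Borel sets, so the integral vanishes over every Borel set.\<close>

lemma integrable_zero_on_boxes_imp_AE_zero:
 fixes h :: "real^'n => real"
 assumes int: "integrable lebesgue h"
  and zero: "\<And>a b. integral\<^sup>L lebesgue (\<lambda>x. indicator (box a b) x *\<^sub>R h x) = 0"
  and total: "integral\<^sup>L lebesgue h = 0"
 shows "AE x in lebesgue. h x = 0"
proof -
 let ?I = "\<lambda>A. integral\<^sup>L lebesgue (\<lambda>x. indicator A x *\<^sub>R h x)"
 have si: "set_integrable lebesgue A h" if "A \<in> sets lebesgue" for A
  unfolding set_integrable_def using int that by (rule integrable_mult_indicator[rotated])
 define \<B> where "\<B> = range (\<lambda>(a, b). box a b :: (real^'n) set)"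
 have sb: "sigma_sets UNIV \<B> = sets borel"
  unfolding \<B>_def by (subst borel_eq_box) simp
 have bor: "?I A = 0" if "A \<in> sets borel" for A
 proof -
  have "box a b \<inter> box c d \<in> \<B>" for a b c d
   unfolding \<B>_def box_Int_box_cart by auto
  then have "Int_stable \<B>" by (auto simp: Int_stable_def \<B>_def)
  moreover have "\<B> \<subseteq> Pow UNIV" by simp
  moreover have "A \<in> sigma_sets UNIV \<B>" using that sb by simp
  ultimately show ?thesis
  proof (induction rule: sigma_sets_induct_disjoint)
   case (basic A)
   then show ?case using zero by (auto simp: \<B>_def)
  next
   case (compl A)
   then have A: "A \<in> sets lebesgue" unfolding sb by (simp add: sets_completionI_sets)
   have "(\<lambda>x. indicator (UNIV - A) x *\<^sub>R h x) = (\<lambda>x. h x - indicator A x *\<^sub>R h x)"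
    by (auto simp: indicator_def)
   then show ?case using compl total int si[OF A, unfolded set_integrable_def] by simp
  next
   case (union A)
   have "A i \<in> sets borel" for i using union(2) sb by auto
   then have A: "A i \<in> sets lebesgue" for i by (simp add: sets_completionI_sets)
   have "(LINT x:(\<Union>i. A i)|lebesgue. h x) = (\<Sum>i. LINT x:A i|lebesgue. h x)"
    using union(1) A by (intro lebesgue_integral_countable_add si) (auto simp: disjoint_family_on_def)
   then show ?case using union(3) by (simp add: set_lebesgue_integral_def)
  qed simp
 qed
 have leb: "?I A = 0" if AL: "A \<in> sets lebesgue" for A
 proof -
  obtain S N N' where SN: "A = S \<union> N" "N \<subseteq> N'" "N' \<in> null_sets lborel" "S \<in> sets lborel"
   by (rule sets_completionE[OF AL])
  have "?I A = ?I S"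
  proof (rule integral_cong_AE)
   have "AE x in lebesgue. x \<notin> N'" using SN by (intro AE_completion AE_not_in)
   then show "AE x in lebesgue. indicator A x *\<^sub>R h x = indicator S x *\<^sub>R h x"
    by eventually_elim (use SN in \<open>auto simp: indicator_def\<close>)
  qed (use AL SN si in \<open>auto simp: set_integrable_def intro!: borel_measurable_integrable\<close>)
  then show ?thesis using bor[of S] SN by simp
 qed
 have hm: "h \<in> borel_measurable lebesgue" using int by auto
 have half: "AE x in lebesgue. indicator A x *\<^sub>R h x = 0"
  if A: "A \<in> sets lebesgue" and s: "\<And>x. x \<in> A ==> 0 \<le> c * h x" and c: "c ~= 0" for c :: real and A
 proof -
  have "integral\<^sup>L lebesgue (\<lambda>x. c * (indicator A x *\<^sub>R h x)) = 0" using leb[OF A] by simp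
  moreover have "integrable lebesgue (\<lambda>x. c * (indicator A x *\<^sub>R h x))"
   using si[OF A] by (simp add: set_integrable_def)
  moreover have "AE x in lebesgue. 0 \<le> c * (indicator A x *\<^sub>R h x)"
   using s by (auto simp: indicator_def)
  ultimately have "AE x in lebesgue. c * (indicator A x *\<^sub>R h x) = 0"
   using integral_nonneg_eq_0_iff_AE by blast
  then show ?thesis using c by auto
 qed
 have "{x \<in> space lebesgue. 0 < h x} \<in> sets lebesgue" "{x \<in> space lebesgue. h x < 0} \<in> sets lebesgue"
  using hm by measurable
 then have s: "{x. 0 < h x} \<in> sets lebesgue" "{x. h x < 0} \<in> sets lebesgue" by simp_all
 have "AE x in lebesgue. indicator {x. 0 < h x} x *\<^sub>R h x = 0"
  by (rule half[OF s(1), of 1]) auto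
 moreover have "AE x in lebesgue. indicator {x. h x < 0} x *\<^sub>R h x = 0"
  by (rule half[OF s(2), of "-1"]) auto
 ultimately show ?thesis by eventually_elim (auto simp: indicator_def split: if_splits)
qed

lemma continuous_on_UNIV_lebesgue_measurable:
 fixes u :: "real^'n => complex"
 assumes "continuous_on UNIV u"
 shows "u \<in> borel_measurable lebesgue" "u \<in> borel_measurable (lebesgue_on W)"
 using assms by (auto intro!: measurable_completion measurable_restrict_space1 borel_measurable_continuous_onI)

lemma indicator_L2: "A \<in> sets lebesgue ==> emeasure lebesgue A < \<infinity> ==> W \<in> sets lebesgue
  ==> (\<lambda>x. c * indicator A x) \<in> L2 W"
proof -
 assume A: "A \<in> sets lebesgue" "emeasure lebesgue A < \<infinity>" and O: "W \<in> sets lebesgue"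
 have "integrable lebesgue (\<lambda>x. indicator W x *\<^sub>R ((cmod c)^2 * indicator A x :: real))"
  using A O by (intro integrable_mult_indicator integrable_mult_right integrable_real_indicator)
 then have "integrable (lebesgue_on W) (\<lambda>x. (cmod c)^2 * indicator A x :: real)"
  using O by (subst integrable_restrict_space) auto
 moreover have "(cmod (c * indicator A x))^2 = (cmod c)^2 * indicator A x" for x
  by (auto simp: indicator_def)
 moreover have "(\<lambda>x. c * indicator A x) \<in> borel_measurable (lebesgue_on W)"
  using A by (intro measurable_restrict_space1 borel_measurable_times borel_measurable_const borel_measurable_indicator)
 ultimately show ?thesis by (simp add: L2_def)
qed

lemma integral_zero_test_imp_AE_zero:
 fixes f :: "real^'n => complex"
 assumes O: "open W" and f: "f \<in> L2 W"
  and zero: "\<And>\<phi>. \<phi> \<in> test_functions W ==> lint W (\<lambda>x. f x * \<phi> x) = 0"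
 shows "AE x in lebesgue_on W. f x = 0"
proof -
 note OS = open_lebesgue[OF O(1)]
 have ind: "integrable (lebesgue_on W) (\<lambda>x. cmod (f x) * indicator (box a b) x)" for a b
 proof -
  have "(\<lambda>x. 1 * indicator (box a b) x :: complex) \<in> L2 W"
   using OS by (intro indicator_L2) (auto simp: emeasure_lborel_box_eq)
  moreover have "cmod (f x) * cmod (1 * indicator (box a b) x) = cmod (f x) * indicator (box a b) x" for x
   by (auto simp: indicator_def)
  ultimately show ?thesis using L2_integrable_prod[OF f, of "\<lambda>x. 1 * indicator (box a b) x"] by (simp only:)
 qed
 have box0: "lint W (\<lambda>x. f x * indicator (box a b) x) = 0
   \<and> integrable (lebesgue_on W) (\<lambda>x. f x * indicator (box a b) x)" if ab: "cbox a b \<subseteq> W" for a b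
 proof -
  let ?u = "\<lambda>m x. f x * complex_of_real (box_bump (real (Suc m)) a b x)"
  let ?f = "\<lambda>x. f x * complex_of_real (indicator (box a b) x)"
  have m: "f \<in> borel_measurable (lebesgue_on W)" using f by (rule L2_measurable)
  have bm: "(\<lambda>x. complex_of_real (box_bump m a b x)) \<in> borel_measurable (lebesgue_on W)" for m
   using Ck_box_bump[of 0 m a b] by (intro continuous_on_UNIV_lebesgue_measurable) simp
  have A: "?f \<in> borel_measurable (lebesgue_on W)"
  proof -
   have "(indicator (box a b) :: real^'n => complex) \<in> borel_measurable (lebesgue_on W)"
    by (intro measurable_restrict_space1 borel_measurable_indicator) simp
   moreover have "complex_of_real (indicator (box a b) x) = indicator (box a b) x" for x
    by (simp add: indicator_def)
   ultimately show ?thesis using borel_measurable_times[OF m] by simp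
  qed
  have B: "?u m \<in> borel_measurable (lebesgue_on W)" for m using m bm by (rule borel_measurable_times)
  have L: "AE x in lebesgue_on W. (\<lambda>m. ?u m x) ----> ?f x"
   by (intro AE_I2 tendsto_mult tendsto_const tendsto_of_real box_bump_limit)
  have D: "AE x in lebesgue_on W. cmod (?u m x) \<le> cmod (f x) * indicator (box a b) x" for m
  proof (rule AE_I2)
   fix x
   show "cmod (?u m x) \<le> cmod (f x) * indicator (box a b) x"
    using box_bump_bounds[of "real (Suc m)" a b x] box_bump_pos_iff[of "real (Suc m)" a b x]
    by (auto simp: norm_mult indicator_def mult_left_le simp del: of_nat_Suc)
  qed
  have "(\<lambda>m. lint W (?u m)) ----> lint W ?f"
   using A B ind L D by (rule integral_dominated_convergence)
  moreover have "lint W (?u m) = 0" for m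
   using zero[OF box_bump_test[OF _ ab, of "real (Suc m)"]] by simp
  ultimately have "lint W ?f = 0" by (simp add: LIMSEQ_const_iff)
  moreover have "integrable (lebesgue_on W) ?f"
   using A B ind L D by (rule integrable_dominated_convergence)
  moreover have "?f = (\<lambda>x. f x * indicator (box a b) x)" by (auto simp: indicator_def)
  ultimately show ?thesis by simp
 qed
 have leb: "integral\<^sup>L lebesgue (\<lambda>x. indicator (box a b) x *\<^sub>R f x) = 0
   \<and> integrable lebesgue (\<lambda>x. indicator (box a b) x *\<^sub>R f x)" if ab: "cbox a b \<subseteq> W" for a b
 proof -
  have eq: "(\<lambda>x. indicator W x *\<^sub>R (f x * indicator (box a b) x)) = (\<lambda>x. indicator (box a b) x *\<^sub>R f x)"
   using ab box_subset_cbox by (fastforce simp: indicator_def)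
  show ?thesis using box0[OF ab] OS
   by (simp add: integral_restrict_space integrable_restrict_space eq)
 qed
 have Q: "AE x in lebesgue. x \<in> cbox a b --> f x = 0" if ab: "cbox a b \<subseteq> W" for a b
 proof -
  have part: "AE x in lebesgue. P (indicator (box a b) x *\<^sub>R f x) = 0"
   if P: "bounded_linear P" for P :: "complex => real"
  proof (rule integrable_zero_on_boxes_imp_AE_zero)
   show "integrable lebesgue (\<lambda>x. P (indicator (box a b) x *\<^sub>R f x))"
    using leb[OF ab] P by (auto intro: integrable_bounded_linear)
   show "integral\<^sup>L lebesgue (\<lambda>x. P (indicator (box a b) x *\<^sub>R f x)) = 0"
    using leb[OF ab] P by (subst integral_bounded_linear) (auto simp: linear_0 bounded_linear.linear)
   fix c d
   obtain a' b' where ab': "box c d \<inter> box a b = box a' b'" "cbox a' b' \<subseteq> cbox a b"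
   proof
    show "box c d \<inter> box a b = box (\<chi> i. max (c $ i) (a $ i)) (\<chi> i. min (d $ i) (b $ i))"
     by (rule box_Int_box_cart)
    show "cbox (\<chi> i. max (c $ i) (a $ i)) (\<chi> i. min (d $ i) (b $ i)) \<subseteq> cbox a b"
     by (auto simp: mem_box_cart)
   qed
   have "indicator (box c d) x *\<^sub>R P (indicator (box a b) x *\<^sub>R f x) = P (indicator (box a' b') x *\<^sub>R f x)" for x
    using ab'(1) P by (auto simp: indicator_def linear_0 bounded_linear.linear)
   then show "integral\<^sup>L lebesgue (\<lambda>x. indicator (box c d) x *\<^sub>R P (indicator (box a b) x *\<^sub>R f x)) = 0"
    using leb[OF subset_trans[OF ab'(2) ab]] P
     integral_bounded_linear[OF P conjunct2[OF leb[OF subset_trans[OF ab'(2) ab]]]]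
    by (simp add: linear_0 bounded_linear.linear)
  qed
  have "cbox a b - box a b \<in> null_sets lebesgue"
   using negligible_frontier_interval[of a b] by (simp add: negligible_iff_null_sets)
  then have "AE x in lebesgue. x \<notin> cbox a b - box a b" by (rule AE_not_in)
  with part[OF bounded_linear_Re] part[OF bounded_linear_Im] show ?thesis
   by eventually_elim (auto simp: indicator_def complex_eq_iff split: if_splits)
 qed
 obtain \<D> where D: "countable \<D>" "\<D> \<subseteq> Pow W" "\<And>X. X \<in> \<D> ==> \<exists>a b. X = cbox a b" "\<Union>\<D> = W"
 proof (rule open_countable_Union_open_cbox[OF O])
  fix \<D> :: "(real^'n) set set"
  assume D: "countable \<D>" "\<D> \<subseteq> Pow W" "\<And>X. X \<in> \<D> ==> \<exists>a b. X = cbox a b" "\<Union>\<D> = W"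
  show thesis by (rule that[OF D])
 qed
 have "AE x in lebesgue. \<forall>X\<in>\<D>. x \<in> X --> f x = 0"
  unfolding AE_ball_countable[OF D(1)]
 proof
  fix X assume X: "X \<in> \<D>"
  obtain a b where ab: "X = cbox a b" using D(3)[OF X] by blast
  have "cbox a b \<subseteq> W" using X D(2) ab by blast
  then show "AE x in lebesgue. x \<in> X --> f x = 0" unfolding ab by (rule Q)
 qed
 then have "AE x in lebesgue. x \<in> W --> f x = 0"
  by eventually_elim (use D(4) in blast)
 then show ?thesis using OS by (simp add: AE_restrict_space_iff)
qed

lemma test_functionsD:
 assumes "\<phi> \<in> test_functions W"
 shows "Ck m \<phi>" "continuous_on S \<phi>" "\<phi> differentiable (at x)" "\<exists>R. \<forall>x. R < norm x --> \<phi> x = 0"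
  "x \<notin> W ==> \<phi> x = 0"
proof -
 show "Ck m \<phi>" for m using assms by (simp add: test_functions_def)
 then have "Ck 0 \<phi>" "Ck 1 \<phi>" by blast+
 then show "continuous_on S \<phi>" "\<phi> differentiable (at x)" by (auto intro: continuous_on_subset)
 have "bounded (closure {x. \<phi> x ~= 0})" using assms by (simp add: test_functions_def compact_imp_bounded)
 then obtain R where "\<forall>x\<in>closure {x. \<phi> x ~= 0}. norm x \<le> R" by (auto simp: bounded_iff)
 then have "\<forall>x. R < norm x --> \<phi> x = 0" using closure_subset[of "{x. \<phi> x ~= 0}"] by force
 then show "\<exists>R. \<forall>x. R < norm x --> \<phi> x = 0" ..
 show "\<phi> x = 0" if "x \<notin> W" using assms that closure_subset[of "{x. \<phi> x ~= 0}"] by (auto simp: test_functions_def)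
qed

lemma test_functions_supportI:
 assumes "\<And>m. Ck m u" "\<phi> \<in> test_functions W" "{x. u x ~= 0} \<subseteq> closure {x. \<phi> x ~= 0}"
 shows "u \<in> test_functions W"
proof -
 have "closure {x. u x ~= 0} \<subseteq> closure {x. \<phi> x ~= 0}" using assms(3) by (simp add: closure_minimal)
 moreover have "compact (closure {x. u x ~= 0})"
  using calculation assms(2) by (auto simp: test_functions_def compact_eq_bounded_closed intro: bounded_subset)
 ultimately show ?thesis using assms by (auto simp: test_functions_def)
qed

lemma test_functions_pdiff:
 assumes "\<phi> \<in> test_functions W"
 shows "pdiff i \<phi> \<in> test_functions W"
proof (rule test_functions_supportI[OF _ assms])
 show "Ck m (pdiff i \<phi>)" for m using test_functionsD(1)[OF assms, of "Suc m"] by simp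
 show "{x. pdiff i \<phi> x ~= 0} \<subseteq> closure {x. \<phi> x ~= 0}"
 proof (rule ccontr)
  assume "\<not> ?thesis"
  then obtain x where x: "pdiff i \<phi> x ~= 0" "x \<in> - closure {x. \<phi> x ~= 0}" by auto
  have "((\<lambda>x. 0) has_derivative (\<lambda>h. 0)) (at x)" by simp
  then have "(\<phi> has_derivative (\<lambda>h. 0)) (at x)"
   by (rule has_derivative_transform_within_open[OF _ _ x(2)])
    (use closure_subset[of "{x. \<phi> x ~= 0}"] in \<open>auto simp: subset_iff\<close>)
  from has_derivative_pdiff[OF this] x show False by simp
 qed
qed

lemma test_functions_mult:
 assumes "\<phi> \<in> test_functions W" "\<And>m. Ck m u"
 shows "(\<lambda>x. u x * \<phi> x) \<in> test_functions W"
 by (rule test_functions_supportI[OF _ assms(1)])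
  (use assms test_functionsD(1) closure_subset[of "{x. \<phi> x ~= 0}"] in \<open>auto intro!: Ck_mult\<close>)

lemma test_functions_add:
 assumes "\<phi> \<in> test_functions W" "\<psi> \<in> test_functions W"
 shows "(\<lambda>x. \<phi> x + \<psi> x) \<in> test_functions W"
proof -
 have "{x. \<phi> x + \<psi> x ~= 0} \<subseteq> {x. \<phi> x ~= 0} \<union> {x. \<psi> x ~= 0}" by auto
 then have sub: "closure {x. \<phi> x + \<psi> x ~= 0} \<subseteq> closure {x. \<phi> x ~= 0} \<union> closure {x. \<psi> x ~= 0}"
  unfolding closure_Un[symmetric] by (rule closure_mono)
 have bd: "bounded (closure {x. \<phi> x ~= 0} \<union> closure {x. \<psi> x ~= 0})"
  using assms by (auto simp: test_functions_def compact_imp_bounded)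
 have "closure {x. \<phi> x ~= 0} \<union> closure {x. \<psi> x ~= 0} \<subseteq> W"
  using assms by (auto simp: test_functions_def)
 then have "closure {x. \<phi> x + \<psi> x ~= 0} \<subseteq> W" using sub by blast
 moreover have "compact (closure {x. \<phi> x + \<psi> x ~= 0})"
  using bounded_subset[OF bd sub] by (simp add: compact_eq_bounded_closed)
 ultimately show ?thesis using assms test_functionsD(1)[OF assms(1)] test_functionsD(1)[OF assms(2)]
  by (simp add: test_functions_def Ck_add)
qed

lemma test_functions_cmult: "\<phi> \<in> test_functions W ==> (\<lambda>x. c * \<phi> x) \<in> test_functions W"
 by (intro test_functions_mult Ck_const)

lemma test_functions_zero: "(\<lambda>x. 0) \<in> test_functions W"
 by (auto simp: test_functions_def Ck_const)

lemma continuous_compact_support_bounded: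
 fixes u :: "real^'n => complex"
 assumes "continuous_on UNIV u" "\<And>x. R < norm x ==> u x = 0"
 obtains B where "0 \<le> B" "\<And>x. cmod (u x) \<le> B"
proof -
 have "bounded (u ` cball 0 R)"
  using assms(1) by (intro compact_imp_bounded compact_continuous_image) (auto intro: continuous_on_subset)
 then obtain B where B: "\<forall>y\<in>u ` cball 0 R. cmod y \<le> B" by (auto simp: bounded_iff)
 have "cmod (u x) \<le> max B 0" for x
  using B assms(2)[of x] by (cases "norm x \<le> R") (auto simp: le_max_iff_disj)
 then show thesis using that[of "max B 0"] by auto
qed

lemma bounded_support_integrable:
 fixes u :: "real^'n => complex"
 assumes "u \<in> borel_measurable lebesgue" "\<And>x. cmod (u x) \<le> B" "\<And>x. R < norm x ==> u x = 0"
 shows "integrable lebesgue u"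
proof (rule Bochner_Integration.integrable_bound)
 show "integrable lebesgue (\<lambda>x :: real^'n. B * indicator (cball 0 R) x :: real)"
  using emeasure_lborel_cball_finite[of "0 :: real^'n" R]
  by (intro integrable_mult_right integrable_real_indicator) (auto simp: emeasure_completion less_top)
 show "AE x in lebesgue. norm (u x) \<le> norm (B * indicator (cball 0 R) x :: real)"
 proof (rule AE_I2)
  fix x show "norm (u x) \<le> norm (B * indicator (cball 0 R) x :: real)"
   using assms(2)[of x] assms(3)[of x] by (cases "norm x \<le> R") auto
 qed
qed (use assms in auto)

lemma integral_lebesgue_translate:
 fixes w :: "real^'n => complex"
 assumes "continuous_on UNIV w"
 shows "integral\<^sup>L lebesgue (\<lambda>x. w (x + h)) = integral\<^sup>L lebesgue w"
proof -
 have m: "w \<in> borel_measurable borel" using assms by (rule borel_measurable_continuous_onI)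
 then have "integral\<^sup>L lebesgue (\<lambda>x. w (x + h)) = integral\<^sup>L lborel (\<lambda>x. w (h + x))"
  by (subst integral_completion) (auto simp: add.commute)
 also have "... = integral\<^sup>L (distr lborel borel ((+) h)) w"
  using m by (subst integral_distr) auto
 also have "... = integral\<^sup>L lebesgue w" using m by (simp add: lborel_distr_plus integral_completion)
 finally show ?thesis .
qed

lemma lipschitz_bound_imp_continuous:
 fixes w :: "real^'n => complex"
 assumes "\<And>x y. cmod (w x - w y) \<le> L * norm (x - y)"
 shows "0 \<le> L" "continuous_on UNIV w"
proof -
 show "0 \<le> L"
  using assms[of "axis undefined 1" 0] by (simp add: order_trans[OF norm_ge_zero])
 with assms have "L-lipschitz_on UNIV w" by (auto simp: lipschitz_on_def dist_norm)
 then show "continuous_on UNIV w" by (rule lipschitz_on_continuous_on)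
qed

text \<open>Difference quotients of step \<open>1 / (n + 1)\<close>; they turn derivatives into limits to which dominated convergence applies.\<close>

definition diff_quot :: "(real^'n => complex) => real^'n => nat => real^'n => complex" where
 "diff_quot w e n x = of_real (real (Suc n)) * (w (x + inverse (real (Suc n)) *\<^sub>R e) - w x)"

lemma diff_quot_continuous:
 assumes "continuous_on UNIV w"
 shows "continuous_on UNIV (diff_quot w e n)"
 unfolding diff_quot_def[abs_def]
 by (intro continuous_intros continuous_on_compose2[OF assms]) auto

lemma diff_quot_bound:
 fixes w :: "real^'n => complex"
 assumes lip: "\<And>x y. cmod (w x - w y) \<le> L * norm (x - y)"
  and supp: "\<And>x. R < norm x ==> w x = 0"
 shows "cmod (diff_quot w e n x) \<le> L * norm e * indicator (cball 0 (R + norm e)) x"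
proof -
 let ?h = "inverse (real (Suc n)) *\<^sub>R e"
 have h: "norm ?h \<le> norm e"
  using mult_right_mono[of "inverse (real (Suc n))" 1 "norm e"] by (simp add: inverse_le_1_iff)
 show ?thesis
 proof (cases "norm x \<le> R + norm e")
  case True
  have "cmod (diff_quot w e n x) = real (Suc n) * cmod (w (x + ?h) - w x)"
   by (simp add: diff_quot_def norm_mult del: of_nat_Suc)
  also have "... \<le> real (Suc n) * (L * norm ?h)"
   using lip[of "x + ?h" x] by (intro mult_left_mono) auto
  also have "... = L * norm e" by simp
  finally show ?thesis using True by simp
 next
  case False
  have "norm x \<le> norm (x + ?h) + norm ?h" using norm_triangle_ineq4[of "x + ?h" ?h] by simp
  then have "R < norm (x + ?h)" using False h by linarith
  moreover have "R < norm x" using False norm_ge_zero[of e] by linarith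
  ultimately have "w (x + ?h) = 0" "w x = 0" by (auto dest: supp)
  then show ?thesis using False by (simp add: diff_quot_def)
 qed
qed

lemma diff_quot_limit:
 fixes w :: "real^'n => complex"
 assumes "((\<lambda>t. w (x + t *\<^sub>R e)) has_vector_derivative D) (at 0)"
 shows "(\<lambda>n. diff_quot w e n x) ----> D"
proof -
 let ?h = "\<lambda>n. inverse (real (Suc n))"
 have "((\<lambda>t. norm (w (x + t *\<^sub>R e) - w x - t *\<^sub>R D) / norm t) \<longlongrightarrow> 0) (at 0)"
  using assms by (simp add: has_vector_derivative_def has_derivative_at)
 moreover have "filterlim ?h (at 0) sequentially"
  unfolding filterlim_at using LIMSEQ_inverse_real_of_nat by auto
 ultimately have "(\<lambda>n. norm (w (x + ?h n *\<^sub>R e) - w x - ?h n *\<^sub>R D) / norm (?h n)) ----> 0"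
  by (rule filterlim_compose)
 moreover have "norm (w (x + ?h n *\<^sub>R e) - w x - ?h n *\<^sub>R D) / norm (?h n) = norm (diff_quot w e n x - D)" for n
 proof -
  have "diff_quot w e n x - D = of_real (real (Suc n)) * (w (x + ?h n *\<^sub>R e) - w x - ?h n *\<^sub>R D)"
   by (simp add: diff_quot_def right_diff_distrib scaleR_conv_of_real del: of_nat_Suc)
  moreover have "cmod Y / norm (inverse (real (Suc n))) = cmod (of_real (real (Suc n)) * Y)" for Y
   by (simp add: norm_mult divide_inverse mult.commute del: of_nat_Suc)
  ultimately show ?thesis by (simp only:)
 qed
 ultimately have "(\<lambda>n. norm (diff_quot w e n x - D)) ----> 0" by simp
 then show ?thesis using LIM_zero_cancel tendsto_norm_zero_iff by blast
qed

lemma indicator_cball_integrable: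
 "integrable lebesgue (\<lambda>x :: real^'n. c * indicator (cball 0 r) x :: real)"
 using emeasure_lborel_cball_finite[of "0 :: real^'n" r]
 by (intro integrable_mult_right integrable_real_indicator) (auto simp: emeasure_completion less_top)

lemma integral_directional_derivative_zero:
 fixes w :: "real^'n => complex"
 assumes lip: "\<And>x y. cmod (w x - w y) \<le> L * norm (x - y)"
  and supp: "\<And>x. R < norm x ==> w x = 0"
  and Dm: "D \<in> borel_measurable lebesgue"
  and der: "AE x in lebesgue. ((\<lambda>t. w (x + t *\<^sub>R e)) has_vector_derivative D x) (at 0)"
 shows "integrable lebesgue D" "integral\<^sup>L lebesgue D = 0"
proof -
 note cont = lipschitz_bound_imp_continuous(2)[OF lip]
 have sm: "diff_quot w e n \<in> borel_measurable lebesgue" for n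
  by (rule continuous_on_UNIV_lebesgue_measurable[OF diff_quot_continuous[OF cont]])
 note Ki = indicator_cball_integrable[of "L * norm e" "R + norm e"]
 have bound: "AE x in lebesgue. norm (diff_quot w e n x) \<le> L * norm e * indicator (cball 0 (R + norm e)) x" for n
  by (intro AE_I2 diff_quot_bound lip supp)
 have lim: "AE x in lebesgue. (\<lambda>n. diff_quot w e n x) ----> D x"
  using der by eventually_elim (rule diff_quot_limit)
 show "integrable lebesgue D"
  using Dm sm Ki lim bound by (rule integrable_dominated_convergence)
 have "(\<lambda>n. integral\<^sup>L lebesgue (diff_quot w e n)) ----> integral\<^sup>L lebesgue D"
  using Dm sm Ki lim bound by (rule integral_dominated_convergence)
 moreover have "integral\<^sup>L lebesgue (diff_quot w e n) = 0" for n
 proof -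
  let ?h = "inverse (real (Suc n)) *\<^sub>R e"
  obtain B where "0 \<le> B" and B: "\<And>x. cmod (w x) \<le> B"
  proof (rule continuous_compact_support_bounded[OF cont supp])
   fix B assume "0 \<le> B" "\<And>x. cmod (w x) \<le> B"
   then show thesis by (rule that)
  qed
  have i1: "integrable lebesgue w"
   by (rule bounded_support_integrable[OF continuous_on_UNIV_lebesgue_measurable(1)[OF cont] B supp])
  have i2: "integrable lebesgue (\<lambda>x. w (x + ?h))"
  proof (rule bounded_support_integrable[OF _ B])
   show "(\<lambda>x. w (x + ?h)) \<in> borel_measurable lebesgue"
    by (intro continuous_on_UNIV_lebesgue_measurable continuous_on_compose2[OF cont] continuous_intros) auto
   fix x :: "real^'n" assume "R + norm ?h < norm x"
   moreover have "norm x \<le> norm (x + ?h) + norm ?h" using norm_triangle_ineq4[of "x + ?h" ?h] by simp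
   ultimately show "w (x + ?h) = 0" by (intro supp) linarith
  qed
  show ?thesis unfolding diff_quot_def
   using i1 i2 by (simp add: integral_lebesgue_translate[OF cont])
 qed
 ultimately show "integral\<^sup>L lebesgue D = 0" by (simp add: LIMSEQ_const_iff)
qed

lemma test_functions_bounded:
 assumes "\<phi> \<in> test_functions W"
 obtains B where "0 \<le> B" "\<And>x. cmod (\<phi> x) \<le> B"
proof -
 obtain R where R: "\<forall>x. R < norm x --> \<phi> x = 0" using test_functionsD(4)[OF assms] ..
 show thesis
 proof (rule continuous_compact_support_bounded[OF test_functionsD(2)[OF assms]])
  show "\<phi> x = 0" if "R < norm x" for x using R that by blast
  fix B assume "0 \<le> B" "\<And>x. cmod (\<phi> x) \<le> B"
  then show thesis by (rule that)
 qed
qed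

lemma vec_eq_sum_axis: "(h :: real^'n) = (\<Sum>i\<in>UNIV. h $ i *\<^sub>R axis i 1)"
 by (simp add: vec_eq_iff axis_def if_distrib cong: if_cong)

lemma has_derivative_sum_pdiff:
 fixes u :: "real^'n => complex"
 assumes "u differentiable (at x)"
 shows "(u has_derivative (\<lambda>h. \<Sum>i\<in>UNIV. h $ i *\<^sub>R pdiff i u x)) (at x)"
proof -
 obtain u' where u': "(u has_derivative u') (at x)" using assms by (auto simp: differentiable_def)
 then have lin: "linear u'" by (rule has_derivative_linear)
 have "u' h = (\<Sum>i\<in>UNIV. h $ i *\<^sub>R pdiff i u x)" for h
 proof -
  have "u' h = u' (\<Sum>i\<in>UNIV. h $ i *\<^sub>R axis i 1)" by (simp flip: vec_eq_sum_axis)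
  also have "... = (\<Sum>i\<in>UNIV. h $ i *\<^sub>R pdiff i u x)"
   by (simp add: linear_sum[OF lin] linear_cmul[OF lin] has_derivative_pdiff[OF u'])
  finally show ?thesis .
 qed
 then have "u' = (\<lambda>h. \<Sum>i\<in>UNIV. h $ i *\<^sub>R pdiff i u x)" by (rule ext)
 with u' show ?thesis by simp
qed

lemma directional_derivative:
 fixes u :: "real^'n => complex"
 assumes "u differentiable (at x)"
 shows "((\<lambda>t. u (x + t *\<^sub>R e)) has_vector_derivative (\<Sum>i\<in>UNIV. e $ i *\<^sub>R pdiff i u x)) (at 0)"
proof -
 have "((\<lambda>t. x + t *\<^sub>R e) has_derivative (\<lambda>t. t *\<^sub>R e)) (at 0)"
  by (auto intro!: derivative_eq_intros)
 moreover have "(u has_derivative (\<lambda>h. \<Sum>i\<in>UNIV. h $ i *\<^sub>R pdiff i u x)) (at (x + 0 *\<^sub>R e))"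
  using has_derivative_sum_pdiff[OF assms] by simp
 ultimately have "((\<lambda>t. u (x + t *\<^sub>R e)) has_derivative (\<lambda>t. \<Sum>i\<in>UNIV. (t *\<^sub>R e) $ i *\<^sub>R pdiff i u x)) (at 0)"
  by (rule has_derivative_compose)
 then show ?thesis by (simp add: has_vector_derivative_def scaleR_sum_right)
qed

lemma test_functions_lipschitz:
 fixes \<phi> :: "real^'n => complex"
 assumes "\<phi> \<in> test_functions W"
 obtains L where "\<And>x y. cmod (\<phi> x - \<phi> y) \<le> L * norm (x - y)"
proof -
 have "\<exists>B. \<forall>x. cmod (pdiff i \<phi> x) \<le> B" for i
  using test_functions_bounded[OF test_functions_pdiff[OF assms]] by blast
 then have "\<exists>B. \<forall>i. \<forall>x. cmod (pdiff i \<phi> x) \<le> B i" by (intro choice allI)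
 then obtain B where B: "\<And>i x. cmod (pdiff i \<phi> x) \<le> B i" by blast
 define L where "L = (\<Sum>i\<in>UNIV. B i)"
 have "cmod (\<phi> x - \<phi> y) \<le> L * norm (x - y)" for x y
 proof (rule differentiable_bound[where S = UNIV])
  fix x
  show "(\<phi> has_derivative (\<lambda>h. \<Sum>i\<in>UNIV. h $ i *\<^sub>R pdiff i \<phi> x)) (at x within UNIV)"
   using has_derivative_sum_pdiff[OF test_functionsD(3)[OF assms]] by simp
  show "onorm (\<lambda>h. \<Sum>i\<in>UNIV. h $ i *\<^sub>R pdiff i \<phi> x) \<le> L"
  proof (rule onorm_bound)
   show "0 \<le> L" unfolding L_def
    by (intro sum_nonneg order_trans[OF norm_ge_zero B])
   fix h :: "real^'n"
   have "norm (\<Sum>i\<in>UNIV. h $ i *\<^sub>R pdiff i \<phi> x) \<le> (\<Sum>i\<in>UNIV. norm h * B i)"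
    by (intro sum_norm_le) (auto intro!: mult_mono B component_le_norm_cart)
   then show "norm (\<Sum>i\<in>UNIV. h $ i *\<^sub>R pdiff i \<phi> x) \<le> L * norm h"
    by (simp add: L_def sum_distrib_left mult.commute)
  qed
 qed auto
 then show thesis by (rule that)
qed

lemma L2_bounded_support:
 fixes u :: "real^'n => complex"
 assumes "u \<in> borel_measurable lebesgue" "\<And>x. cmod (u x) \<le> B" "\<And>x. R < norm x ==> u x = 0"
  and "W \<in> sets lebesgue"
 shows "u \<in> L2 W"
proof -
 have "(\<lambda>x. complex_of_real ((cmod (u x))^2)) \<in> borel_measurable lebesgue"
  using assms(1) by measurable
 then have "integrable lebesgue (\<lambda>x. complex_of_real ((cmod (u x))^2))"
  by (rule bounded_support_integrable[where B = "B\<^sup>2" and R = R])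
   (use assms in \<open>auto simp: norm_power intro!: power_mono\<close>)
 from integrable_Re[OF this] have "integrable lebesgue (\<lambda>x. (cmod (u x))^2)"
  by (simp del: of_real_power)
 then have "integrable (lebesgue_on W) (\<lambda>x. (cmod (u x))^2)"
  using assms(4) by (subst integrable_restrict_space) (auto intro: integrable_mult_indicator simp del: real_scaleR_def)
 then show ?thesis using assms(1) by (simp add: L2_def measurable_restrict_space1)
qed

lemma integral_lebesgue_on_eq:
 fixes u :: "real^'n => 'b::{banach, second_countable_topology}"
 assumes "W \<in> sets lebesgue" "\<And>x. x \<notin> W ==> u x = 0"
 shows "lint W u = integral\<^sup>L lebesgue u"
  "integrable (lebesgue_on W) u \<longleftrightarrow> integrable lebesgue u"
proof -
 have "(\<lambda>x. indicator W x *\<^sub>R u x) = u" using assms(2) by (auto simp: indicator_def)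
 then show "lint W u = integral\<^sup>L lebesgue u"
  "integrable (lebesgue_on W) u \<longleftrightarrow> integrable lebesgue u"
  using assms(1) by (simp_all add: integral_restrict_space integrable_restrict_space)
qed

lemma test_functions_L2:
 assumes "\<phi> \<in> test_functions W" "W' \<in> sets lebesgue"
 shows "\<phi> \<in> L2 W'"
proof -
 obtain B where B: "\<And>x. cmod (\<phi> x) \<le> B" using test_functions_bounded[OF assms(1)] by blast
 obtain R where R: "\<forall>x. R < norm x --> \<phi> x = 0" using test_functionsD(4)[OF assms(1)] ..
 show ?thesis
  by (rule L2_bounded_support[OF continuous_on_UNIV_lebesgue_measurable(1)[OF test_functionsD(2)[OF assms(1)]] B _ assms(2)])
   (use R in blast)
qed

section \<open>Weak derivatives and Sobolev spaces\<close>

text \<open>For a test function \<open>\<phi>\<close> the product \<open>u \<phi>\<close> is Lipschitz with bounded support, so the integral of its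
almost everywhere defined partial derivative is zero. Only almost everywhere differentiability enters, which suits
piecewise affine functions.\<close>

lemma weak_pdiff_lipschitz:
 fixes u :: "real^'n => complex"
 assumes O: "W \<in> sets lebesgue"
  and lip: "\<And>x y. cmod (u x - u y) \<le> L * norm (x - y)"
  and gm: "g \<in> borel_measurable lebesgue"
  and der: "AE x in lebesgue. ((\<lambda>t. u (x + t *\<^sub>R axis i 1)) has_vector_derivative g x) (at 0)"
 shows "weak_pdiff W i u g"
 unfolding weak_pdiff_def
proof
 fix \<phi> assume \<phi>: "\<phi> \<in> test_functions W"
 note uL = lipschitz_bound_imp_continuous[OF lip]
 obtain M where M: "0 \<le> M" "\<And>x. cmod (\<phi> x) \<le> M" using test_functions_bounded[OF \<phi>] by blast
 obtain K where K: "\<And>x y. cmod (\<phi> x - \<phi> y) \<le> K * norm (x - y)" using test_functions_lipschitz[OF \<phi>] by blast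
 note K0 = lipschitz_bound_imp_continuous(1)[OF K]
 obtain R where R: "\<forall>x. R < norm x --> \<phi> x = 0" using test_functionsD(4)[OF \<phi>] ..
 have "bounded (u ` cball 0 (max R 0))"
  by (intro compact_imp_bounded compact_continuous_image continuous_on_subset[OF uL(2)]) auto
 then obtain B where B: "\<forall>y\<in>u ` cball 0 (max R 0). cmod y \<le> B" by (auto simp: bounded_iff)
 then have bnd: "cmod (u x) \<le> B" if "norm x \<le> R" for x using that by force
 have "u 0 \<in> u ` cball 0 (max R 0)" by simp
 then have B0: "0 \<le> B" using B norm_ge_zero order_trans by blast
 define w where "w x = u x * \<phi> x" for x
 define D where "D x = u x * pdiff i \<phi> x + g x * \<phi> x" for x
 note pt = test_functions_pdiff[OF \<phi>, of i]
 have cp: "continuous_on UNIV (\<lambda>x. u x * pdiff i \<phi> x)"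
  by (intro continuous_intros uL(2) test_functionsD(2)[OF pt])
 have wl': "cmod (w x - w y) \<le> (B * K + L * M) * norm (x - y)" if x: "norm x \<le> R" for x y
 proof -
  have "w x - w y = u x * (\<phi> x - \<phi> y) + (u x - u y) * \<phi> y" by (simp add: w_def algebra_simps)
  then have "cmod (w x - w y) \<le> cmod (u x) * cmod (\<phi> x - \<phi> y) + cmod (u x - u y) * cmod (\<phi> y)"
   using norm_triangle_ineq[of "u x * (\<phi> x - \<phi> y)" "(u x - u y) * \<phi> y"] by (simp only: norm_mult)
  also have "... \<le> B * (K * norm (x - y)) + (L * norm (x - y)) * M"
   using bnd[OF x] K lip M B0 K0 uL(1) by (intro add_mono mult_mono) auto
  finally show ?thesis by (simp add: algebra_simps)
 qed
 have wl: "cmod (w x - w y) \<le> (B * K + L * M) * norm (x - y)" for x y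
 proof (cases "norm x \<le> R \<or> norm y \<le> R")
  case True
  then show ?thesis using wl'[of x y] wl'[of y x] by (auto simp: norm_minus_commute)
 next
  case False
  then have "w x = 0" "w y = 0" using R by (auto simp: w_def)
  then show ?thesis using B0 K0 uL(1) M(1) by simp
 qed
 have Dm: "D \<in> borel_measurable lebesgue"
  unfolding D_def
  by (intro borel_measurable_add borel_measurable_times gm continuous_on_UNIV_lebesgue_measurable cp
    test_functionsD(2)[OF \<phi>] uL(2) test_functionsD(2)[OF pt])
 have der': "AE x in lebesgue. ((\<lambda>t. w (x + t *\<^sub>R axis i 1)) has_vector_derivative D x) (at 0)"
  using der
 proof eventually_elim
  case (elim x)
  have "(\<Sum>j\<in>UNIV. axis i 1 $ j *\<^sub>R pdiff j \<phi> x) = pdiff i \<phi> x"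
   by (simp add: axis_def if_distrib[of "\<lambda>c. c *\<^sub>R _"] cong: if_cong)
  then have "((\<lambda>t. \<phi> (x + t *\<^sub>R axis i 1)) has_vector_derivative pdiff i \<phi> x) (at 0)"
   using directional_derivative[OF test_functionsD(3)[OF \<phi>], of x "axis i 1"] by simp
  from has_vector_derivative_mult[OF elim this] show ?case by (simp add: w_def D_def)
 qed
 have D0: "integrable lebesgue D" "integral\<^sup>L lebesgue D = 0"
  by (rule integral_directional_derivative_zero[OF wl _ Dm der', of R], use R in \<open>simp add: w_def\<close>)+
 obtain M' where M': "0 \<le> M'" "\<And>x. cmod (pdiff i \<phi> x) \<le> M'" using test_functions_bounded[OF pt] by blast
 have i1: "integrable lebesgue (\<lambda>x. u x * pdiff i \<phi> x)"
 proof -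
  obtain R' where R': "\<forall>x. R' < norm x --> pdiff i \<phi> x = 0" using test_functionsD(4)[OF pt] ..
  have bound_uv: "cmod (u x * pdiff i \<phi> x) \<le> B * M'" for x
  proof (cases "norm x \<le> R")
   case True
   then show ?thesis using bnd[OF True] M' B0 by (auto simp: norm_mult intro!: mult_mono)
  next
   case False
   then have x: "x \<in> {x. R < norm x}" by simp
   have "open {x :: real^'n. R < norm x}" by (intro open_Collect_less continuous_intros)
   then have "(\<phi> has_derivative (\<lambda>h. 0)) (at x)"
    by (rule has_derivative_transform_within_open[OF has_derivative_const[of 0] _ x]) (use R in auto)
   then show ?thesis using has_derivative_pdiff B0 M'(1) by force
  qed
  show ?thesis
   by (rule bounded_support_integrable[OF continuous_on_UNIV_lebesgue_measurable(1)[OF cp], of "B * M'" R'])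
    (use R' bound_uv in auto)
 qed
 have i2: "integrable lebesgue (\<lambda>x. g x * \<phi> x)"
  using Bochner_Integration.integrable_diff[OF D0(1) i1] by (simp add: D_def)
 have "integral\<^sup>L lebesgue (\<lambda>x. u x * pdiff i \<phi> x) + integral\<^sup>L lebesgue (\<lambda>x. g x * \<phi> x) = 0"
  using D0(2) Bochner_Integration.integral_add[OF i1 i2] by (simp add: D_def[abs_def])
 moreover have "lint W (\<lambda>x. u x * pdiff i \<phi> x) = integral\<^sup>L lebesgue (\<lambda>x. u x * pdiff i \<phi> x)"
  using test_functionsD(5)[OF pt] by (intro integral_lebesgue_on_eq O) auto
 moreover have "lint W (\<lambda>x. g x * \<phi> x) = integral\<^sup>L lebesgue (\<lambda>x. g x * \<phi> x)"
  using test_functionsD(5)[OF \<phi>] by (intro integral_lebesgue_on_eq O) auto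
 ultimately show "lint W (\<lambda>x. u x * pdiff i \<phi> x)
   = - lint W (\<lambda>x. g x * \<phi> x)"
  by (simp add: eq_neg_iff_add_eq_0)
qed

lemma weak_pdiff_test:
 assumes "W \<in> sets lebesgue" "\<phi> \<in> test_functions W"
 shows "weak_pdiff W i \<phi> (pdiff i \<phi>)"
proof -
 obtain K where K: "\<And>x y. cmod (\<phi> x - \<phi> y) \<le> K * norm (x - y)" using test_functions_lipschitz[OF assms(2)] by blast
 show ?thesis
 proof (rule weak_pdiff_lipschitz[OF assms(1) K])
  show "pdiff i \<phi> \<in> borel_measurable lebesgue"
   by (intro continuous_on_UNIV_lebesgue_measurable test_functionsD(2)[OF test_functions_pdiff[OF assms(2)]])
  have "(\<Sum>j\<in>UNIV. axis i 1 $ j *\<^sub>R pdiff j \<phi> x) = pdiff i \<phi> x" for x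
   by (simp add: axis_def if_distrib[of "\<lambda>c. c *\<^sub>R _"] cong: if_cong)
  then show "AE x in lebesgue. ((\<lambda>t. \<phi> (x + t *\<^sub>R axis i 1)) has_vector_derivative pdiff i \<phi> x) (at 0)"
   using directional_derivative[OF test_functionsD(3)[OF assms(2)], of _ "axis i 1"] by simp
 qed
qed

lemma L2_mult_test_integrable:
 assumes "g \<in> L2 W" "\<phi> \<in> test_functions W" "W \<in> sets lebesgue"
 shows "integrable (lebesgue_on W) (\<lambda>x. g x * \<phi> x)"
 by (rule Bochner_Integration.integrable_bound[OF L2_integrable_prod[OF assms(1) test_functions_L2[OF assms(2,3)]]])
  (use assms(1) test_functions_L2[OF assms(2,3)] in \<open>auto simp: norm_mult L2_def intro!: borel_measurable_times\<close>)

lemma weak_pdiff_unique: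
 assumes O: "open W" and g: "g \<in> L2 W" "g' \<in> L2 W" "weak_pdiff W i v g" "weak_pdiff W i v g'"
 shows "AE x in lebesgue_on W. g x = g' x"
proof -
 note OS = open_lebesgue[OF O(1)]
 have "AE x in lebesgue_on W. g x - g' x = 0"
 proof (rule integral_zero_test_imp_AE_zero[OF O L2_diff[OF g(1,2)]])
  fix \<phi> assume \<phi>: "\<phi> \<in> test_functions W"
  have "lint W (\<lambda>x. (g x - g' x) * \<phi> x)
    = lint W (\<lambda>x. g x * \<phi> x) - lint W (\<lambda>x. g' x * \<phi> x)"
   unfolding left_diff_distrib by (intro Bochner_Integration.integral_diff L2_mult_test_integrable g \<phi> OS)
  then show "lint W (\<lambda>x. (g x - g' x) * \<phi> x) = 0"
   using bspec[OF g(3)[unfolded weak_pdiff_def] \<phi>] bspec[OF g(4)[unfolded weak_pdiff_def] \<phi>] by simp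
 qed
 then show ?thesis by eventually_elim simp
qed

lemma H1_wd:
 assumes "v \<in> H1 W"
 shows "v \<in> L2 W" "wd W i v \<in> L2 W" "weak_pdiff W i v (wd W i v)"
proof -
 show "v \<in> L2 W" using assms by (simp add: H1_def)
 have "\<exists>g. g \<in> L2 W \<and> weak_pdiff W i v g" using assms by (auto simp: H1_def)
 from someI_ex[OF this] show "wd W i v \<in> L2 W" "weak_pdiff W i v (wd W i v)"
  unfolding wd_def by auto
qed

lemma H1I:
 assumes "v \<in> L2 W" "\<And>i. g i \<in> L2 W" "\<And>i. weak_pdiff W i v (g i)"
 shows "v \<in> H1 W"
 using assms by (auto simp: H1_def)

text \<open>Uniqueness of weak derivatives lets any choice of them compute the norm, which is defined through \<open>SOME\<close>.\<close>

lemma H1_nrm_eq: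
 assumes O: "open W" and v: "v \<in> L2 W" "\<And>i. g i \<in> L2 W" "\<And>i. weak_pdiff W i v (g i)"
 shows "H1_nrm W v = sqrt ((L2_nrm W v)^2 + (\<Sum>i\<in>UNIV. (L2_nrm W (g i))^2))"
proof -
 have h1: "v \<in> H1 W" using v by (rule H1I)
 have "L2_nrm W (wd W i v) = L2_nrm W (g i)" for i
  by (intro L2_nrm_cong_AE weak_pdiff_unique[OF O _ _ H1_wd(3)[OF h1] v(3)] H1_wd(2)[OF h1] v(2))
 then show ?thesis by (simp add: H1_nrm_def)
qed

lemma weak_pdiff_add:
 assumes "W \<in> sets lebesgue" "u \<in> L2 W" "v \<in> L2 W" "g \<in> L2 W" "g' \<in> L2 W"
  and "weak_pdiff W i u g" "weak_pdiff W i v g'"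
 shows "weak_pdiff W i (\<lambda>x. u x + v x) (\<lambda>x. g x + g' x)"
 unfolding weak_pdiff_def
proof
 fix \<phi> assume \<phi>: "\<phi> \<in> test_functions W"
 note int = L2_mult_test_integrable[OF _ \<phi> assms(1)] L2_mult_test_integrable[OF _ test_functions_pdiff[OF \<phi>] assms(1)]
 show "lint W (\<lambda>x. (u x + v x) * pdiff i \<phi> x)
   = - lint W (\<lambda>x. (g x + g' x) * \<phi> x)"
  unfolding distrib_right using assms \<phi> by (simp add: int weak_pdiff_def)
qed

lemma weak_pdiff_cmult:
 assumes "weak_pdiff W i u g"
 shows "weak_pdiff W i (\<lambda>x. c * u x) (\<lambda>x. c * g x)"
 using assms by (simp add: weak_pdiff_def mult.assoc)

lemma sqrt_sum_triangle:
 fixes a b :: real and f g :: "'i => real"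
 assumes "finite I"
 shows "sqrt ((a + b)^2 + (\<Sum>i\<in>I. (f i + g i)^2)) \<le> sqrt (a\<^sup>2 + (\<Sum>i\<in>I. (f i)^2)) + sqrt (b\<^sup>2 + (\<Sum>i\<in>I. (g i)^2))"
proof -
 let ?F = "case_option a f" and ?G = "case_option b g"
 have eq: "L2_set (case_option c h) (insert None (Some ` I)) = sqrt (c\<^sup>2 + (\<Sum>i\<in>I. (h i)^2))" for c and h :: "'i => real"
  unfolding L2_set_def using assms by (subst sum.insert) (auto simp: sum.reindex)
 have "L2_set (\<lambda>i. ?F i + ?G i) (insert None (Some ` I)) \<le> L2_set ?F (insert None (Some ` I)) + L2_set ?G (insert None (Some ` I))"
  by (rule L2_set_triangle_ineq)
 moreover have "(\<lambda>i. ?F i + ?G i) = case_option (a + b) (\<lambda>i. f i + g i)" by (auto split: option.splits)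
 ultimately show ?thesis by (simp add: eq)
qed

lemma H1_add:
 assumes O: "open W" and uv: "u \<in> H1 W" "v \<in> H1 W"
 shows "(\<lambda>x. u x + v x) \<in> H1 W" "H1_nrm W (\<lambda>x. u x + v x) \<le> H1_nrm W u + H1_nrm W v"
proof -
 note OS = open_lebesgue[OF O(1)]
 note w = H1_wd[OF uv(1)] H1_wd[OF uv(2)]
 let ?g = "\<lambda>i x. wd W i u x + wd W i v x"
 have g: "?g i \<in> L2 W" "weak_pdiff W i (\<lambda>x. u x + v x) (?g i)" for i
  using w OS by (auto intro: L2_add weak_pdiff_add)
 show "(\<lambda>x. u x + v x) \<in> H1 W" by (rule H1I[OF L2_add[OF w(1) w(4)] g])
 have "H1_nrm W (\<lambda>x. u x + v x) = sqrt ((L2_nrm W (\<lambda>x. u x + v x))^2 + (\<Sum>i\<in>UNIV. (L2_nrm W (?g i))^2))"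
  by (rule H1_nrm_eq[OF O L2_add[OF w(1) w(4)] g])
 also have "... \<le> sqrt ((L2_nrm W u + L2_nrm W v)^2 + (\<Sum>i\<in>UNIV. (L2_nrm W (wd W i u) + L2_nrm W (wd W i v))^2))"
  using w by (intro real_sqrt_le_mono add_mono sum_mono power_mono L2_nrm_triangle L2_nrm_nonneg)
 also have "... \<le> H1_nrm W u + H1_nrm W v"
  unfolding H1_nrm_def by (rule sqrt_sum_triangle) simp
 finally show "H1_nrm W (\<lambda>x. u x + v x) \<le> H1_nrm W u + H1_nrm W v" .
qed

lemma H1_cmult:
 assumes O: "open W" and u: "u \<in> H1 W"
 shows "(\<lambda>x. c * u x) \<in> H1 W" "H1_nrm W (\<lambda>x. c * u x) = cmod c * H1_nrm W u"
proof -
 note w = H1_wd[OF u]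
 have g: "(\<lambda>x. c * wd W i u x) \<in> L2 W" "weak_pdiff W i (\<lambda>x. c * u x) (\<lambda>x. c * wd W i u x)" for i
  using w by (auto intro: L2_cmult weak_pdiff_cmult)
 show "(\<lambda>x. c * u x) \<in> H1 W" by (rule H1I[OF L2_cmult[OF w(1)] g])
 have "H1_nrm W (\<lambda>x. c * u x) = sqrt ((cmod c)^2 * ((L2_nrm W u)^2 + (\<Sum>i\<in>UNIV. (L2_nrm W (wd W i u))^2)))"
  unfolding H1_nrm_eq[OF O L2_cmult[OF w(1)] g]
  by (simp add: L2_nrm_cmult power_mult_distrib sum_distrib_left distrib_left)
 then show "H1_nrm W (\<lambda>x. c * u x) = cmod c * H1_nrm W u"
  unfolding H1_nrm_def by (simp add: real_sqrt_mult)
qed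

lemma H1_nrm_nonneg: "0 \<le> H1_nrm W v"
 unfolding H1_nrm_def by (intro real_sqrt_ge_zero add_nonneg_nonneg sum_nonneg) auto

lemma L2_nrm_le_H1_nrm: "L2_nrm W v \<le> H1_nrm W v"
 unfolding H1_nrm_def by (rule real_le_rsqrt) (simp add: sum_nonneg)

lemma test_functions_H1:
 assumes "open W" "\<phi> \<in> test_functions W"
 shows "\<phi> \<in> H1 W"
  "H1_nrm W \<phi> = sqrt ((L2_nrm W \<phi>)^2 + (\<Sum>i\<in>UNIV. (L2_nrm W (pdiff i \<phi>))^2))"
proof -
 note OS = open_lebesgue[OF assms(1)]
 note f = test_functions_L2[OF assms(2) OS] test_functions_L2[OF test_functions_pdiff[OF assms(2)] OS]
  weak_pdiff_test[OF OS assms(2)]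
 show "\<phi> \<in> H1 W" by (rule H1I[OF f])
 show "H1_nrm W \<phi> = sqrt ((L2_nrm W \<phi>)^2 + (\<Sum>i\<in>UNIV. (L2_nrm W (pdiff i \<phi>))^2))"
  by (rule H1_nrm_eq[OF assms(1) f])
qed

lemma H1_nrm_zero: "open W ==> H1_nrm W (\<lambda>x. 0) = 0"
 using H1_cmult(2)[of W "\<lambda>x. 0" 0] test_functions_H1(1)[of W, OF _ test_functions_zero] by simp

lemma H10_H1: "v \<in> H10 W ==> v \<in> H1 W"
 by (simp add: H10_def)

lemma H10_L2: "v \<in> H10 W ==> v \<in> L2 W"
 by (simp add: H10_def H1_def)

lemma test_functions_H10: "open W ==> \<phi> \<in> test_functions W ==> \<phi> \<in> H10 W"
 unfolding H10_def by (auto simp: test_functions_H1 H1_nrm_zero intro!: exI[of _ "\<lambda>m. \<phi>"])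

lemma H1_diff:
 assumes "open W" "u \<in> H1 W" "v \<in> H1 W"
 shows "(\<lambda>x. u x - v x) \<in> H1 W"
 using H1_add(1)[OF assms(1,2) H1_cmult(1)[OF assms(1,3), of "-1"]] by simp

lemma H10_add:
 assumes O: "open W" and uv: "u \<in> H10 W" "v \<in> H10 W"
 shows "(\<lambda>x. u x + v x) \<in> H10 W"
proof -
 obtain p where p: "\<forall>m::nat. p m \<in> test_functions W" "(\<lambda>m. H1_nrm W (\<lambda>x. u x - p m x)) ----> 0"
  using uv(1) by (auto simp: H10_def)
 obtain q where q: "\<forall>m::nat. q m \<in> test_functions W" "(\<lambda>m. H1_nrm W (\<lambda>x. v x - q m x)) ----> 0"
  using uv(2) by (auto simp: H10_def)
 have H: "u \<in> H1 W" "v \<in> H1 W" using uv by (auto intro: H10_H1)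
 have pq: "p m \<in> H1 W" "q m \<in> H1 W" for m using p q test_functions_H1(1)[OF O] by auto
 have le: "norm (H1_nrm W (\<lambda>x. u x + v x - (p m x + q m x))) \<le> H1_nrm W (\<lambda>x. u x - p m x) + H1_nrm W (\<lambda>x. v x - q m x)" for m
  using H1_add(2)[OF O H1_diff[OF O H(1) pq(1)[of m]] H1_diff[OF O H(2) pq(2)[of m]]]
  by (simp add: algebra_simps H1_nrm_nonneg)
 have lim: "(\<lambda>m. H1_nrm W (\<lambda>x. u x - p m x) + H1_nrm W (\<lambda>x. v x - q m x)) ----> 0"
  using tendsto_add[OF p(2) q(2)] by simp
 have "(\<lambda>m. H1_nrm W (\<lambda>x. u x + v x - (p m x + q m x))) ----> 0"
  by (rule Lim_null_comparison[OF always_eventually lim]) (rule allI, rule le)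
 moreover have "\<forall>m. (\<lambda>x. p m x + q m x) \<in> test_functions W" using p q by (auto intro: test_functions_add)
 ultimately show ?thesis using H1_add(1)[OF O H] unfolding H10_def by (intro CollectI conjI exI[of _ "\<lambda>m x. p m x + q m x"])
qed

lemma H10_cmult:
 assumes O: "open W" and u: "u \<in> H10 W"
 shows "(\<lambda>x. c * u x) \<in> H10 W"
proof -
 obtain p where p: "\<forall>m::nat. p m \<in> test_functions W" "(\<lambda>m. H1_nrm W (\<lambda>x. u x - p m x)) ----> 0"
  using u by (auto simp: H10_def)
 have "H1_nrm W (\<lambda>x. c * u x - c * p m x) = cmod c * H1_nrm W (\<lambda>x. u x - p m x)" for m
  using H1_cmult(2)[OF O H1_diff[OF O H10_H1[OF u] test_functions_H1(1)[OF O]], of "p m" c] p(1)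
  by (simp add: right_diff_distrib)
 moreover have "(\<lambda>m. cmod c * H1_nrm W (\<lambda>x. u x - p m x)) ----> cmod c * 0"
  by (intro tendsto_mult tendsto_const p)
 ultimately have "(\<lambda>m. H1_nrm W (\<lambda>x. c * u x - c * p m x)) ----> 0" by simp
 moreover have "\<forall>m. (\<lambda>x. c * p m x) \<in> test_functions W" using p by (auto intro: test_functions_cmult)
 ultimately show ?thesis using H1_cmult(1)[OF O H10_H1[OF u]] unfolding H10_def
  by (intro CollectI conjI exI[of _ "\<lambda>m x. c * p m x"])
qed

lemma H10_diff:
 assumes "open W" "u \<in> H10 W" "v \<in> H10 W"
 shows "(\<lambda>x. u x - v x) \<in> H10 W"
 using H10_add[OF assms(1,2) H10_cmult[OF assms(1,3), of "-1"]] by simp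

lemma H10_zero: "open W ==> (\<lambda>x. 0) \<in> H10 W"
 by (rule test_functions_H10[OF _ test_functions_zero])

lemma H10_sum:
 assumes "open W" "\<And>i. i \<in> I ==> u i \<in> H10 W"
 shows "(\<lambda>x. \<Sum>i\<in>I. c i * u i x) \<in> H10 W"
 using assms(2)
proof (induction I rule: infinite_finite_induct)
 case (insert i I)
 have "(\<lambda>x. c i * u i x + (\<Sum>i\<in>I. c i * u i x)) \<in> H10 W"
  using insert by (intro H10_add[OF assms(1)] H10_cmult[OF assms(1)]) auto
 with insert show ?case by simp
qed (simp_all add: H10_zero assms(1))

lemma L2_nrm_translate:
 fixes u :: "real^'n => complex"
 assumes "continuous_on UNIV u"
 shows "L2_nrm UNIV (\<lambda>x. u (x + h)) = L2_nrm UNIV u"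
proof -
 have "continuous_on UNIV (\<lambda>x. complex_of_real ((cmod (u x))^2))"
  using assms by (intro continuous_intros)
 from integral_lebesgue_translate[OF this, of h] show ?thesis
  by (simp add: L2_nrm_def lebesgue_on_UNIV_eq del: of_real_power)
qed

lemma L2_nrm_sum_le:
 assumes "\<And>i. i \<in> I ==> u i \<in> L2 W"
 shows "L2_nrm W (\<lambda>x. \<Sum>i\<in>I. u i x) \<le> (\<Sum>i\<in>I. L2_nrm W (u i))"
 using assms
proof (induction I rule: infinite_finite_induct)
 case (insert i I)
 have "L2_nrm W (\<lambda>x. u i x + (\<Sum>i\<in>I. u i x)) \<le> L2_nrm W (u i) + L2_nrm W (\<lambda>x. \<Sum>i\<in>I. u i x)"
  using insert by (intro L2_nrm_triangle L2_sum) auto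
 with insert show ?case by simp
qed (simp_all add: L2_nrm_zero)

lemma test_functions_translate_L2:
 fixes \<phi> :: "real^'n => complex"
 assumes "\<phi> \<in> test_functions W"
 shows "(\<lambda>x. \<phi> (x + k)) \<in> L2 UNIV"
proof -
 have cont: "continuous_on UNIV \<phi>" by (rule test_functionsD(2)[OF assms])
 obtain R where R: "\<And>x. R < norm x ==> \<phi> x = 0" using test_functionsD(4)[OF assms] by blast
 obtain B where B: "\<And>x. cmod (\<phi> x) \<le> B" using test_functions_bounded[OF assms] by blast
 show ?thesis
 proof (rule L2_bounded_support[OF _ B])
  show "(\<lambda>x. \<phi> (x + k)) \<in> borel_measurable lebesgue"
   by (intro continuous_on_UNIV_lebesgue_measurable continuous_on_compose2[OF cont] continuous_intros) auto
  fix x :: "real^'n" assume "R + norm k < norm x"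
  moreover have "norm x \<le> norm (x + k) + norm k" using norm_triangle_ineq4[of "x + k" k] by simp
  ultimately show "\<phi> (x + k) = 0" by (intro R) linarith
 qed simp
qed

text \<open>A translation by \<open>h\<close> is composed of \<open>n\<close> translations by \<open>h / n\<close>, so its effect is bounded by the
norm of a difference quotient, which tends to that of the directional derivative.\<close>

lemma test_functions_translation_estimate:
 fixes \<phi> :: "real^'n => complex"
 assumes "\<phi> \<in> test_functions W"
 shows "L2_nrm UNIV (\<lambda>x. \<phi> (x + h) - \<phi> x) \<le> norm h * sqrt (\<Sum>i\<in>UNIV. (L2_nrm UNIV (pdiff i \<phi>))^2)"
proof -
 have cont: "continuous_on UNIV \<phi>" by (rule test_functionsD(2)[OF assms])
 obtain K where K: "\<And>x y. cmod (\<phi> x - \<phi> y) \<le> K * norm (x - y)" using test_functions_lipschitz[OF assms] by blast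
 obtain R where R: "\<And>x. R < norm x ==> \<phi> x = 0" using test_functionsD(4)[OF assms] by blast
 note tL2 = test_functions_translate_L2[OF assms]
 define D where "D x = (\<Sum>i\<in>UNIV. h $ i *\<^sub>R pdiff i \<phi> x)" for x
 define K2 where "K2 x = (K * norm h)^2 * indicator (cball 0 (R + norm h)) x" for x :: "real^'n"
 have dm: "diff_quot \<phi> h n \<in> borel_measurable lebesgue" for n
  by (rule continuous_on_UNIV_lebesgue_measurable[OF diff_quot_continuous[OF cont]])
 have pc: "continuous_on UNIV (pdiff i \<phi>)" for i by (rule test_functionsD(2)[OF test_functions_pdiff[OF assms]])
 have Dm: "D \<in> borel_measurable lebesgue"
  unfolding D_def by (intro continuous_on_UNIV_lebesgue_measurable continuous_intros pc)
 have bound: "norm ((cmod (diff_quot \<phi> h n x))^2) \<le> K2 x" for n x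
 proof -
  have "(cmod (diff_quot \<phi> h n x))^2 \<le> (K * norm h * indicator (cball 0 (R + norm h)) x)^2"
   by (intro power_mono diff_quot_bound K R) auto
  then show ?thesis by (cases "norm x \<le> R + norm h") (simp_all add: K2_def)
 qed
 have lim: "(\<lambda>n. (cmod (diff_quot \<phi> h n x))^2) ----> (cmod (D x))^2" for x
  unfolding D_def
  by (intro tendsto_power tendsto_norm diff_quot_limit directional_derivative test_functionsD(3)[OF assms])
 have "(\<lambda>n. integral\<^sup>L lebesgue (\<lambda>x. (cmod (diff_quot \<phi> h n x))^2)) ----> integral\<^sup>L lebesgue (\<lambda>x. (cmod (D x))^2)"
 proof (rule integral_dominated_convergence[where w = K2])
  show "integrable lebesgue K2" unfolding K2_def by (rule indicator_cball_integrable)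
 qed (use dm Dm lim bound in auto)
 then have "(\<lambda>n. L2_nrm UNIV (diff_quot \<phi> h n)) ----> L2_nrm UNIV D"
  unfolding L2_nrm_def lebesgue_on_UNIV_eq by (intro tendsto_real_sqrt)
 moreover have "L2_nrm UNIV (\<lambda>x. \<phi> (x + h) - \<phi> x) \<le> L2_nrm UNIV (diff_quot \<phi> h n)" for n
 proof -
  let ?k = "inverse (real (Suc n)) *\<^sub>R h"
  have k: "real (Suc n) *\<^sub>R ?k = h" by simp
  have "(\<Sum>j<Suc n. \<phi> (x + real (Suc j) *\<^sub>R ?k) - \<phi> (x + real j *\<^sub>R ?k)) = \<phi> (x + h) - \<phi> x" for x
   by (subst sum_lessThan_telescope) (simp only: k, simp)
  then have "L2_nrm UNIV (\<lambda>x. \<phi> (x + h) - \<phi> x)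
    = L2_nrm UNIV (\<lambda>x. \<Sum>j<Suc n. \<phi> (x + real (Suc j) *\<^sub>R ?k) - \<phi> (x + real j *\<^sub>R ?k))" by (simp only:)
  also have "... \<le> (\<Sum>j<Suc n. L2_nrm UNIV (\<lambda>x. \<phi> (x + real (Suc j) *\<^sub>R ?k) - \<phi> (x + real j *\<^sub>R ?k)))"
   by (intro L2_nrm_sum_le L2_diff tL2)
  also have "... = (\<Sum>j<Suc n. L2_nrm UNIV (\<lambda>x. \<phi> (x + ?k) - \<phi> x))"
  proof (intro sum.cong refl)
   fix j
   have "continuous_on UNIV (\<lambda>x. \<phi> (x + ?k) - \<phi> x)"
    by (intro continuous_intros continuous_on_compose2[OF cont]) auto
   from L2_nrm_translate[OF this, of "real j *\<^sub>R ?k"]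
   show "L2_nrm UNIV (\<lambda>x. \<phi> (x + real (Suc j) *\<^sub>R ?k) - \<phi> (x + real j *\<^sub>R ?k)) = L2_nrm UNIV (\<lambda>x. \<phi> (x + ?k) - \<phi> x)"
    by (simp add: algebra_simps)
  qed
  also have "... = L2_nrm UNIV (\<lambda>x. of_real (real (Suc n)) * (\<phi> (x + ?k) - \<phi> x))"
   by (simp add: L2_nrm_cmult del: of_nat_Suc)
  finally show ?thesis by (simp only: diff_quot_def[abs_def])
 qed
 ultimately have le: "L2_nrm UNIV (\<lambda>x. \<phi> (x + h) - \<phi> x) \<le> L2_nrm UNIV D"
  by (intro LIMSEQ_le_const) auto
 have pL2: "pdiff i \<phi> \<in> L2 UNIV" for i
  by (rule test_functions_L2[OF test_functions_pdiff[OF assms]]) simp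
 have "(L2_nrm UNIV D)^2 \<le> lint UNIV (\<lambda>x. (norm h)^2 * (\<Sum>i\<in>UNIV. (cmod (pdiff i \<phi> x))^2))"
  unfolding L2_nrm_square
 proof (rule integral_mono)
  show "integrable (lebesgue_on UNIV) (\<lambda>x. (cmod (D x))^2)"
   unfolding D_def scaleR_conv_of_real by (intro L2_integrable_square L2_sum L2_cmult pL2)
  show "integrable (lebesgue_on UNIV) (\<lambda>x. (norm h)^2 * (\<Sum>i\<in>UNIV. (cmod (pdiff i \<phi> x))^2))"
   by (intro integrable_mult_right Bochner_Integration.integrable_sum L2_integrable_square pL2)
  fix x
  have "cmod (D x) \<le> (\<Sum>i\<in>UNIV. \<bar>h $ i\<bar> * \<bar>cmod (pdiff i \<phi> x)\<bar>)"
   unfolding D_def by (rule sum_norm_le) simp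
  also have "... \<le> L2_set (\<lambda>i. h $ i) UNIV * L2_set (\<lambda>i. cmod (pdiff i \<phi> x)) UNIV"
   by (rule L2_set_mult_ineq)
  finally have "(cmod (D x))^2 \<le> (L2_set (\<lambda>i. h $ i) UNIV * L2_set (\<lambda>i. cmod (pdiff i \<phi> x)) UNIV)^2"
   by (rule power_mono) simp
  also have "L2_set (\<lambda>i. h $ i) UNIV = norm h" by (simp add: norm_vec_def L2_set_def)
  finally show "(cmod (D x))^2 \<le> (norm h)^2 * (\<Sum>i\<in>UNIV. (cmod (pdiff i \<phi> x))^2)"
   by (simp add: power_mult_distrib L2_set_def sum_nonneg)
 qed
 also have "... = (norm h)^2 * (\<Sum>i\<in>UNIV. (L2_nrm UNIV (pdiff i \<phi>))^2)"
  unfolding L2_nrm_square by (simp add: Bochner_Integration.integral_sum L2_integrable_square[OF pL2])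
 finally have "sqrt ((L2_nrm UNIV D)^2) \<le> sqrt ((norm h)^2 * (\<Sum>i\<in>UNIV. (L2_nrm UNIV (pdiff i \<phi>))^2))"
  by (rule real_sqrt_le_mono)
 then have "L2_nrm UNIV D \<le> norm h * sqrt (\<Sum>i\<in>UNIV. (L2_nrm UNIV (pdiff i \<phi>))^2)"
  by (simp add: real_sqrt_mult L2_nrm_nonneg)
 with le show ?thesis by linarith
qed

section \<open>Barycentric coordinates and piecewise linear interpolation\<close>

definition verts :: "(real^'n) set => (real^'n) set" where
 "verts K = {v. v extreme_point_of K}"

lemma simplex_verts:
 fixes K :: "(real^'n) set"
 assumes "n simplex K"
 shows "finite (verts K)" "K = convex hull (verts K)" "\<not> affine_dependent (verts K)" "int (card (verts K)) = n + 1"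
proof -
 obtain C where C: "\<not> affine_dependent C" "int (card C) = n + 1" "K = convex hull C"
  using assms by (auto simp: simplex_def)
 then have "verts K = C"
  by (auto simp: verts_def extreme_point_of_convex_hull_affine_independent)
 with C show "finite (verts K)" "K = convex hull (verts K)" "\<not> affine_dependent (verts K)" "int (card (verts K)) = n + 1"
  using aff_independent_finite by auto
qed

text \<open>\<open>u\<close> are the barycentric coordinates of \<open>x\<close> in \<open>K\<close>. They are extended by 0 to all points, so that the coordinates
with respect to different simplices can be compared.\<close>

definition bary :: "(real^'n) set => real^'n => (real^'n => real) => bool" where
 "bary K x u \<longleftrightarrow> (\<forall>v\<in>verts K. 0 \<le> u v) \<and> (\<forall>v. v \<notin> verts K --> u v = 0)
  \<and> sum u (verts K) = 1 \<and> (\<Sum>v\<in>verts K. u v *\<^sub>R v) = x"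

lemma bary_exists:
 assumes "n simplex K" "D \<subseteq> verts K" "x \<in> convex hull D"
 shows "\<exists>u. bary K x u \<and> (\<forall>v. v \<notin> D --> u v = 0)"
proof -
 note K = simplex_verts[OF assms(1)]
 have fD: "finite D" using K(1) assms(2) finite_subset by blast
 obtain w where w: "\<forall>v\<in>D. 0 \<le> w v" "sum w D = 1" "(\<Sum>v\<in>D. w v *\<^sub>R v) = x"
  using assms(3) unfolding convex_hull_finite[OF fD] by auto
 define u where "u v = (if v \<in> D then w v else 0)" for v
 have "sum u (verts K) = sum u D"
  by (rule sum.mono_neutral_right[OF K(1) assms(2)]) (simp add: u_def)
 moreover have "(\<Sum>v\<in>verts K. u v *\<^sub>R v) = (\<Sum>v\<in>D. u v *\<^sub>R v)"
  by (rule sum.mono_neutral_right[OF K(1) assms(2)]) (simp add: u_def)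
 moreover have "sum u D = sum w D" "(\<Sum>v\<in>D. u v *\<^sub>R v) = (\<Sum>v\<in>D. w v *\<^sub>R v)"
  by (auto intro!: sum.cong simp: u_def)
 ultimately have "bary K x u" using w assms(2) by (auto simp: bary_def u_def)
 then show ?thesis by (auto simp: u_def)
qed

lemma bary_unique_simplex:
 assumes "n simplex K" "bary K x u" "bary K x w"
 shows "u = w"
proof (rule ccontr)
 note K = simplex_verts[OF assms(1)]
 assume "u ~= w"
 then obtain v where "u v ~= w v" by blast
 moreover have "v \<in> verts K"
 proof (rule ccontr)
  assume "v \<notin> verts K"
  then have "u v = 0" "w v = 0" using assms(2,3) by (simp_all add: bary_def)
  with \<open>u v ~= w v\<close> show False by simp
 qed
 moreover have "sum (\<lambda>v. u v - w v) (verts K) = 0" using assms by (simp add: bary_def sum_subtractf)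
 moreover have "(\<Sum>v\<in>verts K. (u v - w v) *\<^sub>R v) = 0"
  using assms by (simp add: bary_def scaleR_diff_left sum_subtractf)
 ultimately have "affine_dependent (verts K)"
  unfolding affine_dependent_explicit_finite[OF K(1)]
  by (intro exI[of _ "\<lambda>v. u v - w v"]) auto
 with K(3) show False by simp
qed

lemma face_of_simplex_verts:
 assumes "n simplex K" "F face_of K"
 shows "verts F \<subseteq> verts K" "F = convex hull (verts F)"
proof -
 note K = simplex_verts[OF assms(1)]
 show "verts F \<subseteq> verts K"
  using assms(2) extreme_point_of_face unfolding verts_def by blast
 have "compact F" "convex F"
  using face_of_imp_compact[OF convex_simplex[OF assms(1)] compact_simplex[OF assms(1)] assms(2)]
   face_of_imp_convex[OF assms(2)] by auto
 then show "F = convex hull (verts F)"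
  unfolding verts_def by (rule Krein_Milman_Minkowski)
qed

lemma triangulationD:
 assumes "triangulation \<T>"
 shows "finite \<T>" "K \<in> \<T> ==> \<exists>n. n simplex K" "K \<in> \<T> ==> K' \<in> \<T> ==> (K \<inter> K') face_of K"
 using assms by (auto simp: triangulation_def)

text \<open>A point of two simplices lies in their common face, and its coordinates there extend to both.\<close>

lemma bary_unique:
 assumes T: "triangulation \<T>" and K: "K \<in> \<T>" "K' \<in> \<T>" and u: "bary K x u" "bary K' x u'"
 shows "u = u'"
proof -
 obtain n n' where n: "n simplex K" "n' simplex K'" using triangulationD(2)[OF T] K by blast
 define F where "F = K \<inter> K'"
 have F: "F face_of K" "F face_of K'"
  using triangulationD(3)[OF T K] triangulationD(3)[OF T K(2) K(1)] by (auto simp: F_def Int_commute)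
 have mem: "x \<in> L" if "n simplex L" "bary L x u" for L n u
 proof -
  have "x \<in> convex hull (verts L)"
   unfolding convex_hull_finite[OF simplex_verts(1)[OF that(1)]] using that(2) by (auto simp: bary_def)
  then show ?thesis using simplex_verts(2)[OF that(1)] by simp
 qed
 have "x \<in> F" using mem n u by (auto simp: F_def)
 then have xF: "x \<in> convex hull (verts F)" using face_of_simplex_verts(2)[OF n(1) F(1)] by simp
 obtain w where w: "bary K x w" "\<forall>v. v \<notin> verts F --> w v = 0"
  using bary_exists[OF n(1) face_of_simplex_verts(1)[OF n(1) F(1)] xF] by blast
 obtain w' where w': "bary K' x w'" "\<forall>v. v \<notin> verts F --> w' v = 0"
  using bary_exists[OF n(2) face_of_simplex_verts(1)[OF n(2) F(2)] xF] by blast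
 have sub: "verts F \<subseteq> verts K" "verts F \<subseteq> verts K'"
  using face_of_simplex_verts(1) n F by auto
 have "sum w' (verts K) = sum w' (verts F)" "(\<Sum>v\<in>verts K. w' v *\<^sub>R v) = (\<Sum>v\<in>verts F. w' v *\<^sub>R v)"
  using sub w' simplex_verts(1)[OF n(1)] by (auto intro!: sum.mono_neutral_right)
 moreover have "sum w' (verts K') = sum w' (verts F)" "(\<Sum>v\<in>verts K'. w' v *\<^sub>R v) = (\<Sum>v\<in>verts F. w' v *\<^sub>R v)"
  using sub w' simplex_verts(1)[OF n(2)] by (auto intro!: sum.mono_neutral_right)
 moreover have "\<forall>v\<in>verts K. 0 \<le> w' v"
 proof
  fix v assume "v \<in> verts K"
  show "0 \<le> w' v"
   using w' sub by (cases "v \<in> verts F") (auto simp: bary_def)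
 qed
 moreover have "\<forall>v. v \<notin> verts K --> w' v = 0" using w'(2) sub(1) by blast
 ultimately have "bary K x w'" using w'(1) by (simp add: bary_def)
 then have "w = w'" using bary_unique_simplex[OF n(1) w(1)] by blast
 then show ?thesis
  using bary_unique_simplex[OF n(1) u(1) w(1)] bary_unique_simplex[OF n(2) u(2) w'(1)] by simp
qed

text \<open>\<open>hat T x p\<close> is the value at \<open>x\<close> of the nodal basis function of \<open>p\<close>; the choice of the simplex is immaterial by
\<open>bary_unique\<close>.\<close>

definition hat :: "(real^'n) set set => real^'n => real^'n => real" where
 "hat \<T> x = (if x \<in> \<Union>\<T> then SOME u. \<exists>K\<in>\<T>. bary K x u else (\<lambda>p. 0))"

lemma hat_bary:
 assumes "triangulation \<T>" "K \<in> \<T>" "x \<in> K"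
 shows "bary K x (hat \<T> x)"
proof -
 obtain n where n: "n simplex K" using triangulationD(2)[OF assms(1,2)] by blast
 have "x \<in> convex hull (verts K)" using assms(3) simplex_verts(2)[OF n] by simp
 then obtain u where u: "bary K x u" using bary_exists[OF n subset_refl] by blast
 then have ex: "\<exists>u. \<exists>K\<in>\<T>. bary K x u" using assms by blast
 have "x \<in> \<Union>\<T>" using assms by blast
 then have "\<exists>K\<in>\<T>. bary K x (hat \<T> x)"
  unfolding hat_def using someI_ex[OF ex] by simp
 then obtain K' where "K' \<in> \<T>" "bary K' x (hat \<T> x)" by blast
 then have "u = hat \<T> x" using bary_unique[OF assms(1,2) _ u] by blast
 then show ?thesis using u by simp
qed

lemma simplex_coordinate_affine:
 fixes K :: "(real^'n) set"
 assumes "n simplex K" "p \<in> verts K"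
 shows "\<exists>c l. linear l \<and> (\<forall>x u. bary K x u --> u p = c + (l x :: real))"
proof -
 note K = simplex_verts[OF assms(1)]
 define B where "B = (\<lambda>x. - p + x) ` (verts K - {p})"
 have "independent B" unfolding B_def using K(3) affine_dependent_iff_dependent2[OF assms(2)] by blast
 then obtain g where g: "linear g" "\<forall>x\<in>B. g x = (1 :: real)"
  using linear_independent_extend[of B "\<lambda>_. 1"] by blast
 have gv: "g (v - p) = (if v = p then 0 else 1)" if "v \<in> verts K" for v
  using that g linear_0[OF g(1)] by (auto simp: B_def)
 have "u p = 1 + (- g p * - 1 - g x)" if "bary K x u" for x u
 proof -
  have "x - p = (\<Sum>v\<in>verts K. u v *\<^sub>R v) - (\<Sum>v\<in>verts K. u v) *\<^sub>R p" using that by (simp add: bary_def)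
  also have "... = (\<Sum>v\<in>verts K. u v *\<^sub>R (v - p))"
   by (simp add: scaleR_diff_right sum_subtractf scaleR_sum_left)
  finally have "g (x - p) = (\<Sum>v\<in>verts K. u v * g (v - p))"
   by (simp add: linear_sum[OF g(1)] linear_cmul[OF g(1)])
  also have "... = (\<Sum>v\<in>verts K. u v - (if v = p then u v else 0))"
   by (intro sum.cong) (auto simp: gv)
  also have "... = 1 - u p"
   using that K(1) assms(2) by (simp add: bary_def sum_subtractf)
  finally show ?thesis by (simp add: linear_diff[OF g(1)])
 qed
 moreover have "linear (\<lambda>x. - g x)" using g(1) by (rule linear_compose_neg)
 ultimately show ?thesis by (intro exI[of _ "1 + g p"] exI[of _ "\<lambda>x. - g x"]) (auto simp: add_diff_eq)
qed

text \<open>The piecewise affine function with nodal values \<open>m\<close>, and 0 off the mesh.\<close>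

definition interp :: "(real^'n) set set => (real^'n => complex) => real^'n => complex" where
 "interp \<T> m x = (\<Sum>p\<in>(\<Union>K\<in>\<T>. verts K). m p * of_real (hat \<T> x p))"

lemma finite_all_verts: "triangulation \<T> ==> finite (\<Union>K\<in>\<T>. verts K)"
 using triangulationD(1,2) simplex_verts(1) by blast

lemma interp_on_simplex:
 assumes "triangulation \<T>" "K \<in> \<T>" "x \<in> K"
 shows "interp \<T> m x = (\<Sum>p\<in>verts K. m p * of_real (hat \<T> x p))"
 unfolding interp_def using hat_bary[OF assms] assms
 by (intro sum.mono_neutral_right finite_all_verts) (auto simp: bary_def)

lemma interp_outside: "x \<notin> \<Union>\<T> ==> interp \<T> m x = 0"
 by (simp add: interp_def hat_def)

lemma linear_of_real_mult:
 assumes "linear (l :: real^'n => real)"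
 shows "linear (\<lambda>x. (c :: complex) * of_real (l x))"
proof (rule linearI)
 show "c * of_real (l (x + y)) = c * of_real (l x) + c * of_real (l y)" for x y
  by (simp add: linear_add[OF assms] distrib_left)
 show "c * of_real (l (r *\<^sub>R x)) = r *\<^sub>R (c * of_real (l x))" for r x
  unfolding linear_cmul[OF assms] by (simp add: scaleR_conv_of_real)
qed

lemma interp_affine:
 assumes "triangulation \<T>" "K \<in> \<T>"
 shows "\<exists>c l. linear l \<and> (\<forall>x\<in>K. interp \<T> m x = c + (l x :: complex))"
proof -
 obtain n where n: "n simplex K" using triangulationD(2)[OF assms] by blast
 have "\<forall>p\<in>verts K. \<exists>cl. linear (snd cl) \<and> (\<forall>x u. bary K x u --> u p = fst cl + (snd cl x :: real))"
  using simplex_coordinate_affine[OF n] by simp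
 from bchoice[OF this] obtain f where
  f: "\<forall>p\<in>verts K. linear (snd (f p)) \<and> (\<forall>x u. bary K x u --> u p = fst (f p) + snd (f p) x)" ..
 define l where "l x = (\<Sum>p\<in>verts K. m p * of_real (snd (f p) x))" for x
 define c where "c = (\<Sum>p\<in>verts K. m p * of_real (fst (f p)))"
 have "linear l" unfolding l_def using f by (intro linear_compose_sum ballI linear_of_real_mult) auto
 moreover have "interp \<T> m x = c + l x" if "x \<in> K" for x
 proof -
  have "interp \<T> m x = (\<Sum>p\<in>verts K. m p * of_real (fst (f p) + snd (f p) x))"
   unfolding interp_on_simplex[OF assms that]
   using f hat_bary[OF assms that] by (intro sum.cong) auto
  then show ?thesis by (simp add: c_def l_def distrib_left sum.distrib)
 qed
 ultimately show ?thesis by blast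
qed

lemma affine_eq_interp:
 fixes v :: "real^'n => complex"
 assumes "triangulation \<T>" "K \<in> \<T>" "x \<in> K" "linear l" "\<And>y. y \<in> K ==> v y = c + l y"
 shows "v x = interp \<T> v x"
proof -
 obtain n where n: "n simplex K" using triangulationD(2)[OF assms(1,2)] by blast
 note b = hat_bary[OF assms(1-3), unfolded bary_def]
 have vK: "p \<in> K" if "p \<in> verts K" for p using that by (simp add: verts_def extreme_point_of_def)
 have "interp \<T> v x = (\<Sum>p\<in>verts K. (c + l p) * of_real (hat \<T> x p))"
  unfolding interp_on_simplex[OF assms(1-3)] using assms(5) vK by (intro sum.cong) auto
 also have "... = c * of_real (\<Sum>p\<in>verts K. hat \<T> x p) + (\<Sum>p\<in>verts K. l p * of_real (hat \<T> x p))"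
  by (simp add: distrib_right sum.distrib sum_distrib_left)
 also have "(\<Sum>p\<in>verts K. l p * of_real (hat \<T> x p)) = l (\<Sum>p\<in>verts K. hat \<T> x p *\<^sub>R p)"
  unfolding linear_sum[OF assms(4)]
 proof (intro sum.cong refl)
  show "l p * of_real (hat \<T> x p) = l (hat \<T> x p *\<^sub>R p)" for p
   unfolding linear_cmul[OF assms(4)] by (simp add: scaleR_conv_of_real mult.commute)
 qed
 also have "(\<Sum>p\<in>verts K. hat \<T> x p) = 1" using b by blast
 also have "(\<Sum>p\<in>verts K. hat \<T> x p *\<^sub>R p) = x" using b by blast
 finally show ?thesis using assms(3,5) by simp
qed

lemma triangulation_interior_disjoint:
 assumes T: "triangulation \<T>" "K \<in> \<T>" "K' \<in> \<T>" and x: "x \<in> interior K" "x \<in> interior K'"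
 shows "K = K'"
proof -
 have sub: "L \<subseteq> L'" if "L \<in> \<T>" "L' \<in> \<T>" "x \<in> interior L" "x \<in> interior L'" for L L'
 proof -
  have "(L \<inter> L') face_of L" using triangulationD(3)[OF T(1)] that by blast
  moreover have "x \<in> L \<inter> L'" using that interior_subset[of L] interior_subset[of L'] by auto
  moreover have "x \<in> rel_interior L" using that interior_subset_rel_interior[of L] by auto
  ultimately have "L \<subseteq> L \<inter> L'" by (intro subset_of_face_of[of "L \<inter> L'" L L]) auto
  then show ?thesis by blast
 qed
 show ?thesis using sub[OF T(2,3) x] sub[OF T(3,2) x(2,1)] by blast
qed

lemma triangulation_closed_compact:
 assumes "triangulation \<T>" "K \<in> \<T>"
 shows "compact K" "convex K" "closed K" "frontier K \<in> null_sets lebesgue"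
proof -
 obtain n where n: "n simplex K" using triangulationD(2)[OF assms] by blast
 show "compact K" "convex K" "closed K"
  using compact_simplex[OF n] convex_simplex[OF n] closed_simplex[OF n] by auto
 then show "frontier K \<in> null_sets lebesgue"
  using negligible_convex_frontier by (simp add: negligible_iff_null_sets)
qed

lemma AE_not_frontier:
 assumes "triangulation \<T>"
 shows "AE x in lebesgue. \<forall>K\<in>\<T>. x \<notin> frontier K"
 using triangulationD(1)[OF assms] triangulation_closed_compact(4)[OF assms]
 by (intro AE_finite_allI AE_not_in) auto

lemma AE_sum_indicator_triangulation:
 assumes T: "triangulation \<T>"
 shows "AE x in lebesgue. (\<Sum>K\<in>\<T>. indicator K x * f x) = indicator (\<Union>\<T>) x * (f x :: ennreal)"
 using AE_not_frontier[OF T]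
proof eventually_elim
 case (elim x)
 show ?case
 proof (cases "x \<in> \<Union>\<T>")
  case True
  then obtain K where K: "K \<in> \<T>" "x \<in> K" by blast
  have int: "x \<in> interior L" if "L \<in> \<T>" "x \<in> L" for L
   using elim that triangulation_closed_compact(3)[OF T that(1)] by (auto simp: frontier_def)
  have "(\<Sum>L\<in>\<T>. indicator L x * f x) = (\<Sum>L\<in>{K}. indicator L x * f x)"
  proof (rule sum.mono_neutral_right)
   show "\<forall>L\<in>\<T> - {K}. indicator L x * f x = 0"
   proof
    fix L assume L: "L \<in> \<T> - {K}"
    then have "x \<notin> L" using triangulation_interior_disjoint[OF T _ K(1)] int K by blast
    then show "indicator L x * f x = 0" by simp
   qed
  qed (use K triangulationD(1)[OF T] in auto)
  then show ?thesis using K True by simp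
 next
  case False
  then have "(\<Sum>L\<in>\<T>. indicator L x * f x) = 0" by (intro sum.neutral) auto
  with False show ?thesis by simp
 qed
qed

lemma nn_integral_triangulation:
 assumes T: "triangulation \<T>" and f: "f \<in> borel_measurable lebesgue"
 shows "(\<Sum>K\<in>\<T>. \<integral>\<^sup>+x. indicator K x * f x \<partial>lebesgue) = (\<integral>\<^sup>+x. indicator (\<Union>\<T>) x * f x \<partial>lebesgue)"
proof -
 have m: "K \<in> sets lebesgue" if "K \<in> \<T>" for K
  using triangulation_closed_compact(3)[OF T that] by (simp add: borel_closed sets_completionI_sets)
 have "(\<Sum>K\<in>\<T>. \<integral>\<^sup>+x. indicator K x * f x \<partial>lebesgue) = (\<integral>\<^sup>+x. (\<Sum>K\<in>\<T>. indicator K x * f x) \<partial>lebesgue)"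
  using m f by (intro nn_integral_sum[symmetric]) auto
 also have "... = (\<integral>\<^sup>+x. indicator (\<Union>\<T>) x * f x \<partial>lebesgue)"
  using AE_sum_indicator_triangulation[OF T] by (rule nn_integral_cong_AE)
 finally show ?thesis .
qed

section \<open>The inverse inequality on one element\<close>

lemma nn_integral_translate:
 fixes f :: "real^'n => ennreal"
 assumes "f \<in> borel_measurable borel"
 shows "(\<integral>\<^sup>+x. f (x + h) \<partial>lborel) = (\<integral>\<^sup>+x. f x \<partial>lborel)"
proof -
 have "(\<integral>\<^sup>+x. f x \<partial>lborel) = (\<integral>\<^sup>+x. f x \<partial>distr lborel borel ((+) h))" by (simp add: lborel_distr_plus)
 also have "... = (\<integral>\<^sup>+x. f (h + x) \<partial>lborel)" using assms by (subst nn_integral_distr) auto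
 finally show ?thesis by (simp add: add.commute)
qed

definition ball_vol :: "'n itself => real => real" where
 "ball_vol TYPE('n) r = unit_ball_vol (real CARD('n)) * r ^ CARD('n)"

lemma ball_vol_pos: "0 < r ==> 0 < ball_vol TYPE('n::finite) r"
 by (simp add: ball_vol_def unit_ball_vol_pos)

lemma emeasure_cball_vec:
 fixes c :: "real^'n"
 assumes "0 \<le> r"
 shows "emeasure lborel (cball c r) = ennreal (ball_vol TYPE('n) r)"
 using emeasure_cball[OF assms, of c] assms by (simp add: ball_vol_def ennreal_mult' ennreal_power)

lemma ball_vol_scale: "ball_vol TYPE('n::finite) (a * r) = a ^ CARD('n) * ball_vol TYPE('n) r"
 by (simp add: ball_vol_def power_mult_distrib)

text \<open>Comparing the function with its translate by \<open>r / 2\<close> inside the ball bounds the slope by its mean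
square over \<open>K\<close>; the volume of \<open>K\<close> is at most that of a ball of radius \<open>h\<close>.\<close>

lemma affine_inverse_estimate:
 fixes l :: "real^'n => complex" and K :: "(real^'n) set"
 assumes l: "linear l" and K: "closed K" "cball z r \<subseteq> K" "bounded K" "diameter K \<le> h"
  and r: "0 < r" and h: "0 < h" and e: "norm e = 1"
 shows "ennreal ((cmod (l e))^2) * emeasure lborel K
  \<le> ennreal (16 / r\<^sup>2 * (2 * h / r) ^ CARD('n)) * (\<integral>\<^sup>+x. indicator K x * ennreal ((cmod (c + l x))^2) \<partial>lborel)"
proof -
 define A where "A x = c + l x" for x
 have contA: "continuous_on UNIV A" unfolding A_def
  using l by (intro continuous_intros linear_continuous_on linear_conv_bounded_linear[THEN iffD1])
 then have mA: "(\<lambda>x. ennreal ((cmod (A x))^2)) \<in> borel_measurable borel"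
  by (intro measurable_compose[OF _ measurable_ennreal] borel_measurable_continuous_onI continuous_intros)
 define k where "k = (r / 2) *\<^sub>R e"
 have nk: "norm k = r / 2" using r e by (simp add: k_def)
 let ?B = "cball z (r / 2)"
 let ?I = "\<integral>\<^sup>+x. indicator K x * ennreal ((cmod (A x))^2) \<partial>lborel"
 have pt: "(r\<^sup>2 / 4) * (cmod (l e))^2 \<le> 2 * (cmod (A (x + k)))^2 + 2 * (cmod (A x))^2" for x
 proof -
  have "A (x + k) - A x = l k" by (simp add: A_def linear_add[OF l])
  also have "l k = (r / 2) *\<^sub>R l e" by (simp add: k_def linear_cmul[OF l])
  finally have "r / 2 * cmod (l e) \<le> cmod (A (x + k)) + cmod (A x)"
   using r norm_triangle_ineq4[of "A (x + k)" "A x"] by simp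
  then have "(r / 2 * cmod (l e))^2 \<le> (cmod (A (x + k)) + cmod (A x))^2"
   using r by (intro power_mono) auto
  also have "... \<le> 2 * (cmod (A (x + k)))^2 + 2 * (cmod (A x))^2"
   using sum_squares_bound[of "cmod (A (x + k))" "cmod (A x)"] by (simp add: power2_sum)
  finally show ?thesis by (simp add: power_mult_distrib power_divide)
 qed
 have "ennreal ((r\<^sup>2 / 4) * (cmod (l e))^2) * emeasure lborel ?B
   = (\<integral>\<^sup>+x. ennreal ((r\<^sup>2 / 4) * (cmod (l e))^2) * indicator ?B x \<partial>lborel)"
  by (subst nn_integral_cmult_indicator) auto
 also have "... \<le> (\<integral>\<^sup>+x. 2 * (indicator K (x + k) * ennreal ((cmod (A (x + k)))^2))
    + 2 * (indicator K x * ennreal ((cmod (A x))^2)) \<partial>lborel)"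
 proof (rule nn_integral_mono)
  fix x
  show "ennreal ((r\<^sup>2 / 4) * (cmod (l e))^2) * indicator ?B x
    \<le> 2 * (indicator K (x + k) * ennreal ((cmod (A (x + k)))^2)) + 2 * (indicator K x * ennreal ((cmod (A x))^2))"
  proof (cases "x \<in> ?B")
   case True
   have "x \<in> cball z r" using True r by auto
   moreover have "dist z (x + k) \<le> dist z x + norm k"
    using norm_triangle_ineq4[of "z - x" k] by (simp add: dist_norm algebra_simps)
   then have "x + k \<in> cball z r" using True nk by simp
   ultimately have "x \<in> K" "x + k \<in> K" using K(2) by blast+
   then show ?thesis using True ennreal_leI[OF pt[of x]]
    by (simp add: ennreal_plus ennreal_mult')
  qed simp
 qed
 also have "... = 2 * (\<integral>\<^sup>+x. indicator K (x + k) * ennreal ((cmod (A (x + k)))^2) \<partial>lborel) + 2 * ?I"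
 proof -
  have m1: "(\<lambda>x. indicator K x * ennreal ((cmod (A x))^2)) \<in> borel_measurable borel"
   using mA K(1) by (intro borel_measurable_times_ennreal borel_measurable_indicator) auto
  then have m2: "(\<lambda>x. indicator K (x + k) * ennreal ((cmod (A (x + k)))^2)) \<in> borel_measurable borel"
   by (rule measurable_compose[rotated]) auto
  show ?thesis using m1 m2 by (subst nn_integral_add) (auto simp: nn_integral_cmult)
 qed
 also have "(\<integral>\<^sup>+x. indicator K (x + k) * ennreal ((cmod (A (x + k)))^2) \<partial>lborel) = ?I"
  by (rule nn_integral_translate) (use mA K(1) in auto)
 also have "2 * ?I + 2 * ?I = 4 * ?I" by (simp flip: distrib_right)
 finally have 1: "ennreal ((r\<^sup>2 / 4) * (cmod (l e))^2) * ennreal (ball_vol TYPE('n) (r / 2)) \<le> 4 * ?I"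
  using r by (simp add: emeasure_cball_vec)
 have "K \<subseteq> cball z h"
 proof
  fix x assume "x \<in> K"
  moreover have "z \<in> K" using K(2) r by auto
  ultimately have "dist z x \<le> diameter K" using K(3) diameter_bounded_bound by blast
  then show "x \<in> cball z h" using K(4) by simp
 qed
 then have "emeasure lborel K \<le> emeasure lborel (cball z h)" by (rule emeasure_mono) simp
 also have "... = ennreal ((2 * h / r) ^ CARD('n) * ball_vol TYPE('n) (r / 2))"
  using h r ball_vol_scale[of "2 * h / r" "r / 2", where 'n = 'n] by (simp add: emeasure_cball_vec)
 finally have "ennreal ((cmod (l e))^2) * emeasure lborel K
   \<le> ennreal ((cmod (l e))^2) * ennreal ((2 * h / r) ^ CARD('n) * ball_vol TYPE('n) (r / 2))"
  by (rule mult_left_mono) simp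
 also have "... = ennreal (4 / r\<^sup>2 * (2 * h / r) ^ CARD('n))
   * (ennreal ((r\<^sup>2 / 4) * (cmod (l e))^2) * ennreal (ball_vol TYPE('n) (r / 2)))"
  using r h ball_vol_pos[of "r / 2", where 'n = 'n] by (simp add: ennreal_mult'[symmetric] mult_ac)
 also have "... \<le> ennreal (4 / r\<^sup>2 * (2 * h / r) ^ CARD('n)) * (4 * ?I)"
  using 1 by (rule mult_left_mono) simp
 also have "... = ennreal (4 / r\<^sup>2 * (2 * h / r) ^ CARD('n)) * ennreal 4 * ?I"
  by (simp add: mult.assoc)
 also have "ennreal (4 / r\<^sup>2 * (2 * h / r) ^ CARD('n)) * ennreal 4 = ennreal (16 / r\<^sup>2 * (2 * h / r) ^ CARD('n))"
  using r h by (subst ennreal_mult[symmetric]) auto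
 finally show ?thesis by (simp add: A_def)
qed

section \<open>Mollification of piecewise affine functions\<close>

lemma convolution_derivative:
 fixes v \<zeta> :: "real^'n => complex"
 assumes v: "continuous_on UNIV v" and z: "Ck 1 \<zeta>"
 shows "((\<lambda>x. integral (cbox a b) (\<lambda>y. v y * \<zeta> (x - y))) has_derivative
   (\<lambda>h. \<Sum>i\<in>UNIV. h $ i *\<^sub>R integral (cbox a b) (\<lambda>y. v y * pdiff i \<zeta> (x - y)))) (at x)"
proof -
 have zd: "\<zeta> differentiable (at x)" for x using z by simp
 have pc: "continuous_on UNIV (pdiff i \<zeta>)" for i using z by simp
 have zc: "continuous_on UNIV \<zeta>" using Ck_lower[of 0 \<zeta>] z by simp
 define D :: "real^'n => real^'n => ((real^'n) \<Rightarrow>\<^sub>L complex)" where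
  "D x y = (\<Sum>i\<in>UNIV. blinfun_scaleR_left (v y * pdiff i \<zeta> (x - y)) o\<^sub>L blinfun_inner_right (axis i 1))" for x y
 have D: "blinfun_apply (D x y) h = (\<Sum>i\<in>UNIV. h $ i *\<^sub>R (v y * pdiff i \<zeta> (x - y)))" for x y h
  by (simp add: D_def blinfun.sum_left inner_axis' )
 have contD: "continuous_on (UNIV \<times> cbox a b) (\<lambda>(x, y). D x y)"
  unfolding D_def case_prod_unfold
  by (intro continuous_intros bounded_linear.continuous_on[OF bounded_linear_blinfun_scaleR_left]
    continuous_on_compose2[OF pc] continuous_on_compose2[OF v]) auto
 have der: "((\<lambda>x. v y * \<zeta> (x - y)) has_derivative blinfun_apply (D x y)) (at x within UNIV)" for x y
 proof -
  have "((\<lambda>x. x - y) has_derivative (\<lambda>h. h)) (at x)" by (auto intro!: derivative_eq_intros)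
  from has_derivative_compose[OF this has_derivative_sum_pdiff[OF zd]]
  have "((\<lambda>x. \<zeta> (x - y)) has_derivative (\<lambda>h. \<Sum>i\<in>UNIV. h $ i *\<^sub>R pdiff i \<zeta> (x - y))) (at x)" .
  from has_derivative_mult_right[OF this, of "v y"] show ?thesis
   by (simp add: D[abs_def] sum_distrib_left)
 qed
 have int: "(\<lambda>y. v y * \<zeta> (x - y)) integrable_on cbox a b" for x
  by (intro integrable_continuous continuous_intros continuous_on_compose2[OF zc] continuous_on_subset[OF v]) auto
 have der': "((\<lambda>x. integral (cbox a b) (\<lambda>y. v y * \<zeta> (x - y))) has_derivative blinfun_apply (integral (cbox a b) (D x))) (at x within UNIV)"
  by (rule leibniz_rule[OF der int contD]) auto
 have "D x integrable_on cbox a b"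
  by (intro integrable_continuous continuous_on_compose2[OF contD[unfolded case_prod_unfold], of _ "\<lambda>y. (x, y)", simplified] continuous_intros) auto
 then have "blinfun_apply (integral (cbox a b) (D x)) h
   = (\<Sum>i\<in>UNIV. h $ i *\<^sub>R integral (cbox a b) (\<lambda>y. v y * pdiff i \<zeta> (x - y)))" for h
 proof -
  assume i: "D x integrable_on cbox a b"
  have "blinfun_apply (integral (cbox a b) (D x)) h = integral (cbox a b) (\<lambda>y. blinfun_apply (D x y) h)"
   using i by (rule blinfun_apply_integral)
  also have "... = (\<Sum>i\<in>UNIV. integral (cbox a b) (\<lambda>y. h $ i *\<^sub>R (v y * pdiff i \<zeta> (x - y))))"
   unfolding D
   by (intro Henstock_Kurzweil_Integration.integral_sum integrable_continuous continuous_intros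
     continuous_on_compose2[OF pc] continuous_on_subset[OF v]) auto
  finally show ?thesis by simp
 qed
 then have "blinfun_apply (integral (cbox a b) (D x))
   = (\<lambda>h. \<Sum>i\<in>UNIV. h $ i *\<^sub>R integral (cbox a b) (\<lambda>y. v y * pdiff i \<zeta> (x - y)))" by (rule ext)
 with der' show ?thesis by simp
qed

lemma convolution_Ck:
 fixes v \<zeta> :: "real^'n => complex"
 assumes v: "continuous_on UNIV v" and z: "\<And>m. Ck m \<zeta>"
 shows "Ck m (\<lambda>x. integral (cbox a b) (\<lambda>y. v y * \<zeta> (x - y)))"
 using z
proof (induction m arbitrary: \<zeta>)
 case 0
 have "(\<lambda>x. integral (cbox a b) (\<lambda>y. v y * \<zeta> (x - y))) differentiable_on UNIV"
  using convolution_derivative[OF v 0] unfolding differentiable_on_def differentiable_def by blast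
 then show ?case unfolding Ck.simps by (rule differentiable_imp_continuous_on)
next
 case (Suc m)
 note d = convolution_derivative[OF v Suc.prems]
 have p: "pdiff i (\<lambda>x. integral (cbox a b) (\<lambda>y. v y * \<zeta> (x - y))) = (\<lambda>x. integral (cbox a b) (\<lambda>y. v y * pdiff i \<zeta> (x - y)))" for i
 proof
  fix x
  show "pdiff i (\<lambda>x. integral (cbox a b) (\<lambda>y. v y * \<zeta> (x - y))) x = integral (cbox a b) (\<lambda>y. v y * pdiff i \<zeta> (x - y))"
   unfolding has_derivative_pdiff[OF d] by (simp add: axis_def if_distrib[of "\<lambda>c. c *\<^sub>R _"] cong: if_cong)
 qed
 have "Ck m (pdiff i \<zeta>)" for m i using Suc.prems[of "Suc m"] by simp
 then have "Ck m (\<lambda>x. integral (cbox a b) (\<lambda>y. v y * pdiff i \<zeta> (x - y)))" for i by (rule Suc.IH)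
 moreover have "(\<lambda>x. integral (cbox a b) (\<lambda>y. v y * \<zeta> (x - y))) differentiable (at x)" for x
  using d unfolding differentiable_def by blast
 ultimately show ?case by (simp add: p)
qed

definition cube_bump :: "real => real^'n => real" where
 "cube_bump r = box_bump 1 (\<chi> i. - r) (\<chi> i. r)"

lemma cube_bump_nonneg: "0 \<le> cube_bump r x"
 by (simp add: cube_bump_def box_bump_bounds)

lemma cube_bump_support:
 fixes x :: "real^'n"
 assumes "cube_bump r x ~= 0"
 shows "norm x \<le> real CARD('n) * r"
proof -
 have b: "\<bar>x $ i\<bar> \<le> r" for i
  using assms box_bump_pos_iff[of 1 "\<chi> i. - r" "\<chi> i. r" x]
  by (auto simp: cube_bump_def mem_box_cart abs_le_iff less_imp_le minus_le_iff)
 have "norm x \<le> (\<Sum>i\<in>UNIV. \<bar>x $ i\<bar>)" by (rule norm_le_l1_cart)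
 also have "... \<le> (\<Sum>i\<in>(UNIV :: 'n set). r)" by (intro sum_mono b)
 finally show ?thesis by simp
qed

lemma cube_bump_Ck: "Ck m (\<lambda>x. complex_of_real (cube_bump r x))"
 unfolding cube_bump_def by (rule Ck_box_bump)

lemma cube_bump_continuous: "continuous_on UNIV (cube_bump r)"
proof -
 have "continuous_on UNIV (\<lambda>x. Re (complex_of_real (cube_bump r x)))"
  using cube_bump_Ck[of 0 r] unfolding Ck.simps by (rule continuous_on_Re)
 then show ?thesis by simp
qed

definition bump_mass :: "'n::finite itself => real => real" where
 "bump_mass TYPE('n) r = integral\<^sup>L lebesgue (\<lambda>y :: real^'n. cube_bump r (- y))"

lemma cube_bump_integrable:
 fixes F :: "real^'n => complex"
 assumes "continuous_on UNIV F" 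
 shows "integrable lebesgue (\<lambda>y. F y * of_real (cube_bump r (- y)))"
proof -
 have c: "continuous_on UNIV (\<lambda>y. F y * of_real (cube_bump r (- y)))"
  by (intro continuous_intros assms continuous_on_compose2[OF cube_bump_continuous]) auto
 have s: "F y * of_real (cube_bump r (- y)) = 0" if "real CARD('n) * r < norm y" for y
  using cube_bump_support[of r "- y"] that by auto
 obtain B where "0 \<le> B" and B: "\<And>x. cmod (F x * of_real (cube_bump r (- x))) \<le> B"
 proof (rule continuous_compact_support_bounded[OF c s])
  fix B assume "0 \<le> B" "\<And>x. cmod (F x * of_real (cube_bump r (- x))) \<le> B"
  then show thesis by (rule that)
 qed
 show ?thesis by (rule bounded_support_integrable[OF continuous_on_UNIV_lebesgue_measurable(1)[OF c] B s])
qed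

lemma cube_bump_integrable_real: "integrable lebesgue (\<lambda>y :: real^'n. cube_bump r (- y))"
 using integrable_Re[OF cube_bump_integrable[of "\<lambda>y :: real^'n. 1" r]] by simp

lemma bump_mass_pos:
 assumes "0 < r"
 shows "0 < bump_mass TYPE('n::finite) r"
proof (rule ccontr)
 let ?Q = "box (\<chi> i. - r) (\<chi> i. r) :: (real^'n) set"
 assume "\<not> ?thesis"
 moreover have nn: "AE y in lebesgue. 0 \<le> cube_bump r (- y :: real^'n)" by (simp add: cube_bump_nonneg)
 then have "0 \<le> bump_mass TYPE('n) r" unfolding bump_mass_def by (rule integral_nonneg_AE)
 ultimately have "bump_mass TYPE('n) r = 0" by simp
 then have "AE y in lebesgue. cube_bump r (- y :: real^'n) = 0"
  using integral_nonneg_eq_0_iff_AE[OF cube_bump_integrable_real nn] by (simp add: bump_mass_def)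
 then have "AE y in lebesgue. (y :: real^'n) \<notin> ?Q"
 proof eventually_elim
  case (elim y)
  then have "- y \<notin> ?Q"
   using box_bump_pos_iff[of 1 "(\<chi> i. - r) :: real^'n" "\<chi> i. r" "- y"] by (simp add: cube_bump_def)
  then obtain i where "\<not> (- r < - (y $ i) \<and> - (y $ i) < r)" by (auto simp: mem_box_cart)
  then have "\<not> (- r < y $ i \<and> y $ i < r)" by auto
  then show ?case by (auto simp: mem_box_cart)
 qed
 then have "?Q \<in> null_sets lebesgue" by (subst AE_iff_null_sets) auto
 then have "negligible ?Q" by (simp add: negligible_iff_null_sets)
 moreover have "0 \<in> ?Q" using assms by (simp add: mem_box_cart)
 ultimately show False using open_not_negligible[OF open_box] by blast
qed

text \<open>The substitution \<open>y \<mapsto> - y\<close> puts the translation into \<open>v\<close>, where the Lipschitz bound and local affinity of \<open>v\<close> can be used.\<close>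

definition mollify :: "real => (real^'n => complex) => real^'n => complex" where
 "mollify r v x = integral\<^sup>L lebesgue (\<lambda>y. v (y + x) * of_real (cube_bump r (- y))) / of_real (bump_mass TYPE('n) r)"

lemma mollify_constant:
 fixes c :: complex
 assumes "0 < r"
 shows "integral\<^sup>L lebesgue (\<lambda>y :: real^'n. c * of_real (cube_bump r (- y))) / of_real (bump_mass TYPE('n) r) = c"
proof -
 have "integral\<^sup>L lebesgue (\<lambda>y :: real^'n. c * of_real (cube_bump r (- y)))
   = c * integral\<^sup>L lebesgue (\<lambda>y :: real^'n. of_real (cube_bump r (- y)))"
  by (rule integral_mult_right_zero)
 also have "... = c * of_real (bump_mass TYPE('n) r)"
  unfolding bump_mass_def by (subst integral_complex_of_real) simp
 finally have E: "integral\<^sup>L lebesgue (\<lambda>y :: real^'n. c * of_real (cube_bump r (- y))) = c * of_real (bump_mass TYPE('n) r)" .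
 show ?thesis unfolding E using bump_mass_pos[OF assms, where 'n = 'n] by simp
qed

lemma mollifier_mean_bound:
 fixes F :: "real^'n => complex"
 assumes e: "0 < r" and F: "continuous_on UNIV F"
  and b: "\<And>y. norm y \<le> real CARD('n) * r ==> cmod (F y) \<le> B"
 shows "cmod (integral\<^sup>L lebesgue (\<lambda>y. F y * of_real (cube_bump r (- y))) / of_real (bump_mass TYPE('n) r)) \<le> B"
proof -
 let ?w = "\<lambda>y :: real^'n. complex_of_real (cube_bump r (- y))"
 have i: "integrable lebesgue (\<lambda>y. F y * ?w y)" using F by (rule cube_bump_integrable)
 have "cmod (integral\<^sup>L lebesgue (\<lambda>y. F y * ?w y)) \<le> integral\<^sup>L lebesgue (\<lambda>y. cmod (F y * ?w y))"
  by (rule integral_norm_bound)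
 also have "... \<le> integral\<^sup>L lebesgue (\<lambda>y :: real^'n. B * cube_bump r (- y))"
 proof (rule integral_mono)
  show "integrable lebesgue (\<lambda>y. cmod (F y * ?w y))" using i by (rule integrable_norm)
  show "integrable lebesgue (\<lambda>y :: real^'n. B * cube_bump r (- y))"
   by (intro integrable_mult_right cube_bump_integrable_real)
  fix y :: "real^'n"
  show "cmod (F y * ?w y) \<le> B * cube_bump r (- y)"
  proof (cases "cube_bump r (- y) = 0")
   case False
   then have "norm y \<le> real CARD('n) * r" using cube_bump_support[of r "- y"] by simp
   from mult_right_mono[OF b[OF this] cube_bump_nonneg[of r "- y"]] show ?thesis
    by (simp add: norm_mult cube_bump_nonneg)
  qed simp
 qed
 also have "... = B * bump_mass TYPE('n) r" unfolding bump_mass_def by (rule integral_mult_right_zero)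
 finally show ?thesis using bump_mass_pos[OF e, where 'n = 'n] by (simp add: norm_divide divide_le_eq)
qed

text \<open>The constant \<open>c\<close> covers two uses: Lipschitz bounds (\<open>c = 0\<close>) and the reproduction of affine functions (\<open>B = 0\<close>).\<close>

lemma mollify_diff_bound:
 fixes v :: "real^'n => complex"
 assumes e: "0 < r" and v: "continuous_on UNIV v"
  and b: "\<And>y. norm y \<le> real CARD('n) * r ==> cmod (v (y + x) - v (y + x') - c) \<le> B"
 shows "cmod (mollify r v x - mollify r v x' - c) \<le> B"
proof -
 have cv: "continuous_on UNIV (\<lambda>y. v (y + x))" for x by (intro continuous_intros continuous_on_compose2[OF v]) auto
 let ?w = "\<lambda>y :: real^'n. complex_of_real (cube_bump r (- y))"
 note i = cube_bump_integrable[OF cv[of x], of r] cube_bump_integrable[OF cv[of x'], of r]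
  cube_bump_integrable[OF continuous_on_const[of UNIV c], of r]
 have "integral\<^sup>L lebesgue (\<lambda>y. (v (y + x) - v (y + x') - c) * ?w y)
   = integral\<^sup>L lebesgue (\<lambda>y. (v (y + x) * ?w y - v (y + x') * ?w y) - c * ?w y)"
  by (simp only: left_diff_distrib)
 also have "... = integral\<^sup>L lebesgue (\<lambda>y. v (y + x) * ?w y) - integral\<^sup>L lebesgue (\<lambda>y. v (y + x') * ?w y)
   - integral\<^sup>L lebesgue (\<lambda>y. c * ?w y)"
  by (subst Bochner_Integration.integral_diff[OF Bochner_Integration.integrable_diff[OF i(1,2)] i(3)],
    subst Bochner_Integration.integral_diff[OF i(1,2)]) (rule refl)
 finally have eq: "mollify r v x - mollify r v x' - c = integral\<^sup>L lebesgue (\<lambda>y. (v (y + x) - v (y + x') - c) * ?w y)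
   / of_real (bump_mass TYPE('n) r)"
  using mollify_constant[OF e, where 'n = 'n, of c] by (simp only: mollify_def diff_divide_distrib)
 show ?thesis unfolding eq by (rule mollifier_mean_bound[OF e _ b]) (intro continuous_intros cv)
qed

lemma mollify_eq_convolution:
 fixes v :: "real^'n => complex"
 assumes v: "continuous_on UNIV v" and s: "\<And>x. x \<notin> cbox a b ==> v x = 0"
 shows "mollify r v x = integral (cbox a b) (\<lambda>y. v y * of_real (cube_bump r (x - y))) / of_real (bump_mass TYPE('n) r)"
proof -
 let ?f = "\<lambda>y. v y * complex_of_real (cube_bump r (x - y))"
 have c: "continuous_on UNIV ?f"
  by (intro continuous_intros v continuous_on_compose2[OF cube_bump_continuous]) auto
 have "integral\<^sup>L lebesgue (\<lambda>y. v (y + x) * of_real (cube_bump r (- y))) = integral\<^sup>L lebesgue (\<lambda>y. ?f (y + x))"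
  by simp
 also have "... = integral\<^sup>L lebesgue ?f" by (rule integral_lebesgue_translate[OF c])
 also have "... = integral\<^sup>L (lebesgue_on (cbox a b)) ?f"
  using s by (intro integral_lebesgue_on_eq(1)[symmetric]) auto
 also have "... = integral (cbox a b) ?f"
  by (intro lebesgue_integral_eq_integral continuous_imp_integrable continuous_on_subset[OF c]) auto
 finally show ?thesis by (simp add: mollify_def)
qed

text \<open>The mollifications are test functions of \<open>W\<close> once the radius is below the distance of \<open>A\<close> to the
complement. Near a point where \<open>v\<close> is affine they eventually agree with \<open>v\<close> up to a constant, so their gradients
converge almost everywhere, and boundedly; hence they converge in \<open>H1\<close>.\<close>

lemma lipschitz_local_affine_in_H10:
 fixes v :: "real^'n => complex"
 assumes O: "open W" "bounded W" and A: "compact A" "A \<subseteq> W" "\<And>x. x \<notin> A ==> v x = 0"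
  and lip: "\<And>x y. cmod (v x - v y) \<le> L * norm (x - y)"
  and gm: "\<And>i. g i \<in> borel_measurable lebesgue" and gb: "\<And>i x. cmod (g i x) \<le> M"
  and loc: "AE x in lebesgue. \<exists>\<delta>>0. \<exists>l. linear l \<and> (\<forall>i. g i x = l (axis i 1))
    \<and> (\<forall>y\<in>ball x \<delta>. v y = v x + l (y - x))"
 shows "v \<in> H10 W" "v \<in> L2 W" "g i \<in> L2 W" "weak_pdiff W i v (g i)"
proof -
 note OS = open_lebesgue[OF O(1)]
 have fin: "emeasure lebesgue W < \<infinity>" using emeasure_bounded_finite[OF O(2)] O(1) by simp
 note L = lipschitz_bound_imp_continuous[OF lip]
 have const: "integrable (lebesgue_on W) (\<lambda>x. c :: real)" for c
  using fin OS by (intro integrable_const finite_measure.integrable_const finite_measureI) (simp add: emeasure_restrict_space)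
 have bddL2: "u \<in> L2 W" if "u \<in> borel_measurable lebesgue" "\<And>x. cmod (u x) \<le> B" for u :: "real^'n => complex" and B
 proof -
  have "integrable (lebesgue_on W) (\<lambda>x. (cmod (u x))^2)"
   by (rule Bochner_Integration.integrable_bound[OF const[of "B\<^sup>2"]])
    (use that in \<open>auto intro!: power_mono measurable_restrict_space1\<close>)
  then show ?thesis using that(1) by (simp add: L2_def measurable_restrict_space1)
 qed
 show gL2: "g i \<in> L2 W" for i using gm gb by (rule bddL2)
 obtain a b where ab: "A \<subseteq> cbox a b" using compact_imp_bounded[OF A(1)] bounded_subset_cbox_symmetric by blast
 have vs: "v x = 0" if "x \<notin> cbox a b" for x using ab A(3) that by blast
 have vL2: "v \<in> L2 W"
 proof -
  obtain R where R: "\<And>x. x \<in> A ==> norm x \<le> R" using compact_imp_bounded[OF A(1)] by (auto simp: bounded_iff)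
  have vR: "v x = 0" if "R < norm x" for x
  proof (rule A(3), rule notI)
   assume "x \<in> A"
   from R[OF this] that show False by simp
  qed
  obtain B where "0 \<le> B" and B: "\<And>x. cmod (v x) \<le> B"
  proof (rule continuous_compact_support_bounded[OF L(2) vR])
   fix B assume "0 \<le> B" "\<And>x. cmod (v x) \<le> B"
   then show thesis by (rule that)
  qed
  show ?thesis by (rule bddL2[OF continuous_on_UNIV_lebesgue_measurable(1)[OF L(2)] B])
 qed
 then show "v \<in> L2 W" .
 show w: "weak_pdiff W i v (g i)" for i
 proof (rule weak_pdiff_lipschitz[OF OS lip gm])
  show "AE x in lebesgue. ((\<lambda>t. v (x + t *\<^sub>R axis i 1)) has_vector_derivative g i x) (at 0)"
   using loc
  proof eventually_elim
   case (elim x)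
   then obtain \<delta> l where d: "0 < \<delta>" "linear l" "g i x = l (axis i 1)" "\<forall>y\<in>ball x \<delta>. v y = v x + l (y - x)"
    by blast
   have D: "((\<lambda>t. v x + t *\<^sub>R l (axis i 1)) has_vector_derivative g i x) (at 0)"
    unfolding d(3) by (auto intro!: derivative_eq_intros)
   have E: "v x + t *\<^sub>R l (axis i 1) = v (x + t *\<^sub>R axis i 1)" if "t \<in> ball 0 \<delta>" for t
   proof -
    have "x + t *\<^sub>R axis i 1 \<in> ball x \<delta>" using that by (simp add: dist_norm)
    from bspec[OF d(4) this] show ?thesis by (simp add: linear_cmul[OF d(2)])
   qed
   have "0 \<in> ball 0 \<delta>" using d(1) by simp
   from has_vector_derivative_transform_within_open[OF D open_ball this E] show ?case .
  qed
 qed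
 have H1: "v \<in> H1 W" by (rule H1I[OF vL2 gL2 w])
 obtain \<delta> where \<delta>: "0 < \<delta>" "(\<Union>x\<in>A. ball x \<delta>) \<subseteq> W"
  using compact_subset_open_imp_ball_epsilon_subset[OF A(1) O(1) A(2)] by blast
 define N where "N = real CARD('n)"
 have N: "1 \<le> N" by (simp add: N_def Suc_leI)
 define r where "r m = \<delta> / (2 * N) * inverse (real (Suc m))" for m
 have e: "0 < r m" "N * r m < \<delta>" for m
 proof -
  show "0 < r m" using \<delta> N by (simp add: r_def)
  have "N * r m = \<delta> / 2 * inverse (real (Suc m))" using N by (simp add: r_def)
  also have "... \<le> \<delta> / 2 * 1" using \<delta> by (intro mult_left_mono) (auto simp: inverse_le_1_iff)
  finally show "N * r m < \<delta>" using \<delta> by simp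
 qed
 have e0: "(\<lambda>m. N * r m) ----> 0"
 proof -
  have "(\<lambda>m. N * (\<delta> / (2 * N)) * inverse (real (Suc m))) ----> N * (\<delta> / (2 * N)) * 0"
   by (intro tendsto_mult tendsto_const LIMSEQ_inverse_real_of_nat)
  moreover have "(\<lambda>m. N * r m) = (\<lambda>m. N * (\<delta> / (2 * N)) * inverse (real (Suc m)))"
   by (simp only: r_def mult.assoc)
  ultimately show ?thesis by simp
 qed
 define \<phi> where "\<phi> m = mollify (r m) v" for m
 have \<phi>lip: "cmod (\<phi> m x - \<phi> m y) \<le> L * norm (x - y)" for m x y
  using mollify_diff_bound[OF e(1)[of m] L(2), of x y 0 "L * norm (x - y)"] lip[of "z + x" "z + y" for z]
  unfolding \<phi>_def by simp
 have test: "\<phi> m \<in> test_functions W" for m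
 proof -
  have Ckm: "Ck k (\<phi> m)" for k
  proof -
   have "Ck k (\<lambda>x. integral (cbox a b) (\<lambda>y. v y * of_real (cube_bump (r m) (x - y))) * inverse (of_real (bump_mass TYPE('n) (r m))))"
    by (intro Ck_mult Ck_const convolution_Ck[OF L(2)] cube_bump_Ck)
   moreover have "\<phi> m = (\<lambda>x. integral (cbox a b) (\<lambda>y. v y * of_real (cube_bump (r m) (x - y))) * inverse (of_real (bump_mass TYPE('n) (r m))))"
    by (rule ext) (simp add: \<phi>_def mollify_eq_convolution[OF L(2) vs] divide_inverse)
   ultimately show ?thesis by simp
  qed
  let ?S = "{x + y |x y. x \<in> A \<and> y \<in> cball 0 (N * r m)}"
  have "x \<in> ?S" if "\<phi> m x ~= 0" for x
  proof (rule ccontr)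
   assume "x \<notin> ?S"
   have v0: "v (y + x) = 0" if "norm y \<le> N * r m" for y
   proof (rule A(3), rule notI)
    assume "y + x \<in> A"
    moreover have "- y \<in> cball 0 (N * r m)" "x = (y + x) + - y" using that by simp_all
    ultimately have "x \<in> ?S" by blast
    with \<open>x \<notin> ?S\<close> show False ..
   qed
   have "v (y + x) * complex_of_real (cube_bump (r m) (- y)) = 0" for y
   proof (cases "cube_bump (r m) (- y) = 0")
    case False
    from cube_bump_support[OF this] have "norm y \<le> N * r m" by (simp add: N_def)
    from v0[OF this] show ?thesis by simp
   qed simp
   then have "(\<lambda>y. v (y + x) * complex_of_real (cube_bump (r m) (- y))) = (\<lambda>y. 0)" by (rule ext)
   then have "\<phi> m x = 0" unfolding \<phi>_def mollify_def by simp
   with that show False by simp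
  qed
  then have sub: "{x. \<phi> m x ~= 0} \<subseteq> ?S" by blast
  have cS: "compact ?S" by (intro compact_sums A) simp
  then have cl: "closure {x. \<phi> m x ~= 0} \<subseteq> ?S" using sub by (simp add: closure_minimal compact_imp_closed)
  have "?S \<subseteq> W"
  proof
   fix z assume "z \<in> ?S"
   then obtain x y where "z = x + y" "x \<in> A" "norm y \<le> N * r m" by auto
   then have "z \<in> ball x \<delta>" using e(2)[of m] by (simp add: dist_norm)
   then show "z \<in> W" using \<delta>(2) \<open>x \<in> A\<close> by blast
  qed
  moreover have "compact (closure {x. \<phi> m x ~= 0})"
   using bounded_subset[OF compact_imp_bounded[OF cS] cl] by (simp add: compact_eq_bounded_closed)
  ultimately show ?thesis using Ckm cl by (auto simp: test_functions_def)
 qed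
 have pL2: "pdiff i (\<phi> m) \<in> L2 W" "\<phi> m \<in> L2 W" for i m
  using test_functions_L2[OF test_functions_pdiff[OF test] OS] test_functions_L2[OF test OS] by auto
 have pb: "cmod (pdiff i (\<phi> m) x) \<le> L" for i m x
 proof -
  have "(\<Sum>j\<in>UNIV. axis i 1 $ j *\<^sub>R pdiff j (\<phi> m) x) = pdiff i (\<phi> m) x"
   by (simp add: axis_def if_distrib[of "\<lambda>c. c *\<^sub>R _"] cong: if_cong)
  then have "(\<lambda>k. diff_quot (\<phi> m) (axis i 1) k x) ----> pdiff i (\<phi> m) x"
   using diff_quot_limit[OF directional_derivative[OF test_functionsD(3)[OF test]], of m "axis i 1" x] by simp
  moreover obtain R where R: "\<forall>x. R < norm x --> \<phi> m x = 0" using test_functionsD(4)[OF test] ..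
  have "cmod (diff_quot (\<phi> m) (axis i 1) k x) \<le> L" for k
  proof -
   have "cmod (diff_quot (\<phi> m) (axis i 1) k x) \<le> L * norm (axis i (1::real)) * indicator (cball 0 (R + norm (axis i (1::real) :: real^'n))) x"
    by (rule diff_quot_bound[OF \<phi>lip]) (use R in auto)
   also have "... \<le> L" using L(1) by (simp add: norm_axis_1 indicator_def)
   finally show ?thesis .
  qed
  ultimately show ?thesis by (intro tendsto_upperbound[OF tendsto_norm]) auto
 qed
 have lim0: "(\<lambda>m. L2_nrm W (\<lambda>x. v x - \<phi> m x)) ----> 0"
 proof -
  have bd: "cmod (v x - \<phi> m x) \<le> L * (N * r m)" for m x
  proof -
   let ?w = "\<lambda>y :: real^'n. complex_of_real (cube_bump (r m) (- y))"
   have cv: "continuous_on UNIV (\<lambda>y. v (y + x))" by (intro continuous_intros continuous_on_compose2[OF L(2)]) auto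
   have "integral\<^sup>L lebesgue (\<lambda>y. (v (y + x) - v x) * ?w y)
     = integral\<^sup>L lebesgue (\<lambda>y. v (y + x) * ?w y - v x * ?w y)" by (simp only: left_diff_distrib)
   also have "... = integral\<^sup>L lebesgue (\<lambda>y. v (y + x) * ?w y) - integral\<^sup>L lebesgue (\<lambda>y. v x * ?w y)"
    by (intro Bochner_Integration.integral_diff cube_bump_integrable cv continuous_on_const)
   finally have eq: "\<phi> m x - v x = integral\<^sup>L lebesgue (\<lambda>y. (v (y + x) - v x) * ?w y) / of_real (bump_mass TYPE('n) (r m))"
    using mollify_constant[OF e(1)[of m], where 'n = 'n, of "v x"]
    by (simp only: \<phi>_def mollify_def diff_divide_distrib)
   have "cmod (\<phi> m x - v x) \<le> L * (N * r m)"
    unfolding eq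
   proof (rule mollifier_mean_bound[OF e(1)])
    show "continuous_on UNIV (\<lambda>y. v (y + x) - v x)" by (intro continuous_intros cv)
    fix y :: "real^'n" assume "norm y \<le> real CARD('n) * r m"
    then show "cmod (v (y + x) - v x) \<le> L * (N * r m)"
     using lip[of "y + x" x] L(1) mult_left_mono[of "norm y" "N * r m" L] by (simp add: N_def)
   qed
   then show ?thesis by (simp add: norm_minus_commute)
  qed
  have le: "norm (L2_nrm W (\<lambda>x. v x - \<phi> m x)) \<le> L * (N * r m) * sqrt (lint W (\<lambda>x. 1))" for m
  proof -
   have "lint W (\<lambda>x. (cmod (v x - \<phi> m x))^2) \<le> lint W (\<lambda>x. (L * (N * r m))^2 * 1)"
    by (intro integral_mono L2_integrable_square L2_diff vL2 pL2 integrable_mult_right const) (simp add: bd power_mono)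
   also have "... = (L * (N * r m))^2 * lint W (\<lambda>x. 1)" by (subst integral_mult_right_zero) simp
   finally have "L2_nrm W (\<lambda>x. v x - \<phi> m x) \<le> sqrt ((L * (N * r m))^2 * lint W (\<lambda>x. 1))"
    unfolding L2_nrm_def by (rule real_sqrt_le_mono)
   then show ?thesis using L(1) N e(1)[of m] by (simp add: real_sqrt_mult L2_nrm_nonneg)
  qed
  have "(\<lambda>m. L * (N * r m) * sqrt (lint W (\<lambda>x. 1))) ----> L * 0 * sqrt (lint W (\<lambda>x. 1))"
   by (intro tendsto_mult tendsto_const e0)
  then have "(\<lambda>m. L * (N * r m) * sqrt (lint W (\<lambda>x. 1))) ----> 0"
   by (simp only: mult_zero_right mult_zero_left)
  from Lim_null_comparison[OF always_eventually[OF allI[OF le]] this] show ?thesis .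
 qed
 have limi: "(\<lambda>m. L2_nrm W (\<lambda>x. g i x - pdiff i (\<phi> m) x)) ----> 0" for i
 proof -
  have "(\<lambda>m. lint W (\<lambda>x. (cmod (g i x - pdiff i (\<phi> m) x))^2)) ----> lint W (\<lambda>x. 0 :: real)"
  proof (rule integral_dominated_convergence[where w = "\<lambda>x. (M + L)^2"])
   show "(\<lambda>x. (cmod (g i x - pdiff i (\<phi> m) x))^2) \<in> borel_measurable (lebesgue_on W)" for m
    by (intro borel_measurable_integrable L2_integrable_square L2_diff gL2 pL2)
   show "AE x in lebesgue_on W. norm ((cmod (g i x - pdiff i (\<phi> m) x))^2) \<le> (M + L)^2" for m
   proof (rule AE_I2)
    fix x
    have "cmod (g i x - pdiff i (\<phi> m) x) \<le> M + L" by (rule order_trans[OF norm_triangle_ineq4 add_mono[OF gb pb]])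
    then show "norm ((cmod (g i x - pdiff i (\<phi> m) x))^2) \<le> (M + L)^2" by (simp add: power_mono)
   qed
   have "AE x in lebesgue. (\<lambda>m. (cmod (g i x - pdiff i (\<phi> m) x))^2) ----> 0"
    using loc
   proof eventually_elim
    case (elim x)
    then obtain \<rho> l where d: "0 < \<rho>" "linear l" "g i x = l (axis i 1)" "\<forall>y\<in>ball x \<rho>. v y = v x + l (y - x)"
     by blast
    have "\<forall>\<^sub>F m in sequentially. N * r m < \<rho> / 2"
     using e0 d(1) by (intro order_tendstoD(2)[of _ 0]) auto
    then have "\<forall>\<^sub>F m in sequentially. (cmod (g i x - pdiff i (\<phi> m) x))^2 = 0"
    proof eventually_elim
     case (elim m)
     have loc2: "\<phi> m y = \<phi> m x + l (y - x)" if y: "y \<in> ball x (\<rho> / 2)" for y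
     proof -
      have "cmod (mollify (r m) v y - mollify (r m) v x - l (y - x)) \<le> 0"
      proof (rule mollify_diff_bound[OF e(1) L(2)])
       fix z :: "real^'n" assume "norm z \<le> real CARD('n) * r m"
       then have z: "norm z < \<rho> / 2" using elim by (simp add: N_def)
       then have "z + x \<in> ball x \<rho>" using d(1) by (simp add: dist_norm)
       moreover have "z + y \<in> ball x \<rho>"
        using z y norm_triangle_ineq[of "x - y" "- z"] by (simp add: dist_norm algebra_simps)
       ultimately have "v (z + y) - v (z + x) = l (z + y - x) - l (z + x - x)" using d(4) by simp
       also have "... = l (y - x)" by (simp add: linear_diff[OF d(2), symmetric])
       finally show "cmod (v (z + y) - v (z + x) - l (y - x)) \<le> 0" by simp
      qed
      then show ?thesis by (simp add: \<phi>_def algebra_simps)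
     qed
     have "((\<lambda>y. y - x) has_derivative (\<lambda>h. h)) (at x)" by (auto intro!: derivative_eq_intros)
     from bounded_linear.has_derivative[OF linear_conv_bounded_linear[THEN iffD1, OF d(2)] this]
     have "((\<lambda>y. \<phi> m x + l (y - x)) has_derivative (\<lambda>h. 0 + l h)) (at x)"
      by (rule has_derivative_add[OF has_derivative_const])
     then have D: "((\<lambda>y. \<phi> m x + l (y - x)) has_derivative l) (at x)" by (simp only: add_0)
     have "x \<in> ball x (\<rho> / 2)" using d(1) by simp
     from has_derivative_transform_within_open[OF D open_ball this loc2[symmetric]]
     have "(\<phi> m has_derivative l) (at x)" .
     from has_derivative_pdiff[OF this] d(3) show ?case by simp
    qed
    then show ?case by (rule tendsto_eventually)
   qed
   then show "AE x in lebesgue_on W. (\<lambda>m. (cmod (g i x - pdiff i (\<phi> m) x))^2) ----> 0"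
    using OS by (subst AE_restrict_space_iff) (auto elim: eventually_mono)
  qed (use const in auto)
  then have "(\<lambda>m. sqrt (lint W (\<lambda>x. (cmod (g i x - pdiff i (\<phi> m) x))^2))) ----> sqrt 0"
   by (intro tendsto_real_sqrt) simp
  then show ?thesis by (simp add: L2_nrm_def)
 qed
 have E: "H1_nrm W (\<lambda>x. v x - \<phi> m x)
   = sqrt ((L2_nrm W (\<lambda>x. v x - \<phi> m x))^2 + (\<Sum>i\<in>UNIV. (L2_nrm W (\<lambda>x. g i x - pdiff i (\<phi> m) x))^2))" for m
 proof (rule H1_nrm_eq[OF O(1) L2_diff[OF vL2 pL2(2)] L2_diff[OF gL2 pL2(1)]])
  fix i
  show "weak_pdiff W i (\<lambda>x. v x - \<phi> m x) (\<lambda>x. g i x - pdiff i (\<phi> m) x)"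
   using weak_pdiff_add[OF OS vL2 L2_uminus[OF pL2(2)] gL2 L2_uminus[OF pL2(1)] w
     weak_pdiff_cmult[OF weak_pdiff_test[OF OS test], where c = "-1", simplified]] by simp
 qed
 have "(\<lambda>m. sqrt ((L2_nrm W (\<lambda>x. v x - \<phi> m x))^2 + (\<Sum>i\<in>UNIV. (L2_nrm W (\<lambda>x. g i x - pdiff i (\<phi> m) x))^2)))
   ----> sqrt (0\<^sup>2 + (\<Sum>i\<in>(UNIV :: 'n set). 0\<^sup>2))"
  by (rule tendsto_real_sqrt[OF tendsto_add[OF tendsto_power[OF lim0] tendsto_sum[OF tendsto_power[OF limi]]]])
 then have "(\<lambda>m. H1_nrm W (\<lambda>x. v x - \<phi> m x)) ----> sqrt (0\<^sup>2 + (\<Sum>i\<in>(UNIV :: 'n set). 0\<^sup>2))"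
  by (simp only: E)
 moreover have "sqrt (0\<^sup>2 + (\<Sum>i\<in>(UNIV :: 'n set). 0\<^sup>2)) = (0 :: real)" by simp
 ultimately have "(\<lambda>m. H1_nrm W (\<lambda>x. v x - \<phi> m x)) ----> 0" by (simp only:)
 with H1 test show "v \<in> H10 W" unfolding H10_def by auto
qed

section \<open>Quasi-uniform meshes, inverse inequality and exterior balls\<close>

text \<open>Shape regularity and quasi-uniformity in the form in which they are used: every element is comparable with a
ball of radius proportional to the same \<open>h\<close>.\<close>

definition regular_mesh :: "(real^'n) set => (real^'n) set set => real => real => bool" where
 "regular_mesh W S h \<sigma> \<longleftrightarrow> triangulation S \<and> \<Union>S = closure W \<and> 0 < h \<and> 0 < \<sigma>
  \<and> (\<forall>K\<in>S. diameter K \<le> h \<and> (\<exists>z. cball z (\<sigma> * h) \<subseteq> K))"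

lemma cball_subset_radius_le:
 fixes K :: "(real^'n) set"
 assumes "bounded K" "0 \<le> r" "cball x r \<subseteq> K"
 shows "r \<le> diameter K"
proof -
 have "2 * r = diameter (cball x r)" using assms(2) by simp
 also have "... \<le> diameter K" using assms(3,1) by (rule diameter_subset)
 finally show ?thesis using assms(2) by simp
qed

lemma less_inradius_imp_cball:
 fixes K :: "(real^'n) set"
 assumes "bounded K" "K ~= {}" "r < inradius K"
 shows "\<exists>x. cball x r \<subseteq> K"
proof -
 let ?A = "{r. 0 \<le> r \<and> (\<exists>x. cball x r \<subseteq> K)}"
 obtain y where "y \<in> K" using assms(2) by blast
 then have "0 \<in> ?A" by auto
 then have "?A ~= {}" by blast
 then obtain r' where "r' \<in> ?A" "r < r'" using less_cSupE[of r ?A] assms(3) unfolding inradius_def by blast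
 then obtain x where "cball x r' \<subseteq> K" by blast
 moreover have "cball x r \<subseteq> cball x r'" using \<open>r < r'\<close> by (simp add: subset_cball)
 ultimately show ?thesis by blast
qed

lemma mesh_family_regular:
 fixes W :: "(real^'n) set"
 assumes M: "mesh_family W H \<T>" and ne: "W ~= {}"
 shows "\<exists>\<sigma>>0. \<forall>h\<in>H. regular_mesh W (\<T> h) h \<sigma>"
proof -
 have M1: "H \<subseteq> {0<..}" 
  and M2: "\<forall>h\<in>H. triangulation (\<T> h) \<and> (\<forall>K\<in>\<T> h. (int CARD('n)) simplex K)
     \<and> \<Union>(\<T> h) = closure W \<and> h = Max (diameter ` \<T> h)"
  and M3: "\<exists>c. \<forall>h\<in>H. \<forall>K\<in>\<T> h. diameter K \<le> c * inradius K"
  and M4: "\<exists>\<rho>. \<forall>h\<in>H. \<forall>K\<in>\<T> h. \<forall>K'\<in>\<T> h. diameter K \<le> \<rho> * diameter K'"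
  using M unfolding mesh_family_def by blast+
 obtain c where c: "\<forall>h\<in>H. \<forall>K\<in>\<T> h. diameter K \<le> c * inradius K" using M3 ..
 obtain \<rho> where \<rho>: "\<forall>h\<in>H. \<forall>K\<in>\<T> h. \<forall>K'\<in>\<T> h. diameter K \<le> \<rho> * diameter K'" using M4 ..
 define C where "C = max c 1 * max \<rho> 1"
 have C: "1 \<le> C" unfolding C_def using mult_mono[of 1 "max c 1" 1 "max \<rho> 1"] by simp
 have "regular_mesh W (\<T> h) h (1 / (2 * C))" if h: "h \<in> H" for h
 proof -
  have T: "triangulation (\<T> h)" "\<forall>K\<in>\<T> h. (int CARD('n)) simplex K" "\<Union>(\<T> h) = closure W" "h = Max (diameter ` \<T> h)"
   using M2 h by blast+
  have h0: "0 < h" using M1 h by auto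
  have f: "finite (\<T> h)" using triangulationD(1)[OF T(1)] .
  have nonempty: "\<T> h ~= {}"
  proof
   assume "\<T> h = {}"
   with T(3) have "closure W = {}" by simp
   with ne show False by simp
  qed
  have le: "diameter K \<le> h" if "K \<in> \<T> h" for K
  proof -
   have "diameter K \<le> Max (diameter ` \<T> h)" using f that by (intro Max_ge) auto
   from ord_le_eq_trans[OF this T(4)[symmetric]] show ?thesis .
  qed
  have "Max (diameter ` \<T> h) \<in> diameter ` \<T> h" using f nonempty by (intro Max_in) auto
  then obtain K0 where K0: "K0 \<in> \<T> h" "Max (diameter ` \<T> h) = diameter K0" by blast
  have hK0: "h = diameter K0" by (rule trans[OF T(4) K0(2)])
  have "\<exists>z. cball z (1 / (2 * C) * h) \<subseteq> K" if K: "K \<in> \<T> h" for K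
  proof -
   have bK: "bounded K" using triangulation_closed_compact(1)[OF T(1) K] by (rule compact_imp_bounded)
   have neK: "K ~= {}"
   proof
    assume "K = {}"
    then have "int CARD('n) simplex ({} :: (real^'n) set)" using T(2) K by blast
    then show False by (simp add: simplex_empty)
   qed
   have d0: "0 \<le> diameter K" using bK by (rule diameter_ge_0)
   have "h \<le> \<rho> * diameter K" by (rule ord_eq_le_trans[OF hK0]) (use \<rho> h K0(1) K in blast)
   also have "... \<le> max \<rho> 1 * diameter K" using d0 by (intro mult_right_mono) auto
   finally have 1: "h \<le> max \<rho> 1 * diameter K" .
   then have dp: "0 < diameter K" using h0 d0 by (cases "diameter K = 0") auto
   have 2: "diameter K \<le> c * inradius K" using c h K by blast
   have inr: "0 \<le> inradius K"
   proof -
    let ?A = "{r. 0 \<le> r \<and> (\<exists>x. cball x r \<subseteq> K)}"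
    obtain y where "y \<in> K" using neK by blast
    then have "0 \<in> ?A" by auto
    moreover have "bdd_above ?A"
     using cball_subset_radius_le[OF bK] by (intro bdd_aboveI[of _ "diameter K"]) blast
    ultimately show ?thesis unfolding inradius_def by (rule cSup_upper)
   qed
   have "c * inradius K \<le> max c 1 * inradius K" using inr by (intro mult_right_mono) auto
   with 2 have "diameter K \<le> max c 1 * inradius K" by simp
   then have "max \<rho> 1 * diameter K \<le> max \<rho> 1 * (max c 1 * inradius K)" by (intro mult_left_mono) auto
   with 1 have "h \<le> C * inradius K" by (simp add: C_def mult_ac)
   \<comment> \<open>The inradius is a supremum; a strictly smaller radius is attained.\<close>
   then have "1 / (2 * C) * h < inradius K"
    using C h0 by (simp add: field_simps)
   then show ?thesis using less_inradius_imp_cball[OF bK neK] by blast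
  qed
  then show ?thesis using T(1,3) h0 le C unfolding regular_mesh_def by simp
 qed
 moreover have "0 < 1 / (2 * C)" using C by simp
 ultimately show ?thesis by blast
qed

lemma test_functions_mono:
 assumes "U \<subseteq> W" "\<phi> \<in> test_functions U"
 shows "\<phi> \<in> test_functions W"
 using assms by (auto simp: test_functions_def)

lemma L2_mono:
 assumes "u \<in> L2 W" "U \<subseteq> W" "U \<in> sets lebesgue" "W \<in> sets lebesgue"
 shows "u \<in> L2 U"
proof -
 have m: "u \<in> borel_measurable (lebesgue_on W)" using assms(1) by (rule L2_measurable)
 have "u \<in> borel_measurable (lebesgue_on U)"
  using m assms(2) by (rule measurable_restrict_mono)
 moreover have "integrable (lebesgue_on U) (\<lambda>x. (cmod (u x))^2)"
 proof -
  have "integrable lebesgue (\<lambda>x. indicator W x *\<^sub>R (cmod (u x))^2)"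
   using L2_integrable_square[OF assms(1)] assms(4) by (subst (asm) integrable_restrict_space) auto
  then have "integrable lebesgue (\<lambda>x. indicator U x *\<^sub>R (indicator W x *\<^sub>R (cmod (u x))^2))"
   by (rule integrable_mult_indicator[OF assms(3)])
  moreover have "indicator U x *\<^sub>R (indicator W x *\<^sub>R (cmod (u x))^2) = indicator U x *\<^sub>R (cmod (u x))^2" for x
   using assms(2) by (auto simp: indicator_def)
  ultimately have "integrable lebesgue (\<lambda>x. indicator U x *\<^sub>R (cmod (u x))^2)" by (simp only:)
  then show ?thesis using assms(3) by (subst integrable_restrict_space) auto
 qed
 ultimately show ?thesis by (simp add: L2_def)
qed

text \<open>On an open set where \<open>v\<close> is affine, uniqueness of weak derivatives identifies the chosen one.\<close>

lemma wd_local_affine: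
 fixes v :: "real^'n => complex"
 assumes v: "v \<in> H1 W" and O: "open W" and U: "open U" "U \<subseteq> W" "bounded U"
  and l: "linear l" "\<And>x. x \<in> U ==> v x = c + l x"
 shows "AE x in lebesgue. x \<in> U --> wd W i v x = l (axis i 1)"
proof -
 have S: "W \<in> sets lebesgue" "U \<in> sets lebesgue" using O U by (auto simp: borel_open sets_completionI_sets)
 define g where "g = wd W i v"
 have g: "g \<in> L2 U" using H1_wd(2)[OF v] L2_mono[OF _ U(2) S(2,1)] by (simp add: g_def)
 have bl: "bounded_linear l" using l(1) by (simp add: linear_conv_bounded_linear)
 have fin: "emeasure lebesgue U < \<infinity>" using emeasure_bounded_finite[OF U(3)] U(1) by simp
 have w1: "weak_pdiff U i (\<lambda>x. c + l x) g"
  unfolding weak_pdiff_def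
 proof
  fix \<phi> assume \<phi>: "\<phi> \<in> test_functions U"
  note \<phi>' = test_functions_mono[OF U(2) \<phi>]
  have z: "\<phi> x = 0" "pdiff i \<phi> x = 0" if "x \<notin> U" for x
   using test_functionsD(5)[OF \<phi> that] test_functionsD(5)[OF test_functions_pdiff[OF \<phi>] that] by auto
  have zO: "x \<notin> U" if "x \<notin> W" for x using U(2) that by blast
  have "lint U (\<lambda>x. (c + l x) * pdiff i \<phi> x) = integral\<^sup>L lebesgue (\<lambda>x. (c + l x) * pdiff i \<phi> x)"
   using S(2) z by (intro integral_lebesgue_on_eq) auto
  also have "... = integral\<^sup>L lebesgue (\<lambda>x. v x * pdiff i \<phi> x)"
  proof (rule Bochner_Integration.integral_cong[OF refl])
   fix x
   show "(c + l x) * pdiff i \<phi> x = v x * pdiff i \<phi> x"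
    by (cases "x \<in> U") (simp_all add: l(2) z(2))
  qed
  also have "integral\<^sup>L lebesgue (\<lambda>x. v x * pdiff i \<phi> x) = lint W (\<lambda>x. v x * pdiff i \<phi> x)"
   using S(1) z zO by (intro integral_lebesgue_on_eq[symmetric]) auto
  also have "... = - lint W (\<lambda>x. g x * \<phi> x)"
   using H1_wd(3)[OF v] \<phi>' by (simp add: weak_pdiff_def g_def)
  also have "lint W (\<lambda>x. g x * \<phi> x) = integral\<^sup>L lebesgue (\<lambda>x. g x * \<phi> x)"
   using S(1) z zO by (intro integral_lebesgue_on_eq) auto
  also have "... = lint U (\<lambda>x. g x * \<phi> x)"
   using S(2) z by (intro integral_lebesgue_on_eq[symmetric]) auto
  finally show "lint U (\<lambda>x. (c + l x) * pdiff i \<phi> x) = - lint U (\<lambda>x. g x * \<phi> x)" .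
 qed
 have w2: "weak_pdiff U i (\<lambda>x. c + l x) (\<lambda>x. l (axis i 1))"
 proof (rule weak_pdiff_lipschitz[OF S(2)])
  show "cmod ((c + l x) - (c + l y)) \<le> onorm l * norm (x - y)" for x y
   using onorm[OF bl, of "x - y"] by (simp add: linear_diff[OF l(1)])
  have "((\<lambda>t. c + (l x + t *\<^sub>R l (axis i 1))) has_vector_derivative l (axis i 1)) (at 0)" for x
   by (auto intro!: derivative_eq_intros)
  then show "AE x in lebesgue. ((\<lambda>t. c + l (x + t *\<^sub>R axis i 1)) has_vector_derivative l (axis i 1)) (at 0)"
   unfolding linear_add[OF l(1)] linear_cmul[OF l(1)] by simp
 qed simp
 have c2: "(\<lambda>x. l (axis i 1)) \<in> L2 U"
 proof -
  have "integrable (lebesgue_on U) (\<lambda>x. (cmod (l (axis i 1)))^2)"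
   using fin S(2) by (intro integrable_const finite_measure.integrable_const finite_measureI) (simp add: emeasure_restrict_space)
  then show ?thesis by (simp add: L2_def)
 qed
 have "AE x in lebesgue_on U. g x = l (axis i 1)"
  by (rule weak_pdiff_unique[OF U(1) g c2 w1 w2])
 then show ?thesis unfolding g_def using S(2) by (subst (asm) AE_restrict_space_iff) auto
qed

definition inverse_const :: "'n itself => real => real" where
 "inverse_const TYPE('n) \<sigma> = 16 / \<sigma>\<^sup>2 * (2 / \<sigma>) ^ CARD('n)"

abbreviation sqint where "sqint A u \<equiv> \<integral>\<^sup>+x. indicator A x * ennreal ((cmod (u x))^2) \<partial>lebesgue"

lemma nn_integral_L2_off:
 assumes "W \<in> sets lebesgue" "u \<in> L2 W"
 shows "sqint W (\<lambda>x. u x) = ennreal ((L2_nrm W u)^2)"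
  "(\<lambda>x. indicator W x * ennreal ((cmod (u x))^2)) \<in> borel_measurable lebesgue"
proof -
 have "(\<lambda>x. ennreal ((cmod (u x))^2)) \<in> borel_measurable (lebesgue_on W)"
  using L2_measurable[OF assms(2)] by measurable
 then show "(\<lambda>x. indicator W x * ennreal ((cmod (u x))^2)) \<in> borel_measurable lebesgue"
  using assms(1) by (subst (asm) borel_measurable_restrict_space_iff_ennreal) (auto simp: mult.commute)
 show "sqint W (\<lambda>x. u x) = ennreal ((L2_nrm W u)^2)"
  unfolding nn_integral_square_eq[OF assms(2), symmetric]
  using assms(1) by (subst nn_integral_restrict_space) (auto simp: mult.commute)
qed

text \<open>The element constants \<open>q K\<close> do not change the gradient. They are 0 for the inverse inequality and nodal values
for the stability of the quasi-interpolant.\<close>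

lemma gradient_le:
 fixes W :: "(real^'n) set"
 assumes T: "regular_mesh W S h \<sigma>" and O: "open W" and v: "v \<in> H1 W"
  and l: "\<And>K. K \<in> S ==> \<exists>c l. linear l \<and> (\<forall>x\<in>K. v x = c + l x)"
 shows "ennreal ((L2_nrm W (wd W i v))^2)
  \<le> ennreal (inverse_const TYPE('n) \<sigma> / h\<^sup>2) * (\<Sum>K\<in>S. sqint K (\<lambda>x. v x - q K))"
proof -
 have tr: "triangulation S" and U: "\<Union>S = closure W" and h: "0 < h" and s: "0 < \<sigma>"
  and K: "\<And>K. K \<in> S ==> diameter K \<le> h \<and> (\<exists>z. cball z (\<sigma> * h) \<subseteq> K)"
  using T by (auto simp: regular_mesh_def)
 note OS = open_lebesgue[OF O(1)]
 define g where "g = wd W i v"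
 have g: "g \<in> L2 W" using H1_wd(2)[OF v] by (simp add: g_def)
 let ?G = "\<lambda>x. indicator W x * ennreal ((cmod (g x))^2)"
 have loc: "(\<integral>\<^sup>+x. indicator L x * ?G x \<partial>lebesgue)
   \<le> ennreal (inverse_const TYPE('n) \<sigma> / h\<^sup>2) * sqint L (\<lambda>x. v x - q L)"
  if L: "L \<in> S" for L
 proof -
  obtain c l where cl: "linear l" "\<forall>x\<in>L. v x = c + l x" using l[OF L] by blast
  obtain z where z: "cball z (\<sigma> * h) \<subseteq> L" using K[OF L] by blast
  note Lc = triangulation_closed_compact[OF tr L]
  have bL: "bounded L" using Lc(1) by (rule compact_imp_bounded)
  have "AE x in lebesgue. x \<in> interior L \<inter> W --> wd W i v x = l (axis i 1)"
  proof (rule wd_local_affine[OF v O _ _ _ cl(1), where c = c])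
   show "bounded (interior L \<inter> W)" using bounded_subset[OF bL, of "interior L \<inter> W"] interior_subset[of L] by blast
   show "v x = c + l x" if "x \<in> interior L \<inter> W" for x using cl(2) that interior_subset[of L] by blast
  qed (use O in auto)
  moreover have "AE x in lebesgue. x \<notin> frontier L" using Lc(4) by (rule AE_not_in)
  ultimately have "AE x in lebesgue. indicator L x * ?G x \<le> ennreal ((cmod (l (axis i 1)))^2) * indicator L x"
  proof eventually_elim
   case (elim x)
   show ?case
   proof (cases "x \<in> L \<and> x \<in> W")
    case True
    then have "x \<in> interior L" using elim(2) Lc(3) by (simp add: frontier_def)
    with True elim(1) show ?thesis by (simp add: g_def)
   qed (auto simp: indicator_def)
  qed
  then have "(\<integral>\<^sup>+x. indicator L x * ?G x \<partial>lebesgue) \<le> (\<integral>\<^sup>+x. ennreal ((cmod (l (axis i 1)))^2) * indicator L x \<partial>lebesgue)"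
   by (rule nn_integral_mono_AE)
  also have "... = ennreal ((cmod (l (axis i 1)))^2) * emeasure lborel L"
   using Lc(3) by (subst nn_integral_cmult_indicator) auto
  also have "... \<le> ennreal (16 / (\<sigma> * h)^2 * (2 * h / (\<sigma> * h)) ^ CARD('n))
    * (\<integral>\<^sup>+x. indicator L x * ennreal ((cmod ((c - q L) + l x))^2) \<partial>lborel)"
   using affine_inverse_estimate[OF cl(1) Lc(3) z bL, of h "axis i 1" "c - q L"] K[OF L] s h by (simp add: norm_axis_1)
  also have "16 / (\<sigma> * h)^2 * (2 * h / (\<sigma> * h)) ^ CARD('n) = inverse_const TYPE('n) \<sigma> / h\<^sup>2"
   using h by (simp add: inverse_const_def power_mult_distrib)
  also have "(\<integral>\<^sup>+x. indicator L x * ennreal ((cmod ((c - q L) + l x))^2) \<partial>lborel)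
   = sqint L (\<lambda>x. v x - q L)"
   unfolding nn_integral_completion
   by (intro nn_integral_cong) (use cl(2) in \<open>auto simp: indicator_def algebra_simps\<close>)
  finally show ?thesis .
 qed
 have "ennreal ((L2_nrm W g)^2) = (\<integral>\<^sup>+x. ?G x \<partial>lebesgue)" by (rule nn_integral_L2_off(1)[OF OS g, symmetric])
 also have "... = (\<integral>\<^sup>+x. indicator (\<Union>S) x * ?G x \<partial>lebesgue)"
  unfolding U using closure_subset[of W] by (intro nn_integral_cong) (auto simp: indicator_def)
 also have "... = (\<Sum>L\<in>S. \<integral>\<^sup>+x. indicator L x * ?G x \<partial>lebesgue)"
  by (rule nn_integral_triangulation[OF tr nn_integral_L2_off(2)[OF OS g], symmetric])
 also have "... \<le> (\<Sum>L\<in>S. ennreal (inverse_const TYPE('n) \<sigma> / h\<^sup>2) * sqint L (\<lambda>x. v x - q L))"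
  using loc by (rule sum_mono)
 finally show ?thesis by (simp add: g_def sum_distrib_left)
qed

lemma inverse_const_pos: "0 < \<sigma> ==> 0 < inverse_const TYPE('n) \<sigma>"
 by (simp add: inverse_const_def)

lemma global_inverse_estimate:
 fixes W :: "(real^'n) set"
 assumes T: "regular_mesh W S h \<sigma>" and O: "open W" and v: "v \<in> Vh W S"
 shows "L2_nrm W (wd W i v) \<le> sqrt (inverse_const TYPE('n) \<sigma>) / h * L2_nrm W v"
proof -
 let ?A = "inverse_const TYPE('n) \<sigma>"
 have tr: "triangulation S" and U: "\<Union>S = closure W" and h: "0 < h" and s: "0 < \<sigma>"
  using T by (auto simp: regular_mesh_def)
 have A: "0 < ?A" using s by (rule inverse_const_pos)
 note OS = open_lebesgue[OF O(1)]
 have vH: "v \<in> H1 W" and v0: "\<And>x. x \<notin> W ==> v x = 0"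
  and l: "\<And>K. K \<in> S ==> \<exists>c l. linear l \<and> (\<forall>x\<in>K. v x = c + l x)"
  using v by (auto simp: Vh_def dest: H10_H1)
 have vL: "v \<in> L2 W" using H1_wd(1)[OF vH] .
 have eq: "ennreal ((cmod (v x))^2) = indicator W x * ennreal ((cmod (v x))^2)" for x
  using v0[of x] by (auto simp: indicator_def)
 have m: "(\<lambda>x. ennreal ((cmod (v x))^2)) \<in> borel_measurable lebesgue"
  by (subst eq) (rule nn_integral_L2_off(2)[OF OS vL])
 have "ennreal ((L2_nrm W (wd W i v))^2)
   \<le> ennreal (?A / h\<^sup>2) * (\<Sum>K\<in>S. sqint K (\<lambda>x. v x - 0))"
  by (rule gradient_le[OF T O vH l])
 also have "(\<Sum>K\<in>S. sqint K (\<lambda>x. v x - 0))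
   = sqint (closure W) (\<lambda>x. v x)"
  using nn_integral_triangulation[OF tr m] U by simp
 also have "... = sqint W (\<lambda>x. v x)"
  using v0 closure_subset[of W] by (intro nn_integral_cong) (auto simp: indicator_def)
 also have "... = ennreal ((L2_nrm W v)^2)" by (rule nn_integral_L2_off(1)[OF OS vL])
 also have "ennreal (?A / h\<^sup>2) * ennreal ((L2_nrm W v)^2) = ennreal (?A / h\<^sup>2 * (L2_nrm W v)^2)"
  by (rule ennreal_mult[symmetric]) (use A h in auto)
 finally have "(L2_nrm W (wd W i v))^2 \<le> ?A / h\<^sup>2 * (L2_nrm W v)^2"
  using A h by (subst (asm) ennreal_le_iff) auto
 then have "L2_nrm W (wd W i v) \<le> sqrt (?A / h\<^sup>2 * (L2_nrm W v)^2)" by (rule real_le_rsqrt)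
 then show ?thesis using h L2_nrm_nonneg[of W v] by (simp add: real_sqrt_mult real_sqrt_divide)
qed

text \<open>Moving from \<open>q\<close> against the direction \<open>\<nu>\<close> by \<open>\<delta>\<close> leaves room for a ball of radius
\<open>\<delta> / (2 (1 + B))\<close> below the graph.\<close>

lemma exterior_ball_local:
 fixes W :: "(real^'n) set"
 assumes L: "lipschitz_boundary W" and p: "p \<in> frontier W" and D: "0 < D"
 shows "\<exists>r>0. \<exists>\<kappa>>0. \<forall>q\<in>ball p r - W. \<forall>h. 0 < h \<and> h \<le> D --> (\<exists>y. norm (y - q) \<le> h \<and> cball y (\<kappa> * h) \<inter> W = {})"
proof -
 obtain r \<nu> \<phi> B where r: "0 < r" and nu: "norm \<nu> = 1" and lip: "lipschitz_on B {y. y \<bullet> \<nu> = 0} \<phi>"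
  and eq: "W \<inter> ball p r = {y \<in> ball p r. y \<bullet> \<nu> > (\<phi> (y - (y \<bullet> \<nu>) *\<^sub>R \<nu>) :: real)}"
  using L p unfolding lipschitz_boundary_def by blast
 have B: "0 \<le> B" using lipschitz_on_nonneg[OF lip] .
 define \<eta> where "\<eta> = 1 / (2 * (1 + B))"
 have \<eta>: "0 < \<eta>" "\<eta> \<le> 1 / 2" using B by (auto simp: \<eta>_def divide_simps)
 have \<eta>1: "2 * B * \<eta> + \<eta> \<le> 1" using B by (simp add: \<eta>_def divide_simps)
 \<comment> \<open>Shrinking all \<open>h \<le> D\<close> by \<open>m\<close> keeps the construction inside the chart.\<close>
 define m where "m = min 1 (r / (4 * D))"
 have m: "0 < m" "m \<le> 1" "m \<le> r / (4 * D)" using r D by (auto simp: m_def)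
 have nn: "\<nu> \<bullet> \<nu> = 1" using nu by (simp add: norm_eq_1)
 have "\<exists>y. norm (y - q) \<le> h \<and> cball y (\<eta> * m * h) \<inter> W = {}"
  if q: "q \<in> ball p (r / 2) - W" and h: "0 < h" "h \<le> D" for q h
 proof -
  define \<delta> where "\<delta> = m * h"
  have \<delta>: "0 < \<delta>" "\<delta> \<le> h" "\<delta> \<le> r / 4"
  proof -
   show "0 < \<delta>" "\<delta> \<le> h" using m h by (auto simp: \<delta>_def mult_le_cancel_right1)
   have "m * h \<le> r / (4 * D) * D" using m h r D by (intro mult_mono) auto
   then show "\<delta> \<le> r / 4" using D by (simp add: \<delta>_def)
  qed
  have qp: "q \<in> ball p r" using q r by auto
  have qle: "q \<bullet> \<nu> \<le> \<phi> (q - (q \<bullet> \<nu>) *\<^sub>R \<nu>)"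
  proof (rule ccontr)
   assume "\<not> ?thesis"
   then have "q \<in> W \<inter> ball p r" unfolding eq using qp by simp
   then show False using q by simp
  qed
  have "x \<notin> W" if x: "x \<in> cball (q - \<delta> *\<^sub>R \<nu>) (\<eta> * \<delta>)" for x
  proof
   assume xO: "x \<in> W"
   define w where "w = x - (q - \<delta> *\<^sub>R \<nu>)"
   have w: "norm w \<le> \<eta> * \<delta>" using x by (simp add: w_def dist_norm norm_minus_commute)
   have xw: "x = q - \<delta> *\<^sub>R \<nu> + w" by (simp add: w_def)
   have "\<eta> * \<delta> \<le> 1 / 2 * (r / 4)" using \<eta> \<delta> by (intro mult_mono) auto
   then have w8: "norm w \<le> r / 8" using w by simp
   have px: "p - x = (p - q) + \<delta> *\<^sub>R \<nu> - w" by (simp add: xw)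
   have "norm (p - x) \<le> norm (p - q) + norm (\<delta> *\<^sub>R \<nu>) + norm w"
    using norm_triangle_ineq4[of "(p - q) + \<delta> *\<^sub>R \<nu>" w] norm_triangle_ineq[of "p - q" "\<delta> *\<^sub>R \<nu>"] unfolding px by (rule order_trans[OF _ add_right_mono])
   moreover have "norm (\<delta> *\<^sub>R \<nu>) = \<delta>" using nu \<delta> by simp
   moreover have "norm (p - q) < r / 2" using q by (simp add: dist_norm)
   ultimately have "norm (p - x) < r" using \<delta> w8 r by linarith
   then have xb: "x \<in> ball p r" by (simp add: dist_norm)
   then have gt: "\<phi> (x - (x \<bullet> \<nu>) *\<^sub>R \<nu>) < x \<bullet> \<nu>" using xO eq by blast
   have xn: "x \<bullet> \<nu> = q \<bullet> \<nu> - \<delta> + w \<bullet> \<nu>" by (simp add: xw inner_add_left inner_diff_left nn)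
   have wn: "w \<bullet> \<nu> \<le> norm w" "\<bar>w \<bullet> \<nu>\<bar> \<le> norm w" using Cauchy_Schwarz_ineq2[of w \<nu>] nu by auto
   have pd: "(x - (x \<bullet> \<nu>) *\<^sub>R \<nu>) - (q - (q \<bullet> \<nu>) *\<^sub>R \<nu>) = w - (w \<bullet> \<nu>) *\<^sub>R \<nu>"
    unfolding xn by (simp add: xw algebra_simps)
   have perp: "(y - (y \<bullet> \<nu>) *\<^sub>R \<nu>) \<in> {y. y \<bullet> \<nu> = 0}" for y by (simp add: inner_diff_left nn)
   have "dist (\<phi> (x - (x \<bullet> \<nu>) *\<^sub>R \<nu>)) (\<phi> (q - (q \<bullet> \<nu>) *\<^sub>R \<nu>))
     \<le> B * dist (x - (x \<bullet> \<nu>) *\<^sub>R \<nu>) (q - (q \<bullet> \<nu>) *\<^sub>R \<nu>)"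
    by (rule lipschitz_onD[OF lip perp perp])
   also have "... = B * norm (w - (w \<bullet> \<nu>) *\<^sub>R \<nu>)" by (simp only: dist_norm pd)
   also have "... \<le> B * (norm w + \<bar>w \<bullet> \<nu>\<bar>)"
    using norm_triangle_ineq4[of w "(w \<bullet> \<nu>) *\<^sub>R \<nu>"] nu B by (intro mult_left_mono) auto
   also have "... \<le> B * (2 * norm w)" using wn B by (intro mult_left_mono) auto
   also have "... \<le> B * (2 * (\<eta> * \<delta>))" using w B by (intro mult_left_mono) auto
   finally have "\<phi> (q - (q \<bullet> \<nu>) *\<^sub>R \<nu>) - \<phi> (x - (x \<bullet> \<nu>) *\<^sub>R \<nu>) \<le> B * (2 * (\<eta> * \<delta>))"
    unfolding dist_real_def by linarith
   also have "... = 2 * B * \<eta> * \<delta>" by simp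
   finally have "\<phi> (q - (q \<bullet> \<nu>) *\<^sub>R \<nu>) - \<phi> (x - (x \<bullet> \<nu>) *\<^sub>R \<nu>) \<le> 2 * B * \<eta> * \<delta>" .
   then have "\<delta> < 2 * B * \<eta> * \<delta> + \<eta> * \<delta>" using gt qle xn wn(1) w by linarith
   also have "... = (2 * B * \<eta> + \<eta>) * \<delta>" by (simp add: algebra_simps)
   also have "... \<le> 1 * \<delta>" using \<eta>1 \<delta> by (intro mult_right_mono) auto
   finally show False by simp
  qed
  moreover have "norm ((q - \<delta> *\<^sub>R \<nu>) - q) \<le> h" using nu \<delta> by simp
  ultimately show ?thesis unfolding mult.assoc \<delta>_def[symmetric] by blast
 qed
 moreover have "0 < r / 2" "0 < \<eta> * m" using r \<eta> m by auto
 ultimately show ?thesis by blast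
qed

lemma exterior_balls:
 fixes W :: "(real^'n) set"
 assumes L: "lipschitz_boundary W" and b: "bounded W" "open W" and D: "0 < D"
 shows "\<exists>\<kappa>>0. \<kappa> \<le> 1 \<and> (\<forall>q\<in>frontier W. \<forall>h. 0 < h \<and> h \<le> D --> (\<exists>y. norm (y - q) \<le> h \<and> cball y (\<kappa> * h) \<inter> W = {}))"
proof -
 have "\<forall>p\<in>frontier W. \<exists>rk. 0 < fst rk \<and> 0 < snd rk \<and> (\<forall>q\<in>ball p (fst rk) - W. \<forall>h. 0 < h \<and> h \<le> D -->
   (\<exists>y. norm (y - q) \<le> h \<and> cball y (snd rk * h) \<inter> W = {}))"
  using exterior_ball_local[OF L _ D] by (metis fst_conv snd_conv)
 from bchoice[OF this] obtain rk where rk: "\<And>p. p \<in> frontier W ==> 0 < fst (rk p) \<and> 0 < snd (rk p) \<and>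
   (\<forall>q\<in>ball p (fst (rk p)) - W. \<forall>h. 0 < h \<and> h \<le> D --> (\<exists>y. norm (y - q) \<le> h \<and> cball y (snd (rk p) * h) \<inter> W = {}))"
  by blast
 have "compact (frontier W)" using b(1) by (simp add: compact_frontier_bounded)
 moreover have "frontier W \<subseteq> (\<Union>p\<in>frontier W. ball p (fst (rk p)))" using rk by force
 ultimately obtain P where P: "P \<subseteq> frontier W" "finite P" "frontier W \<subseteq> (\<Union>p\<in>P. ball p (fst (rk p)))"
  using compactE_image[of "frontier W" "frontier W" "\<lambda>p. ball p (fst (rk p))"] by auto
 define \<kappa> where "\<kappa> = Min (insert 1 ((\<lambda>p. snd (rk p)) ` P))"
 have \<kappa>: "0 < \<kappa>" "\<kappa> \<le> 1" "\<And>p. p \<in> P ==> \<kappa> \<le> snd (rk p)"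
  unfolding \<kappa>_def using P(2) rk P(1) by (auto intro!: Min_le)
 have "\<exists>y. norm (y - q) \<le> h \<and> cball y (\<kappa> * h) \<inter> W = {}" if q: "q \<in> frontier W" and h: "0 < h" "h \<le> D" for q h
 proof -
  obtain p where p: "p \<in> P" "q \<in> ball p (fst (rk p))" using P(3) q by blast
  have "q \<notin> W" using q b(2) by (simp add: frontier_def interior_open)
  then obtain y where y: "norm (y - q) \<le> h" "cball y (snd (rk p) * h) \<inter> W = {}"
   using rk[of p] p P(1) h by blast
  have "cball y (\<kappa> * h) \<subseteq> cball y (snd (rk p) * h)"
   using \<kappa>(3)[OF p(1)] h by (intro subset_cball mult_right_mono) auto
  with y show ?thesis by blast
 qed
 with \<kappa> show ?thesis by blast
qed

section \<open>The quasi-interpolant\<close>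

text \<open>The interpolant vanishes on all elements that meet the boundary, so its support is a finite union of elements
inside \<open>W\<close>. It is Lipschitz because a segment is covered by finitely many closed sets (the elements and the
complement of \<open>W\<close>) on each of which it is Lipschitz.\<close>

lemma interp_in_Vh:
 fixes W :: "(real^'n) set"
 assumes O: "open W" "bounded W" and T: "triangulation S" "\<Union>S = closure W"
  and m: "\<And>K p. K \<in> S ==> K \<inter> frontier W ~= {} ==> p \<in> verts K ==> m p = 0"
 shows "interp S m \<in> Vh W S"
proof -
 define v where "v = interp S m"
 have finS: "finite S" using triangulationD(1)[OF T(1)] .
 have "\<forall>K\<in>S. \<exists>cl. linear (snd cl) \<and> (\<forall>x\<in>K. v x = fst cl + (snd cl x :: complex))"
 proof
  fix K assume "K \<in> S"
  from interp_affine[OF T(1) this, of m] obtain c l where "linear l" "\<forall>x\<in>K. v x = c + l x" unfolding v_def by blast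
  then show "\<exists>cl. linear (snd cl) \<and> (\<forall>x\<in>K. v x = fst cl + snd cl x)" by (intro exI[of _ "(c, l)"]) simp
 qed
 from bchoice[OF this] obtain F where F: "\<forall>K\<in>S. linear (snd (F K)) \<and> (\<forall>x\<in>K. v x = fst (F K) + snd (F K) x)" ..
 define c l where "c K = fst (F K)" and "l K = snd (F K)" for K
 have l: "linear (l K)" and vl: "\<And>x. x \<in> K ==> v x = c K + l K x" if "K \<in> S" for K
  using F that by (auto simp: c_def l_def)
 have bl: "bounded_linear (l K)" if "K \<in> S" for K using l[OF that] by (simp add: linear_conv_bounded_linear)
 define A where "A = \<Union>{K \<in> S. K \<inter> frontier W = {}}"
 have vz: "v x = 0" if "x \<notin> A" for x
 proof (cases "x \<in> \<Union>S")
  case True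
  then obtain K where K: "K \<in> S" "x \<in> K" by blast
  then have "K \<inter> frontier W ~= {}" using that by (auto simp: A_def)
  then have "m p = 0" if "p \<in> verts K" for p using m K(1) that by blast
  then show ?thesis unfolding v_def interp_on_simplex[OF T(1) K] by simp
 qed (simp add: v_def interp_outside)
 have cA: "compact A" unfolding A_def using finS triangulation_closed_compact(1)[OF T(1)] by (intro compact_Union) auto
 have AO: "A \<subseteq> W"
 proof
  fix x assume "x \<in> A"
  then obtain K where K: "K \<in> S" "K \<inter> frontier W = {}" "x \<in> K" by (auto simp: A_def)
  then have "x \<in> closure W" using T(2) by blast
  moreover have "x \<notin> frontier W" using K by blast
  ultimately show "x \<in> W" using interior_open[OF O(1)] by (simp add: frontier_def)
 qed
 define L where "L = (\<Sum>K\<in>S. onorm (l K))"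
 have on0: "0 \<le> onorm (l K)" if "K \<in> S" for K using onorm_pos_le[OF bl[OF that]] .
 have L0: "0 \<le> L" unfolding L_def using on0 by (rule sum_nonneg)
 have Lle: "onorm (l K) \<le> L" if "K \<in> S" for K unfolding L_def using that finS on0 by (intro member_le_sum) auto
 have lipK: "cmod (v x - v y) \<le> L * norm (x - y)" if "K \<in> S" "x \<in> K" "y \<in> K" for K x y
 proof -
  have "v x - v y = l K (x - y)" using vl[OF that(1)] that by (simp add: linear_diff[OF l[OF that(1)]])
  then have "cmod (v x - v y) \<le> onorm (l K) * norm (x - y)" using onorm[OF bl[OF that(1)], of "x - y"] by simp
  also have "... \<le> L * norm (x - y)" using Lle[OF that(1)] by (intro mult_right_mono) auto
  finally show ?thesis .
 qed
 have lip: "cmod (v x - v y) \<le> L * norm (x - y)" for x y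
 proof -
  define \<gamma> where "\<gamma> t = x + t *\<^sub>R (y - x)" for t :: real
  define U where "U K = {t. \<gamma> t \<in> K}" for K
  have cont: "continuous_on UNIV \<gamma>" unfolding \<gamma>_def by (intro continuous_intros)
  have \<gamma>d: "norm (\<gamma> s - \<gamma> t) = \<bar>s - t\<bar> * norm (y - x)" for s t
  proof -
   have "\<gamma> s - \<gamma> t = (s - t) *\<^sub>R (y - x)" by (simp add: \<gamma>_def scaleR_diff_left)
   then show ?thesis by simp
  qed
  have clU: "closed (U K)" if "K \<in> insert (- W) S" for K
  proof -
   have "closed K" using that O(1) triangulation_closed_compact(3)[OF T(1)] by auto
   then have "closed (\<gamma> -` K)" using cont by (rule closed_vimage)
   then show ?thesis by (simp add: U_def vimage_def)
  qed
  have "lipschitz_on (L * norm (y - x)) {0..1} (\<lambda>t. v (\<gamma> t))"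
  proof (rule lipschitz_on_closed_Union[where I = "insert (- W) S" and U = U])
   fix K assume K: "K \<in> insert (- W) S"
   show "lipschitz_on (L * norm (y - x)) (U K) (\<lambda>t. v (\<gamma> t))"
   proof (rule lipschitz_onI)
    fix s t assume st: "s \<in> U K" "t \<in> U K"
    have "cmod (v (\<gamma> s) - v (\<gamma> t)) \<le> L * norm (\<gamma> s - \<gamma> t)"
    proof (cases "K \<in> S")
     case True
     then show ?thesis using st lipK by (simp add: U_def)
    next
     case False
     then have "\<gamma> s \<notin> W" "\<gamma> t \<notin> W" using K st by (auto simp: U_def)
     then have "v (\<gamma> s) = 0" "v (\<gamma> t) = 0" using vz AO by blast+
     then show ?thesis using L0 by simp
    qed
    then show "dist (v (\<gamma> s)) (v (\<gamma> t)) \<le> L * norm (y - x) * dist s t"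
     by (simp add: dist_norm \<gamma>d dist_real_def mult_ac)
   qed (use L0 in simp)
  next
   show "{0..1} \<subseteq> (\<Union>i\<in>insert (- W) S. U i)"
   proof
    fix t
    have "\<gamma> t \<in> - W \<or> \<gamma> t \<in> \<Union>S" using T(2) closure_subset[of W] by blast
    then show "t \<in> (\<Union>i\<in>insert (- W) S. U i)" by (auto simp: U_def)
   qed
  qed (use clU finS L0 in auto)
  from lipschitz_onD[OF this, of 0 1] have "dist (v x) (v y) \<le> L * norm (y - x)" by (simp add: \<gamma>_def)
  then show ?thesis by (simp add: dist_norm norm_minus_commute)
 qed
 define g where "g i x = (\<Sum>K\<in>S. indicator (interior K) x * l K (axis i 1))" for i x
 have gm: "g i \<in> borel_measurable lebesgue" for i
  unfolding g_def[abs_def] by (intro borel_measurable_sum borel_measurable_times borel_measurable_indicator borel_measurable_const) auto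
 have gb: "cmod (g i x) \<le> (\<Sum>j\<in>UNIV. \<Sum>K\<in>S. cmod (l K (axis j 1)))" for i x
 proof -
  have "cmod (g i x) \<le> (\<Sum>K\<in>S. cmod (indicator (interior K) x * l K (axis i 1)))" unfolding g_def by (rule norm_sum)
  also have "... \<le> (\<Sum>K\<in>S. cmod (l K (axis i 1)))" by (intro sum_mono) (simp add: norm_mult indicator_def)
  also have "... \<le> (\<Sum>j\<in>UNIV. \<Sum>K\<in>S. cmod (l K (axis j 1)))" by (intro member_le_sum sum_nonneg) auto
  finally show ?thesis .
 qed
 have loc: "AE x in lebesgue. \<exists>\<delta>>0. \<exists>l. linear l \<and> (\<forall>i. g i x = l (axis i 1)) \<and> (\<forall>y\<in>ball x \<delta>. v y = v x + l (y - x))"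
  using AE_not_frontier[OF T(1)]
 proof eventually_elim
  case (elim x)
  show ?case
  proof (cases "x \<in> \<Union>S")
   case True
   then obtain K where K: "K \<in> S" "x \<in> K" by blast
   have xi: "x \<in> interior K" using elim K triangulation_closed_compact(3)[OF T(1) K(1)] by (auto simp: frontier_def)
   then obtain \<delta> where d: "0 < \<delta>" "ball x \<delta> \<subseteq> K" unfolding mem_interior by blast
   have "g i x = l K (axis i 1)" for i
   proof -
    have "g i x = (\<Sum>K'\<in>{K}. indicator (interior K') x * l K' (axis i 1))"
     unfolding g_def
    proof (rule sum.mono_neutral_right[OF finS])
     show "\<forall>K'\<in>S - {K}. indicator (interior K') x * l K' (axis i 1) = 0"
     proof
      fix K' assume K': "K' \<in> S - {K}"
      then have "x \<notin> interior K'" using triangulation_interior_disjoint[OF T(1) _ K(1) _ xi] by blast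
      then show "indicator (interior K') x * l K' (axis i 1) = 0" by simp
     qed
    qed (use K in auto)
    then show ?thesis using xi by simp
   qed
   moreover have "v y = v x + l K (y - x)" if "y \<in> ball x \<delta>" for y
   proof -
    have "y \<in> K" using d(2) that by blast
    then show ?thesis using vl[OF K(1)] K(2) by (simp add: linear_diff[OF l[OF K(1)]])
   qed
   ultimately have G: "\<forall>i. g i x = l K (axis i 1)" and V: "\<forall>y\<in>ball x \<delta>. v y = v x + l K (y - x)" by simp_all
   show ?thesis
    by (rule exI[of _ \<delta>], rule conjI[OF d(1)], rule exI[of _ "l K"], rule conjI[OF l[OF K(1)] conjI[OF G V]])
  next
   case False
   then have "x \<in> - closure W" using T(2) by simp
   moreover have "open (- closure W)" by (simp add: open_closed)
   ultimately obtain \<delta> where d: "0 < \<delta>" "ball x \<delta> \<subseteq> - closure W" using open_contains_ball by blast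
   have "v y = 0" if "y \<in> ball x \<delta>" for y
   proof -
    have "y \<notin> \<Union>S" using d(2) that T(2) by auto
    then show ?thesis by (simp add: v_def interp_outside)
   qed
   moreover have "g i x = 0" for i
   proof -
    have "x \<notin> interior K" if "K \<in> S" for K using False that interior_subset[of K] by blast
    then show ?thesis by (simp add: g_def)
   qed
   moreover have "x \<in> ball x \<delta>" using d(1) by simp
   ultimately have G: "\<forall>i. g i x = (\<lambda>_. 0) (axis i (1 :: real) :: real^'n)"
    and V: "\<forall>y\<in>ball x \<delta>. v y = v x + (\<lambda>_. 0) (y - x)" by simp_all
   show ?thesis
    by (rule exI[of _ \<delta>], rule conjI[OF d(1)], rule exI[of _ "\<lambda>_. 0"], rule conjI[OF linear_zero conjI[OF G V]])
  qed
 qed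
 have "v \<in> H10 W" by (rule lipschitz_local_affine_in_H10(1)[OF O cA AO vz lip gm gb loc])
 moreover have "v x = 0" if "x \<notin> W" for x using vz AO that by blast
 moreover have "continuous_on (closure W) v" using lipschitz_bound_imp_continuous(2)[OF lip] by (rule continuous_on_subset) simp
 moreover have "\<forall>K\<in>S. \<exists>c l. linear l \<and> (\<forall>x\<in>K. v x = c + l x)" using l vl by blast
 ultimately show ?thesis unfolding Vh_def v_def[symmetric] by blast
qed

text \<open>The local oscillation that bounds all interpolation errors pointwise. Since it is a function of \<open>x\<close> alone, summing
over elements needs no overlap count.\<close>

definition osc :: "(real^'n => complex) => real => real^'n => real" where
 "osc \<phi> \<rho> x = L2_nrm (cball 0 \<rho>) (\<lambda>w. \<phi> (x + w) - \<phi> x)"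

lemma continuous_L2_cball:
 fixes u :: "real^'n => complex"
 assumes "continuous_on UNIV u"
 shows "u \<in> L2 (cball c r)"
proof -
 have m: "u \<in> borel_measurable lebesgue" using continuous_on_UNIV_lebesgue_measurable(1)[OF assms] .
 have "bounded (u ` cball c r)"
  using assms by (intro compact_imp_bounded compact_continuous_image) (auto intro: continuous_on_subset)
 then obtain B where "\<forall>y\<in>u ` cball c r. cmod y \<le> B" unfolding bounded_iff ..
 then have B: "cmod (u x) \<le> B" if "x \<in> cball c r" for x using that by blast
 have fin: "emeasure lebesgue (cball c r) < \<infinity>" using emeasure_bounded_finite[OF bounded_cball, of c r] by simp
 have const: "integrable (lebesgue_on (cball c r)) (\<lambda>x. B\<^sup>2)"
  using fin by (intro integrable_const finite_measure.integrable_const finite_measureI) (simp add: emeasure_restrict_space)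
 have "integrable (lebesgue_on (cball c r)) (\<lambda>x. (cmod (u x))^2)"
 proof (rule Bochner_Integration.integrable_bound[OF const])
  show "(\<lambda>x. (cmod (u x))^2) \<in> borel_measurable (lebesgue_on (cball c r))"
   using m by (intro measurable_restrict_space1) measurable
  show "AE x in lebesgue_on (cball c r). norm ((cmod (u x))^2) \<le> norm (B\<^sup>2)"
   using B by (intro AE_I2) (auto intro!: power_mono)
 qed
 then show ?thesis using m by (simp add: L2_def measurable_restrict_space1)
qed

lemma osc_nonneg: "0 \<le> osc \<phi> \<rho> x"
 by (simp add: osc_def L2_nrm_nonneg)

lemma cball_lebesgue: "cball c r \<in> sets lebesgue" for c :: "real^'n"
 by simp

lemma osc_nn:
 fixes \<phi> :: "real^'n => complex"
 assumes "continuous_on UNIV \<phi>"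
 shows "ennreal ((osc \<phi> \<rho> x)^2) = (\<integral>\<^sup>+w. indicator (cball 0 \<rho>) w * ennreal ((cmod (\<phi> (x + w) - \<phi> x))^2) \<partial>lborel)"
proof -
 have "continuous_on UNIV (\<lambda>w. \<phi> (x + w) - \<phi> x)"
  by (intro continuous_intros continuous_on_compose2[OF assms]) auto
 then have "(\<lambda>w. \<phi> (x + w) - \<phi> x) \<in> L2 (cball 0 \<rho>)" by (rule continuous_L2_cball)
 from nn_integral_L2_off(1)[OF cball_lebesgue this] show ?thesis
  unfolding osc_def nn_integral_completion by (rule sym)
qed

lemma osc_measurable_integrand:
 fixes \<phi> :: "real^'n => complex"
 assumes "continuous_on UNIV \<phi>"
 shows "(\<lambda>(x, w). indicator (cball 0 \<rho>) w * ennreal ((cmod (\<phi> (x + w) - \<phi> x))^2)) \<in> borel_measurable (lborel \<Otimes>\<^sub>M lborel)"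
proof -
 have b: "borel_measurable (lborel \<Otimes>\<^sub>M lborel) = borel_measurable (borel :: ((real^'n) \<times> (real^'n)) measure)"
  by (rule measurable_cong_sets) (simp_all only: lborel_prod sets_lborel)
 have "continuous_on UNIV (\<lambda>xw :: (real^'n) \<times> (real^'n). (cmod (\<phi> (fst xw + snd xw) - \<phi> (fst xw)))^2)"
  by (intro continuous_intros continuous_on_compose2[OF assms]) auto
 then have "(\<lambda>xw. (cmod (\<phi> (fst xw + snd xw) - \<phi> (fst xw)))^2) \<in> borel_measurable borel"
  by (rule borel_measurable_continuous_onI)
 moreover have "snd -` cball 0 \<rho> \<in> sets (borel :: ((real^'n) \<times> (real^'n)) measure)"
  by (intro borel_closed closed_vimage continuous_intros) auto
 then have "(\<lambda>xw. indicator (snd -` cball 0 \<rho>) xw :: ennreal) \<in> borel_measurable (borel :: ((real^'n) \<times> (real^'n)) measure)"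
  by (rule borel_measurable_indicator)
 ultimately have "(\<lambda>xw. indicator (snd -` cball 0 \<rho>) xw * ennreal ((cmod (\<phi> (fst xw + snd xw) - \<phi> (fst xw)))^2)) \<in> borel_measurable borel"
  by (intro borel_measurable_times_ennreal measurable_compose[OF _ measurable_ennreal])
 then show ?thesis unfolding b by (simp add: case_prod_unfold indicator_def vimage_def)
qed

text \<open>Exchanging the order of integration leaves translation estimates for the test function.\<close>

lemma osc_integral:
 fixes \<phi> :: "real^'n => complex"
 assumes t: "\<phi> \<in> test_functions W" and r: "0 \<le> \<rho>"
 shows "(\<lambda>x. ennreal ((osc \<phi> \<rho> x)^2)) \<in> borel_measurable lborel"
  and "(\<integral>\<^sup>+x. ennreal ((osc \<phi> \<rho> x)^2) \<partial>lborel)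
   \<le> ennreal (\<rho>\<^sup>2 * (\<Sum>i\<in>UNIV. (L2_nrm UNIV (pdiff i \<phi>))^2) * ball_vol TYPE('n) \<rho>)"
proof -
 have c: "continuous_on UNIV \<phi>" by (rule test_functionsD(2)[OF t])
 let ?F = "\<lambda>x w. indicator (cball 0 \<rho>) w * ennreal ((cmod (\<phi> (x + w) - \<phi> x))^2)"
 let ?G = "\<Sum>i\<in>UNIV. (L2_nrm UNIV (pdiff i \<phi>))^2"
 have G: "0 \<le> ?G" by (intro sum_nonneg) auto
 note mF = osc_measurable_integrand[OF c, of \<rho>]
 show "(\<lambda>x. ennreal ((osc \<phi> \<rho> x)^2)) \<in> borel_measurable lborel"
  unfolding osc_nn[OF c] using mF by (rule lborel.borel_measurable_nn_integral)
 have "(\<integral>\<^sup>+x. ennreal ((osc \<phi> \<rho> x)^2) \<partial>lborel) = (\<integral>\<^sup>+x. \<integral>\<^sup>+w. ?F x w \<partial>lborel \<partial>lborel)"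
  unfolding osc_nn[OF c] ..
 also have "... = (\<integral>\<^sup>+w. \<integral>\<^sup>+x. ?F x w \<partial>lborel \<partial>lborel)" using mF by (rule lborel_pair.Fubini'[symmetric])
 also have "... \<le> (\<integral>\<^sup>+w. ennreal (\<rho>\<^sup>2 * ?G) * indicator (cball 0 \<rho>) (w :: real^'n) \<partial>lborel)"
 proof (rule nn_integral_mono)
  fix w :: "real^'n"
  show "(\<integral>\<^sup>+x. ?F x w \<partial>lborel) \<le> ennreal (\<rho>\<^sup>2 * ?G) * indicator (cball 0 \<rho>) w"
  proof (cases "norm w \<le> \<rho>")
   case True
   have dL2: "(\<lambda>x. \<phi> (x + w) - \<phi> x) \<in> L2 UNIV" by (rule L2_diff[OF test_functions_translate_L2[OF t] test_functions_L2[OF t]]) simp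
   have "(\<integral>\<^sup>+x. ?F x w \<partial>lborel) = (\<integral>\<^sup>+x. indicator UNIV x * ennreal ((cmod (\<phi> (x + w) - \<phi> x))^2) \<partial>lebesgue)"
    using True by (simp add: nn_integral_completion)
   also have "... = ennreal ((L2_nrm UNIV (\<lambda>x. \<phi> (x + w) - \<phi> x))^2)" by (rule nn_integral_L2_off(1)[OF _ dL2]) simp
   also have "... \<le> ennreal (\<rho>\<^sup>2 * ?G)"
   proof (rule ennreal_leI)
    have "L2_nrm UNIV (\<lambda>x. \<phi> (x + w) - \<phi> x) \<le> norm w * sqrt ?G" by (rule test_functions_translation_estimate[OF t])
    also have "... \<le> \<rho> * sqrt ?G" using True G by (intro mult_right_mono) auto
    finally have "(L2_nrm UNIV (\<lambda>x. \<phi> (x + w) - \<phi> x))^2 \<le> (\<rho> * sqrt ?G)^2" by (intro power_mono L2_nrm_nonneg)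
    then show "(L2_nrm UNIV (\<lambda>x. \<phi> (x + w) - \<phi> x))^2 \<le> \<rho>\<^sup>2 * ?G" using G by (simp add: power_mult_distrib)
   qed
   finally show ?thesis using True by simp
  qed simp
 qed
 also have "... = ennreal (\<rho>\<^sup>2 * ?G) * ennreal (ball_vol TYPE('n) \<rho>)"
  by (subst nn_integral_cmult_indicator) (simp_all add: emeasure_cball_vec[OF r])
 also have "... = ennreal (\<rho>\<^sup>2 * ?G * ball_vol TYPE('n) \<rho>)" using G r by (intro ennreal_mult'[symmetric] mult_nonneg_nonneg) auto
 finally show "(\<integral>\<^sup>+x. ennreal ((osc \<phi> \<rho> x)^2) \<partial>lborel) \<le> ennreal (\<rho>\<^sup>2 * ?G * ball_vol TYPE('n) \<rho>)" .
qed

definition ball_mean :: "(real^'n => complex) => real => real^'n => complex" where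
 "ball_mean \<phi> s c = integral\<^sup>L (lebesgue_on (cball c s)) \<phi> / of_real (ball_vol TYPE('n) s)"

lemma ball_mean_bound:
 fixes \<phi> :: "real^'n => complex"
 assumes c: "continuous_on UNIV \<phi>" and s: "0 < s" and sub: "cball z s \<subseteq> cball x \<rho>"
 shows "cmod (\<phi> x - ball_mean \<phi> s z) \<le> osc \<phi> \<rho> x / sqrt (ball_vol TYPE('n) s)"
proof -
 let ?B = "cball z s" and ?V = "ball_vol TYPE('n) s"
 have V: "0 < ?V" using ball_vol_pos[OF s] .
 define u where "u y = \<phi> x - \<phi> y" for y
 have u: "continuous_on UNIV u" unfolding u_def by (intro continuous_intros c)
 have uL: "u \<in> L2 ?B" using u by (rule continuous_L2_cball)
 have oL: "(\<lambda>y. 1) \<in> L2 ?B" by (intro continuous_L2_cball continuous_intros)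
 have cL: "(\<lambda>y. \<phi> x) \<in> L2 ?B" by (intro continuous_L2_cball continuous_intros)
 have pL: "\<phi> \<in> L2 ?B" using c by (rule continuous_L2_cball)
 have mB: "measure lebesgue ?B = ?V"
  using emeasure_cball_vec[of s z] s V by (simp add: measure_def)
 have ms: "measure (lebesgue_on ?B) ?B = ?V"
  using mB by (subst measure_restrict_space) auto
 have one: "(L2_nrm ?B (\<lambda>y. 1))^2 = ?V"
  unfolding L2_nrm_square by (simp add: ms)
 have "ip ?B u (\<lambda>y. 1) = ip ?B (\<lambda>y. \<phi> x) (\<lambda>y. 1) - ip ?B \<phi> (\<lambda>y. 1)"
  unfolding u_def using ip_diff_left[OF cL pL oL] .
 also have "ip ?B (\<lambda>y. \<phi> x) (\<lambda>y. 1) = of_real ?V * \<phi> x" 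
  unfolding ip_def by (simp add: ms scaleR_conv_of_real)
 also have "ip ?B \<phi> (\<lambda>y. 1) = of_real ?V * ball_mean \<phi> s z" using V by (simp add: ip_def ball_mean_def)
 finally have "cmod (ip ?B u (\<lambda>y. 1)) = ?V * cmod (\<phi> x - ball_mean \<phi> s z)"
  using V by (simp add: norm_mult flip: right_diff_distrib)
 then have 1: "?V * cmod (\<phi> x - ball_mean \<phi> s z) \<le> L2_nrm ?B u * sqrt ?V"
  using cmod_ip_le(2)[OF uL oL] unfolding real_sqrt_unique[OF one L2_nrm_nonneg] by simp
 have mm: "(\<lambda>y. indicator (cball x \<rho>) y * ennreal ((cmod (u y))^2)) \<in> borel_measurable borel"
  by (intro borel_measurable_times_ennreal borel_measurable_indicator measurable_compose[OF _ measurable_ennreal]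
    borel_measurable_continuous_onI continuous_intros u) auto
 have "ennreal ((L2_nrm ?B u)^2) = (\<integral>\<^sup>+y. indicator ?B y * ennreal ((cmod (u y))^2) \<partial>lborel)"
  using nn_integral_L2_off(1)[OF cball_lebesgue uL] by (simp add: nn_integral_completion)
 also have "... \<le> (\<integral>\<^sup>+y. indicator (cball x \<rho>) y * ennreal ((cmod (u y))^2) \<partial>lborel)"
  using sub by (intro nn_integral_mono) (auto simp: indicator_def)
 also have "... = (\<integral>\<^sup>+w. indicator (cball x \<rho>) (w + x) * ennreal ((cmod (u (w + x)))^2) \<partial>lborel)"
  using nn_integral_translate[OF mm, of x] by simp
 also have "... = ennreal ((osc \<phi> \<rho> x)^2)"
  unfolding osc_nn[OF c] by (intro nn_integral_cong) (auto simp: u_def indicator_def dist_norm norm_minus_commute add.commute)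
 finally have "(L2_nrm ?B u)^2 \<le> (osc \<phi> \<rho> x)^2" by (subst (asm) ennreal_le_iff) auto
 then have "L2_nrm ?B u \<le> osc \<phi> \<rho> x" using osc_nonneg by (rule power2_le_imp_le)
 then have "?V * cmod (\<phi> x - ball_mean \<phi> s z) \<le> osc \<phi> \<rho> x * sqrt ?V"
  using 1 V by (intro order_trans[OF 1] mult_right_mono) auto
 then have "sqrt ?V * (sqrt ?V * cmod (\<phi> x - ball_mean \<phi> s z)) \<le> sqrt ?V * osc \<phi> \<rho> x" 
  using V by (simp add: mult.assoc[symmetric] mult.commute)
 then have "sqrt ?V * cmod (\<phi> x - ball_mean \<phi> s z) \<le> osc \<phi> \<rho> x" using V by (subst (asm) mult_le_cancel_left_pos) auto
 then show ?thesis using V by (simp add: le_divide_eq mult.commute)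
qed

lemma convex_combination_bound:
 fixes a :: "'p => complex" and w :: "'p => real"
 assumes "\<And>p. p \<in> P ==> 0 \<le> w p" "sum w P = 1" "\<And>p. p \<in> P ==> cmod (a p - z) \<le> B"
 shows "cmod ((\<Sum>p\<in>P. a p * of_real (w p)) - z) \<le> B"
proof -
 have "(\<Sum>p\<in>P. z * of_real (w p)) = z * of_real (sum w P)" by (simp add: sum_distrib_left)
 then have "(\<Sum>p\<in>P. a p * of_real (w p)) - z = (\<Sum>p\<in>P. (a p - z) * of_real (w p))"
  using assms(2) by (simp add: left_diff_distrib sum_subtractf)
 also have "cmod ... \<le> (\<Sum>p\<in>P. cmod ((a p - z) * of_real (w p)))" by (rule norm_sum)
 also have "... \<le> (\<Sum>p\<in>P. B * w p)"
 proof (rule sum_mono)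
  fix p assume p: "p \<in> P"
  show "cmod ((a p - z) * of_real (w p)) \<le> B * w p"
   using mult_right_mono[OF assms(3)[OF p] assms(1)[OF p]] assms(1)[OF p] by (simp add: norm_mult)
 qed
 also have "... = B" using assms(2) by (simp flip: sum_distrib_left)
 finally show ?thesis .
qed

definition interp_const :: "'n itself => real => real" where
 "interp_const TYPE('n) \<kappa> = 4 * sqrt ((4 / \<kappa>) ^ CARD('n))"

lemma osc_mean_square:
 fixes \<phi> :: "real^'n => complex"
 assumes t: "\<phi> \<in> test_functions W" and k: "0 < \<kappa>" and h: "0 < h"
 defines "G \<equiv> sqrt (\<Sum>i\<in>UNIV. (L2_nrm UNIV (pdiff i \<phi>))^2)"
  and "e \<equiv> \<lambda>x. osc \<phi> (4 * h) x / sqrt (ball_vol TYPE('n) (\<kappa> * h))"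
 shows "(\<integral>\<^sup>+x. ennreal ((e x)^2) \<partial>lebesgue) \<le> ennreal ((interp_const TYPE('n) \<kappa> * h * G)^2)"
  and "(\<lambda>x. ennreal ((e x)^2)) \<in> borel_measurable lborel"
proof -
 let ?V = "ball_vol TYPE('n) (\<kappa> * h)"
 have V: "0 < ?V" using k h by (intro ball_vol_pos) simp
 have G2: "G\<^sup>2 = (\<Sum>i\<in>UNIV. (L2_nrm UNIV (pdiff i \<phi>))^2)" unfolding G_def by (simp add: sum_nonneg)
 note oi = osc_integral[OF t, of "4 * h"]
 have h4: "0 \<le> 4 * h" using h by simp
 have e2: "ennreal ((e x)^2) = ennreal (1 / ?V) * ennreal ((osc \<phi> (4 * h) x)^2)" for x
  using V by (simp add: e_def power_divide flip: ennreal_mult'')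
 show "(\<lambda>x. ennreal ((e x)^2)) \<in> borel_measurable lborel"
  unfolding e2 using oi(1)[OF h4] by measurable
 have "(\<integral>\<^sup>+x. ennreal ((e x)^2) \<partial>lebesgue) = ennreal (1 / ?V) * (\<integral>\<^sup>+x. ennreal ((osc \<phi> (4 * h) x)^2) \<partial>lborel)"
  unfolding e2 nn_integral_completion using oi(1)[OF h4] by (rule nn_integral_cmult)
 also have "... \<le> ennreal (1 / ?V) * ennreal ((4 * h)^2 * G\<^sup>2 * ball_vol TYPE('n) (4 * h))"
  unfolding G2 by (rule mult_left_mono[OF oi(2)[OF h4]]) simp
 also have "ball_vol TYPE('n) (4 * h) = (4 / \<kappa>) ^ CARD('n) * ?V"
  using ball_vol_scale[of "4 / \<kappa>" "\<kappa> * h", where 'n = 'n] k by simp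
 also have "ennreal (1 / ?V) * ennreal ((4 * h)^2 * G\<^sup>2 * ((4 / \<kappa>) ^ CARD('n) * ?V))
   = ennreal (1 / ?V * ((4 * h)^2 * G\<^sup>2 * ((4 / \<kappa>) ^ CARD('n) * ?V)))"
  using V by (intro ennreal_mult'[symmetric]) simp
 also have "1 / ?V * ((4 * h)^2 * G\<^sup>2 * ((4 / \<kappa>) ^ CARD('n) * ?V)) = (interp_const TYPE('n) \<kappa> * h * G)^2"
  using V k by (simp add: interp_const_def power_mult_distrib)
 finally show "(\<integral>\<^sup>+x. ennreal ((e x)^2) \<partial>lebesgue) \<le> ennreal ((interp_const TYPE('n) \<kappa> * h * G)^2)" .
qed

text \<open>The nodal value at \<open>p\<close> is the mean over a ball within distance \<open>2 h\<close> of \<open>p\<close>, exterior to \<open>W\<close> if \<open>p\<close> belongs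
to an element that meets the boundary. All differences of nodal and function values on one element are bounded by
the oscillation over a ball of radius \<open>4 h\<close>.\<close>

lemma quasi_interpolant:
 fixes W :: "(real^'n) set"
 assumes O: "open W" "bounded W" and T: "regular_mesh W S h \<sigma>" and t: "\<phi> \<in> test_functions W"
  and k: "0 < \<kappa>" "\<kappa> \<le> 1"
  and ext: "\<And>q. q \<in> frontier W ==> \<exists>y. norm (y - q) \<le> h \<and> cball y (\<kappa> * h) \<inter> W = {}"
 defines "G \<equiv> sqrt (\<Sum>i\<in>UNIV. (L2_nrm UNIV (pdiff i \<phi>))^2)"
 shows "\<exists>w\<in>Vh W S. L2_nrm W (\<lambda>x. \<phi> x - w x) \<le> interp_const TYPE('n) \<kappa> * h * G
  \<and> (\<forall>i. L2_nrm W (wd W i w) \<le> 2 * sqrt (inverse_const TYPE('n) \<sigma>) * interp_const TYPE('n) \<kappa> * G)"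
proof -
 let ?A = "inverse_const TYPE('n) \<sigma>" and ?c = "interp_const TYPE('n) \<kappa>"
 have tr: "triangulation S" and U: "\<Union>S = closure W" and h: "0 < h" and s: "0 < \<sigma>"
  and K: "\<And>K. K \<in> S ==> diameter K \<le> h \<and> (\<exists>z. cball z (\<sigma> * h) \<subseteq> K)"
  using T by (auto simp: regular_mesh_def)
 have A: "0 < ?A" using s by (rule inverse_const_pos)
 have c0: "0 \<le> ?c" using k by (simp add: interp_const_def)
 have G0: "0 \<le> G" unfolding G_def by (simp add: sum_nonneg)
 note OS = open_lebesgue[OF O(1)]
 have cont: "continuous_on UNIV \<phi>" by (rule test_functionsD(2)[OF t])
 have near: "norm (x - y) \<le> h" if "L \<in> S" "x \<in> L" "y \<in> L" for L x y
 proof -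
  have "bounded L" using triangulation_closed_compact(1)[OF tr that(1)] by (rule compact_imp_bounded)
  then have "dist x y \<le> diameter L" using that by (intro diameter_bounded_bound)
  then show ?thesis using K[OF that(1)] by (simp add: dist_norm)
 qed
 have vK: "p \<in> L" if "p \<in> verts L" for p L using that by (simp add: verts_def extreme_point_of_def)
 define Z where "Z = {p. \<exists>L\<in>S. p \<in> verts L \<and> L \<inter> frontier W ~= {}}"
 have "\<exists>y. norm (y - p) \<le> 2 * h \<and> (p \<in> Z --> cball y (\<kappa> * h) \<inter> W = {})" for p
 proof (cases "p \<in> Z")
  case True
  then obtain L q where L: "L \<in> S" "p \<in> verts L" "q \<in> L" "q \<in> frontier W" by (auto simp: Z_def)
  obtain y where y: "norm (y - q) \<le> h" "cball y (\<kappa> * h) \<inter> W = {}" using ext[OF L(4)] by blast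
  have "norm (y - p) \<le> norm (y - q) + norm (q - p)" using norm_triangle_ineq[of "y - q" "q - p"] by simp
  also have "... \<le> 2 * h" using y(1) near[OF L(1,3) vK[OF L(2)]] by simp
  finally show ?thesis using y(2) by blast
 next
  case False
  then show ?thesis using h by (intro exI[of _ p]) simp
 qed
 then obtain X where X: "\<And>p. norm (X p - p) \<le> 2 * h" "\<And>p. p \<in> Z ==> cball (X p) (\<kappa> * h) \<inter> W = {}"
  by metis
 define m where "m p = ball_mean \<phi> (\<kappa> * h) (X p)" for p
 define e where "e x = osc \<phi> (4 * h) x / sqrt (ball_vol TYPE('n) (\<kappa> * h))" for x
 have kh: "0 < \<kappa> * h" "\<kappa> * h \<le> h" using k h by (auto simp: mult_le_cancel_right1)
 have e0: "0 \<le> e x" for x using ball_vol_pos[OF kh(1), where 'n = 'n] by (simp add: e_def osc_nonneg)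
 note ee = osc_mean_square[OF t k(1) h, folded e_def G_def]
 have me: "cmod (m p - \<phi> x) \<le> e x" if "L \<in> S" "x \<in> L" "p \<in> verts L" for L x p
 proof -
  have "cball (X p) (\<kappa> * h) \<subseteq> cball x (4 * h)"
  proof
   fix y assume "y \<in> cball (X p) (\<kappa> * h)"
   then have "norm (X p - y) \<le> h" using kh by (simp add: dist_norm)
   moreover have "norm (x - p) \<le> h" using near[OF that(1,2) vK[OF that(3)]] .
   moreover have "norm (p - X p) \<le> 2 * h" using X(1)[of p] by (simp add: norm_minus_commute)
   moreover have "norm (x - y) \<le> norm (x - p) + (norm (p - X p) + norm (X p - y))"
    using norm_triangle_ineq[of "x - p" "p - y"] norm_triangle_ineq[of "p - X p" "X p - y"] by simp
   ultimately show "y \<in> cball x (4 * h)" by (simp add: dist_norm)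
  qed
  from ball_mean_bound[OF cont kh(1) this] show ?thesis by (simp add: m_def e_def norm_minus_commute)
 qed
 have m0: "m p = 0" if "L \<in> S" "L \<inter> frontier W ~= {}" "p \<in> verts L" for L p
 proof -
  have "p \<in> Z" using that by (auto simp: Z_def)
  from X(2)[OF this] have z: "\<phi> y = 0" if "y \<in> cball (X p) (\<kappa> * h)" for y using test_functionsD(5)[OF t, of y] that by blast
  have "integral\<^sup>L (lebesgue_on (cball (X p) (\<kappa> * h))) \<phi> = integral\<^sup>L (lebesgue_on (cball (X p) (\<kappa> * h))) (\<lambda>x. 0)"
   by (rule Bochner_Integration.integral_cong[OF refl]) (simp add: z)
  then show ?thesis by (simp add: m_def ball_mean_def)
 qed
 define w where "w = interp S m"
 have wV: "w \<in> Vh W S" unfolding w_def using O tr U m0 by (rule interp_in_Vh)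
 have we: "cmod (w x - z) \<le> B" if "L \<in> S" "x \<in> L" "\<And>p. p \<in> verts L ==> cmod (m p - z) \<le> B" for L x z B
 proof -
  have b: "bary L x (hat S x)" by (rule hat_bary[OF tr that(1,2)])
  show ?thesis unfolding w_def interp_on_simplex[OF tr that(1,2)]
   by (rule convex_combination_bound) (use b that(3) in \<open>auto simp: bary_def\<close>)
 qed
 have diff: "cmod (\<phi> x - w x) \<le> e x" if "x \<in> W" for x
 proof -
  have "x \<in> \<Union>S" using that closure_subset[of W] U by blast
  then obtain L where L: "L \<in> S" "x \<in> L" by blast
  have "cmod (w x - \<phi> x) \<le> e x" by (rule we[OF L me[OF L]])
  then show ?thesis by (simp add: norm_minus_commute)
 qed
 have wL: "w \<in> L2 W" and wH: "w \<in> H1 W" using wV by (auto simp: Vh_def dest: H10_L2 H10_H1)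
 have dL: "(\<lambda>x. \<phi> x - w x) \<in> L2 W" by (rule L2_diff[OF test_functions_L2[OF t OS] wL])
 have "ennreal ((L2_nrm W (\<lambda>x. \<phi> x - w x))^2) = sqint W (\<lambda>x. \<phi> x - w x)"
  by (rule nn_integral_L2_off(1)[OF OS dL, symmetric])
 also have "... \<le> (\<integral>\<^sup>+x. ennreal ((e x)^2) \<partial>lebesgue)"
  using diff by (intro nn_integral_mono) (auto simp: indicator_def intro!: ennreal_leI power_mono)
 also note ee(1)
 finally have "(L2_nrm W (\<lambda>x. \<phi> x - w x))^2 \<le> (?c * h * G)^2" by (subst (asm) ennreal_le_iff) auto
 then have 1: "L2_nrm W (\<lambda>x. \<phi> x - w x) \<le> ?c * h * G"
  using c0 h G0 by (intro power2_le_imp_le[OF _ mult_nonneg_nonneg[OF mult_nonneg_nonneg]]) auto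
 have "\<forall>L\<in>S. \<exists>p. p \<in> verts L"
 proof
  fix L assume L: "L \<in> S"
  then obtain z where "cball z (\<sigma> * h) \<subseteq> L" using K by blast
  moreover have "z \<in> cball z (\<sigma> * h)" using s h by simp
  ultimately have "z \<in> L" by blast
  from hat_bary[OF tr L this] have "sum (hat S z) (verts L) = 1" by (simp add: bary_def)
  then show "\<exists>p. p \<in> verts L" by (metis equals0I sum.empty zero_neq_one)
 qed
 from bchoice[OF this] obtain p0 where p0: "\<And>L. L \<in> S ==> p0 L \<in> verts L" by blast
 have w2: "cmod (w x - m (p0 L)) \<le> 2 * e x" if L: "L \<in> S" "x \<in> L" for L x
 proof (rule we[OF L])
  fix p assume p: "p \<in> verts L"
  have "m p - m (p0 L) = (m p - \<phi> x) - (m (p0 L) - \<phi> x)" by simp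
  then have "cmod (m p - m (p0 L)) \<le> cmod (m p - \<phi> x) + cmod (m (p0 L) - \<phi> x)" using norm_triangle_ineq4 by metis
  then show "cmod (m p - m (p0 L)) \<le> 2 * e x" using me[OF L p] me[OF L p0[OF L(1)]] by simp
 qed
 have m2: "(\<lambda>x. ennreal ((2 * e x)^2)) \<in> borel_measurable lebesgue"
  and i2: "(\<integral>\<^sup>+x. ennreal ((2 * e x)^2) \<partial>lebesgue) \<le> ennreal (4 * (?c * h * G)^2)"
 proof -
  have eq: "ennreal ((2 * e x)^2) = ennreal 4 * ennreal ((e x)^2)" for x by (simp add: power_mult_distrib ennreal_mult)
  show "(\<lambda>x. ennreal ((2 * e x)^2)) \<in> borel_measurable lebesgue"
   unfolding eq by (intro measurable_completion borel_measurable_times_ennreal borel_measurable_const ee(2))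
  have "(\<integral>\<^sup>+x. ennreal ((2 * e x)^2) \<partial>lebesgue) = ennreal 4 * (\<integral>\<^sup>+x. ennreal ((e x)^2) \<partial>lebesgue)"
   unfolding eq nn_integral_completion using ee(2) by (rule nn_integral_cmult)
  also have "... \<le> ennreal 4 * ennreal ((?c * h * G)^2)" by (rule mult_left_mono[OF ee(1)]) simp
  also have "... = ennreal (4 * (?c * h * G)^2)" by (rule ennreal_mult[symmetric]) auto
  finally show "(\<integral>\<^sup>+x. ennreal ((2 * e x)^2) \<partial>lebesgue) \<le> ennreal (4 * (?c * h * G)^2)" .
 qed
 have 2: "L2_nrm W (wd W i w) \<le> 2 * sqrt ?A * ?c * G" for i
 proof -
  have aff: "\<exists>c l. linear l \<and> (\<forall>x\<in>L. w x = c + l x)" if "L \<in> S" for L using wV that by (auto simp: Vh_def)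
  have "ennreal ((L2_nrm W (wd W i w))^2)
   \<le> ennreal (?A / h\<^sup>2) * (\<Sum>L\<in>S. sqint L (\<lambda>x. w x - m (p0 L)))"
   by (rule gradient_le[OF T O(1) wH aff])
  also have "(\<Sum>L\<in>S. sqint L (\<lambda>x. w x - m (p0 L)))
    \<le> (\<Sum>L\<in>S. \<integral>\<^sup>+x. indicator L x * ennreal ((2 * e x)^2) \<partial>lebesgue)"
  proof (intro sum_mono nn_integral_mono)
   fix L x assume L: "L \<in> S"
   show "indicator L x * ennreal ((cmod (w x - m (p0 L)))^2) \<le> indicator L x * ennreal ((2 * e x)^2)"
   proof (cases "x \<in> L")
    case True
    have "ennreal ((cmod (w x - m (p0 L)))^2) \<le> ennreal ((2 * e x)^2)"
     by (rule ennreal_leI[OF power_mono[OF w2[OF L True] norm_ge_zero]])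
    then show ?thesis by (rule mult_left_mono) simp
   qed simp
  qed
  also have "... = (\<integral>\<^sup>+x. indicator (\<Union>S) x * ennreal ((2 * e x)^2) \<partial>lebesgue)" by (rule nn_integral_triangulation[OF tr m2])
  also have "... \<le> (\<integral>\<^sup>+x. ennreal ((2 * e x)^2) \<partial>lebesgue)" by (intro nn_integral_mono) (auto simp: indicator_def)
  also note i2
  also have "ennreal (?A / h\<^sup>2) * ennreal (4 * (?c * h * G)^2) = ennreal (?A / h\<^sup>2 * (4 * (?c * h * G)^2))"
   using A h by (intro ennreal_mult[symmetric]) auto
  also have "?A / h\<^sup>2 * (4 * (?c * h * G)^2) = (2 * sqrt ?A * ?c * G)^2"
   using A h by (simp add: power_mult_distrib)
  finally have "(L2_nrm W (wd W i w))^2 \<le> (2 * sqrt ?A * ?c * G)^2"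
   by (simp add: mult_left_mono ennreal_le_iff)
  then show ?thesis by (rule power2_le_imp_le) (use A c0 G0 in auto)
 qed
 from wV 1 2 show ?thesis by blast
qed

section \<open>Algebra of the finite element space\<close>

lemma Vh_L2: "v \<in> Vh W S ==> v \<in> L2 W"
 by (auto simp: Vh_def intro: H10_L2)

lemma Vh_H10: "v \<in> Vh W S ==> v \<in> H10 W"
 by (simp add: Vh_def)

lemma Vh_affine: "v \<in> Vh W S ==> K \<in> S ==> \<exists>c l. linear l \<and> (\<forall>x\<in>K. v x = c + l x)"
 by (simp add: Vh_def)

lemma linear_complex_mult_left:
 fixes l :: "real^'n => complex"
 assumes "linear l"
 shows "linear (\<lambda>x. c * l x)"
proof (rule linearI)
 show "c * l (x + y) = c * l x + c * l y" for x y by (simp add: linear_add[OF assms] distrib_left)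
 show "c * l (r *\<^sub>R x) = r *\<^sub>R (c * l x)" for r x by (simp add: linear_cmul[OF assms])
qed

lemma Vh_add:
 assumes O: "open W" and uv: "u \<in> Vh W S" "v \<in> Vh W S"
 shows "(\<lambda>x. u x + v x) \<in> Vh W S"
proof -
 have "\<exists>c l. linear l \<and> (\<forall>x\<in>K. u x + v x = c + l x)" if K: "K \<in> S" for K
 proof -
  obtain c l where cl: "linear l" "\<forall>x\<in>K. u x = c + l x" using Vh_affine[OF uv(1) K] by blast
  obtain c' l' where cl': "linear l'" "\<forall>x\<in>K. v x = c' + l' x" using Vh_affine[OF uv(2) K] by blast
  have "linear (\<lambda>x. l x + l' x)" using cl(1) cl'(1) by (rule linear_compose_add)
  moreover have "\<forall>x\<in>K. u x + v x = (c + c') + (l x + l' x)" using cl(2) cl'(2) by simp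
  ultimately show ?thesis by blast
 qed
 moreover have "(\<lambda>x. u x + v x) \<in> H10 W" using H10_add[OF O] uv by (auto simp: Vh_def)
 moreover have "continuous_on (closure W) (\<lambda>x. u x + v x)" using uv by (auto simp: Vh_def intro: continuous_on_add)
 ultimately show ?thesis using uv by (auto simp: Vh_def)
qed

lemma Vh_cmult:
 assumes O: "open W" and u: "u \<in> Vh W S"
 shows "(\<lambda>x. c * u x) \<in> Vh W S"
proof -
 have "\<exists>d l. linear l \<and> (\<forall>x\<in>K. c * u x = d + l x)" if K: "K \<in> S" for K
 proof -
  obtain d l where cl: "linear l" "\<forall>x\<in>K. u x = d + l x" using Vh_affine[OF u K] by blast
  have "\<forall>x\<in>K. c * u x = c * d + c * l x" using cl(2) by (simp add: distrib_left)
  then show ?thesis using linear_complex_mult_left[OF cl(1)] by blast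
 qed
 moreover have "(\<lambda>x. c * u x) \<in> H10 W" using H10_cmult[OF O] u by (auto simp: Vh_def)
 moreover have "continuous_on (closure W) (\<lambda>x. c * u x)" using u by (auto simp: Vh_def intro: continuous_on_mult_left)
 ultimately show ?thesis using u by (auto simp: Vh_def)
qed

lemma Vh_zero:
 assumes "open W"
 shows "(\<lambda>x. 0) \<in> Vh W S"
proof -
 have a: "\<forall>K\<in>S. \<exists>d l. linear l \<and> (\<forall>x\<in>K. (0 :: complex) = d + l x)"
  by (intro ballI exI[of _ 0] exI[of _ "\<lambda>_. 0"]) (simp add: linear_zero)
 show ?thesis unfolding Vh_def mem_Collect_eq by (intro conjI H10_zero assms a) simp_all
qed

lemma Vh_diff:
 assumes O: "open W" and uv: "u \<in> Vh W S" "v \<in> Vh W S"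
 shows "(\<lambda>x. u x - v x) \<in> Vh W S"
 using Vh_add[OF O uv(1) Vh_cmult[OF O uv(2), of "- 1"]] by simp

lemma Vh_sum:
 assumes O: "open W" and "finite I" "\<And>i. i \<in> I ==> u i \<in> Vh W S"
 shows "(\<lambda>x. \<Sum>i\<in>I. u i x) \<in> Vh W S"
 using assms(2,3)
proof (induction I rule: finite_induct)
 case empty
 then show ?case using Vh_zero[OF O] by simp
next
 case (insert i I)
 then show ?case using Vh_add[OF O, of "u i" S "\<lambda>x. \<Sum>i\<in>I. u i x"] by simp
qed

lemma Vh_eq_interp:
 assumes T: "triangulation S" "\<Union>S = closure W" and v: "v \<in> Vh W S"
 shows "v x = interp S v x"
proof (cases "x \<in> \<Union>S")
 case True
 then obtain K where K: "K \<in> S" "x \<in> K" by blast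
 then obtain c l where "linear l" "\<forall>x\<in>K. v x = c + l x" using Vh_affine[OF v K(1)] by blast
 then show ?thesis using affine_eq_interp[OF T(1) K] by blast
next
 case False
 then have "x \<notin> W" using T(2) closure_subset[of W] by blast
 then show ?thesis using v False by (simp add: Vh_def interp_outside)
qed

lemma sum_function_apply: "(\<Sum>i\<in>I. f i) x = (\<Sum>i\<in>I. f i x :: complex)"
 by (induction I rule: infinite_finite_induct) auto

text \<open>The nodal basis shows that the space has finite dimension; an orthonormal system with as many members as the
dimension then spans it.\<close>

lemma Vh_expansion:
 fixes W :: "(real^'n) set" and p :: "nat => real^'n => complex"
 assumes O: "open W" and T: "triangulation S" "\<Union>S = closure W"
  and p: "\<And>j. j < dim_Vh W S ==> p j \<in> Vh W S"
   "\<And>i j. i < dim_Vh W S ==> j < dim_Vh W S ==> ip W (p i) (p j) = (if i = j then 1 else 0)"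
  and v: "v \<in> Vh W S"
 shows "v = (\<lambda>x. \<Sum>j<dim_Vh W S. ip W v (p j) * p j x)"
proof -
 interpret V: vector_space "\<lambda>(c :: complex) (u :: real^'n => complex) x. c * u x"
  by unfold_locales (auto simp: fun_eq_iff algebra_simps)
 define m where "m = dim_Vh W S"
 have md: "V.dim (Vh W S) = m" by (simp add: m_def dim_Vh_def)
 note p = p[folded m_def]
 have pL: "p j \<in> L2 W" if "j < m" for j using p(1)[OF that] by (rule Vh_L2)
 define B where "B = p ` {..<m}"
 have inj: "inj_on p {..<m}"
 proof (rule inj_onI)
  fix i j assume ij: "i \<in> {..<m}" "j \<in> {..<m}" "p i = p j"
  show "i = j"
  proof (rule ccontr)
   assume "i ~= j"
   then have "ip W (p i) (p j) = 0" using p(2)[of i j] ij(1,2) by simp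
   moreover have "ip W (p i) (p j) = 1" unfolding ij(3) using p(2)[of j j] ij(2) by simp
   ultimately show False by simp
  qed
 qed
 have finB: "finite B" and cardB: "card B = m" using inj by (auto simp: B_def card_image)
 have comb: "(\<Sum>b\<in>B. (\<lambda>x. f b * b x)) = (\<lambda>x. \<Sum>j<m. f (p j) * p j x)" for f
  unfolding B_def sum.reindex[OF inj] by (rule ext) (simp add: sum_function_apply)
 have ipc: "ip W (\<lambda>x. \<Sum>j<m. c j * p j x) (p i) = c i" if i: "i < m" for c i
 proof -
  have "ip W (\<lambda>x. \<Sum>j<m. c j * p j x) (p i) = (\<Sum>j<m. c j * ip W (p j) (p i))"
   by (rule ip_sum_left) (use pL i in auto)
  also have "... = (\<Sum>j<m. if j = i then c i else 0)" by (intro sum.cong) (auto simp: p(2) i)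
  finally show ?thesis using i by simp
 qed
 have indB: "V.independent B"
 proof (rule V.independent_if_scalars_zero[OF finB])
  fix f b assume z: "(\<Sum>b\<in>B. (\<lambda>x. f b * b x)) = 0" and "b \<in> B"
  then obtain i where i: "i < m" "b = p i" by (auto simp: B_def)
  have "(\<lambda>x. \<Sum>j<m. f (p j) * p j x) = (\<lambda>x. 0)" using z unfolding comb by (simp add: zero_fun_def)
  then have "ip W (\<lambda>x. 0) (p i) = f (p i)" using ipc[OF i(1), of "\<lambda>j. f (p j)"] by simp
  then show "f b = 0" by (simp add: ip_zero_left i(2))
 qed
 define Hs where "Hs = (\<lambda>q x. complex_of_real (hat S x q)) ` (\<Union>K\<in>S. verts K)"
 have finH: "finite Hs" unfolding Hs_def using finite_all_verts[OF T(1)] by simp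
 have subH: "Vh W S \<subseteq> V.span Hs"
 proof
  fix u assume u: "u \<in> Vh W S"
  have "u = (\<Sum>q\<in>(\<Union>K\<in>S. verts K). (\<lambda>x. u q * complex_of_real (hat S x q)))"
  proof
   fix x show "u x = (\<Sum>q\<in>(\<Union>K\<in>S. verts K). (\<lambda>x. u q * complex_of_real (hat S x q))) x"
    using Vh_eq_interp[OF T u, of x] by (simp only: sum_function_apply interp_def)
  qed
  moreover have "(\<Sum>q\<in>(\<Union>K\<in>S. verts K). (\<lambda>x. u q * complex_of_real (hat S x q))) \<in> V.span Hs"
  proof (rule V.span_sum)
   fix q assume "q \<in> (\<Union>K\<in>S. verts K)"
   then have "(\<lambda>x. complex_of_real (hat S x q)) \<in> Hs" unfolding Hs_def by (rule imageI)
   from V.span_scale[OF V.span_base[OF this], of "u q"]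
   show "(\<lambda>x. u q * complex_of_real (hat S x q)) \<in> V.span Hs" .
  qed
  ultimately show "u \<in> V.span Hs" by (simp only:)
 qed
 have BV: "B \<subseteq> Vh W S" using p(1) by (auto simp: B_def)
 have "v \<in> V.span B"
 proof (rule ccontr)
  assume nv: "v \<notin> V.span B"
  then have ind: "V.independent (insert v B)" using V.independent_insert[of v B] indB by (simp split: if_splits)
  obtain C where C: "C \<subseteq> Vh W S" "V.independent C" "Vh W S \<subseteq> V.span C" "card C = V.dim (Vh W S)"
   using V.basis_exists[of "Vh W S"] by blast
  have "C \<subseteq> V.span Hs" using C(1) subH by blast
  then have finC: "finite C" using V.independent_span_bound[OF finH C(2)] by blast
  have "insert v B \<subseteq> V.span C" using v BV C(3) by blast
  then have "card (insert v B) \<le> card C" using V.independent_span_bound[OF finC ind] by blast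
  moreover have "v \<notin> B" using nv V.span_base by blast
  ultimately show False using C(4) md cardB finB by simp
 qed
 then obtain f where f: "v = (\<Sum>b\<in>B. (\<lambda>x. f b * b x))" unfolding V.span_finite[OF finB] by blast
 then have ve: "v = (\<lambda>x. \<Sum>j<m. f (p j) * p j x)" unfolding comb .
 have "f (p j) = ip W v (p j)" if "j < m" for j using ipc[OF that, of "\<lambda>j. f (p j)"] ve by simp
 then have "v = (\<lambda>x. \<Sum>j<m. ip W v (p j) * p j x)" by (subst ve) (auto intro!: sum.cong)
 then show ?thesis by (simp only: m_def)
qed

lemma elliptic_formD:
 assumes "elliptic_form W a"
 shows "u \<in> H10 W ==> v \<in> H10 W ==> w \<in> H10 W ==> a (\<lambda>x. u x + v x) w = a u w + a v w"
  "u \<in> H10 W ==> w \<in> H10 W ==> a (\<lambda>x. c * u x) w = c * a u w"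
  "v \<in> H10 W ==> w \<in> H10 W ==> a v w = cnj (a w v)"
  "\<exists>c0>0. \<forall>v\<in>H10 W. Re (a v v) \<ge> c0 * (H1_nrm W v)^2"
  "\<exists>c1. \<forall>v\<in>H10 W. \<forall>w\<in>H10 W. cmod (a v w) \<le> c1 * H1_nrm W v * H1_nrm W w"
 using assms unfolding elliptic_form_def by blast+

lemma form_sum_left:
 assumes a: "elliptic_form W a" and O: "open W" and w: "w \<in> H10 W"
  and "finite I" "\<And>i. i \<in> I ==> u i \<in> H10 W"
 shows "a (\<lambda>x. \<Sum>i\<in>I. c i * u i x) w = (\<Sum>i\<in>I. c i * a (u i) w)"
 using assms(4,5)
proof (induction I rule: finite_induct)
 case empty
 have "a (\<lambda>x. 0 * 0) w = 0 * a (\<lambda>x. 0) w"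
  using elliptic_formD(2)[OF a H10_zero[OF O] w, of 0] by simp
 then show ?case by simp
next
 case (insert i I)
 have h: "(\<lambda>x. c j * u j x) \<in> H10 W" if "j \<in> insert i I" for j using H10_cmult[OF O insert.prems[OF that]] .
 have "(\<lambda>x. \<Sum>i\<in>I. c i * u i x) \<in> H10 W" by (rule H10_sum[OF O]) (use insert.prems in blast)
 then show ?case
  using insert elliptic_formD(1)[OF a h[of i] _ w, of "\<lambda>x. \<Sum>i\<in>I. c i * u i x"] elliptic_formD(2)[OF a insert.prems[of i] w, of "c i"]
  by simp
qed

lemma form_sum_right:
 assumes a: "elliptic_form W a" and O: "open W" and w: "w \<in> H10 W"
  and I: "finite I" "\<And>i. i \<in> I ==> u i \<in> H10 W"
 shows "a w (\<lambda>x. \<Sum>i\<in>I. c i * u i x) = (\<Sum>i\<in>I. cnj (c i) * a w (u i))"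
proof -
 have s: "(\<lambda>x. \<Sum>i\<in>I. c i * u i x) \<in> H10 W" by (rule H10_sum[OF O]) (use I H10_cmult[OF O] in auto)
 have "a w (\<lambda>x. \<Sum>i\<in>I. c i * u i x) = cnj (\<Sum>i\<in>I. c i * a (u i) w)"
  using elliptic_formD(3)[OF a w s] form_sum_left[OF a O w I] by simp
 also have "... = (\<Sum>i\<in>I. cnj (c i) * a w (u i))"
  using elliptic_formD(3)[OF a w I(2)] by simp
 finally show ?thesis .
qed

section \<open>Interpolation between weighted norms of finite matrices\<close>

text \<open>The constant of the K-method: \<open>\<mu> powr \<theta>\<close> is, up to this factor, the integral of
\<open>t powr (\<theta> - 1) * \<mu> / (t + \<mu>)\<close>.\<close>

definition interpolation_const :: "real => ennreal" where
 "interpolation_const \<theta> = (\<integral>\<^sup>+t. indicator {0<..} t * ennreal (t powr (\<theta> - 1) / (1 + t)) \<partial>lborel)"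

lemma interpolation_const_scale:
 assumes "0 < \<mu>"
 shows "(\<integral>\<^sup>+t. indicator {0<..} t * ennreal (t powr (\<theta> - 1) * (\<mu> / (t + \<mu>))) \<partial>lborel)
  = ennreal (\<mu> powr \<theta>) * interpolation_const \<theta>"
proof -
 have m: "(\<lambda>t. indicator {0<..} t * ennreal (t powr (\<theta> - 1) * (\<mu> / (t + \<mu>)))) \<in> borel_measurable lborel" by measurable
 have m2: "(\<lambda>t. indicator {0<..} t * ennreal (t powr (\<theta> - 1) / (1 + t))) \<in> borel_measurable lborel" by measurable
 have "(\<integral>\<^sup>+t. indicator {0<..} t * ennreal (t powr (\<theta> - 1) * (\<mu> / (t + \<mu>))) \<partial>lborel)
   = ennreal \<bar>\<mu>\<bar> * (\<integral>\<^sup>+t. indicator {0<..} (0 + \<mu> * t) * ennreal ((0 + \<mu> * t) powr (\<theta> - 1) * (\<mu> / ((0 + \<mu> * t) + \<mu>))) \<partial>lborel)"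
  using m assms by (intro nn_integral_real_affine) auto
 also have "... = ennreal \<mu> * (\<integral>\<^sup>+t. ennreal (\<mu> powr (\<theta> - 1)) * (indicator {0<..} t * ennreal (t powr (\<theta> - 1) / (1 + t))) \<partial>lborel)"
 proof -
  have "indicator {0<..} (0 + \<mu> * t) * ennreal ((0 + \<mu> * t) powr (\<theta> - 1) * (\<mu> / ((0 + \<mu> * t) + \<mu>)))
   = ennreal (\<mu> powr (\<theta> - 1)) * (indicator {0<..} t * ennreal (t powr (\<theta> - 1) / (1 + t)))" for t
  proof (cases "0 < t")
   case True
   have "\<mu> / (\<mu> * t + \<mu>) = 1 / (1 + t)" using assms True mult_divide_mult_cancel_left[of \<mu> 1 "1 + t"] by (simp add: distrib_left add.commute)
   then have "(\<mu> * t) powr (\<theta> - 1) * (\<mu> / (\<mu> * t + \<mu>)) = \<mu> powr (\<theta> - 1) * (t powr (\<theta> - 1) / (1 + t))"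
    using assms True by (simp add: powr_mult)
   then have "ennreal ((\<mu> * t) powr (\<theta> - 1) * (\<mu> / (\<mu> * t + \<mu>))) = ennreal (\<mu> powr (\<theta> - 1)) * ennreal (t powr (\<theta> - 1) / (1 + t))"
    by (simp only: ennreal_mult' powr_ge_zero)
   then show ?thesis using True assms by simp
  next
   case False
   then have "\<not> 0 < \<mu> * t" using assms by (simp add: zero_less_mult_iff)
   with False show ?thesis by simp
  qed
  then show ?thesis using assms by simp
 qed
 also have "... = ennreal \<mu> * (ennreal (\<mu> powr (\<theta> - 1)) * interpolation_const \<theta>)"
  unfolding interpolation_const_def using m2 by (subst nn_integral_cmult) auto
 also have "... = ennreal (\<mu> * \<mu> powr (\<theta> - 1)) * interpolation_const \<theta>"
  using assms by (simp add: ennreal_mult mult.assoc)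
 also have "\<mu> * \<mu> powr (\<theta> - 1) = \<mu> powr \<theta>"
  using powr_add[of \<mu> 1 "\<theta> - 1"] assms by simp
 finally show ?thesis .
qed

lemma interpolation_const_pos: 
 assumes "\<theta> < 1"
 shows "0 < interpolation_const \<theta>"
proof -
 have "0 < ennreal (1 / 2)" unfolding ennreal_less_zero_iff by simp
 also have "... = (\<integral>\<^sup>+t. ennreal (1 / 2) * indicator {0<..1 :: real} t \<partial>lborel)"
  by (subst nn_integral_cmult_indicator) auto
 also have "... \<le> interpolation_const \<theta>"
  unfolding interpolation_const_def
 proof (rule nn_integral_mono)
  fix t :: real
  show "ennreal (1 / 2) * indicator {0<..1} t \<le> indicator {0<..} t * ennreal (t powr (\<theta> - 1) / (1 + t))"
  proof (cases "0 < t \<and> t \<le> 1")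
   case True
   have "1 powr (\<theta> - 1) \<le> t powr (\<theta> - 1)" using True assms by (intro powr_mono2') auto
   then have "1 / 2 \<le> t powr (\<theta> - 1) / (1 + t)" using True by (intro frac_le) auto
   then have "ennreal (1 / 2) \<le> ennreal (t powr (\<theta> - 1) / (1 + t))" by (rule ennreal_leI)
   moreover have "indicator {0<..1} t = (1 :: ennreal)" "indicator {0<..} t = (1 :: ennreal)" using True by simp_all
   ultimately show ?thesis by (simp only: mult_1_right mult_1_left)
  qed auto
 qed
 finally show ?thesis .
qed

lemma interpolation_const_finite:
 assumes "0 < \<theta>" "\<theta> < 1"
 shows "interpolation_const \<theta> < \<infinity>"
proof -
 have i1: "((\<lambda>t. t powr (\<theta> - 1)) has_integral (1 powr (\<theta> - 1 + 1) / (\<theta> - 1 + 1))) {0..1}"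
  using assms by (intro has_integral_powr_from_0) auto
 have i2: "((\<lambda>t. t powr (\<theta> - 2)) has_integral (- (1 powr (\<theta> - 2 + 1)) / (\<theta> - 2 + 1))) {1..}"
  using assms by (intro has_integral_powr_to_inf) auto
 have n1: "(\<integral>\<^sup>+t. indicator {0..1} t * ennreal (t powr (\<theta> - 1)) \<partial>lborel) = ennreal (1 powr (\<theta> - 1 + 1) / (\<theta> - 1 + 1))"
  (is "_ = ennreal ?I")
 proof -
  have "((\<lambda>t. if t \<in> {0..1} then t powr (\<theta> - 1) else 0) has_integral ?I) UNIV"
   using i1 by (simp only: has_integral_restrict_UNIV)
  then have "(\<integral>\<^sup>+t. ennreal (if t \<in> {0..1} then t powr (\<theta> - 1) else 0) \<partial>lborel) = ennreal ?I"
   by (rule nn_integral_has_integral_lborel[rotated 2]) auto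
  moreover have "ennreal (if t \<in> {0..1} then t powr (\<theta> - 1) else 0) = indicator {0..1} t * ennreal (t powr (\<theta> - 1))" for t
   by (simp add: indicator_def)
  ultimately show ?thesis by simp
 qed
 have n2: "(\<integral>\<^sup>+t. indicator {1..} t * ennreal (t powr (\<theta> - 2)) \<partial>lborel) = ennreal (- (1 powr (\<theta> - 2 + 1)) / (\<theta> - 2 + 1))"
  (is "_ = ennreal ?I")
 proof -
  have "((\<lambda>t. if t \<in> {1..} then t powr (\<theta> - 2) else 0) has_integral ?I) UNIV"
   using i2 by (simp only: has_integral_restrict_UNIV)
  then have "(\<integral>\<^sup>+t. ennreal (if t \<in> {1..} then t powr (\<theta> - 2) else 0) \<partial>lborel) = ennreal ?I"
   by (rule nn_integral_has_integral_lborel[rotated 2]) auto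
  moreover have "ennreal (if t \<in> {1..} then t powr (\<theta> - 2) else 0) = indicator {1..} t * ennreal (t powr (\<theta> - 2))" for t
   by (simp add: indicator_def)
  ultimately show ?thesis by simp
 qed
 have "interpolation_const \<theta> \<le> (\<integral>\<^sup>+t. indicator {0..1} t * ennreal (t powr (\<theta> - 1)) + indicator {1..} t * ennreal (t powr (\<theta> - 2)) \<partial>lborel)"
  unfolding interpolation_const_def
 proof (rule nn_integral_mono)
  fix t :: real
  show "indicator {0<..} t * ennreal (t powr (\<theta> - 1) / (1 + t))
    \<le> indicator {0..1} t * ennreal (t powr (\<theta> - 1)) + indicator {1..} t * ennreal (t powr (\<theta> - 2))"
  proof (cases "0 < t")
   case True
   show ?thesis
   proof (cases "t \<le> 1")
    case True1: True
    have "t powr (\<theta> - 1) / (1 + t) \<le> t powr (\<theta> - 1) / 1" using True by (intro divide_left_mono) auto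
    then have "ennreal (t powr (\<theta> - 1) / (1 + t)) \<le> ennreal (t powr (\<theta> - 1))" by (simp add: ennreal_leI)
    then show ?thesis using True True1 by (simp add: add_increasing2)
   next
    case False
    have "t powr (\<theta> - 1) / (1 + t) \<le> t powr (\<theta> - 1) / t" using True by (intro divide_left_mono) auto
    also have "t powr (\<theta> - 1) / t = t powr (\<theta> - 1 - 1)" using True powr_diff[of t "\<theta> - 1" 1] by simp
    also have "\<theta> - 1 - 1 = \<theta> - 2" by simp
    finally show ?thesis using True False by (simp add: ennreal_leI)
   qed
  qed simp
 qed
 also have "... = ennreal (1 powr (\<theta> - 1 + 1) / (\<theta> - 1 + 1)) + ennreal (- (1 powr (\<theta> - 2 + 1)) / (\<theta> - 2 + 1))"
  by (subst nn_integral_add) (auto simp: n1 n2)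
 also have "... < \<infinity>" by simp
 finally show ?thesis .
qed

lemma sum_of_quotients_bound:
 fixes a b :: complex
 assumes "0 < t" "0 < \<mu>"
 shows "\<mu> / (t + \<mu>) * (cmod (a + b))^2 \<le> (cmod b)^2 + \<mu> * (cmod a)^2 / t"
proof -
 let ?A = "cmod a" and ?B = "cmod b"
 have "0 \<le> (t * ?B - \<mu> * ?A)^2" by simp
 also have "... = (t + \<mu>) * (t * ?B\<^sup>2 + \<mu> * ?A\<^sup>2) - t * \<mu> * (?A + ?B)^2"
  by (simp add: power2_eq_square algebra_simps)
 finally have "t * \<mu> * (?A + ?B)^2 \<le> (t + \<mu>) * (t * ?B\<^sup>2 + \<mu> * ?A\<^sup>2)" by simp
 moreover have "t * \<mu> * (cmod (a + b))^2 \<le> t * \<mu> * (?A + ?B)^2"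
  using assms by (intro mult_left_mono power_mono norm_triangle_ineq) auto
 ultimately have "t * \<mu> * (cmod (a + b))^2 \<le> (t + \<mu>) * (t * ?B\<^sup>2 + \<mu> * ?A\<^sup>2)" by simp
 then have "t * \<mu> * (cmod (a + b))^2 / (t * (t + \<mu>)) \<le> (t + \<mu>) * (t * ?B\<^sup>2 + \<mu> * ?A\<^sup>2) / (t * (t + \<mu>))"
  using assms by (intro divide_right_mono) auto
 moreover have "t * \<mu> * (cmod (a + b))^2 / (t * (t + \<mu>)) = \<mu> / (t + \<mu>) * (cmod (a + b))^2"
  using assms by simp
 moreover have "(t + \<mu>) * (t * ?B\<^sup>2 + \<mu> * ?A\<^sup>2) / (t * (t + \<mu>)) = (t * ?B\<^sup>2 + \<mu> * ?A\<^sup>2) / t"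
  using assms by simp
 moreover have "... = ?B\<^sup>2 + \<mu> * ?A\<^sup>2 / t" using assms by (simp add: add_divide_distrib)
 ultimately show ?thesis by simp
qed

text \<open>Splitting \<open>y j\<close> in the proportion \<open>t : \<nu> j\<close> minimizes \<open>t \<bar>w\<bar>\<^sup>2 + \<nu> j \<bar>u\<bar>\<^sup>2\<close>; the first part is estimated by \<open>A1\<close>, the
second by \<open>A0\<close>.\<close>

lemma matrix_K_functional_bound:
 fixes T :: "'i => 'j => complex"
 assumes fin: "finite I" "finite J" and pos: "\<And>i. i \<in> I ==> 0 < \<mu> i" "\<And>j. j \<in> J ==> 0 < \<nu> j"
  and A0: "\<And>z. (\<Sum>i\<in>I. (cmod (\<Sum>j\<in>J. T i j * z j))^2) \<le> C * (\<Sum>j\<in>J. (cmod (z j))^2)"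
  and A1: "\<And>z. (\<Sum>i\<in>I. \<mu> i * (cmod (\<Sum>j\<in>J. T i j * z j))^2) \<le> C * (\<Sum>j\<in>J. \<nu> j * (cmod (z j))^2)"
  and t: "0 < t"
 shows "(\<Sum>i\<in>I. \<mu> i / (t + \<mu> i) * (cmod (\<Sum>j\<in>J. T i j * y j))^2) \<le> C * (\<Sum>j\<in>J. \<nu> j / (t + \<nu> j) * (cmod (y j))^2)"
proof -
 define u w where "u j = complex_of_real (t / (t + \<nu> j)) * y j" and "w j = complex_of_real (\<nu> j / (t + \<nu> j)) * y j" for j
 have uw: "y j = u j + w j" if "j \<in> J" for j
 proof -
  have "t / (t + \<nu> j) + \<nu> j / (t + \<nu> j) = 1" using t pos(2)[OF that] by (simp add: add_divide_distrib[symmetric])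
  then have "complex_of_real (t / (t + \<nu> j)) + complex_of_real (\<nu> j / (t + \<nu> j)) = 1" by (metis of_real_1 of_real_add)
  then have "(complex_of_real (t / (t + \<nu> j)) + complex_of_real (\<nu> j / (t + \<nu> j))) * y j = y j" by simp
  then show ?thesis unfolding u_def w_def distrib_right by (rule sym)
 qed
 let ?X = "\<lambda>z i. \<Sum>j\<in>J. T i j * z j"
 have X: "?X y i = ?X u i + ?X w i" for i
  by (simp add: sum.distrib[symmetric] distrib_left[symmetric] uw cong: sum.cong)
 have "(\<Sum>i\<in>I. \<mu> i / (t + \<mu> i) * (cmod (?X y i))^2) \<le> (\<Sum>i\<in>I. (cmod (?X w i))^2 + \<mu> i * (cmod (?X u i))^2 / t)"
  unfolding X using t pos(1) by (intro sum_mono sum_of_quotients_bound)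
 also have "... = (\<Sum>i\<in>I. (cmod (?X w i))^2) + (\<Sum>i\<in>I. \<mu> i * (cmod (?X u i))^2) / t"
  by (simp add: sum.distrib sum_divide_distrib)
 also have "... \<le> C * (\<Sum>j\<in>J. (cmod (w j))^2) + C * (\<Sum>j\<in>J. \<nu> j * (cmod (u j))^2) / t"
  using t by (intro add_mono A0 divide_right_mono A1) auto
 also have "... = C * (\<Sum>j\<in>J. (cmod (w j))^2 + \<nu> j * (cmod (u j))^2 / t)"
  by (simp add: sum.distrib distrib_left flip: sum_divide_distrib)
 also have "(\<Sum>j\<in>J. (cmod (w j))^2 + \<nu> j * (cmod (u j))^2 / t) = (\<Sum>j\<in>J. \<nu> j / (t + \<nu> j) * (cmod (y j))^2)"
 proof (rule sum.cong[OF refl])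
  fix j assume j: "j \<in> J"
  have n: "0 < \<nu> j" using pos(2)[OF j] .
  have nw: "(cmod (w j))^2 = (\<nu> j / (t + \<nu> j))^2 * (cmod (y j))^2"
   by (simp add: w_def norm_mult power_mult_distrib norm_divide power_divide flip: of_real_add)
  have nu: "(cmod (u j))^2 = (t / (t + \<nu> j))^2 * (cmod (y j))^2"
   by (simp add: u_def norm_mult power_mult_distrib norm_divide power_divide flip: of_real_add)
  have "(\<nu> j / (t + \<nu> j))^2 + \<nu> j * (t / (t + \<nu> j))^2 / t = \<nu> j * (\<nu> j + t) / (t + \<nu> j)^2"
  proof -
   have "(\<nu> j / (t + \<nu> j))^2 = \<nu> j * \<nu> j / (t + \<nu> j)^2" by (simp add: power_divide power2_eq_square)
   moreover have "\<nu> j * (t / (t + \<nu> j))^2 / t = \<nu> j * t / (t + \<nu> j)^2" using t by (simp add: power_divide power2_eq_square)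
   ultimately show ?thesis by (simp add: distrib_left add_divide_distrib)
  qed
  also have "... = \<nu> j / (t + \<nu> j)" using t n by (simp add: power2_eq_square add.commute)
  finally have "((\<nu> j / (t + \<nu> j))^2 + \<nu> j * (t / (t + \<nu> j))^2 / t) * (cmod (y j))^2 = \<nu> j / (t + \<nu> j) * (cmod (y j))^2" by simp
  then show "(cmod (w j))^2 + \<nu> j * (cmod (u j))^2 / t = \<nu> j / (t + \<nu> j) * (cmod (y j))^2"
   unfolding nw nu by (simp add: distrib_right)
 qed
 finally show ?thesis .
qed

lemma interpolation_integral_sum:
 fixes I :: "'k set"
 assumes "0 < \<theta>" "\<theta> < 1" and ic: "interpolation_const \<theta> = ennreal c" and c: "0 < c"
  and I: "finite I" and m: "\<And>i. i \<in> I ==> 0 < m i" and a: "\<And>i. i \<in> I ==> 0 \<le> a i"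
 shows "(\<integral>\<^sup>+t. indicator {0<..} t * ennreal (t powr (\<theta> - 1) * (\<Sum>i\<in>I. m i / (t + m i) * a i)) \<partial>lborel)
    = ennreal (c * (\<Sum>i\<in>I. m i powr \<theta> * a i))"
  proof -
   have "indicator {0<..} t * ennreal (t powr (\<theta> - 1) * (\<Sum>i\<in>I. m i / (t + m i) * a i))
     = (\<Sum>i\<in>I. ennreal (a i) * (indicator {0<..} t * ennreal (t powr (\<theta> - 1) * (m i / (t + m i)))))" for t
   proof (cases "0 < t")
    case True
    have "t powr (\<theta> - 1) * (\<Sum>i\<in>I. m i / (t + m i) * a i) = (\<Sum>i\<in>I. a i * (t powr (\<theta> - 1) * (m i / (t + m i))))"
     by (simp add: sum_distrib_left mult_ac)
    then have "ennreal (t powr (\<theta> - 1) * (\<Sum>i\<in>I. m i / (t + m i) * a i))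
      = (\<Sum>i\<in>I. ennreal (a i * (t powr (\<theta> - 1) * (m i / (t + m i)))))"
     using True m a by (simp add: sum_ennreal less_imp_le)
    also have "... = (\<Sum>i\<in>I. ennreal (a i) * ennreal (t powr (\<theta> - 1) * (m i / (t + m i))))"
     using a by (intro sum.cong refl ennreal_mult') auto
    finally show ?thesis using True by simp
   qed simp
   then have "(\<integral>\<^sup>+t. indicator {0<..} t * ennreal (t powr (\<theta> - 1) * (\<Sum>i\<in>I. m i / (t + m i) * a i)) \<partial>lborel)
     = (\<integral>\<^sup>+t. (\<Sum>i\<in>I. ennreal (a i) * (indicator {0<..} t * ennreal (t powr (\<theta> - 1) * (m i / (t + m i))))) \<partial>lborel)"
    by simp
   also have "... = (\<Sum>i\<in>I. ennreal (a i) * (\<integral>\<^sup>+t. indicator {0<..} t * ennreal (t powr (\<theta> - 1) * (m i / (t + m i))) \<partial>lborel))"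
    by (subst nn_integral_sum) (auto simp: nn_integral_cmult)
   also have "... = (\<Sum>i\<in>I. ennreal (c * (m i powr \<theta> * a i)))"
   proof (rule sum.cong[OF refl])
    fix i assume i: "i \<in> I"
    show "ennreal (a i) * (\<integral>\<^sup>+t. indicator {0<..} t * ennreal (t powr (\<theta> - 1) * (m i / (t + m i))) \<partial>lborel) = ennreal (c * (m i powr \<theta> * a i))"
     unfolding interpolation_const_scale[OF m[OF i]] ic using a[OF i] c
     by (simp add: ennreal_mult'[symmetric] ennreal_mult[symmetric] mult_ac)
   qed
   also have "... = ennreal (\<Sum>i\<in>I. c * (m i powr \<theta> * a i))" using c a by (intro sum_ennreal) auto
   finally show ?thesis by (simp add: sum_distrib_left)
  qed

text \<open>Integration of the previous bound against \<open>t powr (\<theta> - 1)\<close>; the endpoints are the hypotheses.\<close>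

lemma matrix_interpolation:
 fixes T :: "'i => 'j => complex"
 assumes fin: "finite I" "finite J" and pos: "\<And>i. i \<in> I ==> 0 < \<mu> i" "\<And>j. j \<in> J ==> 0 < \<nu> j" and C: "0 \<le> C"
  and A0: "\<And>z. (\<Sum>i\<in>I. (cmod (\<Sum>j\<in>J. T i j * z j))^2) \<le> C * (\<Sum>j\<in>J. (cmod (z j))^2)"
  and A1: "\<And>z. (\<Sum>i\<in>I. \<mu> i * (cmod (\<Sum>j\<in>J. T i j * z j))^2) \<le> C * (\<Sum>j\<in>J. \<nu> j * (cmod (z j))^2)"
  and th: "0 \<le> \<theta>" "\<theta> \<le> 1"
 shows "(\<Sum>i\<in>I. \<mu> i powr \<theta> * (cmod (\<Sum>j\<in>J. T i j * y j))^2) \<le> C * (\<Sum>j\<in>J. \<nu> j powr \<theta> * (cmod (y j))^2)"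
proof -
 consider "\<theta> = 0" | "\<theta> = 1" | "0 < \<theta>" "\<theta> < 1" using th by linarith
 then show ?thesis
 proof cases
  case 1
  have "(\<Sum>i\<in>I. \<mu> i powr \<theta> * (cmod (\<Sum>j\<in>J. T i j * y j))^2) = (\<Sum>i\<in>I. (cmod (\<Sum>j\<in>J. T i j * y j))^2)"
   using pos(1) 1 by (intro sum.cong) (simp_all add: less_imp_neq[THEN not_sym])
  moreover have "(\<Sum>j\<in>J. \<nu> j powr \<theta> * (cmod (y j))^2) = (\<Sum>j\<in>J. (cmod (y j))^2)"
   using pos(2) 1 by (intro sum.cong) (simp_all add: less_imp_neq[THEN not_sym])
  ultimately show ?thesis using A0[of y] by simp
 next
  case 2
  have "(\<Sum>i\<in>I. \<mu> i powr \<theta> * (cmod (\<Sum>j\<in>J. T i j * y j))^2) = (\<Sum>i\<in>I. \<mu> i * (cmod (\<Sum>j\<in>J. T i j * y j))^2)"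
   using pos(1) 2 by (intro sum.cong) (simp_all add: less_imp_le abs_of_pos)
  moreover have "(\<Sum>j\<in>J. \<nu> j powr \<theta> * (cmod (y j))^2) = (\<Sum>j\<in>J. \<nu> j * (cmod (y j))^2)"
   using pos(2) 2 by (intro sum.cong) (simp_all add: less_imp_le abs_of_pos)
  ultimately show ?thesis using A1[of y] by simp
 next
  case 3
  define c where "c = enn2real (interpolation_const \<theta>)"
  have ic: "interpolation_const \<theta> = ennreal c" using interpolation_const_finite[OF 3] by (simp add: c_def)
  have c: "0 < c" using interpolation_const_pos[OF 3(2)] unfolding ic by simp
  note int = interpolation_integral_sum[OF 3(1,2) ic c]
  let ?x = "\<lambda>i. (cmod (\<Sum>j\<in>J. T i j * y j))^2"
  have "ennreal (c * (\<Sum>i\<in>I. \<mu> i powr \<theta> * ?x i))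
    = (\<integral>\<^sup>+t. indicator {0<..} t * ennreal (t powr (\<theta> - 1) * (\<Sum>i\<in>I. \<mu> i / (t + \<mu> i) * ?x i)) \<partial>lborel)"
   by (rule int[symmetric]) (use fin pos in auto)
  also have "... \<le> (\<integral>\<^sup>+t. ennreal C * (indicator {0<..} t * ennreal (t powr (\<theta> - 1) * (\<Sum>j\<in>J. \<nu> j / (t + \<nu> j) * (cmod (y j))^2))) \<partial>lborel)"
  proof (rule nn_integral_mono)
   fix t :: real
   show "indicator {0<..} t * ennreal (t powr (\<theta> - 1) * (\<Sum>i\<in>I. \<mu> i / (t + \<mu> i) * ?x i))
     \<le> ennreal C * (indicator {0<..} t * ennreal (t powr (\<theta> - 1) * (\<Sum>j\<in>J. \<nu> j / (t + \<nu> j) * (cmod (y j))^2)))"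
   proof (cases "0 < t")
    case True
    have "t powr (\<theta> - 1) * (\<Sum>i\<in>I. \<mu> i / (t + \<mu> i) * ?x i) \<le> t powr (\<theta> - 1) * (C * (\<Sum>j\<in>J. \<nu> j / (t + \<nu> j) * (cmod (y j))^2))"
     by (intro mult_left_mono matrix_K_functional_bound[OF fin pos A0 A1 True]) auto
    also have "... = C * (t powr (\<theta> - 1) * (\<Sum>j\<in>J. \<nu> j / (t + \<nu> j) * (cmod (y j))^2))" by (simp add: mult_ac)
    finally show ?thesis using True C by (simp add: ennreal_mult'[symmetric] ennreal_leI)
   qed simp
  qed
  also have "... = ennreal C * ennreal (c * (\<Sum>j\<in>J. \<nu> j powr \<theta> * (cmod (y j))^2))"
  proof -
   have intJ: "(\<integral>\<^sup>+t. indicator {0<..} t * ennreal (t powr (\<theta> - 1) * (\<Sum>j\<in>J. \<nu> j / (t + \<nu> j) * (cmod (y j))^2)) \<partial>lborel)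
     = ennreal (c * (\<Sum>j\<in>J. \<nu> j powr \<theta> * (cmod (y j))^2))"
    by (rule int) (use fin pos in auto)
   show ?thesis unfolding intJ[symmetric] by (rule nn_integral_cmult) measurable
  qed
  also have "... = ennreal (c * (C * (\<Sum>j\<in>J. \<nu> j powr \<theta> * (cmod (y j))^2)))"
   using C by (simp add: ennreal_mult'[symmetric] mult_ac)
  finally have "c * (\<Sum>i\<in>I. \<mu> i powr \<theta> * ?x i) \<le> c * (C * (\<Sum>j\<in>J. \<nu> j powr \<theta> * (cmod (y j))^2))"
   using c C by (subst (asm) ennreal_le_iff) (auto intro!: mult_nonneg_nonneg sum_nonneg)
  then show ?thesis using c by simp
 qed
qed

section \<open>Stability of the projection\<close>

lemma L2_nrm_wd_add:
 assumes O: "open W" and uv: "u \<in> H1 W" "v \<in> H1 W"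
 shows "L2_nrm W (wd W i (\<lambda>x. u x + v x)) \<le> L2_nrm W (wd W i u) + L2_nrm W (wd W i v)"
proof -
 note OS = open_lebesgue[OF O(1)]
 note w = H1_wd[OF uv(1)] H1_wd[OF uv(2)] H1_wd[OF H1_add(1)[OF O uv]]
 have wp: "weak_pdiff W i (\<lambda>x. u x + v x) (\<lambda>x. wd W i u x + wd W i v x)"
  by (rule weak_pdiff_add[OF OS w(1) w(4) w(2) w(5) w(3) w(6)])
 have "AE x in lebesgue_on W. wd W i (\<lambda>x. u x + v x) x = wd W i u x + wd W i v x"
  by (rule weak_pdiff_unique[OF O w(8) L2_add[OF w(2) w(5)] w(9) wp])
 from L2_nrm_cong_AE[OF this w(8) L2_add[OF w(2) w(5)]] show ?thesis
  using L2_nrm_triangle[OF w(2) w(5)] by simp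
qed

lemma H1_nrm_test:
 fixes \<phi> :: "real^'n => complex"
 assumes O: "open W" and t: "\<phi> \<in> test_functions W"
 shows "(H1_nrm W \<phi>)^2 = (L2_nrm W \<phi>)^2 + (\<Sum>i\<in>UNIV. (L2_nrm UNIV (pdiff i \<phi>))^2)"
proof -
 note OS = open_lebesgue[OF O(1)]
 note test_functions_H1(2)[OF O t]
 moreover have "L2_nrm W (pdiff i \<phi>) = L2_nrm UNIV (pdiff i \<phi>)" for i
 proof -
  have z: "pdiff i \<phi> x = 0" if "x \<notin> W" for x using test_functionsD(5)[OF test_functions_pdiff[OF t] that] .
  have "lint W (\<lambda>x. (cmod (pdiff i \<phi> x))^2) = integral\<^sup>L lebesgue (\<lambda>x. (cmod (pdiff i \<phi> x))^2)"
   using z by (intro integral_lebesgue_on_eq(1)[OF OS]) simp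
  also have "... = lint UNIV (\<lambda>x. (cmod (pdiff i \<phi> x))^2)"
   by (rule integral_lebesgue_on_eq(1)[symmetric]) simp_all
  finally show ?thesis by (simp add: L2_nrm_def)
 qed
 ultimately show ?thesis by (simp add: sum_nonneg add_nonneg_nonneg)
qed

lemma H1_nrm_square: "(H1_nrm W v)^2 = (L2_nrm W v)^2 + (\<Sum>i\<in>UNIV. (L2_nrm W (wd W i v))^2)"
 by (simp add: H1_nrm_def sum_nonneg add_nonneg_nonneg)

lemma projection_contraction:
 assumes f: "f \<in> L2 W" and P: "P \<in> Vh W S" and orth: "ip W P P = ip W f P"
 shows "L2_nrm W P \<le> L2_nrm W f"
proof -
 have "complex_of_real ((L2_nrm W P)^2) = ip W f P" using orth by (simp add: ip_self)
 then have "(L2_nrm W P)^2 = cmod (ip W f P)" by (metis norm_of_real abs_of_nonneg zero_le_power2)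
 also have "... \<le> L2_nrm W f * L2_nrm W P" by (rule cmod_ip_le(2)[OF f Vh_L2[OF P]])
 finally show ?thesis using L2_nrm_nonneg[of W P] L2_nrm_nonneg[of W f]
  by (cases "L2_nrm W P = 0") (auto simp: power2_eq_square)
qed

definition stability_const :: "'n itself => real => real => real" where
 "stability_const TYPE('n) \<sigma> \<kappa> = 1 + real CARD('n) * (3 * sqrt (inverse_const TYPE('n) \<sigma>) * interp_const TYPE('n) \<kappa>)^2"

text \<open>The difference of projection and quasi-interpolant is the projection of the interpolation error, which is
\<open>O(h)\<close> in \<open>L2\<close>; the inverse inequality removes the factor \<open>h\<close>. So the constant does not depend on \<open>h\<close>.\<close>

lemma projection_H1_stable:
 fixes W :: "(real^'n) set"
 assumes O: "open W" "bounded W" and T: "regular_mesh W S h \<sigma>" and t: "\<phi> \<in> test_functions W"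
  and k: "0 < \<kappa>" "\<kappa> \<le> 1"
  and ext: "\<And>q. q \<in> frontier W ==> \<exists>y. norm (y - q) \<le> h \<and> cball y (\<kappa> * h) \<inter> W = {}"
  and P: "P \<in> Vh W S" and orth: "\<And>v. v \<in> Vh W S ==> ip W P v = ip W \<phi> v"
 shows "(H1_nrm W P)^2 \<le> stability_const TYPE('n) \<sigma> \<kappa> * (H1_nrm W \<phi>)^2"
proof -
 let ?A = "inverse_const TYPE('n) \<sigma>" and ?c = "interp_const TYPE('n) \<kappa>"
 define G where "G = sqrt (\<Sum>i\<in>UNIV. (L2_nrm UNIV (pdiff i \<phi>))^2)"
 have G: "0 \<le> G" "G\<^sup>2 = (\<Sum>i\<in>UNIV. (L2_nrm UNIV (pdiff i \<phi>))^2)" unfolding G_def by (simp_all add: sum_nonneg)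
 note OS = open_lebesgue[OF O(1)]
 have h: "0 < h" and A: "0 < ?A" using T inverse_const_pos by (auto simp: regular_mesh_def)
 have c0: "0 \<le> ?c" using k by (simp add: interp_const_def)
 have pL: "\<phi> \<in> L2 W" using test_functions_L2[OF t OS] .
 obtain w where w: "w \<in> Vh W S" "L2_nrm W (\<lambda>x. \<phi> x - w x) \<le> ?c * h * G"
  "\<And>i. L2_nrm W (wd W i w) \<le> 2 * sqrt ?A * ?c * G"
  using quasi_interpolant[OF O T t k ext] unfolding G_def by blast
 define e where "e x = P x - w x" for x
 have eV: "e \<in> Vh W S" unfolding e_def[abs_def] by (rule Vh_diff[OF O(1) P w(1)])
 have "ip W e e = ip W (\<lambda>x. \<phi> x - w x) e"
  using ip_diff_left[OF Vh_L2[OF P] Vh_L2[OF w(1)] Vh_L2[OF eV]] ip_diff_left[OF pL Vh_L2[OF w(1)] Vh_L2[OF eV]] orth[OF eV]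
  by (simp add: e_def[abs_def])
 from projection_contraction[OF L2_diff[OF pL Vh_L2[OF w(1)]] eV this] w(2)
 have e1: "L2_nrm W e \<le> ?c * h * G" by simp
 have "L2_nrm W (wd W i P) \<le> 3 * sqrt ?A * ?c * G" for i
 proof -
  have "L2_nrm W (wd W i e) \<le> sqrt ?A / h * L2_nrm W e" by (rule global_inverse_estimate[OF T O(1) eV])
  also have "... \<le> sqrt ?A / h * (?c * h * G)" using A h by (intro mult_left_mono e1) auto
  also have "... = sqrt ?A * ?c * G" using h by simp
  finally have we: "L2_nrm W (wd W i e) \<le> sqrt ?A * ?c * G" .
  have "P = (\<lambda>x. e x + w x)" by (simp add: e_def)
  then have "L2_nrm W (wd W i P) \<le> L2_nrm W (wd W i e) + L2_nrm W (wd W i w)"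
   using L2_nrm_wd_add[OF O(1) H10_H1[OF Vh_H10[OF eV]] H10_H1[OF Vh_H10[OF w(1)]]] by simp
  then show ?thesis using we w(3)[of i] by simp
 qed
 then have "(\<Sum>i\<in>UNIV. (L2_nrm W (wd W i P))^2) \<le> (\<Sum>i\<in>(UNIV :: 'n set). (3 * sqrt ?A * ?c * G)^2)"
  by (intro sum_mono power_mono L2_nrm_nonneg)
 also have "... = real CARD('n) * (3 * sqrt ?A * ?c)^2 * G\<^sup>2" by (simp add: power_mult_distrib)
 finally have 1: "(\<Sum>i\<in>UNIV. (L2_nrm W (wd W i P))^2) \<le> real CARD('n) * (3 * sqrt ?A * ?c)^2 * G\<^sup>2" .
 have "L2_nrm W P \<le> L2_nrm W \<phi>" by (rule projection_contraction[OF pL P orth[OF P]])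
 then have 2: "(L2_nrm W P)^2 \<le> (L2_nrm W \<phi>)^2" by (intro power_mono L2_nrm_nonneg)
 define D where "D = real CARD('n) * (3 * sqrt ?A * ?c)^2"
 have D: "0 \<le> D" by (simp add: D_def)
 have "(H1_nrm W P)^2 \<le> (L2_nrm W \<phi>)^2 + D * G\<^sup>2" unfolding H1_nrm_square D_def using 1 2 by simp
 also have "... \<le> (1 + D) * ((L2_nrm W \<phi>)^2 + G\<^sup>2)" using D by (simp add: algebra_simps)
 also have "(L2_nrm W \<phi>)^2 + G\<^sup>2 = (H1_nrm W \<phi>)^2" by (simp add: H1_nrm_test[OF O(1) t] G(2))
 finally show ?thesis by (simp add: stability_const_def D_def)
qed

section \<open>Discrete eigenfunction expansions\<close>

definition fe_setting where
 "fe_setting W a S p mu \<longleftrightarrow> open W \<and> elliptic_form W a \<and> triangulation S \<and> \<Union>S = closure W \<and> discrete_eigensystem W a S p mu"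

lemma fe_settingD:
 assumes "fe_setting W a S p mu"
 shows "open W" "elliptic_form W a" "triangulation S" "\<Union>S = closure W"
  "j < dim_Vh W S ==> p j \<in> Vh W S" "j < dim_Vh W S ==> 0 < mu j"
  "j < dim_Vh W S ==> Lh W a S (p j) = (\<lambda>x. complex_of_real (mu j) * p j x)"
  "i < dim_Vh W S ==> j < dim_Vh W S ==> ip W (p i) (p j) = (if i = j then 1 else 0)"
  "j < dim_Vh W S ==> p j \<in> L2 W" "j < dim_Vh W S ==> p j \<in> H10 W"
 using assms unfolding fe_setting_def discrete_eigensystem_def by (auto intro: Vh_L2 Vh_H10)

lemma ip_orthonormal_sum:
 assumes "finite I" "\<And>i. i \<in> I ==> p i \<in> L2 W"
  "\<And>i j. i \<in> I ==> j \<in> I ==> ip W (p i) (p j) = (if i = j then 1 else 0)" "i \<in> I"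
 shows "ip W (\<lambda>x. \<Sum>j\<in>I. c j * p j x) (p i) = c i"
proof -
 have "ip W (\<lambda>x. \<Sum>j\<in>I. c j * p j x) (p i) = (\<Sum>j\<in>I. c j * ip W (p j) (p i))"
  by (rule ip_sum_left) (use assms in auto)
 also have "... = (\<Sum>j\<in>I. if j = i then c i else 0)" using assms by (intro sum.cong) auto
 finally show ?thesis using assms by simp
qed

lemma L2_nrm_orthonormal_sum:
 assumes "finite I" "\<And>i. i \<in> I ==> p i \<in> L2 W"
  "\<And>i j. i \<in> I ==> j \<in> I ==> ip W (p i) (p j) = (if i = j then 1 else 0)"
 shows "(L2_nrm W (\<lambda>x. \<Sum>j\<in>I. c j * p j x))^2 = (\<Sum>j\<in>I. (cmod (c j))^2)"
proof -
 let ?s = "\<lambda>x. \<Sum>j\<in>I. c j * p j x"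
 have s: "?s \<in> L2 W" using assms(2) by (intro L2_sum L2_cmult)
 have "complex_of_real ((L2_nrm W ?s)^2) = ip W ?s ?s" by (simp add: ip_self)
 also have "... = (\<Sum>j\<in>I. cnj (c j) * ip W ?s (p j))" by (rule ip_sum_right) (use assms s in auto)
 also have "... = (\<Sum>j\<in>I. complex_of_real ((cmod (c j))^2))"
  by (intro sum.cong refl) (simp only: ip_orthonormal_sum[OF assms] complex_norm_square mult.commute)
 also have "... = complex_of_real (\<Sum>j\<in>I. (cmod (c j))^2)" by simp
 finally show ?thesis by (simp only: of_real_eq_iff)
qed

lemma bessel:
 assumes I: "finite I" "\<And>i. i \<in> I ==> p i \<in> L2 W"
  "\<And>i j. i \<in> I ==> j \<in> I ==> ip W (p i) (p j) = (if i = j then 1 else 0)" and f: "f \<in> L2 W"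
 shows "(L2_nrm W (\<lambda>x. f x - (\<Sum>j\<in>I. ip W f (p j) * p j x)))^2 = (L2_nrm W f)^2 - (\<Sum>j\<in>I. (cmod (ip W f (p j)))^2)"
  and "(\<Sum>j\<in>I. (cmod (ip W f (p j)))^2) \<le> (L2_nrm W f)^2"
proof -
 let ?s = "\<lambda>x. \<Sum>j\<in>I. ip W f (p j) * p j x" and ?N = "\<Sum>j\<in>I. (cmod (ip W f (p j)))^2"
 have s: "?s \<in> L2 W" using I(2) by (intro L2_sum L2_cmult)
 have ss: "ip W ?s ?s = of_real ?N" using L2_nrm_orthonormal_sum[OF I, of "\<lambda>j. ip W f (p j)"] by (simp only: ip_self)
 have fs: "ip W f ?s = of_real ?N"
 proof -
  have "ip W f ?s = (\<Sum>j\<in>I. cnj (ip W f (p j)) * ip W f (p j))" by (rule ip_sum_right) (use I f in auto)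
  also have "... = (\<Sum>j\<in>I. complex_of_real ((cmod (ip W f (p j)))^2))"
   by (intro sum.cong refl) (simp only: complex_norm_square mult.commute)
  finally show ?thesis by simp
 qed
 have sf: "ip W ?s f = of_real ?N" unfolding ip_cnj[of W ?s f] fs by simp
 have "complex_of_real ((L2_nrm W (\<lambda>x. f x - ?s x))^2) = ip W (\<lambda>x. f x - ?s x) (\<lambda>x. f x - ?s x)" by (rule ip_self[symmetric])
 also have "... = (ip W f f - ip W f ?s) - (ip W ?s f - ip W ?s ?s)"
  by (simp only: ip_diff_left[OF f s L2_diff[OF f s]] ip_diff_right[OF f s f] ip_diff_right[OF f s s])
 also have "... = complex_of_real ((L2_nrm W f)^2 - ?N)" unfolding ss fs sf by (simp add: ip_self)
 finally have eq: "(L2_nrm W (\<lambda>x. f x - ?s x))^2 = (L2_nrm W f)^2 - ?N" by (simp only: of_real_eq_iff)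
 then show "(L2_nrm W (\<lambda>x. f x - ?s x))^2 = (L2_nrm W f)^2 - ?N" .
 show "?N \<le> (L2_nrm W f)^2" using eq zero_le_power2[of "L2_nrm W (\<lambda>x. f x - ?s x)"] by linarith
qed

lemma fe_expansion:
 assumes E: "fe_setting W a S p mu" and v: "v \<in> Vh W S"
 shows "v = (\<lambda>x. \<Sum>j<dim_Vh W S. ip W v (p j) * p j x)"
 by (rule Vh_expansion[OF fe_settingD(1)[OF E] fe_settingD(3,4)[OF E] fe_settingD(5)[OF E] fe_settingD(8)[OF E] v])

lemma fe_coeff:
 assumes E: "fe_setting W a S p mu" and i: "i < dim_Vh W S"
 shows "ip W (\<lambda>x. \<Sum>j<dim_Vh W S. c j * p j x) (p i) = c i"
 by (rule ip_orthonormal_sum) (use fe_settingD[OF E] i in auto)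

lemma fe_sum_Vh:
 assumes E: "fe_setting W a S p mu"
 shows "(\<lambda>x. \<Sum>j<dim_Vh W S. c j * p j x) \<in> Vh W S"
 by (rule Vh_sum[OF fe_settingD(1)[OF E]]) (use Vh_cmult[OF fe_settingD(1)[OF E]] fe_settingD(5)[OF E] in auto)

lemma fe_eqI:
 assumes E: "fe_setting W a S p mu" and uv: "u \<in> Vh W S" "v \<in> Vh W S"
  and eq: "\<And>j. j < dim_Vh W S ==> ip W u (p j) = ip W v (p j)"
 shows "u = v"
proof -
 have "(\<lambda>x. \<Sum>j<dim_Vh W S. ip W u (p j) * p j x) = (\<lambda>x. \<Sum>j<dim_Vh W S. ip W v (p j) * p j x)"
  by (intro ext sum.cong refl) (simp add: eq)
 from trans[OF trans[OF fe_expansion[OF E uv(1)] this] fe_expansion[OF E uv(2), symmetric]] show ?thesis .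
qed

text \<open>Both \<open>Lh\<close> and \<open>pih\<close> are Riesz representers in the finite element space, of \<open>a v\<close> and of \<open>ip W f\<close>.\<close>

lemma fe_representer:
 assumes E: "fe_setting W a S p mu"
  and F: "\<And>\<phi>. \<phi> \<in> Vh W S ==> F \<phi> = (\<Sum>j<dim_Vh W S. cnj (ip W \<phi> (p j)) * F (p j))"
 shows "(THE w. w \<in> Vh W S \<and> (\<forall>\<phi>\<in>Vh W S. ip W w \<phi> = F \<phi>)) = (\<lambda>x. \<Sum>j<dim_Vh W S. F (p j) * p j x)" (is "_ = ?w")
  and "\<phi> \<in> Vh W S ==> ip W (\<lambda>x. \<Sum>j<dim_Vh W S. F (p j) * p j x) \<phi> = F \<phi>"
proof -
 note D = fe_settingD[OF E]
 show wa: "ip W ?w \<phi> = F \<phi>" if \<phi>: "\<phi> \<in> Vh W S" for \<phi>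
 proof -
  have "ip W ?w \<phi> = (\<Sum>j<dim_Vh W S. F (p j) * ip W (p j) \<phi>)"
   by (rule ip_sum_left) (use D(9) Vh_L2[OF \<phi>] in auto)
  also have "... = F \<phi>"
   unfolding F[OF \<phi>]
  proof (intro sum.cong refl)
   fix j show "F (p j) * ip W (p j) \<phi> = cnj (ip W \<phi> (p j)) * F (p j)"
    by (subst ip_cnj[of W "p j" \<phi>]) (rule mult.commute)
  qed
  finally show ?thesis .
 qed
 show "(THE w. w \<in> Vh W S \<and> (\<forall>\<phi>\<in>Vh W S. ip W w \<phi> = F \<phi>)) = ?w"
 proof (rule the_equality)
  show "?w \<in> Vh W S \<and> (\<forall>\<phi>\<in>Vh W S. ip W ?w \<phi> = F \<phi>)" 
   by (intro conjI ballI fe_sum_Vh[OF E] wa)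
  fix u assume u: "u \<in> Vh W S \<and> (\<forall>\<phi>\<in>Vh W S. ip W u \<phi> = F \<phi>)"
  show "u = ?w"
  proof (rule fe_eqI[OF E conjunct1[OF u] fe_sum_Vh[OF E]])
   fix j assume "j < dim_Vh W S"
   from D(5)[OF this] show "ip W u (p j) = ip W ?w (p j)" using bspec[OF conjunct2[OF u]] wa by simp
  qed
 qed
qed

lemma fe_Lh_char:
 assumes E: "fe_setting W a S p mu" and v: "v \<in> Vh W S"
 shows "Lh W a S v \<in> Vh W S" "\<phi> \<in> Vh W S ==> ip W (Lh W a S v) \<phi> = a v \<phi>"
  "Lh W a S v = (\<lambda>x. \<Sum>j<dim_Vh W S. a v (p j) * p j x)"
proof -
 note D = fe_settingD[OF E]
 have F: "a v \<phi> = (\<Sum>j<dim_Vh W S. cnj (ip W \<phi> (p j)) * a v (p j))" if \<phi>: "\<phi> \<in> Vh W S" for \<phi>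
 proof -
  have "a v \<phi> = a v (\<lambda>x. \<Sum>j<dim_Vh W S. ip W \<phi> (p j) * p j x)" by (rule arg_cong[OF fe_expansion[OF E \<phi>]])
  also have "... = (\<Sum>j<dim_Vh W S. cnj (ip W \<phi> (p j)) * a v (p j))"
   by (rule form_sum_right[OF D(2,1) Vh_H10[OF v]]) (use D(10) in auto)
  finally show ?thesis .
 qed
 note R = fe_representer[OF E, where F = "a v", OF F]
 show "Lh W a S v = (\<lambda>x. \<Sum>j<dim_Vh W S. a v (p j) * p j x)" unfolding Lh_def by (rule R(1))
 then show "Lh W a S v \<in> Vh W S" "\<phi> \<in> Vh W S ==> ip W (Lh W a S v) \<phi> = a v \<phi>"
  using fe_sum_Vh[OF E] R(2) by simp_all
qed

lemma fe_eigen: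
 assumes E: "fe_setting W a S p mu" and i: "i < dim_Vh W S" and v: "v \<in> Vh W S"
 shows "a (p i) v = of_real (mu i) * ip W (p i) v" "a v (p i) = of_real (mu i) * ip W v (p i)"
proof -
 note D = fe_settingD[OF E]
 have "a (p i) v = ip W (Lh W a S (p i)) v" by (rule fe_Lh_char(2)[OF E D(5)[OF i] v, symmetric])
 also have "... = of_real (mu i) * ip W (p i) v" unfolding D(7)[OF i] by (rule ip_cmult_left)
 finally show 1: "a (p i) v = of_real (mu i) * ip W (p i) v" .
 have "a v (p i) = cnj (a (p i) v)" by (rule elliptic_formD(3)[OF D(2) Vh_H10[OF v] D(10)[OF i]])
 also have "... = of_real (mu i) * ip W v (p i)" unfolding 1 ip_cnj[of W v "p i"] by simp
 finally show "a v (p i) = of_real (mu i) * ip W v (p i)" .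
qed

lemma fe_energy:
 assumes E: "fe_setting W a S p mu" and v: "v \<in> Vh W S"
 shows "a v v = of_real (\<Sum>j<dim_Vh W S. mu j * (cmod (ip W v (p j)))^2)"
proof -
 note D = fe_settingD[OF E]
 have "a v v = ip W (Lh W a S v) v" by (rule fe_Lh_char(2)[OF E v v, symmetric])
 also have "... = (\<Sum>j<dim_Vh W S. a v (p j) * ip W (p j) v)"
  unfolding fe_Lh_char(3)[OF E v] by (rule ip_sum_left) (use D(9) Vh_L2[OF v] in auto)
 also have "... = (\<Sum>j<dim_Vh W S. complex_of_real (mu j * (cmod (ip W v (p j)))^2))"
 proof (intro sum.cong refl)
  fix j assume "j \<in> {..<dim_Vh W S}"
  then have j: "j < dim_Vh W S" by simp
  show "a v (p j) * ip W (p j) v = complex_of_real (mu j * (cmod (ip W v (p j)))^2)"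
   unfolding fe_eigen(2)[OF E j v] ip_cnj[of W "p j" v] by (simp only: of_real_mult complex_norm_square mult.assoc)
 qed
 finally show ?thesis by simp
qed

lemma fe_pih:
 assumes E: "fe_setting W a S p mu" and f: "f \<in> L2 W"
 shows "pih W S f \<in> Vh W S" "\<phi> \<in> Vh W S ==> ip W (pih W S f) \<phi> = ip W f \<phi>"
proof -
 note D = fe_settingD[OF E]
 have F: "ip W f \<phi> = (\<Sum>j<dim_Vh W S. cnj (ip W \<phi> (p j)) * ip W f (p j))" if \<phi>: "\<phi> \<in> Vh W S" for \<phi>
 proof -
  have "ip W f \<phi> = ip W f (\<lambda>x. \<Sum>j<dim_Vh W S. ip W \<phi> (p j) * p j x)" by (rule arg_cong[OF fe_expansion[OF E \<phi>]])
  also have "... = (\<Sum>j<dim_Vh W S. cnj (ip W \<phi> (p j)) * ip W f (p j))"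
   by (rule ip_sum_right) (use D(9) f in auto)
  finally show ?thesis .
 qed
 note R = fe_representer[OF E, where F = "ip W f", OF F]
 have "pih W S f = (\<lambda>x. \<Sum>j<dim_Vh W S. ip W f (p j) * p j x)" unfolding pih_def by (rule R(1))
 then show "pih W S f \<in> Vh W S" "\<phi> \<in> Vh W S ==> ip W (pih W S f) \<phi> = ip W f \<phi>"
  using fe_sum_Vh[OF E] R(2) by simp_all
qed

text \<open>The resolvent is an \<open>inv_into\<close>; injectivity on the finite element space makes it a true inverse.\<close>

lemma fe_resolvent:
 assumes E: "fe_setting W a S p mu" and g: "g \<in> Vh W S"
  and z: "\<And>j. j < dim_Vh W S ==> z ~= of_real (mu j)"
 shows "resolvent_h W a S z g = (\<lambda>x. \<Sum>j<dim_Vh W S. ip W g (p j) / (z - of_real (mu j)) * p j x)"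
proof -
 note D = fe_settingD[OF E]
 let ?F = "\<lambda>v x. z * v x - Lh W a S v x"
 have FV: "?F v \<in> Vh W S" if "v \<in> Vh W S" for v
  by (rule Vh_diff[OF D(1) Vh_cmult[OF D(1) that] fe_Lh_char(1)[OF E that]])
 have coef: "ip W (?F v) (p j) = (z - of_real (mu j)) * ip W v (p j)" if v: "v \<in> Vh W S" and j: "j < dim_Vh W S" for v j
 proof -
  have "ip W (?F v) (p j) = ip W (\<lambda>x. z * v x) (p j) - ip W (Lh W a S v) (p j)"
   by (rule ip_diff_left[OF L2_cmult[OF Vh_L2[OF v]] Vh_L2[OF fe_Lh_char(1)[OF E v]] D(9)[OF j]])
  also have "... = z * ip W v (p j) - of_real (mu j) * ip W v (p j)"
   unfolding fe_Lh_char(2)[OF E v D(5)[OF j]] fe_eigen(2)[OF E j v] ip_cmult_left ..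
  finally show ?thesis by (simp add: left_diff_distrib)
 qed
 have inj: "inj_on ?F (Vh W S)"
 proof (rule inj_onI)
  fix u v assume uv: "u \<in> Vh W S" "v \<in> Vh W S" and eq: "?F u = ?F v"
  show "u = v"
  proof (rule fe_eqI[OF E uv])
   fix j assume j: "j < dim_Vh W S"
   have "(z - of_real (mu j)) * ip W u (p j) = (z - of_real (mu j)) * ip W v (p j)"
    by (simp only: coef[OF uv(1) j, symmetric] coef[OF uv(2) j, symmetric] eq)
   then show "ip W u (p j) = ip W v (p j)" using z[OF j] by simp
  qed
 qed
 define w where "w = (\<lambda>x. \<Sum>j<dim_Vh W S. ip W g (p j) / (z - of_real (mu j)) * p j x)"
 have wV: "w \<in> Vh W S" unfolding w_def by (rule fe_sum_Vh[OF E])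
 have "?F w = g"
 proof (rule fe_eqI[OF E FV[OF wV] g])
  fix j assume j: "j < dim_Vh W S"
  have "ip W w (p j) = ip W g (p j) / (z - of_real (mu j))" unfolding w_def by (rule fe_coeff[OF E j])
  then show "ip W (?F w) (p j) = ip W g (p j)" unfolding coef[OF wV j] using z[OF j] by simp
 qed
 then have "resolvent_h W a S z g = inv_into (Vh W S) ?F (?F w)" unfolding resolvent_h_def by simp
 also have "... = w" by (rule inv_into_f_f[OF inj wV])
 finally show ?thesis by (simp only: w_def)
qed

section \<open>Comparison of continuous and discrete norms\<close>

lemma eigenbasisD:
 assumes "eigenbasis W a \<psi> lam"
 shows "\<psi> j \<in> L2 W" "\<psi> j \<in> H10 W" "ip W (\<psi> i) (\<psi> j) = (if i = j then 1 else 0)"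
  "v \<in> L2 W ==> (\<lambda>m. L2_nrm W (\<lambda>x. v x - (\<Sum>j<m. ip W v (\<psi> j) * \<psi> j x))) ----> 0"
  "\<theta> \<in> H10 W ==> a (\<psi> j) \<theta> = of_real (lam j) * ip W (\<psi> j) \<theta>"
  "0 < lam j" "lam 0 \<le> lam j"
proof -
 have g: "L_graph W a (\<psi> j) (\<lambda>x. complex_of_real (lam j) * \<psi> j x)" for j using assms unfolding eigenbasis_def by blast
 show "\<psi> j \<in> L2 W" "ip W (\<psi> i) (\<psi> j) = (if i = j then 1 else 0)"
  "v \<in> L2 W ==> (\<lambda>m. L2_nrm W (\<lambda>x. v x - (\<Sum>j<m. ip W v (\<psi> j) * \<psi> j x))) ----> 0"
  using assms unfolding eigenbasis_def by blast+
 show "\<psi> j \<in> H10 W" using g[of j] by (simp add: L_graph_def T_graph_def)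
 show "\<theta> \<in> H10 W ==> a (\<psi> j) \<theta> = of_real (lam j) * ip W (\<psi> j) \<theta>"
  using g[of j] by (simp add: L_graph_def T_graph_def ip_cmult_left)
 have "mono lam" "0 < lam 0" using assms unfolding eigenbasis_def by blast+
 then show "lam 0 \<le> lam j" by (simp add: mono_def)
 with \<open>0 < lam 0\<close> show "0 < lam j" by linarith
qed

lemma form_nonneg:
 assumes "elliptic_form W a" "v \<in> H10 W"
 shows "0 \<le> Re (a v v)"
proof -
 obtain c0 where "0 < c0" "\<forall>v\<in>H10 W. Re (a v v) \<ge> c0 * (H1_nrm W v)^2" using elliptic_formD(4)[OF assms(1)] by blast
 then show ?thesis using assms(2) by (meson mult_nonneg_nonneg order_trans less_imp_le zero_le_power2)
qed

lemma form_diff_left: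
 assumes a: "elliptic_form W a" and O: "open W" and u: "u \<in> H10 W" "v \<in> H10 W" "w \<in> H10 W"
 shows "a (\<lambda>x. u x - v x) w = a u w - a v w"
 using elliptic_formD(1)[OF a u(1) H10_cmult[OF O u(2), of "- 1"] u(3)] elliptic_formD(2)[OF a u(2,3), of "- 1"] by simp

lemma eigen_sum_form:
 assumes a: "elliptic_form W a" and O: "open W" and E: "eigenbasis W a \<psi> lam" and J: "finite J"
 defines "w \<equiv> \<lambda>c x. \<Sum>j\<in>J. c j * \<psi> j x"
 shows "w c \<in> H10 W" "\<theta> \<in> H10 W ==> a (w c) \<theta> = (\<Sum>j\<in>J. of_real (lam j) * (c j * ip W (\<psi> j) \<theta>))"
  "a (w c) (w c) = of_real (\<Sum>j\<in>J. lam j * (cmod (c j))^2)"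
proof -
 note D = eigenbasisD[OF E]
 show wH: "w c \<in> H10 W" unfolding w_def by (rule H10_sum[OF O]) (rule D(2))
 show wf: "a (w c) \<theta> = (\<Sum>j\<in>J. of_real (lam j) * (c j * ip W (\<psi> j) \<theta>))" if t: "\<theta> \<in> H10 W" for \<theta>
  unfolding w_def form_sum_left[OF a O t J D(2)] D(5)[OF t] by (simp add: mult_ac)
 have "a (w c) (w c) = (\<Sum>j\<in>J. complex_of_real (lam j * (cmod (c j))^2))"
  unfolding wf[OF wH]
 proof (rule sum.cong[OF refl])
  fix j assume j: "j \<in> J"
  have "ip W (w c) (\<psi> j) = c j" unfolding w_def by (rule ip_orthonormal_sum) (use J D(1,3) j in auto)
  then have "ip W (\<psi> j) (w c) = cnj (c j)" by (subst ip_cnj) simp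
  then show "of_real (lam j) * (c j * ip W (\<psi> j) (w c)) = complex_of_real (lam j * (cmod (c j))^2)"
   by (simp only: of_real_mult complex_norm_square)
 qed
 then show "a (w c) (w c) = of_real (\<Sum>j\<in>J. lam j * (cmod (c j))^2)" by simp
qed

text \<open>The form is nonnegative on the difference of \<open>v\<close> and its partial eigenfunction expansion, and \<open>a (\<psi> j) v\<close> is a multiple of \<open>ip W (\<psi> j) v\<close>.\<close>

lemma energy_bessel:
 assumes a: "elliptic_form W a" and O: "open W" and E: "eigenbasis W a \<psi> lam" and v: "v \<in> H10 W"
 shows "(\<Sum>j<m. lam j * (cmod (ip W v (\<psi> j)))^2) \<le> Re (a v v)"
proof -
 let ?c = "\<lambda>j. ip W v (\<psi> j)"
 define w where "w = (\<lambda>x. \<Sum>j<m. ?c j * \<psi> j x)"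
 define R where "R = (\<Sum>j<m. lam j * (cmod (?c j))^2)"
 note S = eigen_sum_form[OF a O E finite_lessThan[of m], where c = ?c, folded w_def R_def]
 have wv: "a w v = of_real R"
 proof -
  have "a w v = (\<Sum>j<m. of_real (lam j) * (?c j * ip W (\<psi> j) v))" by (rule S(2)[OF v])
  also have "... = (\<Sum>j<m. complex_of_real (lam j * (cmod (?c j))^2))"
  proof (rule sum.cong[OF refl])
   fix j show "of_real (lam j) * (?c j * ip W (\<psi> j) v) = complex_of_real (lam j * (cmod (?c j))^2)"
    by (subst ip_cnj[of W "\<psi> j" v]) (simp only: of_real_mult complex_norm_square)
  qed
  finally show ?thesis by (simp add: R_def)
 qed
 have ww: "a w w = of_real R" by (rule S(3))
 have vw: "a v w = of_real R" using elliptic_formD(3)[OF a v S(1)] wv by simp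
 have dH: "(\<lambda>x. v x - w x) \<in> H10 W" by (rule H10_diff[OF O v S(1)])
 have vd: "a v (\<lambda>x. v x - w x) = cnj (a v v - a w v)"
  using elliptic_formD(3)[OF a v dH] form_diff_left[OF a O v S(1) v] by simp
 have wd: "a w (\<lambda>x. v x - w x) = cnj (a v w - a w w)"
  using elliptic_formD(3)[OF a S(1) dH] form_diff_left[OF a O v S(1) S(1)] by simp
 have "a (\<lambda>x. v x - w x) (\<lambda>x. v x - w x) = cnj (a v v - of_real R)"
  using form_diff_left[OF a O v S(1) dH] vd wd wv ww vw by simp
 with form_nonneg[OF a dH] have "0 \<le> Re (cnj (a v v - of_real R))" by simp
 then show ?thesis by (simp add: R_def)
qed

lemma lowest_eigenvalue_bound:
 assumes a: "elliptic_form W a" and O: "open W" and E: "eigenbasis W a \<psi> lam" and v: "v \<in> H10 W"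
 shows "lam 0 * (L2_nrm W v)^2 \<le> Re (a v v)"
proof -
 note D = eigenbasisD[OF E]
 let ?c = "\<lambda>j. ip W v (\<psi> j)"
 have vL: "v \<in> L2 W" using v by (rule H10_L2)
 have b: "(L2_nrm W (\<lambda>x. v x - (\<Sum>j<m. ?c j * \<psi> j x)))^2 = (L2_nrm W v)^2 - (\<Sum>j<m. (cmod (?c j))^2)" for m
  by (rule bessel(1)) (use D(1,3) vL in auto)
 have "lam 0 * (L2_nrm W v)^2 - lam 0 * (L2_nrm W (\<lambda>x. v x - (\<Sum>j<m. ?c j * \<psi> j x)))^2 \<le> Re (a v v)" for m
 proof -
  have "lam 0 * (\<Sum>j<m. (cmod (?c j))^2) \<le> (\<Sum>j<m. lam j * (cmod (?c j))^2)"
   unfolding sum_distrib_left by (intro sum_mono mult_right_mono D(7)) auto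
  also have "... \<le> Re (a v v)" by (rule energy_bessel[OF a O E v])
  finally show ?thesis unfolding b by (simp add: right_diff_distrib)
 qed
 moreover have "(\<lambda>m. lam 0 * (L2_nrm W v)^2 - lam 0 * (L2_nrm W (\<lambda>x. v x - (\<Sum>j<m. ?c j * \<psi> j x)))^2)
   ----> lam 0 * (L2_nrm W v)^2 - lam 0 * 0\<^sup>2"
  by (intro tendsto_diff tendsto_const tendsto_mult tendsto_power D(4)[OF vL])
 ultimately have "lam 0 * (L2_nrm W v)^2 - lam 0 * 0\<^sup>2 \<le> Re (a v v)"
  by (intro LIMSEQ_le_const2) auto
 then show ?thesis by simp
qed

lemma discrete_eigenvalue_lower_bound:
 assumes F: "fe_setting W a S p mu" and E: "eigenbasis W a \<psi> lam" and j: "j < dim_Vh W S"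
 shows "lam 0 \<le> mu j"
proof -
 note D = fe_settingD[OF F]
 have ipj: "ip W (p j) (p j) = 1" using D(8)[OF j j] by simp
 then have "(L2_nrm W (p j))^2 = 1" unfolding ip_self by (simp only: of_real_eq_1_iff)
 moreover have "a (p j) (p j) = of_real (mu j)" using fe_eigen(1)[OF F j D(5)[OF j]] ipj by simp
 ultimately show ?thesis using lowest_eigenvalue_bound[OF D(2,1) E D(10)[OF j]] by simp
qed

lemma ip_tendsto:
 assumes f: "f \<in> L2 W" and g: "\<And>k. g k \<in> L2 W" and q: "q \<in> L2 W"
  and lim: "(\<lambda>k. L2_nrm W (\<lambda>x. f x - g k x)) ----> 0"
 shows "(\<lambda>k. ip W (g k) q) ----> ip W f q"
proof (rule LIM_zero_cancel, rule Lim_null_comparison[OF always_eventually])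
 show "\<forall>k. norm (ip W (g k) q - ip W f q) \<le> L2_nrm W (\<lambda>x. f x - g k x) * L2_nrm W q"
  using cmod_ip_le(2)[OF L2_diff[OF f g] q] by (simp add: ip_diff_left[OF f g q] norm_minus_commute)
 show "(\<lambda>k. L2_nrm W (\<lambda>x. f x - g k x) * L2_nrm W q) ----> 0" using lim by (rule tendsto_mult_left_zero)
qed

text \<open>The left-hand side is the form on \<open>pih W S f\<close>. For test functions the stability of the projection applies;
the bound passes to limits in \<open>H1\<close>.\<close>

lemma discrete_energy_bound:
 assumes F: "fe_setting W a S p mu"
  and stab: "\<And>\<phi>. \<phi> \<in> test_functions W ==> (H1_nrm W (pih W S \<phi>))^2 \<le> C * (H1_nrm W \<phi>)^2"
  and C: "0 \<le> C" and c1: "0 \<le> c1" "\<And>v. v \<in> H10 W ==> cmod (a v v) \<le> c1 * (H1_nrm W v)^2" and f: "f \<in> H10 W"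
 shows "(\<Sum>j<dim_Vh W S. mu j * (cmod (ip W f (p j)))^2) \<le> c1 * C * (H1_nrm W f)^2"
proof -
 note D = fe_settingD[OF F]
 note OS = open_lebesgue[OF D(1)]
 let ?m = "dim_Vh W S"
 have test: "(\<Sum>j<?m. mu j * (cmod (ip W \<phi> (p j)))^2) \<le> c1 * C * (H1_nrm W \<phi>)^2" if t: "\<phi> \<in> test_functions W" for \<phi>
 proof -
  have pL: "\<phi> \<in> L2 W" by (rule test_functions_L2[OF t OS])
  note P = fe_pih(1)[OF F pL]
  have "(\<Sum>j<?m. mu j * (cmod (ip W \<phi> (p j)))^2) = (\<Sum>j<?m. mu j * (cmod (ip W (pih W S \<phi>) (p j)))^2)"
   by (intro sum.cong refl) (simp add: fe_pih(2)[OF F pL D(5)])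
  also have "... \<le> cmod (a (pih W S \<phi>) (pih W S \<phi>))" unfolding fe_energy[OF F P] norm_of_real by (rule abs_ge_self)
  also have "... \<le> c1 * (H1_nrm W (pih W S \<phi>))^2" by (rule c1(2)[OF Vh_H10[OF P]])
  also have "... \<le> c1 * (C * (H1_nrm W \<phi>)^2)" by (rule mult_left_mono[OF stab[OF t] c1(1)])
  finally show ?thesis by (simp only: mult.assoc)
 qed
 obtain \<phi> where ph: "\<And>k::nat. \<phi> k \<in> test_functions W" and lim: "(\<lambda>k. H1_nrm W (\<lambda>x. f x - \<phi> k x)) ----> 0"
  using f unfolding H10_def by blast
 have fL: "f \<in> L2 W" and fH: "f \<in> H1 W" using f by (auto intro: H10_L2 H10_H1)
 have pL: "\<phi> k \<in> L2 W" for k by (rule test_functions_L2[OF ph OS])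
 have pH: "\<phi> k \<in> H1 W" for k by (rule test_functions_H1(1)[OF D(1) ph])
 have "(\<lambda>k. L2_nrm W (\<lambda>x. f x - \<phi> k x)) ----> 0"
  by (rule Lim_null_comparison[OF always_eventually lim]) (simp add: L2_nrm_nonneg L2_nrm_le_H1_nrm)
 then have l2: "(\<lambda>k. ip W (\<phi> k) (p j)) ----> ip W f (p j)" if "j < ?m" for j
  by (rule ip_tendsto[OF fL pL D(9)[OF that]])
 have n: "H1_nrm W (\<phi> k) \<le> H1_nrm W f + H1_nrm W (\<lambda>x. f x - \<phi> k x)" for k
 proof -
  have e: "\<phi> k = (\<lambda>x. f x + (- 1) * (f x - \<phi> k x))" by simp
  have d: "(\<lambda>x. f x - \<phi> k x) \<in> H1 W" by (rule H1_diff[OF D(1) fH pH])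
  have "H1_nrm W (\<lambda>x. f x + (- 1) * (f x - \<phi> k x)) \<le> H1_nrm W f + H1_nrm W (\<lambda>x. (- 1) * (f x - \<phi> k x))"
   by (rule H1_add(2)[OF D(1) fH H1_cmult(1)[OF D(1) d]])
  also have "H1_nrm W (\<lambda>x. (- 1) * (f x - \<phi> k x)) = cmod (- 1) * H1_nrm W (\<lambda>x. f x - \<phi> k x)" by (rule H1_cmult(2)[OF D(1) d])
  finally show ?thesis using e by simp
 qed
 have "(\<lambda>k. \<Sum>j<?m. mu j * (cmod (ip W (\<phi> k) (p j)))^2) ----> (\<Sum>j<?m. mu j * (cmod (ip W f (p j)))^2)"
  using l2 by (intro tendsto_sum tendsto_mult tendsto_const tendsto_power tendsto_norm) auto
 moreover have "(\<lambda>k. \<bar>c1 * C\<bar> * (H1_nrm W f + H1_nrm W (\<lambda>x. f x - \<phi> k x))^2) ----> \<bar>c1 * C\<bar> * (H1_nrm W f + 0)^2"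
  by (intro tendsto_mult tendsto_const tendsto_power tendsto_add lim)
 moreover have "(\<Sum>j<?m. mu j * (cmod (ip W (\<phi> k) (p j)))^2) \<le> \<bar>c1 * C\<bar> * (H1_nrm W f + H1_nrm W (\<lambda>x. f x - \<phi> k x))^2" for k
 proof -
  have "c1 * C * (H1_nrm W (\<phi> k))^2 \<le> \<bar>c1 * C\<bar> * (H1_nrm W f + H1_nrm W (\<lambda>x. f x - \<phi> k x))^2"
   by (intro mult_mono power_mono n H1_nrm_nonneg) auto
  then show ?thesis using test[OF ph[of k]] by linarith
 qed
 ultimately have "(\<Sum>j<?m. mu j * (cmod (ip W f (p j)))^2) \<le> \<bar>c1 * C\<bar> * (H1_nrm W f + 0)^2"
  by (intro LIMSEQ_le[of _ _ "\<lambda>k. \<bar>c1 * C\<bar> * (H1_nrm W f + H1_nrm W (\<lambda>x. f x - \<phi> k x))^2"]) auto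
 then show ?thesis using c1(1) C by simp
qed

text \<open>Interpolation for the matrix \<open>ip W (\<psi> j) (p i)\<close> and a partial sum of the data, then a limit of the finitely many discrete coefficients.\<close>

lemma data_coefficients_bound:
 assumes F: "fe_setting W a S p mu" and E: "eigenbasis W a \<psi> lam" and th: "0 \<le> \<theta>" "\<theta> \<le> 1"
  and K: "1 \<le> K" "\<And>v. v \<in> H10 W ==> (\<Sum>j<dim_Vh W S. mu j * (cmod (ip W v (p j)))^2) \<le> K * Re (a v v)"
  and f: "f \<in> Hdot W \<psi> lam \<theta>"
 shows "(\<Sum>i<dim_Vh W S. mu i powr \<theta> * (cmod (ip W f (p i)))^2) \<le> K * (Hdot_nrm W \<psi> lam \<theta> f)^2"
proof -
 note D = fe_settingD[OF F] and B = eigenbasisD[OF E]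
 let ?n = "dim_Vh W S" and ?c = "\<lambda>j. ip W f (\<psi> j)"
 have fL: "f \<in> L2 W" and sm: "summable (\<lambda>j. lam j powr \<theta> * (cmod (?c j))^2)" using f by (auto simp: Hdot_def)
 define s where "s z m x = (\<Sum>j<m. z j * \<psi> j x)" for z :: "nat => complex" and m :: nat and x
 have sL: "s z m \<in> L2 W" for z m unfolding s_def[abs_def] using B(1) by (intro L2_sum L2_cmult)
 have sH: "s z m \<in> H10 W" for z m unfolding s_def[abs_def] by (rule H10_sum[OF D(1)]) (rule B(2))
 have ipS: "ip W (s z m) (p i) = (\<Sum>j<m. ip W (\<psi> j) (p i) * z j)" if i: "i < ?n" for z m i
  unfolding s_def[abs_def] using ip_sum_left[of "{..<m}" \<psi> W "p i" z] B(1) D(9)[OF i] by (simp add: mult.commute)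
 have hn: "(\<Sum>j. lam j powr \<theta> * (cmod (?c j))^2) = (Hdot_nrm W \<psi> lam \<theta> f)^2"
  unfolding Hdot_nrm_def using suminf_nonneg[OF sm] by simp
 have "(\<Sum>i<?n. mu i powr \<theta> * (cmod (ip W (s ?c m) (p i)))^2) \<le> K * (Hdot_nrm W \<psi> lam \<theta> f)^2" for m
 proof -
  have "(\<Sum>i<?n. mu i powr \<theta> * (cmod (ip W (s ?c m) (p i)))^2)
    = (\<Sum>i<?n. mu i powr \<theta> * (cmod (\<Sum>j<m. ip W (\<psi> j) (p i) * ?c j))^2)"
   by (intro sum.cong refl) (simp add: ipS)
  also have "... \<le> K * (\<Sum>j<m. lam j powr \<theta> * (cmod (?c j))^2)"
  proof (rule matrix_interpolation)
   fix z :: "nat => complex"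
   have "(\<Sum>i<?n. (cmod (\<Sum>j<m. ip W (\<psi> j) (p i) * z j))^2) = (\<Sum>i<?n. (cmod (ip W (s z m) (p i)))^2)"
    by (intro sum.cong refl) (simp add: ipS)
   also have "... \<le> (L2_nrm W (s z m))^2" by (rule bessel(2)) (use D(8,9) sL in auto)
   also have "... = (\<Sum>j<m. (cmod (z j))^2)" unfolding s_def[abs_def] by (rule L2_nrm_orthonormal_sum) (use B(1,3) in auto)
   also have "... \<le> K * (\<Sum>j<m. (cmod (z j))^2)" using mult_right_mono[OF K(1), of "\<Sum>j<m. (cmod (z j))^2"] by (simp add: sum_nonneg)
   finally show "(\<Sum>i<?n. (cmod (\<Sum>j<m. ip W (\<psi> j) (p i) * z j))^2) \<le> K * (\<Sum>j<m. (cmod (z j))^2)" .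
   have "(\<Sum>i<?n. mu i * (cmod (\<Sum>j<m. ip W (\<psi> j) (p i) * z j))^2) = (\<Sum>i<?n. mu i * (cmod (ip W (s z m) (p i)))^2)"
    by (intro sum.cong refl) (simp add: ipS)
   also have "... \<le> K * Re (a (s z m) (s z m))" by (rule K(2)[OF sH])
   also have "a (s z m) (s z m) = of_real (\<Sum>j<m. lam j * (cmod (z j))^2)"
    unfolding s_def[abs_def] by (rule eigen_sum_form(3)[OF D(2,1) E]) simp
   finally show "(\<Sum>i<?n. mu i * (cmod (\<Sum>j<m. ip W (\<psi> j) (p i) * z j))^2) \<le> K * (\<Sum>j<m. lam j * (cmod (z j))^2)" by simp
  qed (use D(6) B(6) K(1) th in auto)
  also have "... \<le> K * (\<Sum>j. lam j powr \<theta> * (cmod (?c j))^2)"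
   using K(1) by (intro mult_left_mono sum_le_suminf sm) auto
  finally show ?thesis unfolding hn .
 qed
 moreover have "(\<lambda>m. \<Sum>i<?n. mu i powr \<theta> * (cmod (ip W (s ?c m) (p i)))^2) ----> (\<Sum>i<?n. mu i powr \<theta> * (cmod (ip W f (p i)))^2)"
 proof (intro tendsto_sum tendsto_mult tendsto_const tendsto_power tendsto_norm)
  fix i assume "i \<in> {..<?n}"
  then have i: "i < ?n" by simp
  show "(\<lambda>m. ip W (s ?c m) (p i)) ----> ip W f (p i)"
   by (rule ip_tendsto[OF fL sL D(9)[OF i]]) (unfold s_def, rule B(4)[OF fL])
 qed
 ultimately show ?thesis by (intro LIMSEQ_le_const2) auto
qed

text \<open>Interpolation for the adjoint matrix, now with constant 1: the form restricted to the finite element space is diagonal.\<close>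

lemma discrete_Hdot_bound:
 assumes F: "fe_setting W a S p mu" and E: "eigenbasis W a \<psi> lam" and th: "0 \<le> \<theta>" "\<theta> \<le> 1"
  and v: "v \<in> Vh W S"
 shows "v \<in> Hdot W \<psi> lam \<theta>"
  "Hdot_nrm W \<psi> lam \<theta> v \<le> sqrt (\<Sum>i<dim_Vh W S. mu i powr \<theta> * (cmod (ip W v (p i)))^2)"
proof -
 note D = fe_settingD[OF F] and B = eigenbasisD[OF E]
 let ?n = "dim_Vh W S"
 define s where "s z x = (\<Sum>i<?n. z i * p i x)" for z :: "nat => complex" and x
 have sV: "s z \<in> Vh W S" for z unfolding s_def[abs_def] by (rule fe_sum_Vh[OF F])
 have sv: "v = s (\<lambda>i. ip W v (p i))" unfolding s_def[abs_def] by (rule fe_expansion[OF F v])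
 have ipS: "ip W (s z) (\<psi> j) = (\<Sum>i<?n. ip W (p i) (\<psi> j) * z i)" for z j
  unfolding s_def[abs_def] using ip_sum_left[of "{..<?n}" p W "\<psi> j" z] B(1) D(9) by (simp add: mult.commute)
 have co: "ip W (s z) (p i) = z i" if "i < ?n" for z i unfolding s_def[abs_def] by (rule fe_coeff[OF F that])
 let ?R = "\<Sum>i<?n. mu i powr \<theta> * (cmod (ip W v (p i)))^2"
 have le: "(\<Sum>j<m. lam j powr \<theta> * (cmod (ip W v (\<psi> j)))^2) \<le> ?R" for m
 proof -
  have "(\<Sum>j<m. lam j powr \<theta> * (cmod (ip W v (\<psi> j)))^2)
    = (\<Sum>j<m. lam j powr \<theta> * (cmod (\<Sum>i<?n. ip W (p i) (\<psi> j) * ip W v (p i)))^2)"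
   by (subst (1) sv) (simp only: ipS)
  also have "... \<le> 1 * ?R"
  proof (rule matrix_interpolation)
   fix z :: "nat => complex"
   have "(\<Sum>j<m. (cmod (ip W (s z) (\<psi> j)))^2) \<le> (L2_nrm W (s z))^2" by (rule bessel(2)) (use B(1,3) Vh_L2[OF sV] in auto)
   also have "... = (\<Sum>i<?n. (cmod (z i))^2)" unfolding s_def[abs_def] by (rule L2_nrm_orthonormal_sum) (use D(8,9) in auto)
   finally show "(\<Sum>j<m. (cmod (\<Sum>i<?n. ip W (p i) (\<psi> j) * z i))^2) \<le> 1 * (\<Sum>i<?n. (cmod (z i))^2)" by (simp only: ipS mult_1)
   have "(\<Sum>j<m. lam j * (cmod (ip W (s z) (\<psi> j)))^2) \<le> Re (a (s z) (s z))" by (rule energy_bessel[OF D(2,1) E Vh_H10[OF sV]])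
   also have "... = (\<Sum>i<?n. mu i * (cmod (ip W (s z) (p i)))^2)" unfolding fe_energy[OF F sV] by simp
   also have "... = (\<Sum>i<?n. mu i * (cmod (z i))^2)" by (intro sum.cong refl) (simp add: co)
   finally show "(\<Sum>j<m. lam j * (cmod (\<Sum>i<?n. ip W (p i) (\<psi> j) * z i))^2) \<le> 1 * (\<Sum>i<?n. mu i * (cmod (z i))^2)" by (simp only: ipS mult_1)
  qed (use D(6) B(6) th in auto)
  finally show ?thesis by simp
 qed
 have sm: "summable (\<lambda>j. lam j powr \<theta> * (cmod (ip W v (\<psi> j)))^2)"
  by (rule summableI_nonneg_bounded[OF _ le]) simp
 then show "v \<in> Hdot W \<psi> lam \<theta>" using Vh_L2[OF v] by (simp add: Hdot_def)
 show "Hdot_nrm W \<psi> lam \<theta> v \<le> sqrt ?R"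
  unfolding Hdot_nrm_def by (intro real_sqrt_le_mono suminf_le_const sm le)
qed

section \<open>The error of the fully discrete scheme\<close>

lemma Wh_integral:
 assumes F: "fe_setting W a S p mu" and f: "f \<in> L2 W" and g: "0 < \<gamma>" "\<gamma> < 1" and t: "0 < t" "0 \<le> \<tau>"
 shows "integral {t..t + \<tau>} (\<lambda>r. Wh W S p mu \<gamma> \<beta> r (pih W S f) x)
  = (\<Sum>i<dim_Vh W S. exact_symbol \<gamma> \<beta> t \<tau> (mu i) * ip W f (p i) * p i x)"
proof -
 note D = fe_settingD[OF F]
 have "((\<lambda>r. Wh W S p mu \<gamma> \<beta> r (pih W S f) x) has_integral
   (\<Sum>i<dim_Vh W S. exact_symbol \<gamma> \<beta> t \<tau> (mu i) * ip W (pih W S f) (p i) * p i x)) {t..t + \<tau>}"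
  unfolding Wh_def
  by (intro has_integral_sum has_integral_mult_left exact_symbol_has_integral[OF g t]) (use D(6) in auto)
 then have "integral {t..t + \<tau>} (\<lambda>r. Wh W S p mu \<gamma> \<beta> r (pih W S f) x)
   = (\<Sum>i<dim_Vh W S. exact_symbol \<gamma> \<beta> t \<tau> (mu i) * ip W (pih W S f) (p i) * p i x)" by (rule integral_unique)
 also have "... = (\<Sum>i<dim_Vh W S. exact_symbol \<gamma> \<beta> t \<tau> (mu i) * ip W f (p i) * p i x)"
  by (intro sum.cong refl) (simp add: fe_pih(2)[OF F f D(5)])
 finally show ?thesis .
qed

lemma zc_neq_spectrum:
 assumes "0 < b" "b < lam / sqrt 2" "lam \<le> m"
 shows "zc b y ~= of_real m"
proof
 assume eq: "zc b y = of_real m"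
 have "Im (zc b y) = b * sinh y" "Re (zc b y) = b * cosh y" by (simp_all add: zc_def)
 with eq have "b * sinh y = 0" "b * cosh y = m" by simp_all
 then have "y = 0" using assms(1) by simp
 with \<open>b * cosh y = m\<close> have "b = m" by simp
 have lam: "0 < lam" using assms(1,2) by (metis less_trans zero_less_divide_iff real_sqrt_gt_zero zero_less_numeral not_less_iff_gr_or_eq)
 have "lam / sqrt 2 \<le> lam / 1" using lam by (intro divide_left_mono) auto
 with assms \<open>b = m\<close> show False by simp
qed

lemma Qhk_expansion:
 assumes F: "fe_setting W a S p mu" and f: "f \<in> L2 W"
  and z: "\<And>j i. i < dim_Vh W S ==> zc b (of_int j * k) ~= of_real (mu i)"
 shows "Qhk W a S \<gamma> \<beta> b k N t \<tau> (pih W S f) x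
  = (\<Sum>i<dim_Vh W S. quad_symbol \<gamma> \<beta> b k N t \<tau> (mu i) * ip W f (p i) * p i x)"
proof -
 note D = fe_settingD[OF F]
 let ?n = "dim_Vh W S"
 define A where "A j = (mittag_leffler \<gamma> 1 (- of_real (t powr \<gamma>) * zc b (of_int j * k) powr of_real \<beta>)
    - mittag_leffler \<gamma> 1 (- of_real ((t + \<tau>) powr \<gamma>) * zc b (of_int j * k) powr of_real \<beta>))
    * zc b (of_int j * k) powr of_real (- \<beta>) * vector_derivative (zc b) (at (of_int j * k))" for j :: int
 define Z where "Z j = zc b (of_int j * k)" for j :: int
 have q: "quad_symbol \<gamma> \<beta> b k N t \<tau> m = - (of_real k / (2 * of_real pi * \<i>)) * (\<Sum>j\<in>{- int N..int N}. A j / (Z j - of_real m))" for m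
  by (simp only: quad_symbol_def A_def Z_def Let_def)
 have r: "resolvent_h W a S (Z j) (pih W S f) x = (\<Sum>i<?n. ip W f (p i) / (Z j - of_real (mu i)) * p i x)" for j
 proof -
  have "resolvent_h W a S (Z j) (pih W S f) = (\<lambda>x. \<Sum>i<?n. ip W (pih W S f) (p i) / (Z j - of_real (mu i)) * p i x)"
   by (rule fe_resolvent[OF F fe_pih(1)[OF F f]]) (use z in \<open>simp add: Z_def\<close>)
  then have "resolvent_h W a S (Z j) (pih W S f) x = (\<Sum>i<?n. ip W (pih W S f) (p i) / (Z j - of_real (mu i)) * p i x)"
   by (rule fun_cong)
  also have "... = (\<Sum>i<?n. ip W f (p i) / (Z j - of_real (mu i)) * p i x)"
   by (intro sum.cong refl) (simp add: fe_pih(2)[OF F f D(5)])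
  finally show ?thesis .
 qed
 have "Qhk W a S \<gamma> \<beta> b k N t \<tau> (pih W S f) x
   = - (of_real k / (2 * of_real pi * \<i>)) * (\<Sum>j\<in>{- int N..int N}. A j * resolvent_h W a S (Z j) (pih W S f) x)"
  by (simp only: Qhk_def A_def Z_def Let_def)
 also have "... = - (of_real k / (2 * of_real pi * \<i>)) * (\<Sum>j\<in>{- int N..int N}. \<Sum>i<?n. A j / (Z j - of_real (mu i)) * (ip W f (p i) * p i x))"
 proof (intro arg_cong2[where f = "(*)"] refl sum.cong)
  fix j :: int
  show "A j * resolvent_h W a S (Z j) (pih W S f) x = (\<Sum>i<?n. A j / (Z j - of_real (mu i)) * (ip W f (p i) * p i x))"
   unfolding r sum_distrib_left by (intro sum.cong refl) simp
 qed
 also have "(\<Sum>j\<in>{- int N..int N}. \<Sum>i<?n. A j / (Z j - of_real (mu i)) * (ip W f (p i) * p i x))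
   = (\<Sum>i<?n. (\<Sum>j\<in>{- int N..int N}. A j / (Z j - of_real (mu i))) * (ip W f (p i) * p i x))"
  unfolding sum_distrib_right by (rule sum.swap)
 also have "- (of_real k / (2 * of_real pi * \<i>)) * ... = (\<Sum>i<?n. quad_symbol \<gamma> \<beta> b k N t \<tau> (mu i) * ip W f (p i) * p i x)"
  by (subst sum_distrib_left) (simp only: q mult.assoc)
 finally show ?thesis .
qed

text \<open>The norm of order \<open>\<theta>\<close> of discrete coefficients.\<close>

definition wnorm :: "nat => (nat => real) => real => (nat => complex) => real" where
 "wnorm n mu \<theta> c = sqrt (\<Sum>i<n. mu i powr \<theta> * (cmod (c i))^2)"

lemma wnorm_L2_set: "wnorm n mu \<theta> c = L2_set (\<lambda>i. sqrt (mu i powr \<theta>) * cmod (c i)) {..<n}"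
 by (simp add: wnorm_def L2_set_def power_mult_distrib)

lemma wnorm_add: "wnorm n mu \<theta> (\<lambda>i. c i + d i) \<le> wnorm n mu \<theta> c + wnorm n mu \<theta> d"
proof -
 have "wnorm n mu \<theta> (\<lambda>i. c i + d i) \<le> L2_set (\<lambda>i. sqrt (mu i powr \<theta>) * cmod (c i) + sqrt (mu i powr \<theta>) * cmod (d i)) {..<n}"
  unfolding wnorm_L2_set
  by (intro L2_set_mono) (auto simp: distrib_left[symmetric] intro!: mult_left_mono norm_triangle_ineq)
 also have "... \<le> wnorm n mu \<theta> c + wnorm n mu \<theta> d" unfolding wnorm_L2_set by (rule L2_set_triangle_ineq)
 finally show ?thesis .
qed

lemma wnorm_sum:
 assumes "finite K"
 shows "wnorm n mu \<theta> (\<lambda>i. \<Sum>k\<in>K. c k i) \<le> (\<Sum>k\<in>K. wnorm n mu \<theta> (c k))"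
 using assms
proof (induction K rule: finite_induct)
 case empty
 then show ?case by (simp add: wnorm_def)
next
 case (insert k K)
 then show ?case using wnorm_add[of n mu \<theta> "c k" "\<lambda>i. \<Sum>k\<in>K. c k i"] by simp
qed

lemma wnorm_mult:
 assumes "\<And>i. i < n ==> cmod (d i) \<le> B" "0 \<le> B"
 shows "wnorm n mu \<theta> (\<lambda>i. d i * c i) \<le> B * wnorm n mu \<theta> c"
proof -
 have "wnorm n mu \<theta> (\<lambda>i. d i * c i) \<le> L2_set (\<lambda>i. B * (sqrt (mu i powr \<theta>) * cmod (c i))) {..<n}"
  unfolding wnorm_L2_set
 proof (rule L2_set_mono)
  fix i assume "i \<in> {..<n}"
  then have "cmod (d i) * (sqrt (mu i powr \<theta>) * cmod (c i)) \<le> B * (sqrt (mu i powr \<theta>) * cmod (c i))"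
   using assms(1) by (intro mult_right_mono) auto
  then show "sqrt (mu i powr \<theta>) * cmod (d i * c i) \<le> B * (sqrt (mu i powr \<theta>) * cmod (c i))"
   by (simp add: norm_mult mult_ac)
 qed simp
 also have "... = B * wnorm n mu \<theta> c" unfolding wnorm_L2_set by (rule L2_set_right_distrib[OF assms(2), symmetric])
 finally show ?thesis .
qed

lemma tsub_facts:
 assumes t: "0 < tmax" and M: "j \<in> {1..M - 1}" and l: "l \<in> {1..NN}"
 shows "0 < tsub tmax M NN j (l - 1)" "0 < tau tmax M NN j"
  "tsub tmax M NN j l = tsub tmax M NN j (l - 1) + tau tmax M NN j"
  "tmax - tmid tmax M NN j l \<in> {0<..<tmax}"
proof -
 have NN: "0 < NN" and l1: "1 \<le> l" "l \<le> NN" using l by auto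
 have tp: "0 < tpt tmax M j" using t by (simp add: tpt_def)
 have tau: "tau tmax M NN j = tpt tmax M j / real NN" by (simp add: tau_def tpt_def)
 show tau0: "0 < tau tmax M NN j" unfolding tau using tp NN by simp
 have p: "0 < tsub tmax M NN j i" for i unfolding tsub_def using tp tau0 by (intro add_pos_nonneg) auto
 then show "0 < tsub tmax M NN j (l - 1)" .
 show st: "tsub tmax M NN j l = tsub tmax M NN j (l - 1) + tau tmax M NN j"
  using l1 by (simp add: tsub_def of_nat_diff algebra_simps)
 have "real l * tau tmax M NN j \<le> real NN * tau tmax M NN j" using l1 tau0 by (intro mult_right_mono) auto
 also have "... = tpt tmax M j" unfolding tau using NN by simp
 finally have le: "tsub tmax M NN j l \<le> 2 * tpt tmax M j" by (simp add: tsub_def)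
 have "2 * tpt tmax M j = 2 powr (1 - (real M - real j)) * tmax"
  unfolding tpt_def by (simp add: powr_diff powr_minus_divide)
 also have "... \<le> 2 powr 0 * tmax" using M t by (intro mult_right_mono powr_mono) auto
 finally have "tsub tmax M NN j l \<le> tmax" using le by simp
 then have "tmid tmax M NN j l < tmax" using st tau0 by (simp add: tmid_def)
 moreover have "0 < tmid tmax M NN j l" using p by (simp add: tmid_def add_pos_pos)
 ultimately show "tmax - tmid tmax M NN j l \<in> {0<..<tmax}" by simp
qed

text \<open>The sum telescopes over a dyadic block.\<close>

lemma sum_ln_tsub:
 assumes t: "0 < tmax" and NN: "1 \<le> NN"
 shows "(\<Sum>l = 1..NN. ln (tsub tmax M NN j l) - ln (tsub tmax M NN j (l - 1))) = ln 2"
proof -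
 have tp: "0 < tpt tmax M j" using t by (simp add: tpt_def)
 have "(\<Sum>l\<in>{Suc 0..NN}. ln (tsub tmax M NN j l) - ln (tsub tmax M NN j (l - 1))) = ln (tsub tmax M NN j NN) - ln (tsub tmax M NN j 0)"
  by (rule sum_telescope'') (use NN in simp)
 moreover have "tsub tmax M NN j NN = 2 * tpt tmax M j" using NN by (simp add: tsub_def tau_def tpt_def)
 moreover have "tsub tmax M NN j 0 = tpt tmax M j" by (simp add: tsub_def)
 ultimately show ?thesis using tp by (simp add: ln_mult)
qed

lemma Hdot_nrm_nonneg:
 assumes "f \<in> Hdot W \<psi> lam r"
 shows "0 \<le> Hdot_nrm W \<psi> lam r f"
proof -
 have "summable (\<lambda>j. lam j powr r * (cmod (ip W f (\<psi> j)))^2)" using assms by (simp add: Hdot_def)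
 then show ?thesis unfolding Hdot_nrm_def by (intro real_sqrt_ge_zero suminf_nonneg) auto
qed

lemma fully_discrete_error:
 fixes NN M N :: nat
 assumes F: "fe_setting W a S p mu" and E: "eigenbasis W a \<psi> lam" and th: "0 \<le> \<theta>" "\<theta> \<le> 1"
  and K: "1 \<le> K" "\<And>v. v \<in> H10 W ==> (\<Sum>j<dim_Vh W S. mu j * (cmod (ip W v (p j)))^2) \<le> K * Re (a v v)"
  and g: "0 < \<gamma>" "\<gamma> < 1" and b: "0 < b" "b < lam 0 / sqrt 2" and t: "0 < tmax" and N: "1 \<le> NN"
  and q: "0 \<le> Cq" "\<And>m t \<tau>. lam 0 \<le> m ==> 0 < t ==> 0 \<le> \<tau> ==>
    cmod (exact_symbol \<gamma> \<beta> t \<tau> m - quad_symbol \<gamma> \<beta> b k N t \<tau> m) \<le> Cq * (ln (t + \<tau>) - ln t)"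
  and f: "\<And>t. t \<in> {0<..<tmax} ==> f t \<in> Hdot W \<psi> lam \<theta>" "\<And>t. t \<in> {0<..<tmax} ==> Hdot_nrm W \<psi> lam \<theta> (f t) \<le> R"
 defines "e \<equiv> \<lambda>x. u_semi W S p mu \<gamma> \<beta> tmax f NN M x - u_full W a S \<gamma> \<beta> b k N tmax f NN M x"
 shows "e \<in> Hdot W \<psi> lam \<theta> \<and> Hdot_nrm W \<psi> lam \<theta> e \<le> sqrt K * ln 2 * Cq * real M * R"
proof -
 note D = fe_settingD[OF F]
 let ?n = "dim_Vh W S"
 let ?ts = "\<lambda>j l. tsub tmax M NN j l" and ?tau = "\<lambda>j. tau tmax M NN j"
 let ?f = "\<lambda>j l. f (tmax - tmid tmax M NN j l)"
 define Ds where "Ds j l i = exact_symbol \<gamma> \<beta> (?ts j (l - 1)) (?tau j) (mu i) - quad_symbol \<gamma> \<beta> b k N (?ts j (l - 1)) (?tau j) (mu i)" for j l i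
 define c where "c i = (\<Sum>j = 1..M - 1. \<Sum>l = 1..NN. Ds j l i * ip W (?f j l) (p i))" for i
 have R0: "0 \<le> R"
 proof -
  have "tmax / 2 \<in> {0<..<tmax}" using t by simp
  from order_trans[OF Hdot_nrm_nonneg[OF f(1)[OF this]] f(2)[OF this]] show ?thesis .
 qed
 have fH: "?f j l \<in> Hdot W \<psi> lam \<theta>" "Hdot_nrm W \<psi> lam \<theta> (?f j l) \<le> R" "?f j l \<in> L2 W"
  if "j \<in> {1..M - 1}" "l \<in> {1..NN}" for j l
  using f[OF tsub_facts(4)[OF t that]] by (auto simp: Hdot_def)
 have zn: "zc b y ~= of_real (mu i)" if "i < ?n" for y i
  by (rule zc_neq_spectrum[OF b discrete_eigenvalue_lower_bound[OF F E that]])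
 have term1: "integral {?ts j (l - 1)..?ts j l} (\<lambda>r. Wh W S p mu \<gamma> \<beta> r (pih W S (?f j l)) x)
    - Qhk W a S \<gamma> \<beta> b k N (?ts j (l - 1)) (?tau j) (pih W S (?f j l)) x
   = (\<Sum>i<?n. Ds j l i * ip W (?f j l) (p i) * p i x)" if jl: "j \<in> {1..M - 1}" "l \<in> {1..NN}" for j l x
 proof -
  note T = tsub_facts[OF t jl]
  have Q: "Qhk W a S \<gamma> \<beta> b k N (?ts j (l - 1)) (?tau j) (pih W S (?f j l)) x
    = (\<Sum>i<?n. quad_symbol \<gamma> \<beta> b k N (?ts j (l - 1)) (?tau j) (mu i) * ip W (?f j l) (p i) * p i x)"
   by (rule Qhk_expansion[OF F fH(3)[OF jl]]) (rule zn)
  show ?thesis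
   unfolding T(3) Wh_integral[OF F fH(3)[OF jl] g T(1) less_imp_le[OF T(2)]] Q
   by (simp only: sum_subtractf[symmetric] Ds_def left_diff_distrib)
 qed
 have ee: "e = (\<lambda>x. \<Sum>i<?n. c i * p i x)"
 proof
  fix x
  have "e x = (\<Sum>j = 1..M - 1. \<Sum>l = 1..NN. integral {?ts j (l - 1)..?ts j l} (\<lambda>r. Wh W S p mu \<gamma> \<beta> r (pih W S (?f j l)) x)
    - Qhk W a S \<gamma> \<beta> b k N (?ts j (l - 1)) (?tau j) (pih W S (?f j l)) x)"
   by (simp only: e_def u_semi_def u_full_def sum_subtractf)
  also have "... = (\<Sum>j = 1..M - 1. \<Sum>l = 1..NN. \<Sum>i<?n. Ds j l i * ip W (?f j l) (p i) * p i x)"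
   by (intro sum.cong refl term1)
  also have "... = (\<Sum>j = 1..M - 1. \<Sum>i<?n. \<Sum>l = 1..NN. Ds j l i * ip W (?f j l) (p i) * p i x)"
   by (intro sum.cong refl sum.swap)
  also have "... = (\<Sum>i<?n. \<Sum>j = 1..M - 1. \<Sum>l = 1..NN. Ds j l i * ip W (?f j l) (p i) * p i x)" by (rule sum.swap)
  also have "... = (\<Sum>i<?n. c i * p i x)" by (simp only: c_def sum_distrib_right)
  finally show "e x = (\<Sum>i<?n. c i * p i x)" .
 qed
 have eV: "e \<in> Vh W S" unfolding ee by (rule fe_sum_Vh[OF F])
 have co: "ip W e (p i) = c i" if "i < ?n" for i unfolding ee by (rule fe_coeff[OF F that])
 have data: "wnorm ?n mu \<theta> (\<lambda>i. ip W (?f j l) (p i)) \<le> sqrt K * R" if jl: "j \<in> {1..M - 1}" "l \<in> {1..NN}" for j l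
 proof -
  have "wnorm ?n mu \<theta> (\<lambda>i. ip W (?f j l) (p i)) \<le> sqrt (K * (Hdot_nrm W \<psi> lam \<theta> (?f j l))^2)"
   unfolding wnorm_def by (intro real_sqrt_le_mono data_coefficients_bound[OF F E th K fH(1)[OF jl]])
  also have "... = sqrt K * Hdot_nrm W \<psi> lam \<theta> (?f j l)" using Hdot_nrm_nonneg[OF fH(1)[OF jl]] by (simp add: real_sqrt_mult)
  also have "... \<le> sqrt K * R" using K(1) by (intro mult_left_mono fH(2)[OF jl]) auto
  finally show ?thesis .
 qed
 have one: "wnorm ?n mu \<theta> (\<lambda>i. Ds j l i * ip W (?f j l) (p i)) \<le> Cq * (ln (?ts j l) - ln (?ts j (l - 1))) * (sqrt K * R)"
  if jl: "j \<in> {1..M - 1}" "l \<in> {1..NN}" for j l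
 proof -
  note T = tsub_facts[OF t jl]
  have d0: "0 \<le> Cq * (ln (?ts j l) - ln (?ts j (l - 1)))" using q(1) T by (intro mult_nonneg_nonneg) auto
  have "wnorm ?n mu \<theta> (\<lambda>i. Ds j l i * ip W (?f j l) (p i))
    \<le> Cq * (ln (?ts j l) - ln (?ts j (l - 1))) * wnorm ?n mu \<theta> (\<lambda>i. ip W (?f j l) (p i))"
  proof (rule wnorm_mult[OF _ d0])
   fix i assume "i < ?n"
   then show "cmod (Ds j l i) \<le> Cq * (ln (?ts j l) - ln (?ts j (l - 1)))"
    unfolding Ds_def T(3) by (intro q(2) discrete_eigenvalue_lower_bound[OF F E] T(1) less_imp_le[OF T(2)])
  qed
  also have "... \<le> Cq * (ln (?ts j l) - ln (?ts j (l - 1))) * (sqrt K * R)" by (rule mult_left_mono[OF data[OF jl] d0])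
  finally show ?thesis .
 qed
 have "wnorm ?n mu \<theta> c \<le> (\<Sum>j = 1..M - 1. wnorm ?n mu \<theta> (\<lambda>i. \<Sum>l = 1..NN. Ds j l i * ip W (?f j l) (p i)))"
  unfolding c_def[abs_def] by (rule wnorm_sum) simp
 also have "... \<le> (\<Sum>j = 1..M - 1. \<Sum>l = 1..NN. wnorm ?n mu \<theta> (\<lambda>i. Ds j l i * ip W (?f j l) (p i)))"
  by (intro sum_mono wnorm_sum) simp
 also have "... \<le> (\<Sum>j = 1..M - 1. \<Sum>l = 1..NN. Cq * (ln (?ts j l) - ln (?ts j (l - 1))) * (sqrt K * R))"
  by (intro sum_mono one)
 also have "... = (\<Sum>j = 1..M - 1. Cq * ln 2 * (sqrt K * R))"
  by (simp only: sum_distrib_left[symmetric] sum_distrib_right[symmetric] sum_ln_tsub[OF t N])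
 also have "... = real (M - 1) * (Cq * ln 2 * (sqrt K * R))" by simp
 also have "... \<le> real M * (Cq * ln 2 * (sqrt K * R))"
  using q(1) R0 K(1) by (intro mult_right_mono mult_nonneg_nonneg) auto
 finally have 1: "wnorm ?n mu \<theta> c \<le> sqrt K * ln 2 * Cq * real M * R" by (simp add: mult_ac)
 note H = discrete_Hdot_bound[OF F E th eV]
 have "sqrt (\<Sum>i<?n. mu i powr \<theta> * (cmod (ip W e (p i)))^2) = wnorm ?n mu \<theta> c"
  unfolding wnorm_def by (intro arg_cong[where f = sqrt] sum.cong refl) (simp add: co)
 with H 1 show ?thesis by simp
qed

text \<open>The mesh sizes are bounded in terms of the diameter of the domain, so the exterior balls, and with
them all constants, can be chosen uniformly in \<open>h\<close>.\<close>

lemma uniform_discrete_energy_bound: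
 fixes W :: "(real^'n) set"
 assumes P: "polygonal_domain W" and L: "lipschitz_boundary W" and a: "elliptic_form W a"
  and M: "mesh_family W H \<T>" and E: "\<And>h. h \<in> H ==> discrete_eigensystem W a (\<T> h) (\<psi>h h) (lamh h)"
 shows "\<exists>K\<ge>1. \<forall>h\<in>H. fe_setting W a (\<T> h) (\<psi>h h) (lamh h) \<and>
  (\<forall>v\<in>H10 W. (\<Sum>j<dim_Vh W (\<T> h). lamh h j * (cmod (ip W v (\<psi>h h j)))^2) \<le> K * Re (a v v))"
proof -
 have O: "open W" "bounded W" and ne: "W ~= {}" using P by (auto simp: polygonal_domain_def)
 note OS = open_lebesgue[OF O(1)]
 obtain \<sigma> where s: "0 < \<sigma>" and reg: "\<And>h. h \<in> H ==> regular_mesh W (\<T> h) h \<sigma>" using mesh_family_regular[OF M ne] by blast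
 define D where "D = diameter (closure W) / \<sigma> + 1"
 have bc: "bounded (closure W)" using O(2) by (rule bounded_closure)
 have D: "0 < D" unfolding D_def using s diameter_ge_0[OF bc] by (intro add_nonneg_pos divide_nonneg_pos) auto
 have hD: "0 < h \<and> h \<le> D" if h: "h \<in> H" for h
 proof -
  note R = reg[OF h, unfolded regular_mesh_def]
  have h0: "0 < h" and U: "\<Union>(\<T> h) = closure W" using R by auto
  have "\<T> h ~= {}"
  proof
   assume "\<T> h = {}"
   with U have "closure W = {}" by simp
   with ne show False by simp
  qed
  then obtain T z where T: "T \<in> \<T> h" "cball z (\<sigma> * h) \<subseteq> T" using R by blast
  then have "cball z (\<sigma> * h) \<subseteq> closure W" using U by blast
  from cball_subset_radius_le[OF bc _ this] have "\<sigma> * h \<le> diameter (closure W)" using s h0 by simp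
  then have "h \<le> diameter (closure W) / \<sigma>" using s by (simp add: le_divide_eq mult.commute)
  with h0 show ?thesis by (simp add: D_def)
 qed
 obtain \<kappa> where k: "0 < \<kappa>" "\<kappa> \<le> 1"
  and ext: "\<forall>q\<in>frontier W. \<forall>h. 0 < h \<and> h \<le> D --> (\<exists>y. norm (y - q) \<le> h \<and> cball y (\<kappa> * h) \<inter> W = {})"
  using exterior_balls[OF L O(2,1) D] by blast
 obtain c0 where c0: "0 < c0" "\<forall>v\<in>H10 W. Re (a v v) \<ge> c0 * (H1_nrm W v)^2" using elliptic_formD(4)[OF a] by blast
 obtain c1 where c1: "\<forall>v\<in>H10 W. \<forall>w\<in>H10 W. cmod (a v w) \<le> c1 * H1_nrm W v * H1_nrm W w" using elliptic_formD(5)[OF a] by blast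
 have c1': "cmod (a v v) \<le> \<bar>c1\<bar> * (H1_nrm W v)^2" if "v \<in> H10 W" for v
 proof -
  have "cmod (a v v) \<le> c1 * H1_nrm W v * H1_nrm W v" using c1 that by blast
  also have "... = c1 * (H1_nrm W v)^2" by (simp add: power2_eq_square)
  also have "... \<le> \<bar>c1\<bar> * (H1_nrm W v)^2" by (intro mult_right_mono) auto
  finally show ?thesis .
 qed
 define C where "C = stability_const TYPE('n) \<sigma> \<kappa>"
 have C: "0 \<le> C" by (simp add: C_def stability_const_def)
 define K where "K = max 1 (\<bar>c1\<bar> * C / c0)"
 have "fe_setting W a (\<T> h) (\<psi>h h) (lamh h) \<and>
  (\<forall>v\<in>H10 W. (\<Sum>j<dim_Vh W (\<T> h). lamh h j * (cmod (ip W v (\<psi>h h j)))^2) \<le> K * Re (a v v))" if h: "h \<in> H" for h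
 proof
  show F: "fe_setting W a (\<T> h) (\<psi>h h) (lamh h)"
   using O a E[OF h] reg[OF h] by (auto simp: fe_setting_def regular_mesh_def)
  have stab: "(H1_nrm W (pih W (\<T> h) \<phi>))^2 \<le> C * (H1_nrm W \<phi>)^2" if t: "\<phi> \<in> test_functions W" for \<phi>
  proof -
   have pL: "\<phi> \<in> L2 W" by (rule test_functions_L2[OF t OS])
   show ?thesis unfolding C_def
   proof (rule projection_H1_stable[OF O reg[OF h] t k _ fe_pih(1)[OF F pL] fe_pih(2)[OF F pL]])
    show "\<exists>y. norm (y - q) \<le> h \<and> cball y (\<kappa> * h) \<inter> W = {}" if "q \<in> frontier W" for q
     using ext that hD[OF h] by blast
   qed
  qed
  show "\<forall>v\<in>H10 W. (\<Sum>j<dim_Vh W (\<T> h). lamh h j * (cmod (ip W v (\<psi>h h j)))^2) \<le> K * Re (a v v)"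
  proof
   fix v assume v: "v \<in> H10 W"
   have "(\<Sum>j<dim_Vh W (\<T> h). lamh h j * (cmod (ip W v (\<psi>h h j)))^2) \<le> \<bar>c1\<bar> * C * (H1_nrm W v)^2"
    by (rule discrete_energy_bound[OF F stab C abs_ge_zero c1' v])
   also have "... \<le> \<bar>c1\<bar> * C * (Re (a v v) / c0)"
    using C c0 v by (intro mult_left_mono) (auto simp: le_divide_eq mult.commute)
   also have "... = \<bar>c1\<bar> * C / c0 * Re (a v v)" by simp
   also have "... \<le> K * Re (a v v)" using form_nonneg[OF a v] by (intro mult_right_mono) (auto simp: K_def)
   finally show "(\<Sum>j<dim_Vh W (\<T> h). lamh h j * (cmod (ip W v (\<psi>h h j)))^2) \<le> K * Re (a v v)" .
  qed
 qed
 moreover have "1 \<le> K" by (simp add: K_def)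
 ultimately show ?thesis by blast
qed

theorem lemma5p5:
  fixes \<Omega> :: "(real ^ 'n) set"
    and a :: "(real ^ 'n \<Rightarrow> complex) \<Rightarrow> (real ^ 'n \<Rightarrow> complex) \<Rightarrow> complex"
    and \<psi> :: "nat \<Rightarrow> real ^ 'n \<Rightarrow> complex" and lam :: "nat \<Rightarrow> real"
    and H :: "real set" and \<T> :: "real \<Rightarrow> (real ^ 'n) set set"
    and \<psi>h :: "real \<Rightarrow> nat \<Rightarrow> real ^ 'n \<Rightarrow> complex" and lamh :: "real \<Rightarrow> nat \<Rightarrow> real"
    and \<gamma> \<beta> b s d :: real
  assumes "polygonal_domain \<Omega>" and "lipschitz_boundary \<Omega>"
    and "elliptic_form \<Omega> a"
    and "eigenbasis \<Omega> a \<psi> lam"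
    and "mesh_family \<Omega> H \<T>"
    and "\<And>h. h \<in> H \<Longrightarrow> discrete_eigensystem \<Omega> a (\<T> h) (\<psi>h h) (lamh h)"
    and "0 < \<gamma>" "\<gamma> < 1" and "0 < \<beta>" "\<beta> < 1"
    and "0 < b" "b < lam 0 / sqrt 2"
    and "0 \<le> s" "s \<le> 1 / 2"
    and "0 < d" "d < pi / 4"
  shows "\<exists>C::real. \<forall>h\<in>H. \<forall>tmax>0. \<forall>f\<in>Linf_Hdot \<Omega> \<psi> lam (2 * s) tmax.
           (\<forall>t\<in>{0<..<tmax}. ereal (Hdot_nrm \<Omega> \<psi> lam (2 * s) (f t))
                              \<le> Linf_Hdot_nrm \<Omega> \<psi> lam (2 * s) tmax f) \<longrightarrow>
           (\<forall>NN\<ge>1. \<forall>M\<ge>1. \<forall>N\<ge>1. \<forall>k. k = sqrt (pi * d / (\<beta> * real N)) \<longrightarrow>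
              (let e = (\<lambda>x. u_semi \<Omega> (\<T> h) (\<psi>h h) (lamh h) \<gamma> \<beta> tmax f NN M x
                            - u_full \<Omega> a (\<T> h) \<gamma> \<beta> b k N tmax f NN M x)
               in e \<in> Hdot \<Omega> \<psi> lam (2 * s) \<and>
                  Hdot_nrm \<Omega> \<psi> lam (2 * s) e
                    \<le> C * real M * exp (- sqrt (pi * \<beta> * d * real N))
                        * real_of_ereal (Linf_Hdot_nrm \<Omega> \<psi> lam (2 * s) tmax f)))"
proof -
 obtain K where K: "1 \<le> K" and FK: "\<And>h. h \<in> H ==> fe_setting \<Omega> a (\<T> h) (\<psi>h h) (lamh h) \<and>
  (\<forall>v\<in>H10 \<Omega>. (\<Sum>j<dim_Vh \<Omega> (\<T> h). lamh h j * (cmod (ip \<Omega> v (\<psi>h h j)))^2) \<le> K * Re (a v v))"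
  using uniform_discrete_energy_bound[OF assms(1,2,3,5,6)] by blast
 obtain Q where Q: "0 \<le> Q"
  "\<And>lam' N k t \<tau>. lam 0 \<le> lam' ==> 1 \<le> N ==> k = sqrt (pi * d / (\<beta> * real N)) ==> 0 < t ==> 0 \<le> \<tau>
   ==> cmod (exact_symbol \<gamma> \<beta> t \<tau> lam' - quad_symbol \<gamma> \<beta> b k N t \<tau> lam')
     \<le> Q * exp (- sqrt (pi * \<beta> * d * real N)) * (ln (t + \<tau>) - ln t)"
  by (rule quad_symbol_error[OF assms(11,12,15,16,9,10,7,8)]) blast
 have th: "0 \<le> 2 * s" "2 * s \<le> 1" using assms(13,14) by auto
 show ?thesis
 proof (rule exI[of _ "sqrt K * ln 2 * Q"], intro ballI allI impI, unfold Let_def)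
  fix h tmax f and NN M N :: nat and k
  let ?err = "\<lambda>x. u_semi \<Omega> (\<T> h) (\<psi>h h) (lamh h) \<gamma> \<beta> tmax f NN M x
    - u_full \<Omega> a (\<T> h) \<gamma> \<beta> b k N tmax f NN M x"
  let ?L = "Linf_Hdot_nrm \<Omega> \<psi> lam (2 * s) tmax f"
  assume h: "h \<in> H" and t: "0 < tmax" and f: "f \<in> Linf_Hdot \<Omega> \<psi> lam (2 * s) tmax"
   and le: "\<forall>t\<in>{0<..<tmax}. ereal (Hdot_nrm \<Omega> \<psi> lam (2 * s) (f t)) \<le> ?L"
   and N: "1 \<le> NN" "1 \<le> M" "1 \<le> N" and k: "k = sqrt (pi * d / (\<beta> * real N))"
  have fH: "f r \<in> Hdot \<Omega> \<psi> lam (2 * s)" if "r \<in> {0<..<tmax}" for r using f that unfolding Linf_Hdot_def by blast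
  have fin: "?L < \<infinity>" using f unfolding Linf_Hdot_def by blast
  have fR: "Hdot_nrm \<Omega> \<psi> lam (2 * s) (f r) \<le> real_of_ereal ?L" if "r \<in> {0<..<tmax}" for r
  proof -
   have "ereal (Hdot_nrm \<Omega> \<psi> lam (2 * s) (f r)) \<le> ?L" using le that by blast
   with fin show ?thesis by (cases ?L) auto
  qed
  let ?e = "exp (- sqrt (pi * \<beta> * d * real N))"
  have q0: "0 \<le> Q * ?e" using Q(1) by simp
  have FS: "fe_setting \<Omega> a (\<T> h) (\<psi>h h) (lamh h)" using FK[OF h] by blast
  have KB: "(\<Sum>j<dim_Vh \<Omega> (\<T> h). lamh h j * (cmod (ip \<Omega> v (\<psi>h h j)))^2) \<le> K * Re (a v v)" if "v \<in> H10 \<Omega>" for v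
   using FK[OF h] that by blast
  have "?err \<in> Hdot \<Omega> \<psi> lam (2 * s) \<and> Hdot_nrm \<Omega> \<psi> lam (2 * s) ?err
    \<le> sqrt K * ln 2 * (Q * ?e) * real M * real_of_ereal ?L"
   by (rule fully_discrete_error[OF FS assms(4) th K KB assms(7,8,11,12) t N(1) q0 Q(2)[OF _ N(3) k] fH fR])
  moreover have "sqrt K * ln 2 * (Q * ?e) * real M * real_of_ereal ?L = sqrt K * ln 2 * Q * real M * ?e * real_of_ereal ?L"
   by (simp only: mult_ac)
  ultimately show "?err \<in> Hdot \<Omega> \<psi> lam (2 * s) \<and> Hdot_nrm \<Omega> \<psi> lam (2 * s) ?err
    \<le> sqrt K * ln 2 * Q * real M * ?e * real_of_ereal ?L" by simp
 qed
qed

end
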